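(* Suppose that $\sigma$ is a Radon measure with full support on $\partial D$ satisfying (VD) such that (LS) holds for $\Theta_{\Psi,\sigma}$, and that $\mathrm{PI}(\Psi;D)$ holds for $(D,d,m,\mathcal E^0,\mathcal F^0)$. Then $\sigma$ does not charge sets of zero $\bar{\mathcal E}$-capacity. Moreover, if $\sup_{x\in\partial D}\Theta_{\Psi,\sigma}(x,r_0)<\infty$ for some $r_0\in(0,\operatorname{diam}(\partial D)/2)$, then there is $C>0$ such that $$\|f|_{\partial D}\|_{L^2(\partial D;\sigma)}\le C\,\bar{\mathcal E}_1(f,f)^{1/2}\qquad\text{for each } f\in\bar{\mathcal F}\cap C(D^* ),$$ where $\bar{\mathcal E}_1(f,f):=\bar{\mathcal E}(f,f)+\|f\|^2_{L^2(D^*;m_0)}$. Consequently, $\|f|_{\partial D}\|_{L^2(\partial D;\sigma)}\le C\,\bar{\mathcal E}_1(f,f)^{1/2}$ for each $f\in\bar{\mathcal F}$.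
   Context: Setting. $(D,d)$ is a locally compact separable metric space, $m$ a Radon measure on $D$ with full support, $(D^*,d)$ the completion of $(D,d)$ ($D$ is open in $D^*$), $\partial D:=D^*\setminus D$, and $m_0(E):=m(E\cap D)$ for $E\subset D^*$. $B(x,r)$ is the open ball in $D^*$, $V(x,r):=m_0(B(x,r))$, $V_\mu(x,r):=\mu(B(x,r))$ for a Radon measure $\mu$, and $d_D(x):=\inf_{z\in\partial D}d(x,z)$. Standing assumptions: $m_0$ is a Radon measure on $D^*$ and is volume doubling ($V(x,2r)\le C\,V(x,r)$ for all $x\in D^*$, $r>0$); $(D,d)$ is $A$-uniform for some $A>1$, i.e. any $x,y\in D$ are joined by a continuous curve $\gamma\subset D$ with $\operatorname{diam}(\gamma)\le A\,d(x,y)$ and $d_D(z)\ge A^{-1}\min\{d(x,z),d(y,z)\}$ for all $z\in\gamma$; $(\mathcal E^0,\mathcal F^0)$ is a transient, irreducible, strongly local regular Dirichlet form on $L^2(D;m)$. For open $U\subset D$, $\mathcal F_{\rm loc}(U)$ is the set of Borel functions on $U$ which on each relatively compact open $O\subset U$ agree $m$-a.e. with some element of $\mathcal F^0$. $\mu_{\langle f\rangle}$ denotes the energy measure: for bounded $u\in\mathcal F^0$ it is determined by $\int_D g\,d\mu_{\langle u\rangle}=2\mathcal E^0(u,ug)-\mathcal E^0(u^2,g)$ for bounded $g$ in the extended Dirichlet space of $(\mathcal E^0,\mathcal F^0)$, and it is extended to $\mathcal F_{\rm loc}(U)$ by truncation and locality. The active reflected Dirichlet form is $\bar{\mathcal F}:=\{f\in\mathcal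 F_{\rm loc}(D)\cap L^2(D;m):\mu_{\langle f\rangle}(D)<\infty\}$, $\bar{\mathcal E}(f,f):=\frac12\mu_{\langle f\rangle}(D)$; it is assumed to be a regular Dirichlet form on $L^2(D^*;m_0)$ (it is then strongly local). Functions in $\bar{\mathcal F}$ are represented by $\bar{\mathcal E}$-quasi-continuous versions. $\partial D$ is assumed to have positive $\bar{\mathcal E}$-capacity. $\Psi$ is a continuous bijection of $(0,\infty)$ onto itself such that for some $C_\Psi\ge1$, $0<\beta_1\le\beta_2<\infty$: $C_\Psi^{-1}(R/r)^{\beta_1}\le\Psi(R)/\Psi(r)\le C_\Psi(R/r)^{\beta_2}$ for $0<r<R<\infty$. $\mathrm{PI}(\Psi;D)$: there are $C_p>0$, $A_p\ge1$ such that for all $x\in D$, $r\in(0,d_D(x)/A_p)$ and $f\in\mathcal F_{\rm loc}(B(x,A_pr))$, $\int_{B(x,r)}(f-[f]_{B(x,r)})^2dm_0\le C_p\Psi(r)\mu_{\langle f\rangle}(B(x,A_pr))$, where $[f]_E=\frac1{m_0(E)}\int_Ef\,dm_0$. For a Radon measure $\sigma$ with full support on $\partial D$: (VD) means $V_\sigma(x,2r)\le C V_\sigma(x,r)$ for all $x\in\partial D$, $r>0$; $\Theta_{\Psi,\sigma}(x,r):=\Psi(r)V_\sigma(x,r)/V(x,r)$ for $x\in\partial D$, $r>0$; (LS) for $\Theta_{\Psi,\sigma}$ means there are $C,\beta>0$ with $\Theta_{\Psi,\sigma}(x,R)/\Theta_{\Psi,\sigma}(x,r)\ge C(R/r)^\beta$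 for all $x\in\partial D$, $0<r<R<\operatorname{diam}(\partial D)$. *)

theory Defs
  imports "HOL-Analysis.Analysis"
begin

text \<open>
  The completion of the locally compact separable metric space is the whole type, of class
  \<open>polish_space\<close>; the space itself is a dense subset \<open>D\<close>, and its boundary is \<open>- D\<close>.
  A function on a subset \<open>X\<close> is a total function whose values off \<open>X\<close> are irrelevant, and a
  measure on \<open>X\<close> is a measure whose \<open>sets\<close> are the Borel subsets of \<open>X\<close>.
\<close>

section \<open>Measures and metric notions\<close>

text \<open>
  Finiteness on compact sets suffices: on a locally compact separable metric space such Borel
  measures are regular. The completion is locally compact too, by volume doubling.
\<close>

definition radon_measure_on :: "'a::metric_space set \<Rightarrow> 'a measure \<Rightarrow> bool" where
  "radon_measure_on X \<mu> \<longleftrightarrow>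
     sets \<mu> = sets (restrict_space borel X) \<and>
     (\<forall>K. compact K \<and> K \<subseteq> X \<longrightarrow> emeasure \<mu> K < \<infinity>)"

definition full_support_on :: "'a::metric_space set \<Rightarrow> 'a measure \<Rightarrow> bool" where
  "full_support_on X \<mu> \<longleftrightarrow>
     (\<forall>U. openin (top_of_set X) U \<and> U \<noteq> {} \<longrightarrow> emeasure \<mu> U > 0)"

text \<open>\<open>m\<^sub>0(E) = m(E \<inter> D)\<close>, as the image of \<open>m\<close> under the inclusion of \<open>D\<close>.\<close>

definition ext_measure :: "'a::metric_space measure \<Rightarrow> 'a measure" where
  "ext_measure m = distr m borel (\<lambda>x. x)"

definition volume_doubling_on :: "'a::metric_space set \<Rightarrow> 'a measure \<Rightarrow> bool" where
  "volume_doubling_on X \<mu> \<longleftrightarrow>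
     (\<exists>C>0. \<forall>x\<in>X. \<forall>r>0.
        emeasure \<mu> (ball x (2 * r) \<inter> X) \<le> ennreal C * emeasure \<mu> (ball x r \<inter> X))"

text \<open>The library's \<open>diameter\<close> is unspecified on unbounded sets.\<close>

definition ediam :: "'a::metric_space set \<Rightarrow> ennreal" where
  "ediam S = (SUP x\<in>S. SUP y\<in>S. ennreal (dist x y))"

text \<open>The distance to the boundary is \<open>infdist x (- D)\<close>.\<close>

definition uniform_domain :: "real \<Rightarrow> 'a::metric_space set \<Rightarrow> bool" where
  "uniform_domain A D \<longleftrightarrow>
     (\<forall>x\<in>D. \<forall>y\<in>D. \<exists>\<gamma>. path \<gamma> \<and> pathstart \<gamma> = x \<and> pathfinish \<gamma> = y \<and> path_image \<gamma> \<subseteq> D \<and>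
        diameter (path_image \<gamma>) \<le> A * dist x y \<and>
        (\<forall>z\<in>path_image \<gamma>. infdist z (- D) \<ge> inverse A * min (dist x z) (dist y z)))"

definition scale_function :: "(real \<Rightarrow> real) \<Rightarrow> bool" where
  "scale_function \<Psi> \<longleftrightarrow>
     continuous_on {0<..} \<Psi> \<and> bij_betw \<Psi> {0<..} {0<..} \<and>
     (\<exists>C \<beta>1 \<beta>2. 1 \<le> C \<and> 0 < \<beta>1 \<and> \<beta>1 \<le> \<beta>2 \<and>
        (\<forall>r R. 0 < r \<and> r < R \<longrightarrow>
           inverse C * (R / r) powr \<beta>1 \<le> \<Psi> R / \<Psi> r \<and> \<Psi> R / \<Psi> r \<le> C * (R / r) powr \<beta>2))"

section \<open>Dirichlet forms\<close>

definition L2_space :: "'a measure \<Rightarrow> ('a \<Rightarrow> real) set" where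
  "L2_space M = {f \<in> borel_measurable M. integrable M (\<lambda>x. (f x)\<^sup>2)}"

definition L2_inner :: "'a measure \<Rightarrow> ('a \<Rightarrow> real) \<Rightarrow> ('a \<Rightarrow> real) \<Rightarrow> real" where
  "L2_inner M f g = (\<integral>x. f x * g x \<partial>M)"

definition L2_norm :: "'a measure \<Rightarrow> ('a \<Rightarrow> real) \<Rightarrow> real" where
  "L2_norm M f = sqrt (\<integral>x. (f x)\<^sup>2 \<partial>M)"

text \<open>\<open>\<E>\<^sub>\<alpha>(f,g) = \<E>(f,g) + \<alpha> (f,g)\<close> with the inner product of \<open>L\<^sup>2\<close>.\<close>

definition form_plus ::
  "'a measure \<Rightarrow> (('a \<Rightarrow> real) \<Rightarrow> ('a \<Rightarrow> real) \<Rightarrow> real) \<Rightarrow> real \<Rightarrow> ('a \<Rightarrow> real) \<Rightarrow> ('a \<Rightarrow> real) \<Rightarrow> real" where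
  "form_plus M E \<alpha> f g = E f g + \<alpha> * L2_inner M f g"

text \<open>
  The domain \<open>F\<close> is a set of functions, not of almost-everywhere classes; it contains with a
  function all its versions.
\<close>

locale dirichlet_form =
  fixes M :: "'a measure"
    and E :: "('a \<Rightarrow> real) \<Rightarrow> ('a \<Rightarrow> real) \<Rightarrow> real"
    and F :: "('a \<Rightarrow> real) set"
  assumes domain_L2: "F \<subseteq> L2_space M"
    and domain_zero: "(\<lambda>x. 0) \<in> F"
    and domain_add: "f \<in> F \<Longrightarrow> g \<in> F \<Longrightarrow> (\<lambda>x. f x + g x) \<in> F"
    and domain_scale: "f \<in> F \<Longrightarrow> (\<lambda>x. c * f x) \<in> F"
    and domain_version:
      "f \<in> F \<Longrightarrow> g \<in> borel_measurable M \<Longrightarrow> (AE x in M. f x = g x) \<Longrightarrow> g \<in> F"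
    and domain_dense:
      "f \<in> L2_space M \<Longrightarrow> \<epsilon> > 0 \<Longrightarrow> \<exists>g\<in>F. L2_norm M (\<lambda>x. f x - g x) < \<epsilon>"
    and form_version:
      "f \<in> F \<Longrightarrow> g \<in> F \<Longrightarrow> h \<in> F \<Longrightarrow> (AE x in M. f x = g x) \<Longrightarrow> E f h = E g h"
    and form_sym: "f \<in> F \<Longrightarrow> g \<in> F \<Longrightarrow> E f g = E g f"
    and form_add: "f \<in> F \<Longrightarrow> g \<in> F \<Longrightarrow> h \<in> F \<Longrightarrow> E (\<lambda>x. f x + g x) h = E f h + E g h"
    and form_scale: "f \<in> F \<Longrightarrow> h \<in> F \<Longrightarrow> E (\<lambda>x. c * f x) h = c * E f h"
    and form_nonneg: "f \<in> F \<Longrightarrow> E f f \<ge> 0"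
    and form_closed:
      "(\<And>n. s n \<in> F) \<Longrightarrow>
       (\<And>\<epsilon>. \<epsilon> > 0 \<Longrightarrow> \<exists>N. \<forall>i\<ge>N. \<forall>j\<ge>N.
          form_plus M E 1 (\<lambda>x. s i x - s j x) (\<lambda>x. s i x - s j x) < \<epsilon>) \<Longrightarrow>
       \<exists>f\<in>F. (\<lambda>n. form_plus M E 1 (\<lambda>x. s n x - f x) (\<lambda>x. s n x - f x)) \<longlonglongrightarrow> 0"
    and domain_markov: "f \<in> F \<Longrightarrow> (\<lambda>x. min 1 (max 0 (f x))) \<in> F"
    and form_markov: "f \<in> F \<Longrightarrow> E (\<lambda>x. min 1 (max 0 (f x))) (\<lambda>x. min 1 (max 0 (f x))) \<le> E f f"

definition Cc :: "'a::topological_space set \<Rightarrow> ('a \<Rightarrow> real) set" where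
  "Cc X = {f. continuous_on X f \<and> (\<exists>K. compact K \<and> K \<subseteq> X \<and> (\<forall>x\<in>X - K. f x = 0))}"

locale regular_dirichlet_form = dirichlet_form M E F
  for M :: "'a::metric_space measure"
    and E :: "('a \<Rightarrow> real) \<Rightarrow> ('a \<Rightarrow> real) \<Rightarrow> real"
    and F :: "('a \<Rightarrow> real) set" +
  assumes core_dense_domain:
      "f \<in> F \<Longrightarrow> \<epsilon> > 0 \<Longrightarrow>
       \<exists>g \<in> F \<inter> Cc (space M). form_plus M E 1 (\<lambda>x. f x - g x) (\<lambda>x. f x - g x) < \<epsilon>"
    and core_dense_Cc:
      "f \<in> Cc (space M) \<Longrightarrow> \<epsilon> > 0 \<Longrightarrow>
       \<exists>g \<in> F \<inter> Cc (space M). \<forall>x\<in>space M. \<bar>f x - g x\<bar> < \<epsilon>"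

text \<open>The support of the measure \<open>\<bar>f\<bar> dM\<close>.\<close>

definition ess_support :: "'a::topological_space measure \<Rightarrow> ('a \<Rightarrow> real) \<Rightarrow> 'a set" where
  "ess_support M f =
     {x \<in> space M. \<forall>U. openin (top_of_set (space M)) U \<and> x \<in> U \<longrightarrow>
        \<not> (AE y in M. y \<in> U \<longrightarrow> f y = 0)}"

definition strongly_local ::
  "'a::topological_space measure \<Rightarrow> (('a \<Rightarrow> real) \<Rightarrow> ('a \<Rightarrow> real) \<Rightarrow> real) \<Rightarrow> ('a \<Rightarrow> real) set \<Rightarrow> bool" where
  "strongly_local M E F \<longleftrightarrow>
     (\<forall>u\<in>F. \<forall>v\<in>F.
        compact (ess_support M u) \<and> compact (ess_support M v) \<and>
        (\<exists>U c. openin (top_of_set (space M)) U \<and> ess_support M u \<subseteq> U \<and>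
               (AE y in M. y \<in> U \<longrightarrow> v y = c)) \<longrightarrow>
        E u v = 0)"

text \<open>
  The \<open>L\<^sup>2\<close>-resolvent \<open>G\<^sub>\<alpha> = \<integral>\<^sub>0\<^sup>\<infinity> e\<^sup>-\<^sup>\<alpha>\<^sup>t T\<^sub>t dt\<close> of the associated semigroup \<open>(T\<^sub>t)\<close>, which is
  determined up to null sets by \<open>\<E>\<^sub>\<alpha>(G\<^sub>\<alpha> f, v) = (f, v)\<close> for \<open>v\<close> in the domain.
\<close>

definition resolvent ::
  "'a measure \<Rightarrow> (('a \<Rightarrow> real) \<Rightarrow> ('a \<Rightarrow> real) \<Rightarrow> real) \<Rightarrow> ('a \<Rightarrow> real) set \<Rightarrow>
   real \<Rightarrow> ('a \<Rightarrow> real) \<Rightarrow> 'a \<Rightarrow> real" where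
  "resolvent M E F \<alpha> f =
     (SOME u. u \<in> F \<and> (\<forall>v\<in>F. form_plus M E \<alpha> u v = L2_inner M f v))"

text \<open>
  Transience: the potential \<open>G f = \<integral>\<^sub>0\<^sup>\<infinity> T\<^sub>t f dt = lim\<^sub>n G\<^bsub>1/n\<^esub> f\<close> of every nonnegative integrable
  \<open>f\<close> (in \<open>L\<^sup>2\<close>, where the resolvent is defined) is finite almost everywhere. The limit is monotone.
\<close>

definition transient ::
  "'a measure \<Rightarrow> (('a \<Rightarrow> real) \<Rightarrow> ('a \<Rightarrow> real) \<Rightarrow> real) \<Rightarrow> ('a \<Rightarrow> real) set \<Rightarrow> bool" where
  "transient M E F \<longleftrightarrow>
     (\<forall>f \<in> L2_space M. integrable M f \<and> (AE x in M. f x \<ge> 0) \<longrightarrow>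
        (AE x in M. bdd_above (range (\<lambda>n. resolvent M E F (1 / real (Suc n)) f x))))"

text \<open>
  A set is invariant if multiplication by its indicator commutes with every \<open>T\<^sub>t\<close>, or, what is the
  same by Laplace transformation, with every \<open>G\<^sub>\<alpha>\<close>.
\<close>

definition invariant_set ::
  "'a measure \<Rightarrow> (('a \<Rightarrow> real) \<Rightarrow> ('a \<Rightarrow> real) \<Rightarrow> real) \<Rightarrow> ('a \<Rightarrow> real) set \<Rightarrow> 'a set \<Rightarrow> bool" where
  "invariant_set M E F A \<longleftrightarrow>
     A \<in> sets M \<and>
     (\<forall>\<alpha>>0. \<forall>f \<in> L2_space M.
        AE x in M. resolvent M E F \<alpha> (\<lambda>y. indicator A y * f y) x
                 = indicator A x * resolvent M E F \<alpha> f x)"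

definition irreducible_form ::
  "'a measure \<Rightarrow> (('a \<Rightarrow> real) \<Rightarrow> ('a \<Rightarrow> real) \<Rightarrow> real) \<Rightarrow> ('a \<Rightarrow> real) set \<Rightarrow> bool" where
  "irreducible_form M E F \<longleftrightarrow>
     (\<forall>A. invariant_set M E F A \<longrightarrow> emeasure M A = 0 \<or> emeasure M (space M - A) = 0)"

definition capacity_open ::
  "'a measure \<Rightarrow> (('a \<Rightarrow> real) \<Rightarrow> ('a \<Rightarrow> real) \<Rightarrow> real) \<Rightarrow> ('a \<Rightarrow> real) set \<Rightarrow> 'a set \<Rightarrow> ennreal" where
  "capacity_open M E F U =
     (INF u \<in> {u \<in> F. AE x in M. x \<in> U \<longrightarrow> u x \<ge> 1}. ennreal (form_plus M E 1 u u))"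

definition capacity ::
  "'a::topological_space measure \<Rightarrow> (('a \<Rightarrow> real) \<Rightarrow> ('a \<Rightarrow> real) \<Rightarrow> real) \<Rightarrow> ('a \<Rightarrow> real) set \<Rightarrow>
   'a set \<Rightarrow> ennreal" where
  "capacity M E F A =
     (INF U \<in> {U. openin (top_of_set (space M)) U \<and> A \<subseteq> U}. capacity_open M E F U)"

definition quasi_continuous ::
  "'a::topological_space measure \<Rightarrow> (('a \<Rightarrow> real) \<Rightarrow> ('a \<Rightarrow> real) \<Rightarrow> real) \<Rightarrow> ('a \<Rightarrow> real) set \<Rightarrow>
   ('a \<Rightarrow> real) \<Rightarrow> bool" where
  "quasi_continuous M E F f \<longleftrightarrow>
     (\<forall>\<epsilon>>0. \<exists>U. openin (top_of_set (space M)) U \<and> capacity M E F U < ennreal \<epsilon> \<and>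
                continuous_on (space M - U) f)"

section \<open>Extended Dirichlet space and energy measures\<close>

definition approximating_seq ::
  "'a measure \<Rightarrow> (('a \<Rightarrow> real) \<Rightarrow> ('a \<Rightarrow> real) \<Rightarrow> real) \<Rightarrow> ('a \<Rightarrow> real) set \<Rightarrow>
   ('a \<Rightarrow> real) \<Rightarrow> (nat \<Rightarrow> 'a \<Rightarrow> real) \<Rightarrow> bool" where
  "approximating_seq M E F f s \<longleftrightarrow>
     (\<forall>n. s n \<in> F) \<and>
     (\<forall>\<epsilon>>0. \<exists>N. \<forall>i\<ge>N. \<forall>j\<ge>N. E (\<lambda>x. s i x - s j x) (\<lambda>x. s i x - s j x) < \<epsilon>) \<and>
     (AE x in M. (\<lambda>n. s n x) \<longlonglongrightarrow> f x)"

definition extended_space ::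
  "'a measure \<Rightarrow> (('a \<Rightarrow> real) \<Rightarrow> ('a \<Rightarrow> real) \<Rightarrow> real) \<Rightarrow> ('a \<Rightarrow> real) set \<Rightarrow> ('a \<Rightarrow> real) set" where
  "extended_space M E F = {f \<in> borel_measurable M. \<exists>s. approximating_seq M E F f s}"

definition extended_form ::
  "'a measure \<Rightarrow> (('a \<Rightarrow> real) \<Rightarrow> ('a \<Rightarrow> real) \<Rightarrow> real) \<Rightarrow> ('a \<Rightarrow> real) set \<Rightarrow>
   ('a \<Rightarrow> real) \<Rightarrow> ('a \<Rightarrow> real) \<Rightarrow> real" where
  "extended_form M E F f g =
     (THE c. \<forall>s t. approximating_seq M E F f s \<and> approximating_seq M E F g t \<longrightarrow>
                   (\<lambda>n. E (s n) (t n)) \<longlonglongrightarrow> c)"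

text \<open>
  The energy measure of a bounded \<open>u\<close>. It may charge null sets of \<open>M\<close> but not sets of zero capacity,
  so the bounded test functions of the extended Dirichlet space enter through their
  quasi-continuous versions.
\<close>

definition energy_measure_bounded ::
  "'a::metric_space measure \<Rightarrow> (('a \<Rightarrow> real) \<Rightarrow> ('a \<Rightarrow> real) \<Rightarrow> real) \<Rightarrow> ('a \<Rightarrow> real) set \<Rightarrow>
   ('a \<Rightarrow> real) \<Rightarrow> 'a measure" where
  "energy_measure_bounded M E F u =
     (THE \<mu>. radon_measure_on (space M) \<mu> \<and>
        (\<forall>g \<in> extended_space M E F. bounded (g ` space M) \<and> quasi_continuous M E F g \<longrightarrow>
           (\<integral>x. g x \<partial>\<mu>) = 2 * extended_form M E F u (\<lambda>x. u x * g x)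
                            - extended_form M E F (\<lambda>x. (u x)\<^sup>2) g))"

definition truncate :: "real \<Rightarrow> ('a \<Rightarrow> real) \<Rightarrow> 'a \<Rightarrow> real" where
  "truncate c f x = max (- c) (min c (f x))"

definition energy_measure ::
  "'a::metric_space measure \<Rightarrow> (('a \<Rightarrow> real) \<Rightarrow> ('a \<Rightarrow> real) \<Rightarrow> real) \<Rightarrow> ('a \<Rightarrow> real) set \<Rightarrow>
   ('a \<Rightarrow> real) \<Rightarrow> 'a measure" where
  "energy_measure M E F u =
     measure_of (space M) (sets M)
       (\<lambda>A. lim (\<lambda>n. emeasure (energy_measure_bounded M E F (truncate (real n) u)) A))"

text \<open>
  Relative compactness is understood in \<open>U\<close>, an open subset of the state space: the closure of \<open>W\<close>
  is a compact subset of \<open>U\<close>.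
\<close>

definition relcompact_open_in :: "'a::topological_space set \<Rightarrow> 'a set \<Rightarrow> bool" where
  "relcompact_open_in U W \<longleftrightarrow> open W \<and> compact (closure W) \<and> closure W \<subseteq> U"

definition F_loc ::
  "'a::metric_space measure \<Rightarrow> ('a \<Rightarrow> real) set \<Rightarrow> 'a set \<Rightarrow> ('a \<Rightarrow> real) set" where
  "F_loc M F U =
     {f \<in> borel_measurable (restrict_space borel U).
        \<forall>W. relcompact_open_in U W \<longrightarrow> (\<exists>u\<in>F. AE x in M. x \<in> W \<longrightarrow> f x = u x)}"

text \<open>The energy measure, on \<open>U\<close>, of \<open>f \<in> F_loc M F U\<close>.\<close>

definition energy_measure_loc ::
  "'a::metric_space measure \<Rightarrow> (('a \<Rightarrow> real) \<Rightarrow> ('a \<Rightarrow> real) \<Rightarrow> real) \<Rightarrow> ('a \<Rightarrow> real) set \<Rightarrow>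
   'a set \<Rightarrow> ('a \<Rightarrow> real) \<Rightarrow> 'a measure" where
  "energy_measure_loc M E F U f =
     (THE \<nu>. sets \<nu> = sets (restrict_space borel U) \<and>
        (\<forall>W. \<forall>u\<in>F. relcompact_open_in U W \<and> (AE x in M. x \<in> W \<longrightarrow> f x = u x) \<longrightarrow>
           (\<forall>A \<in> sets borel. A \<subseteq> W \<longrightarrow> emeasure \<nu> A = emeasure (energy_measure M E F u) A)))"

text \<open>
  The domain of the active reflected Dirichlet form. As the boundary is a null set of \<open>m\<^sub>0\<close>, the
  spaces \<open>L\<^sup>2(D;m)\<close> and \<open>L\<^sup>2(D\<^sup>*;m\<^sub>0)\<close> are identified: members are Borel on the completion, with
  arbitrary values on the boundary.
\<close>

definition reflected_domain ::
  "'a::metric_space measure \<Rightarrow> (('a \<Rightarrow> real) \<Rightarrow> ('a \<Rightarrow> real) \<Rightarrow> real) \<Rightarrow> ('a \<Rightarrow> real) set \<Rightarrow>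
   ('a \<Rightarrow> real) set" where
  "reflected_domain m E F =
     {f \<in> L2_space (ext_measure m). f \<in> F_loc m F (space m) \<and>
        emeasure (energy_measure_loc m E F (space m) f) (space m) < \<infinity>}"

text \<open>
  The active reflected Dirichlet form is given by its quadratic form, which determines the symmetric
  bilinear form \<open>E'\<close> on the domain.
\<close>

definition is_reflected_form ::
  "'a::metric_space measure \<Rightarrow> (('a \<Rightarrow> real) \<Rightarrow> ('a \<Rightarrow> real) \<Rightarrow> real) \<Rightarrow> ('a \<Rightarrow> real) set \<Rightarrow>
   (('a \<Rightarrow> real) \<Rightarrow> ('a \<Rightarrow> real) \<Rightarrow> real) \<Rightarrow> ('a \<Rightarrow> real) set \<Rightarrow> bool" where
  "is_reflected_form m E F E' F' \<longleftrightarrow>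
     F' = reflected_domain m E F \<and>
     (\<forall>f\<in>F'. E' f f = measure (energy_measure_loc m E F (space m) f) (space m) / 2)"

section \<open>Poincare inequality and scaling of the boundary measure\<close>

definition poincare_inequality ::
  "'a::metric_space measure \<Rightarrow> (('a \<Rightarrow> real) \<Rightarrow> ('a \<Rightarrow> real) \<Rightarrow> real) \<Rightarrow> ('a \<Rightarrow> real) set \<Rightarrow>
   'a set \<Rightarrow> (real \<Rightarrow> real) \<Rightarrow> bool" where
  "poincare_inequality m E F D \<Psi> \<longleftrightarrow>
     (\<exists>Cp Ap. 0 < Cp \<and> 1 \<le> Ap \<and>
        (\<forall>x\<in>D. \<forall>r. 0 < r \<and> r < infdist x (- D) / Ap \<longrightarrow>
           (\<forall>f \<in> F_loc m F (ball x (Ap * r)).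
              let m0 = ext_measure m;
                  avg = (LINT z:ball x r|m0. f z) / measure m0 (ball x r)
              in (\<integral>\<^sup>+z\<in>ball x r. ennreal ((f z - avg)\<^sup>2) \<partial>m0)
                   \<le> ennreal (Cp * \<Psi> r) *
                      emeasure (energy_measure_loc m E F (ball x (Ap * r)) f) (ball x (Ap * r)))))"

definition Theta ::
  "'a::metric_space measure \<Rightarrow> 'a set \<Rightarrow> (real \<Rightarrow> real) \<Rightarrow> 'a measure \<Rightarrow> 'a \<Rightarrow> real \<Rightarrow> real" where
  "Theta m D \<Psi> \<sigma> x r =
     \<Psi> r * measure \<sigma> (ball x r \<inter> - D) / measure (ext_measure m) (ball x r)"

definition lower_scaling ::
  "'a::metric_space set \<Rightarrow> ('a \<Rightarrow> real \<Rightarrow> real) \<Rightarrow> bool" where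
  "lower_scaling B \<Theta> \<longleftrightarrow>
     (\<exists>C \<beta>. 0 < C \<and> 0 < \<beta> \<and>
        (\<forall>x\<in>B. \<forall>r R. 0 < r \<and> r < R \<and> ennreal R < ediam B \<longrightarrow>
           \<Theta> x R / \<Theta> x r \<ge> C * (R / r) powr \<beta>))"

end

(*
  For a boundary point x choose Whitney points p_k in D at distance about r_k = r0 / 2^k from x and from
  the boundary. Uniformity joins p_k to p_(k+1) by a chain of boundedly many balls inside D, so the Poincare
  inequality bounds the squared difference of the averages of f near p_k and p_(k+1) by the energy of f in a
  ball of radius comparable to r_k around x, times Psi(r_k) / V(x, r_k). For continuous f the averages tend to
  f(x); summing with geometric weights and integrating against sigma, doubling turns the k-th term into the total
  energy times sup Theta(., r_k), which decays geometrically by lower scaling. This is a trace inequality on every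
  piece of the boundary where Theta(., r0) is bounded. Applied to functions in the core that equal 1 on a compact set, it
  shows that sigma does not charge sets of zero capacity; for quasi-continuous versions the global inequality
  follows by convergence outside a set of zero capacity and Fatou's lemma.

  Energy measures enter through a definite description. They are constructed from the functional
  g -> 2 E(u, u g) - E(u^2, g), which is positive by the Markov property, and the Riesz representation theorem;
  strong locality makes the measure on an open set depend only on the function there.
*)
theory Submission imports Defs
begin

text \<open>Three objects are known only by description: the extended form, the energy measure of a
  bounded function, and the energy measure on an open set. Existence and uniqueness must precede any
  estimate. For the extended form this is closability along a.e. convergent energy-Cauchy sequences,
  without \<open>L2\<close> convergence. The test functions of energy measures are quasi-continuous
  and may lie outside \<open>L2\<close>, so capacity enters already there. Positivity of g -> 2 E(u,
  u g) - E(u^2, g) concerns products, while the Markov axiom only clips one function. The resolvent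
  is the bridge: it is Markovian, the forms alpha (f - alpha G f, g) live on all of
  \<open>L2\<close>, and on simple functions they are finite matrices with nonpositive off-diagonal
  entries and nonnegative row sums. In the trace estimate the scaling exponent is halved: with theta
  = 2 powr (- beta / 2), one factor theta^k pays for Cauchy-Schwarz over the levels, the other sums
  the series. Sets of zero capacity need not be Borel, hence the null covers and the completion of
  sigma.\<close>

notation (input) LIMSEQ ("((_)/ ----> (_))" [60, 60] 60)

abbreviation (input) quad :: "('b \<Rightarrow> 'b \<Rightarrow> real) \<Rightarrow> 'b \<Rightarrow> real" where
 "quad B f \<equiv> B f f"

abbreviation (input) form_tendsto ::
 "(('a \<Rightarrow> real) \<Rightarrow> ('a \<Rightarrow> real) \<Rightarrow> real) \<Rightarrow> (nat \<Rightarrow> 'a \<Rightarrow> real) \<Rightarrow> ('a \<Rightarrow> real) \<Rightarrow> bool" where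
 "form_tendsto B s f \<equiv> (\<lambda>n. quad B (\<lambda>x. s n x - f x)) ----> 0"

abbreviation (input) L2_tendsto :: "'a measure \<Rightarrow> (nat \<Rightarrow> 'a \<Rightarrow> real) \<Rightarrow> ('a \<Rightarrow> real) \<Rightarrow> bool" where
 "L2_tendsto M \<equiv> form_tendsto (L2_inner M)"

section \<open>Positive semidefinite forms on spaces of functions\<close>

text \<open>One set of Hilbert space arguments serves \<open>L2_inner\<close>, \<open>E\<close>, the
  forms \<open>form_plus M E a\<close> and the approximating forms \<open>apx\<close>. Elements are
  functions rather than classes, so \<open>B f f = 0\<close> does not give \<open>f = 0\<close> and
  the form may be degenerate.\<close>

locale psd_form =
 fixes V :: "('a \<Rightarrow> real) set" and B :: "('a \<Rightarrow> real) \<Rightarrow> ('a \<Rightarrow> real) \<Rightarrow> real"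
 assumes V_zero: "(\<lambda>x. 0) \<in> V"
  and V_add: "f \<in> V ==> g \<in> V ==> (\<lambda>x. f x + g x) \<in> V"
  and V_scale: "f \<in> V ==> (\<lambda>x. c * f x) \<in> V"
  and B_sym: "f \<in> V ==> g \<in> V ==> B f g = B g f"
  and B_addl: "f \<in> V ==> g \<in> V ==> h \<in> V ==> B (\<lambda>x. f x + g x) h = B f h + B g h"
  and B_scalel: "f \<in> V ==> h \<in> V ==> B (\<lambda>x. c * f x) h = c * B f h"
  and B_nonneg: "f \<in> V ==> B f f \<ge> 0"
begin

lemma V_diff: "f \<in> V ==> g \<in> V ==> (\<lambda>x. f x - g x) \<in> V"
 using V_add[of f "\<lambda>x. (-1) * g x"] V_scale[of g "-1"] by simp

lemma V_uminus: "f \<in> V ==> (\<lambda>x. - f x) \<in> V"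
 using V_scale[of f "-1"] by simp

lemma V_sum: "(\<And>i. i \<in> I ==> f i \<in> V) ==> (\<lambda>x. \<Sum>i\<in>I. f i x) \<in> V"
 by (induction I rule: infinite_finite_induct) (auto intro: V_zero V_add)

lemma B_addr: "f \<in> V ==> g \<in> V ==> h \<in> V ==> B h (\<lambda>x. f x + g x) = B h f + B h g"
 by (simp add: B_sym[of h] V_add B_addl)

lemma B_scaler: "f \<in> V ==> h \<in> V ==> B h (\<lambda>x. c * f x) = c * B h f"
 by (simp add: B_sym[of h] V_scale B_scalel)

lemma B_diffl: "f \<in> V ==> g \<in> V ==> h \<in> V ==> B (\<lambda>x. f x - g x) h = B f h - B g h"
 using B_addl[of f "\<lambda>x. (-1) * g x" h] V_scale[of g "-1"] B_scalel[of g h "-1"] by simp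

lemma B_diffr: "f \<in> V ==> g \<in> V ==> h \<in> V ==> B h (\<lambda>x. f x - g x) = B h f - B h g"
 by (simp add: B_sym[of h] V_diff B_diffl)

lemma B_zerol: "h \<in> V ==> B (\<lambda>x. 0) h = 0"
 using B_scalel[of "\<lambda>x. 0" h 0] V_zero by simp

lemma B_suml: "(\<And>i. i \<in> I ==> f i \<in> V) ==> h \<in> V ==> B (\<lambda>x. \<Sum>i\<in>I. f i x) h = (\<Sum>i\<in>I. B (f i) h)"
proof (induction I rule: infinite_finite_induct)
 case (insert i I)
 then show ?case by (simp add: B_addl V_sum)
qed (auto simp: B_zerol)

lemma B_sumr: "(\<And>i. i \<in> I ==> f i \<in> V) ==> h \<in> V ==> B h (\<lambda>x. \<Sum>i\<in>I. f i x) = (\<Sum>i\<in>I. B h (f i))"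
 by (simp add: B_sym[of h] V_sum B_suml)

lemma B_square_add:
 "f \<in> V ==> g \<in> V ==> quad B (\<lambda>x. f x + g x) = B f f + 2 * B f g + B g g"
 by (simp add: B_addl B_addr V_add B_sym[of g f])

lemma B_square_diff:
 "f \<in> V ==> g \<in> V ==> quad B (\<lambda>x. f x - g x) = B f f - 2 * B f g + B g g"
 by (simp add: B_diffl B_diffr V_diff B_sym[of g f])

lemma B_square_scale: "f \<in> V ==> quad B (\<lambda>x. c * f x) = c\<^sup>2 * B f f"
 by (simp add: B_scalel B_scaler V_scale power2_eq_square)

lemma B_square_commute:
 "f \<in> V ==> g \<in> V ==> quad B (\<lambda>x. f x - g x) = quad B (\<lambda>x. g x - f x)"
 by (simp add: B_square_diff B_sym[of g f])

lemma parallelogram: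
 "f \<in> V ==> g \<in> V ==>
  quad B (\<lambda>x. f x - g x) =
  2 * B f f + 2 * B g g - 4 * quad B (\<lambda>x. (f x + g x) / 2)"
 using B_square_scale[of "\<lambda>x. f x + g x" "1/2"] V_add[of f g]
 by (simp add: B_square_diff B_square_add power2_eq_square)

lemma Cauchy_Schwarz_square:
 assumes "f \<in> V" "g \<in> V"
 shows "(B f g)\<^sup>2 \<le> B f f * B g g"
proof -
 have q: "0 \<le> B f f * t\<^sup>2 + 2 * B f g * t + B g g" for t
 proof -
  have "quad B (\<lambda>x. t * f x + g x) = B f f * t\<^sup>2 + 2 * B f g * t + B g g"
   using assms by (simp add: B_square_add V_scale B_square_scale B_scalel)
  then show ?thesis using B_nonneg[OF V_add[OF V_scale[OF assms(1), of t] assms(2)]] by simp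
 qed
 show ?thesis
 proof (cases "B f f = 0")
  case True
  \<comment> \<open>In the degenerate case the polynomial \<open>q\<close> is affine in t; a nonzero
    slope would make it equal to -1 + 0 at the chosen t, namely
    \<open>- (B g g + 1) + B g g\<close>.\<close>
  have "B f g = 0"
  proof (rule ccontr)
   assume n: "B f g \<noteq> 0"
   have "2 * B f g * (- (B g g + 1) / (2 * B f g)) = - (B g g + 1)" using n by simp
   with q[of "- (B g g + 1) / (2 * B f g)"] True show False by simp
  qed
  then show ?thesis using True by simp
 next
  case False
  then have p: "B f f > 0" using B_nonneg[OF assms(1)] by simp
  have "B f f * (- B f g / B f f)\<^sup>2 + 2 * B f g * (- B f g / B f f) + B g g
    = B g g - (B f g)\<^sup>2 / B f f"
   using p by (simp add: power2_eq_square field_simps)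
  with q[of "- B f g / B f f"] have "(B f g)\<^sup>2 / B f f \<le> B g g" by simp
  then show ?thesis using p by (simp add: field_simps)
 qed
qed

lemma Cauchy_Schwarz:
 assumes "f \<in> V" "g \<in> V"
 shows "\<bar>B f g\<bar> \<le> sqrt (B f f) * sqrt (B g g)"
 using real_sqrt_le_mono[OF Cauchy_Schwarz_square[OF assms]] by (simp add: real_sqrt_mult)

lemma triangle:
 assumes "f \<in> V" "g \<in> V"
 shows "sqrt (quad B (\<lambda>x. f x + g x)) \<le> sqrt (B f f) + sqrt (B g g)"
proof (rule real_le_lsqrt)
 have "B f g \<le> sqrt (B f f) * sqrt (B g g)" using Cauchy_Schwarz[OF assms] by linarith
 then show "quad B (\<lambda>x. f x + g x) \<le> (sqrt (B f f) + sqrt (B g g))\<^sup>2"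
  using assms by (simp add: B_square_add power2_sum B_nonneg)
qed (auto simp: B_nonneg V_add assms)

lemma square_add_le:
 assumes "f \<in> V" "g \<in> V"
 shows "quad B (\<lambda>x. f x + g x) \<le> 2 * B f f + 2 * B g g"
 using B_nonneg[OF V_diff[OF assms]] assms by (simp add: B_square_add B_square_diff)

lemma square_diff_le:
 assumes "f \<in> V" "g \<in> V"
 shows "quad B (\<lambda>x. f x - g x) \<le> 2 * B f f + 2 * B g g"
 using B_nonneg[OF V_add[OF assms]] assms by (simp add: B_square_add B_square_diff)

lemma tendsto_B:
 assumes "\<And>n. s n \<in> V" "\<And>n. t n \<in> V" "f \<in> V" "g \<in> V"
  and s: "form_tendsto B s f"
  and t: "form_tendsto B t g"
 shows "(\<lambda>n. B (s n) (t n)) ----> B f g"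
proof -
 let ?a = "\<lambda>n. sqrt (quad B (\<lambda>x. s n x - f x))"
 let ?b = "\<lambda>n. sqrt (quad B (\<lambda>x. t n x - g x))"
 have a: "?a ----> 0" using tendsto_real_sqrt[OF s] by simp
 have b: "?b ----> 0" using tendsto_real_sqrt[OF t] by simp
 have c: "(\<lambda>n. ?a n * ?b n + ?a n * sqrt (B g g) + sqrt (B f f) * ?b n) ----> 0"
  using tendsto_add[OF tendsto_add[OF tendsto_mult[OF a b] tendsto_mult[OF a tendsto_const]]
    tendsto_mult[OF tendsto_const b]] by simp
 have "norm (B (s n) (t n) - B f g) \<le> ?a n * ?b n + ?a n * sqrt (B g g) + sqrt (B f f) * ?b n" for n
 proof -
  have "B (s n) (t n) - B f g = B (\<lambda>x. s n x - f x) (\<lambda>x. t n x - g x)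
    + B (\<lambda>x. s n x - f x) g + B f (\<lambda>x. t n x - g x)"
   using assms by (simp add: B_diffl B_diffr V_diff)
  moreover have "\<bar>B (\<lambda>x. s n x - f x) (\<lambda>x. t n x - g x)\<bar> \<le> ?a n * ?b n"
   using assms by (intro Cauchy_Schwarz V_diff)
  moreover have "\<bar>B (\<lambda>x. s n x - f x) g\<bar> \<le> ?a n * sqrt (B g g)"
   using assms by (intro Cauchy_Schwarz V_diff)
  moreover have "\<bar>B f (\<lambda>x. t n x - g x)\<bar> \<le> sqrt (B f f) * ?b n"
   using assms by (intro Cauchy_Schwarz V_diff)
  ultimately show ?thesis by simp
 qed
 then have "(\<lambda>n. B (s n) (t n) - B f g) ----> 0"
  by (intro Lim_null_comparison[OF always_eventually c]) blast
 then show ?thesis using Lim_null by blast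
qed

definition Cauchy_seq :: "(nat \<Rightarrow> 'a \<Rightarrow> real) \<Rightarrow> bool" where
 "Cauchy_seq s \<longleftrightarrow> (\<forall>\<epsilon>>0. \<exists>N. \<forall>i\<ge>N. \<forall>j\<ge>N. quad B (\<lambda>x. s i x - s j x) < \<epsilon>)"

lemma Cauchy_seq_bounded:
 assumes "Cauchy_seq s" "\<And>n. s n \<in> V"
 obtains C where "C \<ge> 0" "\<And>n. B (s n) (s n) \<le> C"
proof -
 obtain N where N: "\<And>i. i \<ge> N ==> quad B (\<lambda>x. s i x - s N x) < 1"
  using assms(1)[unfolded Cauchy_seq_def, rule_format, of 1] by auto
 define C where "C = (\<Sum>k<N. B (s k) (s k)) + (2 + 2 * B (s N) (s N))"
 have "B (s n) (s n) \<le> C" for n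
 proof (cases "n < N")
  case True
  then have "B (s n) (s n) \<le> (\<Sum>k<N. B (s k) (s k))"
   by (intro member_le_sum) (auto simp: B_nonneg assms)
  then show ?thesis using B_nonneg[OF assms(2)[of N]] by (simp add: C_def)
 next
  case False
  then have "B (s n) (s n) \<le> 2 * 1 + 2 * B (s N) (s N)"
   using square_add_le[OF V_diff[OF assms(2)[of n] assms(2)[of N]] assms(2)[of N]] N[of n] by simp
  moreover have "0 \<le> (\<Sum>k<N. B (s k) (s k))" by (intro sum_nonneg B_nonneg assms)
  ultimately show ?thesis unfolding C_def by linarith
 qed
 moreover have "C \<ge> 0" using calculation[of 0] B_nonneg[OF assms(2)[of 0]] by linarith
 ultimately show ?thesis using that by blast
qed

lemma Cauchy_seq_diff:
 assumes "Cauchy_seq s" "Cauchy_seq t" "\<And>n. s n \<in> V" "\<And>n. t n \<in> V"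
 shows "Cauchy_seq (\<lambda>n x. s n x - t n x)"
 unfolding Cauchy_seq_def
proof (intro allI impI)
 fix e :: real assume "e > 0"
 obtain N1 where N1: "\<And>i j. i \<ge> N1 ==> j \<ge> N1 ==> quad B (\<lambda>x. s i x - s j x) < e/4"
  using assms(1)[unfolded Cauchy_seq_def, rule_format, of "e/4"] \<open>e > 0\<close> by auto
 obtain N2 where N2: "\<And>i j. i \<ge> N2 ==> j \<ge> N2 ==> quad B (\<lambda>x. t i x - t j x) < e/4"
  using assms(2)[unfolded Cauchy_seq_def, rule_format, of "e/4"] \<open>e > 0\<close> by auto
 have "quad B (\<lambda>x. (s i x - t i x) - (s j x - t j x)) < e"
  if "i \<ge> max N1 N2" "j \<ge> max N1 N2" for i j
 proof -
  have "(\<lambda>x. (s i x - t i x) - (s j x - t j x)) = (\<lambda>x. (s i x - s j x) - (t i x - t j x))"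
   by (auto simp: algebra_simps)
  then show ?thesis
   using square_diff_le[OF V_diff[OF assms(3)[of i] assms(3)[of j]] V_diff[OF assms(4)[of i] assms(4)[of j]]]
    N1[of i j] N2[of i j] that by simp
 qed
 then show "\<exists>N. \<forall>i\<ge>N. \<forall>j\<ge>N. quad B (\<lambda>x. (s i x - t i x) - (s j x - t j x)) < e"
  by blast
qed

text \<open>Only real numbers need to converge here, not the sequences themselves. This provides the
  value of the extended form, whose approximating sequences may have no limit in
  \<open>V\<close>.\<close>

lemma convergent_B:
 assumes "Cauchy_seq s" "Cauchy_seq t" "\<And>n. s n \<in> V" "\<And>n. t n \<in> V"
 shows "convergent (\<lambda>n. B (s n) (t n))"
proof -
 obtain C where C: "C \<ge> 0" "\<And>n. B (s n) (s n) \<le> C" using Cauchy_seq_bounded[OF assms(1,3)] by blast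
 obtain C' where C': "C' \<ge> 0" "\<And>n. B (t n) (t n) \<le> C'" using Cauchy_seq_bounded[OF assms(2,4)] by blast
 have "Cauchy (\<lambda>n. B (s n) (t n))"
  unfolding Cauchy_def
 proof (intro allI impI)
  fix \<epsilon> :: real assume e: "\<epsilon> > 0"
  define K where "K = sqrt C + sqrt C' + 1"
  have K: "K > 0" "sqrt C \<le> K" "sqrt C' \<le> K" using C C' unfolding K_def by (auto intro: add_nonneg_pos)
  let ?d = "(\<epsilon> / (2*K))\<^sup>2"
  have d: "?d > 0" using e K by simp
  obtain N1 where N1: "\<And>i j. i \<ge> N1 ==> j \<ge> N1 ==> quad B (\<lambda>x. s i x - s j x) < ?d"
   using assms(1)[unfolded Cauchy_seq_def, rule_format, OF d] by auto
  obtain N2 where N2: "\<And>i j. i \<ge> N2 ==> j \<ge> N2 ==> quad B (\<lambda>x. t i x - t j x) < ?d"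
   using assms(2)[unfolded Cauchy_seq_def, rule_format, OF d] by auto
  have "dist (B (s i) (t i)) (B (s j) (t j)) < \<epsilon>" if ij: "i \<ge> max N1 N2" "j \<ge> max N1 N2" for i j
  proof -
   have eq: "B (s i) (t i) - B (s j) (t j) = B (\<lambda>x. s i x - s j x) (t i) + B (s j) (\<lambda>x. t i x - t j x)"
    using assms by (simp add: B_diffl B_diffr)
   have "sqrt (quad B (\<lambda>x. s i x - s j x)) < \<epsilon> / (2*K)"
    using real_sqrt_less_mono[OF N1[of i j]] ij e K by simp
   moreover have "sqrt (B (t i) (t i)) \<le> K" using C'(2)[of i] K real_sqrt_le_mono order_trans by blast
   ultimately have 1: "sqrt (quad B (\<lambda>x. s i x - s j x)) * sqrt (B (t i) (t i)) < \<epsilon>/(2*K) * K"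
    using K e B_nonneg[OF assms(4)[of i]] B_nonneg[OF V_diff[OF assms(3)[of i] assms(3)[of j]]]
    by (smt (verit, ccfv_SIG) divide_pos_pos mult_less_le_imp_less mult_left_mono mult_less_cancel_right real_sqrt_ge_zero)
   have "sqrt (quad B (\<lambda>x. t i x - t j x)) < \<epsilon> / (2*K)"
    using real_sqrt_less_mono[OF N2[of i j]] ij e K by simp
   moreover have "sqrt (B (s j) (s j)) \<le> K" using C(2)[of j] K real_sqrt_le_mono order_trans by blast
   ultimately have 2: "sqrt (B (s j) (s j)) * sqrt (quad B (\<lambda>x. t i x - t j x)) < K * (\<epsilon>/(2*K))"
    using K e B_nonneg[OF assms(3)[of j]] B_nonneg[OF V_diff[OF assms(4)[of i] assms(4)[of j]]]
    by (smt (verit, ccfv_SIG) divide_pos_pos mult_less_le_imp_less mult_left_mono mult_less_cancel_left real_sqrt_ge_zero mult_right_mono)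
   have "\<bar>B (s i) (t i) - B (s j) (t j)\<bar> < \<epsilon>/(2*K) * K + K * (\<epsilon>/(2*K))"
    unfolding eq
    using Cauchy_Schwarz[OF V_diff[OF assms(3)[of i] assms(3)[of j]] assms(4)[of i]]
     Cauchy_Schwarz[OF assms(3)[of j] V_diff[OF assms(4)[of i] assms(4)[of j]]] 1 2 by linarith
   also have "\<dots> = \<epsilon>" using K by simp
   finally show ?thesis by (simp add: dist_real_def)
  qed
  then show "\<exists>M. \<forall>m\<ge>M. \<forall>n\<ge>M. dist (B (s m) (t m)) (B (s n) (t n)) < \<epsilon>" by blast
 qed
 then show ?thesis by (simp add: Cauchy_convergent_iff)
qed

text \<open>Near-minimizers of \<open>B\<close> over a decreasing sequence of convex sets are Cauchy by the
 parallelogram identity; this replaces weak compactness throughout.\<close>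

lemma minimizing_Cauchy_seq:
 assumes sub: "\<And>n. C n \<subseteq> V" and dec: "\<And>n. C (Suc n) \<subseteq> C n"
  and conv: "\<And>n f g. f \<in> C n ==> g \<in> C n ==> (\<lambda>x. (f x + g x) / 2) \<in> C n"
  and bd: "\<And>n. \<exists>f\<in>C n. B f f \<le> K"
 obtains v where "\<And>n. v n \<in> C n" "Cauchy_seq v" "\<And>n. B (v n) (v n) \<le> K + 1 / real (Suc n)"
proof -
 \<comment> \<open>The infimum over \<open>C n\<close> increases with n and stays below
   \<open>K\<close>, hence converges; near-minimality of \<open>v n\<close> is measured against
   it.\<close>
 define d where "d n = (INF f\<in>C n. B f f)" for n
 have ne: "C n \<noteq> {}" for n using bd by blast
 have bb: "bdd_below ((\<lambda>f. B f f) ` C n)" for n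
  using sub B_nonneg by (intro bdd_belowI[of _ 0]) auto
 have d_le: "d n \<le> B f f" if "f \<in> C n" for n f
  unfolding d_def using that bb by (intro cINF_lower) auto
 have d_ge: "d n \<ge> 0" for n
  unfolding d_def using ne sub B_nonneg by (intro cINF_greatest) auto
 have dK: "d n \<le> K" for n using bd[of n] d_le by force
 have inc: "d n \<le> d (Suc n)" for n
  unfolding d_def using bb ne dec by (intro cINF_superset_mono) auto
 have "\<exists>f\<in>C n. B f f < d n + 1 / real (Suc n)" for n
  using cINF_less_iff[OF ne bb, of n "d n + 1 / real (Suc n)"] unfolding d_def by simp
 then obtain v where v: "\<And>n. v n \<in> C n" "\<And>n. B (v n) (v n) < d n + 1 / real (Suc n)" by metis
 have incs: "incseq d" using inc by (simp add: incseq_SucI)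
 have mono: "C n \<subseteq> C m" if "m \<le> n" for m n
  using lift_Suc_antimono_le[of C m n] dec that by blast
 have "convergent d"
  using incseq_convergent[OF incs, of K] dK unfolding convergent_def by metis
 then have Cd: "Cauchy d" by (rule convergent_Cauchy)
 have "Cauchy_seq v"
  unfolding Cauchy_seq_def
 proof (intro allI impI)
  fix \<epsilon> :: real assume e: "\<epsilon> > 0"
  obtain N1 where N1: "\<And>i j. i \<ge> N1 ==> j \<ge> N1 ==> \<bar>d i - d j\<bar> < \<epsilon> / 8"
   using Cd e unfolding Cauchy_def dist_real_def by (meson divide_pos_pos zero_less_numeral)
  obtain N2 :: nat where N2: "real N2 > 8 / \<epsilon>" using reals_Archimedean2 by blast
  have N2': "1 / real (Suc i) < \<epsilon> / 8" if "i \<ge> N2" for i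
  proof -
   have "real (Suc i) > 8 / \<epsilon>" using N2 that by simp
   then show ?thesis using e by (simp add: field_simps)
  qed
  \<comment> \<open>For i <= j both functions lie in the larger set \<open>C i\<close>, so their
    midpoint has energy at least \<open>d i\<close>. The parallelogram identity turns
    near-minimality of both into a small distance.\<close>
  have key: "quad B (\<lambda>x. v i x - v j x) < \<epsilon>" if ij: "i \<le> j" "i \<ge> max N1 N2" for i j
  proof -
   have vi: "v i \<in> C i" and vj: "v j \<in> C i" using v(1) mono[OF ij(1)] by auto
   have m: "d i \<le> quad B (\<lambda>x. (v i x + v j x) / 2)"
    by (rule d_le[OF conv[OF vi vj]])
   have "quad B (\<lambda>x. v i x - v j x) \<le> 2 * B (v i) (v i) + 2 * B (v j) (v j) - 4 * d i"
    using parallelogram[of "v i" "v j"] vi vj sub m by force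
   moreover have "\<bar>d i - d j\<bar> < \<epsilon> / 8" "1 / real (Suc i) < \<epsilon> / 8" "1 / real (Suc j) < \<epsilon> / 8"
    using N1[of i j] N2'[of i] N2'[of j] ij by auto
   moreover have "b < \<epsilon>" if "b \<le> 2 * x + 2 * y - 4 * p" "\<bar>p - q\<bar> < \<epsilon> / 8" "a < \<epsilon> / 8" "c < \<epsilon> / 8"
    "x < p + a" "y < q + c" for b x y p q a c :: real
    using that by linarith
   ultimately show ?thesis using v(2)[of i] v(2)[of j] by blast
  qed
  have "quad B (\<lambda>x. v i x - v j x) < \<epsilon>" if ij: "i \<ge> max N1 N2" "j \<ge> max N1 N2" for i j
  proof (cases "i \<le> j")
   case True
   then show ?thesis using key[of i j] ij by simp
  next
   case False
   have "v i \<in> V" "v j \<in> V" using v(1) sub by blast+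
   then show ?thesis using key[of j i] B_square_commute[of "v i" "v j"] False ij by simp
  qed
  then show "\<exists>N. \<forall>i\<ge>N. \<forall>j\<ge>N. quad B (\<lambda>x. v i x - v j x) < \<epsilon>" by blast
 qed
 moreover have "B (v n) (v n) \<le> K + 1 / real (Suc n)" for n
  using less_imp_le[OF v(2)[of n]] add_right_mono[OF dK[of n]] by (rule order_trans)
 ultimately show ?thesis using that v(1) by blast
qed

end

section \<open>Square integrable functions\<close>

lemma L2_space_iff: "f \<in> L2_space M \<longleftrightarrow> f \<in> borel_measurable M \<and> integrable M (\<lambda>x. (f x)\<^sup>2)"
 by (simp add: L2_space_def)

lemma L2_measurable: "f \<in> L2_space M ==> f \<in> borel_measurable M"
 by (simp add: L2_space_def)

lemma L2_integrable_square: "f \<in> L2_space M ==> integrable M (\<lambda>x. (f x)\<^sup>2)"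
 by (simp add: L2_space_def)

lemma L2_integrable_mult:
 assumes "f \<in> L2_space M" "g \<in> L2_space M"
 shows "integrable M (\<lambda>x. f x * g x)"
proof (rule Bochner_Integration.integrable_bound)
 show "integrable M (\<lambda>x. (f x)\<^sup>2 + (g x)\<^sup>2)"
  using assms by (auto simp: L2_space_def)
 show "(\<lambda>x. f x * g x) \<in> borel_measurable M" using assms[THEN L2_measurable] by measurable
 show "AE x in M. norm (f x * g x) \<le> norm ((f x)\<^sup>2 + (g x)\<^sup>2)"
 proof (rule AE_I2)
  fix x
  have "0 \<le> (\<bar>f x\<bar> - \<bar>g x\<bar>)\<^sup>2 + (f x)\<^sup>2 + (g x)\<^sup>2" by simp
  then have "2 * (\<bar>f x\<bar> * \<bar>g x\<bar>) \<le> 2 * ((f x)\<^sup>2 + (g x)\<^sup>2)"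
   by (simp only: power2_diff power2_abs) (simp add: algebra_simps)
  then show "norm (f x * g x) \<le> norm ((f x)\<^sup>2 + (g x)\<^sup>2)" by (simp add: abs_mult)
 qed
qed

lemma L2_bounded_by:
 assumes "g \<in> L2_space M" "f \<in> borel_measurable M" "AE x in M. \<bar>f x\<bar> \<le> \<bar>c * g x\<bar>"
 shows "f \<in> L2_space M"
proof -
 have i: "integrable M (\<lambda>x. c\<^sup>2 * (g x)\<^sup>2)" using assms by (auto simp: L2_space_def)
 have m: "(\<lambda>x. (f x)\<^sup>2) \<in> borel_measurable M" using assms by measurable
 have "AE x in M. norm ((f x)\<^sup>2) \<le> norm (c\<^sup>2 * (g x)\<^sup>2)"
  using assms(3)
 proof eventually_elim
  case (elim x)
  then have "\<bar>f x\<bar>\<^sup>2 \<le> \<bar>c * g x\<bar>\<^sup>2" by (intro power_mono) auto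
  then show ?case by (simp add: power_mult_distrib)
 qed
 with i m show ?thesis using assms(2) unfolding L2_space_iff
  by (blast intro: Bochner_Integration.integrable_bound)
qed

lemma L2_zero: "(\<lambda>x. 0) \<in> L2_space M" by (simp add: L2_space_def)

lemma L2_scale: "f \<in> L2_space M ==> (\<lambda>x. c * f x) \<in> L2_space M"
 by (auto simp: L2_space_def power_mult_distrib)

lemma L2_add:
 assumes "f \<in> L2_space M" "g \<in> L2_space M"
 shows "(\<lambda>x. f x + g x) \<in> L2_space M"
proof -
 have "integrable M (\<lambda>x. (f x)\<^sup>2 + 2 * (f x * g x) + (g x)\<^sup>2)"
  using L2_integrable_mult[OF assms] assms[THEN L2_integrable_square] by auto
 then show ?thesis using assms by (auto simp: L2_space_def power2_sum algebra_simps)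
qed

lemma L2_psd: "psd_form (L2_space M) (L2_inner M)"
proof
 fix f g h :: "'a \<Rightarrow> real" and c
 show "f \<in> L2_space M ==> g \<in> L2_space M ==> h \<in> L2_space M ==>
   L2_inner M (\<lambda>x. f x + g x) h = L2_inner M f h + L2_inner M g h"
  by (simp add: L2_inner_def distrib_right L2_integrable_mult)
 show "L2_inner M (\<lambda>x. c * f x) h = c * L2_inner M f h"
  by (simp add: L2_inner_def mult.assoc)
qed (auto simp: L2_zero L2_add L2_scale L2_inner_def mult.commute)

interpretation L2: psd_form "L2_space M" "L2_inner M" for M :: "'a measure"
 by (rule L2_psd)

lemma L2_inner_square: "L2_inner M f f = (\<integral>x. (f x)\<^sup>2 \<partial>M)"
 by (simp add: L2_inner_def power2_eq_square)

lemma L2_zero_AE: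
 assumes "f \<in> L2_space M" "L2_inner M f f = 0"
 shows "AE x in M. f x = 0"
 using integral_nonneg_eq_0_iff_AE[OF L2_integrable_square[OF assms(1)]] assms(2)
 by (simp add: L2_inner_square)

lemma L2_diff_zero_AE:
 assumes "f \<in> L2_space M" "g \<in> L2_space M"
  "quad (L2_inner M) (\<lambda>x. f x - g x) = 0"
 shows "AE x in M. f x = g x"
 using L2_zero_AE[OF L2.V_diff[OF assms(1,2)] assms(3)] by simp

lemma L2_tendsto_AE_subseq:
 assumes "\<And>n. f n \<in> L2_space M" "g \<in> L2_space M"
  "L2_tendsto M f g"
 obtains r :: "nat \<Rightarrow> nat" where "strict_mono r" "AE x in M. (\<lambda>n. f (r n) x) ----> g x"
proof -
 have "integrable M (\<lambda>x. (f n x - g x)\<^sup>2)" for n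
  by (intro L2_integrable_square L2.V_diff assms)
 moreover have "(\<lambda>n. \<integral>x. norm ((f n x - g x)\<^sup>2) \<partial>M) ----> 0"
  using assms(3) by (simp add: L2_inner_square)
 ultimately obtain r :: "nat \<Rightarrow> nat" where r: "strict_mono r" "AE x in M. (\<lambda>n. (f (r n) x - g x)\<^sup>2) ----> 0"
  using tendsto_L1_AE_subseq[of M "\<lambda>n x. (f n x - g x)\<^sup>2"] by blast
 have "AE x in M. (\<lambda>n. f (r n) x) ----> g x"
  using r(2)
 proof eventually_elim
  case (elim x)
  have "(\<lambda>n. f (r n) x - g x) ----> 0"
   using tendsto_real_sqrt[OF elim] by (simp add: tendsto_rabs_zero_iff)
  then show ?case using Lim_null by blast
 qed
 with r(1) that show ?thesis by blast
qed

lemma L2_dominated_convergence: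
 assumes "\<And>n. f n \<in> borel_measurable M" "g \<in> borel_measurable M" "h \<in> L2_space M"
  "AE x in M. (\<lambda>n. f n x) ----> g x" "\<And>n. AE x in M. \<bar>f n x\<bar> \<le> c * \<bar>h x\<bar>"
 shows "L2_tendsto M f g"
  and "g \<in> L2_space M" and "\<And>n. f n \<in> L2_space M"
proof -
 note [measurable] = assms(1,2) L2_measurable[OF assms(3)]
 have ab: "AE x in M. \<forall>n. \<bar>f n x\<bar> \<le> c * \<bar>h x\<bar>" using assms(5) by (simp add: AE_all_countable)
 have gb: "AE x in M. \<bar>g x\<bar> \<le> c * \<bar>h x\<bar>"
  using ab assms(4)
 proof eventually_elim
  case (elim x)
  have "(\<lambda>n. \<bar>f n x\<bar>) ----> \<bar>g x\<bar>" using elim(2) by (rule tendsto_rabs)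
  then show ?case using elim(1) by (intro LIMSEQ_le_const2) auto
 qed
 have le: "c * \<bar>t\<bar> \<le> \<bar>c * t\<bar>" for t :: real
  using abs_ge_self[of "c * \<bar>t\<bar>"] by (simp add: abs_mult)
 have "AE x in M. \<bar>g x\<bar> \<le> \<bar>c * h x\<bar>" using gb by eventually_elim (use le order_trans in blast)
 then show "g \<in> L2_space M" by (rule L2_bounded_by[OF assms(3,2)])
 have "AE x in M. \<bar>f n x\<bar> \<le> \<bar>c * h x\<bar>" for n
  using assms(5)[of n] by eventually_elim (use le order_trans in blast)
 then show "f n \<in> L2_space M" for n by (rule L2_bounded_by[OF assms(3,1)])
 have "(\<lambda>n. \<integral>x. (f n x - g x)\<^sup>2 \<partial>M) ----> (\<integral>x. 0 \<partial>M)"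
 proof (rule integral_dominated_convergence[where w = "\<lambda>x. 4 * c\<^sup>2 * (h x)\<^sup>2"])
  show "integrable M (\<lambda>x. 4 * c\<^sup>2 * (h x)\<^sup>2)" using assms(3) by (auto simp: L2_space_def)
  show "AE x in M. (\<lambda>n. (f n x - g x)\<^sup>2) ----> 0"
   using assms(4)
  proof eventually_elim
   case (elim x)
   have "(\<lambda>n. (f n x - g x)\<^sup>2) ----> (g x - g x)\<^sup>2" by (intro tendsto_intros elim)
   then show ?case by simp
  qed
  show "AE x in M. norm ((f n x - g x)\<^sup>2) \<le> 4 * c\<^sup>2 * (h x)\<^sup>2" for n
   using assms(5)[of n] gb
  proof eventually_elim
   case (elim x)
   have "\<bar>f n x - g x\<bar> \<le> 2 * (c * \<bar>h x\<bar>)" using elim by linarith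
   then have "\<bar>f n x - g x\<bar>\<^sup>2 \<le> (2 * (c * \<bar>h x\<bar>))\<^sup>2" by (intro power_mono) auto
   then show ?case by (simp add: power_mult_distrib)
  qed
 qed measurable
 then show "L2_tendsto M f g"
  by (simp add: L2_inner_square)
qed

lemma LIMSEQ_null_bounded:
 fixes f :: "nat \<Rightarrow> real"
 assumes "g ----> 0" "\<And>n. \<bar>f n\<bar> \<le> g n"
 shows "f ----> 0"
 by (rule Lim_null_comparison[OF always_eventually assms(1)]) (use assms(2) in auto)

lemma LIMSEQ_I_bounded:
 fixes f :: "nat \<Rightarrow> real"
 assumes "g ----> 0" "\<And>n. \<bar>f n - l\<bar> \<le> g n"
 shows "f ----> l"
 using LIMSEQ_null_bounded[OF assms] Lim_null[of f l sequentially] by simp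

lemma (in psd_form) square_midpoint_le:
 assumes "f \<in> V" "g \<in> V"
 shows "quad B (\<lambda>x. (f x + g x) / 2) \<le> (B f f + B g g) / 2"
proof -
 have "m \<le> (a + b) / 2" if "p = 2 * a + 2 * b - 4 * m" "0 \<le> p" for p a b m :: real
  using that by simp
 from this[OF parallelogram[OF assms] B_nonneg[OF V_diff[OF assms]]] show ?thesis .
qed

text \<open>Projection argument: a minimizer w of the energy on the affine hyperplane
  \<open>l = 1\<close> is orthogonal to the kernel of \<open>l\<close>, so
  \<open>B w v = l v * B w w\<close>, and w divided by its energy represents \<open>l\<close>.
  Completeness is an assumption because it is supplied later by closedness of the form.\<close>

lemma (in psd_form) Riesz_representer:
 assumes complete: "\<And>s. (\<And>n. s n \<in> V) ==> Cauchy_seq s ==>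
   \<exists>f\<in>V. form_tendsto B s f"
  and l_add: "\<And>f g. f \<in> V ==> g \<in> V ==> l (\<lambda>x. f x + g x) = l f + l g"
  and l_scale: "\<And>f c. f \<in> V ==> l (\<lambda>x. c * f x) = c * l f"
  and l_bound: "\<And>f. f \<in> V ==> \<bar>l f\<bar> \<le> K * sqrt (B f f)"
 shows "\<exists>u\<in>V. \<forall>v\<in>V. B u v = l v"
proof (cases "\<forall>v\<in>V. l v = 0")
 case True
 then show ?thesis using V_zero B_zerol by (intro bexI[of _ "\<lambda>x. 0"]) auto
next
 case False
 then obtain v0 where v0: "v0 \<in> V" "l v0 \<noteq> 0" by blast
 have l_diff: "l (\<lambda>x. f x - g x) = l f - l g" if "f \<in> V" "g \<in> V" for f g
  using l_add[of f "\<lambda>x. (-1) * g x"] l_scale[of g "-1"] V_scale[of g "-1"] that by simp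
 define C where "C = {v \<in> V. l v = 1}"
 have v1: "(\<lambda>x. inverse (l v0) * v0 x) \<in> C" using v0 by (auto simp: C_def V_scale l_scale)
 define d where "d = (INF v\<in>C. B v v)"
 have bb: "bdd_below ((\<lambda>v. B v v) ` C)" by (intro bdd_belowI[of _ 0]) (auto simp: C_def B_nonneg)
 have d_le: "d \<le> B v v" if "v \<in> C" for v unfolding d_def using bb that by (intro cINF_lower) auto
 \<comment> \<open>These sublevel sets just above the infimum \<open>d\<close> decrease and are
   stable under midpoints, so near-minimizers can be chosen Cauchy; membership in
   \<open>Cn n\<close> keeps their energy within 1/(n+1) of \<open>d\<close>.\<close>
 define Cn where "Cn n = {v \<in> C. B v v \<le> d + 1 / real (Suc n)}" for n
 have C_mid: "(\<lambda>x. (f x + g x) / 2) \<in> C" if "f \<in> C" "g \<in> C" for f g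
  using that V_scale[OF V_add[of f g], of "1/2"] l_scale[OF V_add[of f g], of "1/2"]
  by (auto simp: C_def l_add)
 obtain v where v: "\<And>n. v n \<in> Cn n" "Cauchy_seq v"
 proof (rule minimizing_Cauchy_seq[of Cn "d + 1"])
  show "Cn n \<subseteq> V" for n by (auto simp: Cn_def C_def)
  have "1 / real (Suc (Suc n)) \<le> 1 / real (Suc n)" for n by (simp add: field_simps)
  then show "Cn (Suc n) \<subseteq> Cn n" for n unfolding Cn_def by (smt (verit, best) mem_Collect_eq subsetI)
  show "(\<lambda>x. (f x + g x) / 2) \<in> Cn n" if "f \<in> Cn n" "g \<in> Cn n" for f g n
  proof -
   have "f \<in> C" "g \<in> C" using that by (auto simp: Cn_def)
   then show ?thesis using that C_mid[of f g] square_midpoint_le[of f g] by (simp add: Cn_def C_def)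
  qed
  show "\<exists>f\<in>Cn n. B f f \<le> d + 1" for n
  proof -
   have "d < d + 1 / real (Suc n)" by simp
   then obtain f where "f \<in> C" "B f f < d + 1 / real (Suc n)"
    using cINF_less_iff[OF _ bb, of "d + 1 / real (Suc n)"] v1 unfolding d_def by blast
   moreover have "1 / real (Suc n) \<le> 1" by simp
   ultimately have "f \<in> Cn n" "B f f \<le> d + 1" unfolding Cn_def by (simp, linarith)
   then show ?thesis by blast
  qed
 qed blast
 have vV: "v n \<in> V" for n using v(1)[of n] by (auto simp: Cn_def C_def)
 obtain w where w: "w \<in> V" "form_tendsto B v w"
  using complete[OF vV v(2)] by blast
 have "(\<lambda>n. l (v n)) ----> l w"
 proof -
  have "(\<lambda>n. K * sqrt (quad B (\<lambda>x. v n x - w x))) ----> 0"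
   using tendsto_mult[OF tendsto_const tendsto_real_sqrt[OF w(2)]] by simp
  moreover have "\<bar>l (v n) - l w\<bar> \<le> K * sqrt (quad B (\<lambda>x. v n x - w x))" for n
   using l_bound[OF V_diff[OF vV[of n] w(1)]] l_diff[OF vV[of n] w(1)] by simp
  ultimately show ?thesis by (rule LIMSEQ_I_bounded)
 qed
 moreover have "l (v n) = 1" for n using v(1)[of n] by (auto simp: Cn_def C_def)
 ultimately have lw: "l w = 1" by (simp add: LIMSEQ_const_iff)
 then have wC: "w \<in> C" using w(1) by (simp add: C_def)
 have "(\<lambda>n. B (v n) (v n)) ----> B w w" using tendsto_B[OF vV vV w(1,1) w(2,2)] .
 moreover have "(\<lambda>n. d + 1 / real (Suc n)) ----> d"
  using tendsto_add[OF tendsto_const LIMSEQ_inverse_real_of_nat, of d] by (simp add: inverse_eq_divide)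
 moreover have "B (v n) (v n) \<le> d + 1 / real (Suc n)" for n using v(1)[of n] by (simp add: Cn_def)
 ultimately have Bw: "B w w \<le> d" by (intro LIMSEQ_le) auto
 have orth: "B w h = 0" if h: "h \<in> V" "l h = 0" for h
 proof (rule ccontr)
  assume n: "B w h \<noteq> 0"
  have q: "0 \<le> 2 * t * B w h + t\<^sup>2 * B h h" for t
  proof -
   have "(\<lambda>x. w x + t * h x) \<in> C" using wC h by (auto simp: C_def V_add V_scale l_add l_scale)
   then have "B w w \<le> quad B (\<lambda>x. w x + t * h x)" using d_le Bw by force
   then show ?thesis using w(1) h by (simp add: B_square_add V_scale B_square_scale B_scaler)
  qed
  \<comment> \<open>Adding the multiple \<open>- B w h * t\<close> of h to w changes the energy by
    \<open>(B w h)^2 * t * (t * B h h - 2)\<close>, which is negative because this t satisfies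
    \<open>t * B h h <= 1\<close>.\<close>
  define t where "t = inverse (B h h + 1)"
  have p: "B h h + 1 > 0" using B_nonneg[OF h(1)] by linarith
  have t: "t > 0" "t * B h h \<le> 1" using p by (auto simp: t_def field_simps)
  have "2 * (- B w h * t) * B w h + (- B w h * t)\<^sup>2 * B h h = (B w h)\<^sup>2 * (t * (t * B h h - 2))"
   by (simp add: algebra_simps power2_eq_square)
  also have "\<dots> < 0" using n t by (intro mult_pos_neg) auto
  finally show False using q[of "- B w h * t"] by linarith
 qed
 have Bwv: "B w v = l v * B w w" if "v \<in> V" for v
 proof -
  have "l (\<lambda>x. v x - l v * w x) = 0"
   using that w(1) lw by (simp add: l_diff V_scale l_scale)
  then have "B w (\<lambda>x. v x - l v * w x) = 0" using that w(1) by (intro orth V_diff V_scale)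
  then show ?thesis using that w(1) by (simp add: B_diffr V_scale B_scaler)
 qed
 have "B w w \<noteq> 0"
 proof
  assume "B w w = 0"
  then show False using l_bound[OF w(1)] lw by simp
 qed
 then have "B (\<lambda>x. inverse (B w w) * w x) v = l v" if "v \<in> V" for v
  using Bwv[OF that] B_scalel[OF w(1) that] by simp
 then show ?thesis using V_scale[OF w(1)] by blast
qed

section \<open>Dirichlet forms\<close>

context dirichlet_form
begin

sublocale form: psd_form F E
 using domain_zero domain_add domain_scale form_sym form_add form_scale form_nonneg
 by unfold_locales auto

abbreviation E1 :: "('a \<Rightarrow> real) \<Rightarrow> ('a \<Rightarrow> real) \<Rightarrow> real" where "E1 \<equiv> form_plus M E 1"

lemma E1_eq: "E1 f g = E f g + L2_inner M f g" by (simp add: form_plus_def)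

lemma form_plus_psd:
 assumes "a \<ge> 0" shows "psd_form F (form_plus M E a)"
proof
 have L: "f \<in> F ==> f \<in> L2_space M" for f using domain_L2 by auto
 fix f g h :: "'a \<Rightarrow> real" and c
 show "f \<in> F ==> g \<in> F ==> form_plus M E a f g = form_plus M E a g f"
  by (simp add: form_plus_def form_sym L L2.B_sym)
 show "f \<in> F ==> g \<in> F ==> h \<in> F ==>
   form_plus M E a (\<lambda>x. f x + g x) h = form_plus M E a f h + form_plus M E a g h"
  by (simp add: form_plus_def form_add L L2.B_addl algebra_simps)
 show "f \<in> F ==> h \<in> F ==> form_plus M E a (\<lambda>x. c * f x) h = c * form_plus M E a f h"
  by (simp add: form_plus_def form_scale L L2.B_scalel algebra_simps)
 show "f \<in> F ==> 0 \<le> form_plus M E a f f"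
  using assms by (simp add: form_plus_def form_nonneg L L2.B_nonneg)
qed (auto simp: domain_zero domain_add domain_scale)

sublocale form1: psd_form F E1 by (rule form_plus_psd) simp

lemma F_L2: "f \<in> F ==> f \<in> L2_space M" using domain_L2 by auto

lemma F_measurable: "f \<in> F ==> f \<in> borel_measurable M" using F_L2 L2_measurable by auto

lemma E_le_E1: "f \<in> F ==> E f f \<le> E1 f f" by (simp add: E1_eq F_L2 L2.B_nonneg)

lemma L2_le_E1: "f \<in> F ==> L2_inner M f f \<le> E1 f f" by (simp add: E1_eq form_nonneg)

section \<open>Closedness, lower semicontinuity and weak convergence for the energy\<close>

lemma E_cong_AE:
 assumes "f \<in> F" "g \<in> F" "h \<in> F" "k \<in> F" "AE x in M. f x = g x" "AE x in M. h x = k x"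
 shows "E f h = E g k"
 using form_version[OF assms(1,2,3,5)] form_version[OF assms(3,4,2,6)] assms
 by (simp add: form_sym[of g])

lemma E_square_diff_cong_AE:
 assumes "f \<in> F" "g \<in> F" "s \<in> F" "AE x in M. f x = g x"
 shows "quad E (\<lambda>x. s x - f x) = quad E (\<lambda>x. s x - g x)"
proof -
 have "AE x in M. s x - f x = s x - g x" using assms(4) by eventually_elim simp
 then show ?thesis using assms by (intro E_cong_AE) (auto intro: form.V_diff)
qed

text \<open>The axiom \<open>form_closed\<close> only yields some limit g. Since E1-convergence
  contains L2-convergence, g and f agree almost everywhere, and \<open>domain_version\<close>
  carries membership and convergence over to f itself.\<close>

lemma closed_Cauchy:
 assumes s: "\<And>n. s n \<in> F" "form.Cauchy_seq s" and f: "f \<in> L2_space M" "L2_tendsto M s f"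
 shows "f \<in> F" "form_tendsto E s f"
  "form_tendsto E1 s f"
proof -
 note sL = s(1)[THEN F_L2]
 have "\<exists>N. \<forall>i\<ge>N. \<forall>j\<ge>N. quad E1 (\<lambda>x. s i x - s j x) < e" if "e > 0" for e :: real
 proof -
  obtain N1 where N1: "\<And>i j. i \<ge> N1 ==> j \<ge> N1 ==> quad E (\<lambda>x. s i x - s j x) < e/2"
   using s(2)[unfolded form.Cauchy_seq_def, rule_format, of "e/2"] \<open>e > 0\<close> by auto
  have "\<forall>\<^sub>F n in sequentially. quad (L2_inner M) (\<lambda>x. s n x - f x) < e/8"
   using order_tendstoD(2)[OF f(2), of "e/8"] that by simp
  then obtain N2 where N2: "\<And>n. n \<ge> N2 ==> quad (L2_inner M) (\<lambda>x. s n x - f x) < e/8"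
   by (auto simp: eventually_sequentially)
  have "quad E1 (\<lambda>x. s i x - s j x) < e" if "i \<ge> max N1 N2" "j \<ge> max N1 N2" for i j
  proof -
   have "quad (L2_inner M) (\<lambda>x. (s i x - f x) - (s j x - f x)) \<le>
     2 * quad (L2_inner M) (\<lambda>x. s i x - f x) + 2 * quad (L2_inner M) (\<lambda>x. s j x - f x)"
    using sL f(1) by (intro L2.square_diff_le L2.V_diff)
   then show ?thesis using N1[of i j] N2[of i] N2[of j] that by (simp add: E1_eq)
  qed
  then show ?thesis by blast
 qed
 from form_closed[OF s(1) this] obtain g where g: "g \<in> F"
  "form_tendsto E1 s g" by blast
 have Lg: "L2_tendsto M s g"
  by (rule tendsto_sandwich[OF _ _ tendsto_const g(2)])
   (auto intro!: always_eventually L2.B_nonneg L2.V_diff sL F_L2 g L2_le_E1 form.V_diff s)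
 have Eg: "form_tendsto E s g"
  by (rule tendsto_sandwich[OF _ _ tendsto_const g(2)])
   (auto intro!: always_eventually form_nonneg E_le_E1 form.V_diff s g)
 have "quad (L2_inner M) (\<lambda>x. g x - f x) \<le> 0"
 proof (rule LIMSEQ_le_const)
  show "(\<lambda>n. 2 * quad (L2_inner M) (\<lambda>x. s n x - f x) + 2 * quad (L2_inner M) (\<lambda>x. s n x - g x)) ----> 0"
   using tendsto_add[OF tendsto_mult[OF tendsto_const f(2)] tendsto_mult[OF tendsto_const Lg], of 2 2] by simp
  have "quad (L2_inner M) (\<lambda>x. (s n x - f x) - (s n x - g x)) \<le>
    2 * quad (L2_inner M) (\<lambda>x. s n x - f x) + 2 * quad (L2_inner M) (\<lambda>x. s n x - g x)" for n
   using sL f(1) g(1)[THEN F_L2] by (intro L2.square_diff_le L2.V_diff)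
  then show "\<exists>N. \<forall>n\<ge>N. quad (L2_inner M) (\<lambda>x. g x - f x) \<le>
    2 * quad (L2_inner M) (\<lambda>x. s n x - f x) + 2 * quad (L2_inner M) (\<lambda>x. s n x - g x)"
   by simp
 qed
 then have ae: "AE x in M. g x = f x"
  using L2.B_nonneg[OF L2.V_diff[OF F_L2[OF g(1)] f(1)]]
  by (intro L2_diff_zero_AE F_L2 g(1) f(1)) linarith
 then show fF: "f \<in> F" using domain_version[OF g(1) L2_measurable[OF f(1)]] by simp
 show Ef: "form_tendsto E s f"
  using Eg E_square_diff_cong_AE[OF g(1) fF s(1) ae] by simp
 show "form_tendsto E1 s f"
  unfolding E1_eq using tendsto_add[OF Ef f(2)] by simp
qed

lemma L2_ball_mid:
 assumes "f \<in> L2_space M" "g \<in> L2_space M" "h \<in> L2_space M"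
  "quad (L2_inner M) (\<lambda>x. g x - f x) \<le> c" "quad (L2_inner M) (\<lambda>x. h x - f x) \<le> c"
 shows "quad (L2_inner M) (\<lambda>x. (g x + h x) / 2 - f x) \<le> c"
proof -
 have eq: "(\<lambda>x. (g x + h x) / 2 - f x) = (\<lambda>x. ((g x - f x) + (h x - f x)) / 2)"
  by (auto simp: field_simps)
 have "(quad (L2_inner M) (\<lambda>x. g x - f x) + quad (L2_inner M) (\<lambda>x. h x - f x)) / 2 \<le> c"
  using assms(4,5) by simp
 then show ?thesis unfolding eq
  by (rule order_trans[OF L2.square_midpoint_le[OF L2.V_diff[OF assms(2,1)] L2.V_diff[OF assms(3,1)]]])
qed

text \<open>A substitute for Banach-Saks. Among the elements of \<open>C\<close> whose squared L2
  distance to f is at most 1/(n+1), near-minimizers of the energy form a Cauchy sequence. Keeping a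
  class \<open>C\<close> stable under midpoints lets the approximants retain pointwise constraints
  such as a uniform bound or values on a compact set.\<close>

lemma bounded_energy_closed:
 assumes C: "C \<subseteq> F" "\<And>f g. f \<in> C ==> g \<in> C ==> (\<lambda>x. (f x + g x) / 2) \<in> C"
  and w: "\<And>n. w n \<in> C" "\<And>n. E (w n) (w n) \<le> K"
  and f: "f \<in> L2_space M" "L2_tendsto M w f"
 shows "f \<in> F" "E f f \<le> K"
  "\<exists>v. (\<forall>n. v n \<in> C) \<and> form_tendsto E1 v f"
proof -
 define Cn where "Cn n = {v \<in> C. quad (L2_inner M) (\<lambda>x. v x - f x) \<le> 1 / real (Suc n)}" for n
 have CL: "v \<in> C ==> v \<in> L2_space M" for v using C(1) F_L2 by auto
 obtain v where v: "\<And>n. v n \<in> Cn n" "form.Cauchy_seq v" "\<And>n. E (v n) (v n) \<le> K + 1 / real (Suc n)"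
 proof (rule form.minimizing_Cauchy_seq[of Cn K])
  show "Cn n \<subseteq> F" for n using C by (auto simp: Cn_def)
  have "1 / real (Suc (Suc n)) \<le> 1 / real (Suc n)" for n by (simp add: field_simps)
  then show "Cn (Suc n) \<subseteq> Cn n" for n unfolding Cn_def by (smt (verit, best) mem_Collect_eq subsetI)
  show "(\<lambda>x. (g x + h x) / 2) \<in> Cn n" if "g \<in> Cn n" "h \<in> Cn n" for g h n
   using that C(2)[of g h] L2_ball_mid[OF f(1) CL[of g] CL[of h]] by (simp add: Cn_def)
  show "\<exists>f\<in>Cn n. E f f \<le> K" for n
  proof -
   have "\<forall>\<^sub>F m in sequentially. quad (L2_inner M) (\<lambda>x. w m x - f x) < 1 / real (Suc n)"
    using order_tendstoD(2)[OF f(2), of "1 / real (Suc n)"] by simp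
   then obtain m where "quad (L2_inner M) (\<lambda>x. w m x - f x) < 1 / real (Suc n)"
    by (auto simp: eventually_sequentially)
   then show ?thesis using w by (intro bexI[of _ "w m"]) (auto simp: Cn_def)
  qed
 qed blast
 have vC: "v n \<in> C" for n using v(1)[of n] by (simp add: Cn_def)
 then have vF: "v n \<in> F" for n using C(1) by auto
 have lim: "(\<lambda>n. 1 / real (Suc n)) ----> 0" using LIMSEQ_inverse_real_of_nat by (simp add: inverse_eq_divide)
 have Lv: "L2_tendsto M v f"
 proof (rule tendsto_sandwich[OF _ _ tendsto_const lim])
  show "\<forall>\<^sub>F n in sequentially. 0 \<le> quad (L2_inner M) (\<lambda>x. v n x - f x)"
   by (intro always_eventually allI L2.B_nonneg L2.V_diff CL vC f(1))
  show "\<forall>\<^sub>F n in sequentially. quad (L2_inner M) (\<lambda>x. v n x - f x) \<le> 1 / real (Suc n)"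
   using v(1) by (auto simp: Cn_def)
 qed
 note cl = closed_Cauchy[OF vF v(2) f(1) Lv]
 show "f \<in> F" by (rule cl)
 show "\<exists>v. (\<forall>n. v n \<in> C) \<and> form_tendsto E1 v f"
  using vC cl(3) by blast
 have "(\<lambda>n. E (v n) (v n)) ----> E f f" using form.tendsto_B[OF vF vF cl(1,1) cl(2,2)] .
 moreover have "(\<lambda>n. K + 1 / real (Suc n)) ----> K" using tendsto_add[OF tendsto_const lim, of K] by simp
 ultimately show "E f f \<le> K" using v(3) by (intro LIMSEQ_le) auto
qed

lemma F_midpoint: "f \<in> F ==> g \<in> F ==> (\<lambda>x. (f x + g x) / 2) \<in> F"
 using domain_scale[OF domain_add, of f g "1/2"] by simp

lemma lower_semicontinuous:
 assumes "\<And>n. w n \<in> F" "\<And>n. E (w n) (w n) \<le> K" "f \<in> L2_space M" "L2_tendsto M w f"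
 shows "f \<in> F" "E f f \<le> K"
 using bounded_energy_closed(1,2)[of F w K f] assms F_midpoint by auto

text \<open>If \<open>E (w n) v <= - \<epsilon>\<close> for infinitely many n, lower semicontinuity
  along \<open>w n + t v\<close>, which tends to \<open>t v\<close> in L2, gives
  \<open>t^2 * E v v <= K - 2 * t * \<epsilon> + t^2 * E v v\<close> for every t > 0. This fails for
  large t.\<close>

lemma weak_convergence_one_sided:
 assumes w: "\<And>n. w n \<in> F" "\<And>n. E (w n) (w n) \<le> K" and L: "L2_tendsto M w (\<lambda>x. 0)"
  and v: "v \<in> F" and e: "\<epsilon> > 0"
 shows "finite {n. E (w n) v \<le> - \<epsilon>}"
proof (rule ccontr)
 assume "infinite {n. E (w n) v \<le> - \<epsilon>}"
 then obtain r :: "nat \<Rightarrow> nat" where r: "strict_mono r" "\<And>n. E (w (r n)) v \<le> - \<epsilon>"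
  using infinite_enumerate[of "{n. E (w n) v \<le> - \<epsilon>}"] by auto
 have K: "K \<ge> 0" using form_nonneg[OF w(1)[of 0]] w(2)[of 0] by linarith
 have b: "2 * t * \<epsilon> \<le> K" if t: "t > 0" for t
 proof -
  define u where "u n = (\<lambda>x. w (r n) x + t * v x)" for n
  have tv: "(\<lambda>x. t * v x) \<in> F" by (rule domain_scale[OF v])
  have "quad E (\<lambda>x. t * v x) \<le> K - 2 * t * \<epsilon> + t\<^sup>2 * E v v"
  proof (rule lower_semicontinuous[of u])
   show "u n \<in> F" for n unfolding u_def by (rule domain_add[OF w(1) tv])
   show "E (u n) (u n) \<le> K - 2 * t * \<epsilon> + t\<^sup>2 * E v v" for n
   proof -
    have "E (u n) (u n) = E (w (r n)) (w (r n)) + 2 * (t * E (w (r n)) v) + t\<^sup>2 * E v v"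
     unfolding u_def by (simp only: form.B_square_add[OF w(1) tv] form.B_scaler[OF v w(1)] form.B_square_scale[OF v])
    moreover have "t * E (w (r n)) v \<le> t * (- \<epsilon>)" using r(2)[of n] t by (intro mult_left_mono) auto
    ultimately show ?thesis using w(2)[of "r n"] by simp
   qed
   show "(\<lambda>x. t * v x) \<in> L2_space M" by (rule F_L2[OF tv])
   show "L2_tendsto M u (\<lambda>x. t * v x)"
    using LIMSEQ_subseq_LIMSEQ[OF L r(1)] by (simp add: u_def o_def)
  qed
  then show ?thesis using v by (simp add: form.B_square_scale)
 qed
 have "2 * (K / \<epsilon> + 1) * \<epsilon> = 2 * K + 2 * \<epsilon>" using e by (simp add: field_simps)
 moreover have "K / \<epsilon> + 1 > 0" using K e by (simp add: add_nonneg_pos)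
 ultimately show False using b[of "K / \<epsilon> + 1"] e K by linarith
qed

text \<open>The one-sided statement is applied to \<open>w n - f\<close> with both v and -v. This
  replaces weak compactness of bounded sets: bounded energy and L2 convergence already force
  convergence of \<open>E (w n) v\<close>.\<close>

lemma weak_convergence:
 assumes w: "\<And>n. w n \<in> F" "\<And>n. E (w n) (w n) \<le> K" and f: "f \<in> L2_space M" "L2_tendsto M w f" and v: "v \<in> F"
 shows "f \<in> F" "(\<lambda>n. E (w n) v) ----> E f v"
proof -
 show fF: "f \<in> F" by (rule lower_semicontinuous[OF w f])
 define d where "d n = (\<lambda>x. w n x - f x)" for n
 have dF: "d n \<in> F" for n unfolding d_def by (rule form.V_diff[OF w(1) fF])
 have db: "E (d n) (d n) \<le> 2 * K + 2 * E f f" for n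
  using form.square_diff_le[OF w(1)[of n] fF] w(2)[of n] unfolding d_def by linarith
 have dL: "L2_tendsto M d (\<lambda>x. 0)" using f(2) by (simp add: d_def)
 have "(\<lambda>n. E (d n) v) ----> 0"
 proof (rule LIMSEQ_I)
  fix \<epsilon> :: real assume e: "\<epsilon> > 0"
  have "finite ({n. E (d n) v \<le> - \<epsilon>} \<union> {n. E (d n) (\<lambda>x. - v x) \<le> - \<epsilon>})"
   using weak_convergence_one_sided[OF dF db dL v e]
    weak_convergence_one_sided[OF dF db dL form.V_uminus[OF v] e] by simp
  then obtain N where N: "\<And>n. n \<in> {n. E (d n) v \<le> - \<epsilon>} \<union> {n. E (d n) (\<lambda>x. - v x) \<le> - \<epsilon>} ==> n < N"
   unfolding finite_nat_set_iff_bounded by blast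
  have "norm (E (d n) v - 0) < \<epsilon>" if "n \<ge> N" for n
  proof -
   have "n \<notin> {n. E (d n) v \<le> - \<epsilon>} \<union> {n. E (d n) (\<lambda>x. - v x) \<le> - \<epsilon>}" using N[of n] that leD by blast
   moreover have "E (d n) (\<lambda>x. - v x) = - E (d n) v" using form.B_scaler[OF v dF[of n], where c = "-1"] by simp
   ultimately show ?thesis by auto
  qed
  then show "\<exists>N. \<forall>n\<ge>N. norm (E (d n) v - 0) < \<epsilon>" by blast
 qed
 moreover have "E (d n) v = E (w n) v - E f v" for n unfolding d_def by (rule form.B_diffl[OF w(1) fF v])
 ultimately show "(\<lambda>n. E (w n) v) ----> E f v"
  using Lim_null[of "\<lambda>n. E (w n) v" "E f v" sequentially] by simp
qed

end

subsection \<open>The resolvent and the approximating forms\<close>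

context dirichlet_form
begin

lemma form_plus_complete:
 assumes a: "\<alpha> > 0" and s: "\<And>n. s n \<in> F" "psd_form.Cauchy_seq (form_plus M E \<alpha>) s"
 shows "\<exists>f\<in>F. form_tendsto (form_plus M E \<alpha>) s f"
proof -
 interpret P: psd_form F "form_plus M E \<alpha>" by (rule form_plus_psd) (use a in simp)
 \<comment> \<open>\<open>c\<close> and \<open>c'\<close> are the constants in the equivalence of
   the quadratic forms for parameters 1 and \<open>\<alpha>\<close>, so completeness for
   \<open>\<alpha>\<close> follows from \<open>form_closed\<close>.\<close>
 define c where "c = max 1 (1 / \<alpha>)"
 define c' where "c' = max 1 \<alpha>"
 have c: "c > 0" "1 \<le> c" "1 \<le> c * \<alpha>" using a by (auto simp: c_def field_simps max_def)
 have c': "1 \<le> c'" "\<alpha> \<le> c'" by (auto simp: c'_def)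
 have up: "E1 f f \<le> c * form_plus M E \<alpha> f f" if "f \<in> F" for f
 proof -
  have "1 * E f f + 1 * L2_inner M f f \<le> c * E f f + (c * \<alpha>) * L2_inner M f f"
   using c that by (intro add_mono mult_right_mono form_nonneg L2.B_nonneg F_L2) auto
  then show ?thesis by (simp add: form_plus_def algebra_simps)
 qed
 have dn: "form_plus M E \<alpha> f f \<le> c' * E1 f f" if "f \<in> F" for f
 proof -
  have "1 * E f f + \<alpha> * L2_inner M f f \<le> c' * E f f + c' * L2_inner M f f"
   using c' that by (intro add_mono mult_right_mono form_nonneg L2.B_nonneg F_L2) auto
  then show ?thesis by (simp add: form_plus_def algebra_simps)
 qed
 have "\<exists>N. \<forall>i\<ge>N. \<forall>j\<ge>N. quad E1 (\<lambda>x. s i x - s j x) < e" if "e > 0" for e :: real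
 proof -
  have "e / c > 0" using that c by simp
  then obtain N where N: "\<And>i j. i \<ge> N ==> j \<ge> N ==>
    quad (form_plus M E \<alpha>) (\<lambda>x. s i x - s j x) < e / c"
   using s(2)[unfolded P.Cauchy_seq_def] by blast
  have "quad E1 (\<lambda>x. s i x - s j x) < e" if "i \<ge> N" "j \<ge> N" for i j
  proof -
   have "c * quad (form_plus M E \<alpha>) (\<lambda>x. s i x - s j x) < c * (e / c)"
    using N[OF that] c(1) by (rule mult_strict_left_mono)
   then show ?thesis using up[OF form.V_diff[OF s(1)[of i] s(1)[of j]]] c(1) by simp
  qed
  then show ?thesis by blast
 qed
 from form_closed[OF s(1) this] obtain f where f: "f \<in> F"
  "form_tendsto E1 s f" by blast
 have "(\<lambda>n. c' * quad E1 (\<lambda>x. s n x - f x)) ----> 0"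
  using tendsto_mult[OF tendsto_const f(2)] by simp
 then have "form_tendsto (form_plus M E \<alpha>) s f"
 proof (rule LIMSEQ_null_bounded)
  show "\<bar>form_plus M E \<alpha> (\<lambda>x. s n x - f x) (\<lambda>x. s n x - f x)\<bar> \<le> c' * quad E1 (\<lambda>x. s n x - f x)" for n
   using dn[OF form.V_diff[OF s(1) f(1)]] P.B_nonneg[OF form.V_diff[OF s(1) f(1)]] by simp
 qed
 with f(1) show ?thesis by blast
qed

text \<open>This is alpha G_alpha, the normalization in which the operator maps functions with
  values in [0,1] to functions with values in [0,1] almost everywhere.\<close>

definition res :: "real \<Rightarrow> ('a \<Rightarrow> real) \<Rightarrow> 'a \<Rightarrow> real" where
 "res \<alpha> f = (SOME u. u \<in> F \<and> (\<forall>v\<in>F. form_plus M E \<alpha> u v = \<alpha> * L2_inner M f v))"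

lemma res_exists:
 assumes a: "\<alpha> > 0" and f: "f \<in> L2_space M"
 shows "\<exists>u\<in>F. \<forall>v\<in>F. form_plus M E \<alpha> u v = \<alpha> * L2_inner M f v"
proof -
 interpret P: psd_form F "form_plus M E \<alpha>" by (rule form_plus_psd) (use a in simp)
 show ?thesis
 \<comment> \<open>The bound combines Cauchy-Schwarz in L2 with
   \<open>\<alpha> * L2_inner M v v <= form_plus M E \<alpha> v v\<close>; this is where the divisor
   \<open>sqrt \<alpha>\<close> comes from.\<close>
 proof (rule P.Riesz_representer[where K = "\<alpha> * sqrt (L2_inner M f f) / sqrt \<alpha>"])
  show "\<alpha> * L2_inner M f (\<lambda>x. g x + h x) = \<alpha> * L2_inner M f g + \<alpha> * L2_inner M f h"
   if "g \<in> F" "h \<in> F" for g h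
   using that f by (simp add: L2.B_addr F_L2 algebra_simps)
  show "\<alpha> * L2_inner M f (\<lambda>x. c * g x) = c * (\<alpha> * L2_inner M f g)" if "g \<in> F" for g c
   using that f by (simp add: L2.B_scaler F_L2 algebra_simps)
  show "\<bar>\<alpha> * L2_inner M f v\<bar> \<le> \<alpha> * sqrt (L2_inner M f f) / sqrt \<alpha> * sqrt (form_plus M E \<alpha> v v)"
   if "v \<in> F" for v
  proof -
   have eq: "a * (s * (t / r)) = a * s / r * t" for a s t r :: real by simp
   have "\<alpha> * L2_inner M v v \<le> form_plus M E \<alpha> v v"
    using form_nonneg[OF that] by (simp add: form_plus_def)
   then have "sqrt (L2_inner M v v) \<le> sqrt (form_plus M E \<alpha> v v / \<alpha>)"
    using a by (intro real_sqrt_le_mono) (simp add: field_simps)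
   then have "sqrt (L2_inner M f f) * sqrt (L2_inner M v v) \<le> sqrt (L2_inner M f f) * (sqrt (form_plus M E \<alpha> v v) / sqrt \<alpha>)"
    using f by (intro mult_left_mono) (auto simp: real_sqrt_divide L2.B_nonneg)
   then have le: "\<bar>L2_inner M f v\<bar> \<le> sqrt (L2_inner M f f) * (sqrt (form_plus M E \<alpha> v v) / sqrt \<alpha>)"
    using L2.Cauchy_Schwarz[OF f F_L2[OF that]] by linarith
   have "\<bar>\<alpha> * L2_inner M f v\<bar> = \<alpha> * \<bar>L2_inner M f v\<bar>" using a by (simp only: abs_mult abs_of_pos)
   also have "\<dots> \<le> \<alpha> * (sqrt (L2_inner M f f) * (sqrt (form_plus M E \<alpha> v v) / sqrt \<alpha>))"
    using le less_imp_le[OF a] by (rule mult_left_mono)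
   also have "\<dots> = \<alpha> * sqrt (L2_inner M f f) / sqrt \<alpha> * sqrt (form_plus M E \<alpha> v v)"
    by (rule eq)
   finally show ?thesis .
  qed
  fix s assume "\<And>n. s n \<in> F" "P.Cauchy_seq s"
  then show "\<exists>f\<in>F. form_tendsto (form_plus M E \<alpha>) s f"
   by (rule form_plus_complete[OF a])
 qed
qed

lemma res:
 assumes "a > 0" "f \<in> L2_space M"
 shows res_in: "res a f \<in> F"
  and res_eq: "v \<in> F ==> E (res a f) v = a * (L2_inner M f v - L2_inner M (res a f) v)"
proof -
 have "res a f \<in> F \<and> (\<forall>v\<in>F. form_plus M E a (res a f) v = a * L2_inner M f v)"
  unfolding res_def
  by (rule someI_ex[of "\<lambda>u. u \<in> F \<and> (\<forall>v\<in>F. form_plus M E a u v = a * L2_inner M f v)"])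
   (use res_exists[OF assms] in blast)
 then show "res a f \<in> F" "v \<in> F ==> E (res a f) v = a * (L2_inner M f v - L2_inner M (res a f) v)"
  by (auto simp: form_plus_def algebra_simps)
qed

text \<open>The approximating form alpha (f, g - alpha G_alpha g). Unlike \<open>E\<close> it is
  defined and continuous on all of L2, so inequalities for it may be checked on simple
  functions.\<close>

definition apx :: "real \<Rightarrow> ('a \<Rightarrow> real) \<Rightarrow> ('a \<Rightarrow> real) \<Rightarrow> real" where
 "apx \<alpha> f g = \<alpha> * (L2_inner M f g - L2_inner M f (res \<alpha> g))"

text \<open>The choice in \<open>res\<close> sees its argument only through inner products, so
  values off \<open>space M\<close> cannot influence it, although functions are total.\<close>

lemma apx_cong:
 assumes "\<And>x. x \<in> space M ==> f x = f' x" "\<And>x. x \<in> space M ==> g x = g' x"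
 shows "apx a f g = apx a f' g'"
proof -
 have i: "L2_inner M h k = L2_inner M h' k'"
  if "\<And>x. x \<in> space M ==> h x = h' x" "\<And>x. x \<in> space M ==> k x = k' x" for h k h' k'
  unfolding L2_inner_def by (rule Bochner_Integration.integral_cong) (auto simp: that)
 have "res a g = res a g'" unfolding res_def using i[OF assms(2)] by simp
 then show ?thesis unfolding apx_def using i[OF assms(1) assms(2)] i[OF assms(1)] by simp
qed

lemma res_sym:
 assumes "a > 0" "f \<in> L2_space M" "g \<in> L2_space M"
 shows "L2_inner M f (res a g) = L2_inner M g (res a f)"
proof -
 note f = res_in[OF assms(1,2)] and g = res_in[OF assms(1,3)]
 have "a * (L2_inner M f (res a g) - L2_inner M (res a f) (res a g)) =
   a * (L2_inner M g (res a f) - L2_inner M (res a g) (res a f))"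
  using res_eq[OF assms(1,2) g] res_eq[OF assms(1,3) f] form_sym[OF f g] by metis
 then show ?thesis using assms(1) L2.B_sym[OF F_L2[OF f] F_L2[OF g]] by simp
qed

text \<open>Both summands are nonnegative. One bounds the energy of \<open>res a f\<close>, the
  other its L2 distance to f, and their sum shows that \<open>apx\<close> is positive
  semidefinite.\<close>

lemma apx_square:
 assumes "a > 0" "f \<in> L2_space M"
 shows "apx a f f = E (res a f) (res a f) +
  a * quad (L2_inner M) (\<lambda>x. res a f x - f x)"
 using res_eq[OF assms res_in[OF assms]] assms F_L2[OF res_in[OF assms]]
 by (simp add: apx_def L2.B_square_diff L2.B_sym[of "res a f" M f] algebra_simps)

lemma apx_psd:
 assumes a: "\<alpha> > 0"
 shows "psd_form (L2_space M) (apx \<alpha>)"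
proof
 fix f g h :: "'a \<Rightarrow> real" and c
 show "apx \<alpha> f g = apx \<alpha> g f" if "f \<in> L2_space M" "g \<in> L2_space M"
  using res_sym[OF a that] L2.B_sym[OF that] by (simp add: apx_def)
 show "apx \<alpha> (\<lambda>x. f x + g x) h = apx \<alpha> f h + apx \<alpha> g h"
  if "f \<in> L2_space M" "g \<in> L2_space M" "h \<in> L2_space M"
  using that F_L2[OF res_in[OF a that(3)]] by (simp add: apx_def L2.B_addl algebra_simps)
 show "apx \<alpha> (\<lambda>x. c * f x) h = c * apx \<alpha> f h"
  if "f \<in> L2_space M" "h \<in> L2_space M"
  using that F_L2[OF res_in[OF a that(2)]] by (simp add: apx_def L2.B_scalel algebra_simps)
 show "0 \<le> apx \<alpha> f f" if "f \<in> L2_space M"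
  unfolding apx_square[OF a that] using a
  by (intro add_nonneg_nonneg mult_nonneg_nonneg form_nonneg L2.B_nonneg L2.V_diff F_L2 res_in that) auto
qed (auto simp: L2_zero L2_add L2_scale)

lemma res_energy_le:
 assumes "a > 0" "f \<in> L2_space M"
 shows "E (res a f) (res a f) \<le> apx a f f"
  "a * quad (L2_inner M) (\<lambda>x. res a f x - f x) \<le> apx a f f"
 using assms form_nonneg[OF res_in[OF assms]] L2.B_nonneg[OF L2.V_diff[OF F_L2[OF res_in[OF assms]] assms(2)]]
 by (auto simp: apx_square)

lemma apx_le_L2:
 assumes "a > 0" "f \<in> L2_space M"
 shows "apx a f f \<le> a * L2_inner M f f"
proof -
 have "a * L2_inner M f (res a f) = E (res a f) (res a f) + a * L2_inner M (res a f) (res a f)"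
  using res_eq[OF assms res_in[OF assms]] by (simp add: algebra_simps)
 moreover have "E (res a f) (res a f) \<ge> 0" "L2_inner M (res a f) (res a f) \<ge> 0"
  by (intro form_nonneg L2.B_nonneg F_L2 res_in assms)+
 moreover have "a * L2_inner M (res a f) (res a f) \<ge> 0"
  using calculation(3) assms(1) by simp
 ultimately show ?thesis unfolding apx_def right_diff_distrib by linarith
qed

lemma apx_eq:
 assumes "a > 0" "f \<in> L2_space M" "v \<in> F"
 shows "apx a f v = E (res a f) v"
proof -
 have "L2_inner M f (res a v) = L2_inner M v (res a f)" using res_sym[OF assms(1,2) F_L2[OF assms(3)]] .
 then show ?thesis
  using res_eq[OF assms] L2.B_sym[OF F_L2[OF assms(3)] F_L2[OF res_in[OF assms(1,2)]]] by (simp add: apx_def)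
qed

text \<open>Expand \<open>E f f\<close> around u = \<open>res a f\<close>. By the resolvent equation
  \<open>E u (f - u)\<close> is a times the squared L2 distance of f and u, which is exactly the
  second term in \<open>apx_square\<close>.\<close>

lemma apx_le:
 assumes "a > 0" "f \<in> F"
 shows "apx a f f \<le> E f f"
proof -
 let ?u = "res a f"
 note fL = F_L2[OF assms(2)]
 note u = res_in[OF assms(1) fL]
 note d = form.V_diff[OF assms(2) u]
 have "E f f = E ?u ?u + 2 * E ?u (\<lambda>x. f x - ?u x) + quad E (\<lambda>x. f x - ?u x)"
  using form.B_square_add[OF u d] by simp
 moreover have "E ?u (\<lambda>x. f x - ?u x) = a * quad (L2_inner M) (\<lambda>x. f x - ?u x)"
  using res_eq[OF assms(1) fL d] L2.B_diffl[OF fL F_L2[OF u] F_L2[OF d]] by simp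
 moreover have "a * quad (L2_inner M) (\<lambda>x. f x - ?u x) \<ge> 0"
  using assms(1) F_L2[OF d] by (simp add: L2.B_nonneg)
 moreover have "apx a f f = E ?u ?u + a * quad (L2_inner M) (\<lambda>x. f x - ?u x)"
  using apx_square[OF assms(1) fL] L2.B_square_commute[OF fL F_L2[OF u]] by simp
 moreover have "quad E (\<lambda>x. f x - ?u x) \<ge> 0" by (rule form_nonneg[OF d])
 ultimately show ?thesis by linarith
qed

lemma res_tendsto_L2:
 assumes f: "f \<in> L2_space M" and K: "\<And>n. apx (real (Suc n)) f f \<le> K"
 shows "L2_tendsto M (\<lambda>n. res (real (Suc n)) f) f"
proof (rule LIMSEQ_null_bounded)
 show "(\<lambda>n. K * inverse (real (Suc n))) ----> 0"
  using tendsto_mult[OF tendsto_const LIMSEQ_inverse_real_of_nat] by simp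
 show "\<bar>L2_inner M (\<lambda>x. res (real (Suc n)) f x - f x) (\<lambda>x. res (real (Suc n)) f x - f x)\<bar>
   \<le> K * inverse (real (Suc n))" for n
 proof -
  have p: "real (Suc n) > 0" by simp
  have "real (Suc n) * quad (L2_inner M) (\<lambda>x. res (real (Suc n)) f x - f x) \<le> K"
   using res_energy_le(2)[OF p f] K[of n] by (rule order_trans)
  moreover have "quad (L2_inner M) (\<lambda>x. res (real (Suc n)) f x - f x) \<ge> 0"
   by (intro L2.B_nonneg L2.V_diff F_L2 res_in f p)
  ultimately show ?thesis using p by (simp add: field_simps del: of_nat_Suc)
 qed
qed

text \<open>Since \<open>apx a f v = E (res a f) v\<close>, weak convergence of the resolvents to f
  is enough.\<close>

lemma apx_tendsto:
 assumes "f \<in> F" "v \<in> F"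
 shows "(\<lambda>n. apx (real (Suc n)) f v) ----> E f v"
proof -
 note fL = F_L2[OF assms(1)]
 have b: "apx (real (Suc n)) f f \<le> E f f" for n using assms by (intro apx_le) auto
 have "(\<lambda>n. E (res (real (Suc n)) f) v) ----> E f v"
 proof (rule weak_convergence(2)[OF _ _ fL res_tendsto_L2[OF fL b] assms(2)])
  show "res (real (Suc n)) f \<in> F" for n using fL by (intro res_in) auto
  show "E (res (real (Suc n)) f) (res (real (Suc n)) f) \<le> E f f" for n
   using res_energy_le(1)[OF _ fL, of "real (Suc n)"] b[of n] by simp
 qed
 moreover have "apx (real (Suc n)) f v = E (res (real (Suc n)) f) v" for n
  using fL assms by (intro apx_eq) auto
 ultimately show ?thesis by simp
qed

text \<open>The membership test for the domain: a bound on the approximating energies puts a square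
  integrable f into \<open>F\<close>. Contractions and products enter \<open>F\<close> this
  way.\<close>

lemma apx_bounded:
 assumes f: "f \<in> L2_space M" and K: "\<And>n. apx (real (Suc n)) f f \<le> K"
 shows "f \<in> F" "E f f \<le> K"
proof -
 have 1: "res (real (Suc n)) f \<in> F" for n using f by (intro res_in) auto
 have 2: "E (res (real (Suc n)) f) (res (real (Suc n)) f) \<le> K" for n
  using res_energy_le(1)[OF _ f, of "real (Suc n)"] K[of n] by simp
 show "f \<in> F" "E f f \<le> K" using lower_semicontinuous[OF 1 2 f res_tendsto_L2[OF f K]] by auto
qed

text \<open>\<open>res \<alpha> f\<close> minimizes energy plus alpha times the squared L2 distance
  to f, and the excess of v is the same functional evaluated at the difference. If v is no worse in
  either term, the excess is zero.\<close>

lemma res_minimizer: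
 assumes a: "\<alpha> > 0" and f: "f \<in> L2_space M" and v: "v \<in> F"
  and le: "E v v \<le> E (res \<alpha> f) (res \<alpha> f)"
   "quad (L2_inner M) (\<lambda>x. v x - f x) \<le> quad (L2_inner M) (\<lambda>x. res \<alpha> f x - f x)"
 shows "AE x in M. v x = res \<alpha> f x"
proof -
 let ?u = "res \<alpha> f"
 note u = res_in[OF a f]
 note d = form.V_diff[OF v u]
 note uL = F_L2[OF u] and vL = F_L2[OF v] and dL = F_L2[OF d]
 have 1: "E v v = E ?u ?u + 2 * E ?u (\<lambda>x. v x - ?u x) + quad E (\<lambda>x. v x - ?u x)"
  using form.B_square_add[OF u d] by simp
 have 2: "E ?u (\<lambda>x. v x - ?u x) = - (\<alpha> * L2_inner M (\<lambda>x. ?u x - f x) (\<lambda>x. v x - ?u x))"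
 proof -
  have "x = - (a * w)" if "x = a * (y - z)" "w = z - y" for x a y z w :: real
  proof -
   have "y - z = - w" using that(2) by simp
   then show ?thesis using that(1) by simp
  qed
  from this[OF res_eq[OF a f d] L2.B_diffl[OF uL f dL]] show ?thesis .
 qed
 have 3: "quad (L2_inner M) (\<lambda>x. v x - f x) = quad (L2_inner M) (\<lambda>x. ?u x - f x)
   + 2 * L2_inner M (\<lambda>x. ?u x - f x) (\<lambda>x. v x - ?u x) + quad (L2_inner M) (\<lambda>x. v x - ?u x)"
  using L2.B_square_add[OF L2.V_diff[OF uL f] dL] by simp
 have arith: "d \<le> 0" if "e = u + 2 * x + w" "x = - (a * y)" "p = q + 2 * y + d" "e \<le> u" "p \<le> q" "0 \<le> w" "0 < a"
  for e u x w a y p q d :: real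
 proof -
  have "a * (2 * y + d) \<le> 0" using that by (intro mult_nonneg_nonpos) auto
  moreover have "2 * x + w \<le> 0" using that by simp
  ultimately have "a * d \<le> 0" using that by (simp add: distrib_left)
  then show ?thesis using that by (simp add: mult_le_0_iff)
 qed
 have "quad (L2_inner M) (\<lambda>x. v x - ?u x) \<le> 0"
  by (rule arith[OF 1 2 3 le form_nonneg[OF d] a])
 then show ?thesis using L2.B_nonneg[OF dL] by (intro L2_diff_zero_AE[OF vL uL]) linarith
qed

text \<open>Clipping \<open>res \<alpha> f\<close> to [0,1] does not raise its energy, by the Markov
  property, and does not move it away from f, whose values lie in [0,1]. Uniqueness of the minimizer
  then says that clipping changes nothing.\<close>

lemma res_markov:
 assumes a: "\<alpha> > 0" and f: "f \<in> L2_space M" "\<And>x. x \<in> space M ==> 0 \<le> f x \<and> f x \<le> 1"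
 shows "AE x in M. 0 \<le> res \<alpha> f x \<and> res \<alpha> f x \<le> 1"
proof -
 let ?u = "res \<alpha> f" and ?v = "\<lambda>x. min 1 (max 0 (res \<alpha> f x))"
 note u = res_in[OF a f(1)]
 have "AE x in M. ?v x = ?u x"
 proof (rule res_minimizer[OF a f(1) domain_markov[OF u] form_markov[OF u]])
  show "quad (L2_inner M) (\<lambda>x. ?v x - f x) \<le> quad (L2_inner M) (\<lambda>x. ?u x - f x)"
   unfolding L2_inner_square
  proof (rule integral_mono)
   show "integrable M (\<lambda>x. (?v x - f x)\<^sup>2)" "integrable M (\<lambda>x. (?u x - f x)\<^sup>2)"
    by (intro L2_integrable_square L2.V_diff F_L2 f(1) u domain_markov)+
   show "(?v x - f x)\<^sup>2 \<le> (?u x - f x)\<^sup>2" if "x \<in> space M" for x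
   proof -
    have "\<bar>?v x - f x\<bar> \<le> \<bar>?u x - f x\<bar>" using f(2)[OF that] by auto
    then show ?thesis by (simp add: abs_le_square_iff)
   qed
  qed
 qed
 then show ?thesis by eventually_elim linarith
qed

end

subsection \<open>Normal contractions and positivity of the energy\<close>

text \<open>The Beurling-Deny decomposition of a finite symmetric matrix: a jump part with weights
  \<open>- q i j\<close> and a killing part weighted by the row sums.\<close>

lemma weighted_form_identity:
 fixes q :: "'i \<Rightarrow> 'i \<Rightarrow> real"
 assumes "\<And>i j. i \<in> I ==> j \<in> I ==> q i j = q j i"
 shows "(\<Sum>i\<in>I. \<Sum>j\<in>I. a i * b j * q i j) =
  (\<Sum>i\<in>I. \<Sum>j\<in>I. - q i j * ((a i - a j) * (b i - b j))) / 2 + (\<Sum>i\<in>I. a i * b i * (\<Sum>j\<in>I. q i j))"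
proof -
 have s1: "(\<Sum>i\<in>I. \<Sum>j\<in>I. a j * b i * q i j) = (\<Sum>i\<in>I. \<Sum>j\<in>I. a i * b j * q i j)"
  by (subst sum.swap) (auto intro!: sum.cong simp: assms)
 have s2: "(\<Sum>i\<in>I. \<Sum>j\<in>I. a j * b j * q i j) = (\<Sum>i\<in>I. \<Sum>j\<in>I. a i * b i * q i j)"
  by (subst sum.swap) (auto intro!: sum.cong simp: assms)
 have "(\<Sum>i\<in>I. \<Sum>j\<in>I. - q i j * ((a i - a j) * (b i - b j))) =
  (\<Sum>i\<in>I. \<Sum>j\<in>I. a i * b j * q i j + a j * b i * q i j - a i * b i * q i j - a j * b j * q i j)"
  by (intro sum.cong refl) (simp add: algebra_simps)
 also have "\<dots> = 2 * (\<Sum>i\<in>I. \<Sum>j\<in>I. a i * b j * q i j) - 2 * (\<Sum>i\<in>I. \<Sum>j\<in>I. a i * b i * q i j)"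
  by (simp add: sum_subtractf sum.distrib s1 s2)
 finally have 1: "(\<Sum>i\<in>I. \<Sum>j\<in>I. - q i j * ((a i - a j) * (b i - b j))) =
   2 * (\<Sum>i\<in>I. \<Sum>j\<in>I. a i * b j * q i j) - 2 * (\<Sum>i\<in>I. \<Sum>j\<in>I. a i * b i * q i j)" .
 have "x = p / 2 + y" if "p = 2 * x - 2 * y" for x y p :: real using that by linarith
 from this[OF 1] show ?thesis by (simp only: sum_distrib_left)
qed

text \<open>The sign conditions make all jump and killing weights nonnegative, so the pointwise
  inequalities can be summed term by term. Diagonal entries are harmless because their differences
  vanish.\<close>

lemma weighted_form_contraction:
 fixes q :: "'i \<Rightarrow> 'i \<Rightarrow> real"
 assumes sym: "\<And>i j. i \<in> I ==> j \<in> I ==> q i j = q j i"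
  and off: "\<And>i j. i \<in> I ==> j \<in> I ==> i \<noteq> j ==> q i j \<le> 0"
  and row: "\<And>i. i \<in> I ==> 0 \<le> (\<Sum>j\<in>I. q i j)"
  and f: "\<And>i j. i \<in> I ==> j \<in> I ==> (f i - f j)\<^sup>2 \<le> K * (a i - a j)\<^sup>2 + L * (b i - b j)\<^sup>2"
   "\<And>i. i \<in> I ==> (f i)\<^sup>2 \<le> K * (a i)\<^sup>2 + L * (b i)\<^sup>2"
 shows "(\<Sum>i\<in>I. \<Sum>j\<in>I. f i * f j * q i j) \<le>
  K * (\<Sum>i\<in>I. \<Sum>j\<in>I. a i * a j * q i j) + L * (\<Sum>i\<in>I. \<Sum>j\<in>I. b i * b j * q i j)"
proof -
 have 1: "(\<Sum>i\<in>I. \<Sum>j\<in>I. - q i j * ((f i - f j) * (f i - f j))) \<le>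
   (\<Sum>i\<in>I. \<Sum>j\<in>I. K * (- q i j * ((a i - a j) * (a i - a j))) + L * (- q i j * ((b i - b j) * (b i - b j))))"
 proof (intro sum_mono)
  fix i j assume ij: "i \<in> I" "j \<in> I"
  show "- q i j * ((f i - f j) * (f i - f j)) \<le>
    K * (- q i j * ((a i - a j) * (a i - a j))) + L * (- q i j * ((b i - b j) * (b i - b j)))"
  proof (cases "i = j")
   case False
   then have "- q i j * (f i - f j)\<^sup>2 \<le> - q i j * (K * (a i - a j)\<^sup>2 + L * (b i - b j)\<^sup>2)"
    using off[OF ij] f(1)[OF ij] by (intro mult_left_mono) auto
   then show ?thesis by (simp add: power2_eq_square algebra_simps)
  qed simp
 qed
 have 2: "(\<Sum>i\<in>I. f i * f i * (\<Sum>j\<in>I. q i j)) \<le>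
   (\<Sum>i\<in>I. K * (a i * a i * (\<Sum>j\<in>I. q i j)) + L * (b i * b i * (\<Sum>j\<in>I. q i j)))"
 proof (intro sum_mono)
  fix i assume i: "i \<in> I"
  have "(f i)\<^sup>2 * (\<Sum>j\<in>I. q i j) \<le> (K * (a i)\<^sup>2 + L * (b i)\<^sup>2) * (\<Sum>j\<in>I. q i j)"
   using row[OF i] f(2)[OF i] by (intro mult_right_mono) auto
  then show "f i * f i * (\<Sum>j\<in>I. q i j) \<le> K * (a i * a i * (\<Sum>j\<in>I. q i j)) + L * (b i * b i * (\<Sum>j\<in>I. q i j))"
   by (simp add: power2_eq_square algebra_simps)
 qed
 have id: "(\<Sum>i\<in>I. \<Sum>j\<in>I. a i * a j * q i j) =
   (\<Sum>i\<in>I. \<Sum>j\<in>I. - q i j * ((a i - a j) * (a i - a j))) / 2 + (\<Sum>i\<in>I. a i * a i * (\<Sum>j\<in>I. q i j))" for a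
  by (rule weighted_form_identity) (rule sym)
 have "x / 2 + y \<le> K * (x1 / 2 + y1) + L * (x2 / 2 + y2)"
  if "x \<le> K * x1 + L * x2" "y \<le> K * y1 + L * y2" for x y x1 y1 x2 y2 :: real
  using that by (simp add: algebra_simps)
 from this[OF 1[unfolded sum.distrib sum_distrib_left[symmetric]] 2[unfolded sum.distrib sum_distrib_left[symmetric]]]
 show ?thesis unfolding id .
qed

text \<open>The discrete energy density. It rests on \<open>2 (a - b) (a g - b h) - (a^2 - b^2) (g -
  h) = (a - b)^2 (g + h)\<close>, which turns an expression with mixed signs into one that is
  visibly monotone in the squared increments of u.\<close>

lemma weighted_form_Gamma:
 fixes q :: "'i \<Rightarrow> 'i \<Rightarrow> real"
 assumes sym: "\<And>i j. i \<in> I ==> j \<in> I ==> q i j = q j i"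
 shows "2 * (\<Sum>i\<in>I. \<Sum>j\<in>I. u i * (u j * g j) * q i j) - (\<Sum>i\<in>I. \<Sum>j\<in>I. (u i)\<^sup>2 * g j * q i j) =
  (\<Sum>i\<in>I. \<Sum>j\<in>I. - q i j * ((u i - u j)\<^sup>2 * (g i + g j))) / 2 + (\<Sum>i\<in>I. (u i)\<^sup>2 * g i * (\<Sum>j\<in>I. q i j))"
proof -
 have "2 * (\<Sum>i\<in>I. \<Sum>j\<in>I. - q i j * ((u i - u j) * (u i * g i - u j * g j))) -
   (\<Sum>i\<in>I. \<Sum>j\<in>I. - q i j * (((u i)\<^sup>2 - (u j)\<^sup>2) * (g i - g j))) =
   (\<Sum>i\<in>I. \<Sum>j\<in>I. - q i j * ((u i - u j)\<^sup>2 * (g i + g j)))"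
  unfolding sum_distrib_left sum_subtractf[symmetric]
  by (intro sum.cong refl) (simp add: power2_eq_square algebra_simps)
 moreover have "2 * (\<Sum>i\<in>I. u i * (u i * g i) * (\<Sum>j\<in>I. q i j)) - (\<Sum>i\<in>I. (u i)\<^sup>2 * g i * (\<Sum>j\<in>I. q i j)) =
   (\<Sum>i\<in>I. (u i)\<^sup>2 * g i * (\<Sum>j\<in>I. q i j))"
  unfolding sum_distrib_left[of 2] sum_subtractf[symmetric]
  by (intro sum.cong refl) (simp add: power2_eq_square algebra_simps)
 moreover have id: "(\<Sum>i\<in>I. \<Sum>j\<in>I. a i * b j * q i j) =
   (\<Sum>i\<in>I. \<Sum>j\<in>I. - q i j * ((a i - a j) * (b i - b j))) / 2 + (\<Sum>i\<in>I. a i * b i * (\<Sum>j\<in>I. q i j))" for a b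
  by (rule weighted_form_identity) (rule sym)
 moreover have "2 * (x1 / 2 + y1) - (x2 / 2 + y2) = x3 / 2 + y3" if "2 * x1 - x2 = x3" "2 * y1 - y2 = y3"
  for x1 x2 x3 y1 y2 y3 :: real
  using that by simp
 ultimately show ?thesis unfolding id[of u "\<lambda>i. u i * g i"] id[of "\<lambda>i. (u i)\<^sup>2" g] by blast
qed

text \<open>In the form of \<open>weighted_form_Gamma\<close> both claims are termwise: contracting
  u decreases the squared increments, and \<open>g i + g j <= 2 * c\<close> bounds the jump part
  while g <= 2c with nonnegative weights bounds the killing part.\<close>

lemma weighted_form_Gamma_mono:
 fixes q :: "'i \<Rightarrow> 'i \<Rightarrow> real"
 assumes sym: "\<And>i j. i \<in> I ==> j \<in> I ==> q i j = q j i"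
  and off: "\<And>i j. i \<in> I ==> j \<in> I ==> i \<noteq> j ==> q i j \<le> 0"
  and row: "\<And>i. i \<in> I ==> 0 \<le> (\<Sum>j\<in>I. q i j)"
  and t: "\<And>i j. i \<in> I ==> j \<in> I ==> (t i - t j)\<^sup>2 \<le> (u i - u j)\<^sup>2"
   "\<And>i. i \<in> I ==> (t i)\<^sup>2 \<le> (u i)\<^sup>2"
  and g: "\<And>i. i \<in> I ==> 0 \<le> g i \<and> g i \<le> c"
 shows "2 * (\<Sum>i\<in>I. \<Sum>j\<in>I. t i * (t j * g j) * q i j) - (\<Sum>i\<in>I. \<Sum>j\<in>I. (t i)\<^sup>2 * g j * q i j) \<le>
   2 * (\<Sum>i\<in>I. \<Sum>j\<in>I. u i * (u j * g j) * q i j) - (\<Sum>i\<in>I. \<Sum>j\<in>I. (u i)\<^sup>2 * g j * q i j)"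
  and "2 * (\<Sum>i\<in>I. \<Sum>j\<in>I. u i * (u j * g j) * q i j) - (\<Sum>i\<in>I. \<Sum>j\<in>I. (u i)\<^sup>2 * g j * q i j) \<le>
   2 * c * (\<Sum>i\<in>I. \<Sum>j\<in>I. u i * u j * q i j)"
proof -
 have G: "2 * (\<Sum>i\<in>I. \<Sum>j\<in>I. u i * (u j * g j) * q i j) - (\<Sum>i\<in>I. \<Sum>j\<in>I. (u i)\<^sup>2 * g j * q i j) =
  (\<Sum>i\<in>I. \<Sum>j\<in>I. - q i j * ((u i - u j)\<^sup>2 * (g i + g j))) / 2 + (\<Sum>i\<in>I. (u i)\<^sup>2 * g i * (\<Sum>j\<in>I. q i j))" for u
  by (rule weighted_form_Gamma) (rule sym)
 have id: "(\<Sum>i\<in>I. \<Sum>j\<in>I. u i * u j * q i j) =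
   (\<Sum>i\<in>I. \<Sum>j\<in>I. - q i j * ((u i - u j) * (u i - u j))) / 2 + (\<Sum>i\<in>I. u i * u i * (\<Sum>j\<in>I. q i j))"
  by (rule weighted_form_identity) (rule sym)
 have "(\<Sum>i\<in>I. \<Sum>j\<in>I. - q i j * ((t i - t j)\<^sup>2 * (g i + g j))) \<le> (\<Sum>i\<in>I. \<Sum>j\<in>I. - q i j * ((u i - u j)\<^sup>2 * (g i + g j)))"
 proof (intro sum_mono)
  fix i j assume ij: "i \<in> I" "j \<in> I"
  show "- q i j * ((t i - t j)\<^sup>2 * (g i + g j)) \<le> - q i j * ((u i - u j)\<^sup>2 * (g i + g j))"
  proof (cases "i = j")
   case False
   then show ?thesis using off[OF ij] t(1)[OF ij] g[OF ij(1)] g[OF ij(2)]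
    by (intro mult_left_mono mult_right_mono) auto
  qed simp
 qed
 moreover have "(\<Sum>i\<in>I. (t i)\<^sup>2 * g i * (\<Sum>j\<in>I. q i j)) \<le> (\<Sum>i\<in>I. (u i)\<^sup>2 * g i * (\<Sum>j\<in>I. q i j))"
  using row t(2) g by (intro sum_mono mult_right_mono) auto
 ultimately show "2 * (\<Sum>i\<in>I. \<Sum>j\<in>I. t i * (t j * g j) * q i j) - (\<Sum>i\<in>I. \<Sum>j\<in>I. (t i)\<^sup>2 * g j * q i j) \<le>
   2 * (\<Sum>i\<in>I. \<Sum>j\<in>I. u i * (u j * g j) * q i j) - (\<Sum>i\<in>I. \<Sum>j\<in>I. (u i)\<^sup>2 * g j * q i j)"
  unfolding G by (intro add_mono divide_right_mono) auto
 have 1: "(\<Sum>i\<in>I. \<Sum>j\<in>I. - q i j * ((u i - u j)\<^sup>2 * (g i + g j))) \<le>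
   (\<Sum>i\<in>I. \<Sum>j\<in>I. 2 * c * (- q i j * ((u i - u j) * (u i - u j))))"
 proof (intro sum_mono)
  fix i j assume ij: "i \<in> I" "j \<in> I"
  show "- q i j * ((u i - u j)\<^sup>2 * (g i + g j)) \<le> 2 * c * (- q i j * ((u i - u j) * (u i - u j)))"
  proof (cases "i = j")
   case False
   then have "- q i j * ((u i - u j)\<^sup>2 * (g i + g j)) \<le> - q i j * ((u i - u j)\<^sup>2 * (2 * c))"
    using off[OF ij] g[OF ij(1)] g[OF ij(2)] by (intro mult_left_mono) auto
   then show ?thesis by (simp add: power2_eq_square algebra_simps)
  qed simp
 qed
 have 2: "(\<Sum>i\<in>I. (u i)\<^sup>2 * g i * (\<Sum>j\<in>I. q i j)) \<le> (\<Sum>i\<in>I. 2 * c * (u i * u i * (\<Sum>j\<in>I. q i j)))"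
 proof (intro sum_mono)
  fix i assume i: "i \<in> I"
  have "(u i)\<^sup>2 * (\<Sum>j\<in>I. q i j) * g i \<le> (u i)\<^sup>2 * (\<Sum>j\<in>I. q i j) * (2 * c)"
   using row[OF i] g[OF i] by (intro mult_left_mono) auto
  then show "(u i)\<^sup>2 * g i * (\<Sum>j\<in>I. q i j) \<le> 2 * c * (u i * u i * (\<Sum>j\<in>I. q i j))"
   by (simp add: power2_eq_square algebra_simps)
 qed
 show "2 * (\<Sum>i\<in>I. \<Sum>j\<in>I. u i * (u j * g j) * q i j) - (\<Sum>i\<in>I. \<Sum>j\<in>I. (u i)\<^sup>2 * g j * q i j) \<le>
   2 * c * (\<Sum>i\<in>I. \<Sum>j\<in>I. u i * u j * q i j)"
 proof -
  have "x / 2 + y \<le> 2 * c * (x1 / 2 + y1)" if "x \<le> 2 * c * x1" "y \<le> 2 * c * y1" for x y x1 y1 :: real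
   using that by (simp add: algebra_simps)
  from this[OF 1[unfolded sum_distrib_left[symmetric]] 2[unfolded sum_distrib_left[symmetric]]]
  show ?thesis unfolding G id .
 qed
qed

section \<open>Normal contractions and positivity of the energy functional, by reduction to finite
  matrices\<close>

lemma L2_abs: "f \<in> L2_space M ==> (\<lambda>x. \<bar>f x\<bar>) \<in> L2_space M"
 by (auto simp: L2_space_def)

context dirichlet_form
begin

lemma indicator_L2:
 assumes "A \<in> sets M" "emeasure M A < \<infinity>"
 shows "(indicator A :: 'a \<Rightarrow> real) \<in> L2_space M"
proof -
 have "(\<lambda>x. (indicator A x :: real)\<^sup>2) = indicator A" by (auto simp: indicator_def)
 then show ?thesis using assms by (simp add: L2_space_def)
qed

text \<open>The source of nonpositive off-diagonal entries: disjoint indicators have inner product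
  0, and the resolvent of an indicator is nonnegative.\<close>

lemma apx_indicator_disjoint:
 assumes a: "\<alpha> > 0" and A: "A \<in> sets M" "emeasure M A < \<infinity>" and B: "B \<in> sets M" "emeasure M B < \<infinity>"
  and d: "A \<inter> B = {}"
 shows "apx \<alpha> (indicator A) (indicator B) \<le> 0"
proof -
 have "AE x in M. 0 \<le> res \<alpha> (indicator B) x \<and> res \<alpha> (indicator B) x \<le> 1"
  by (rule res_markov[OF a indicator_L2[OF B]]) (auto simp: indicator_def)
 then have "AE x in M. 0 \<le> indicator A x * res \<alpha> (indicator B) x"
  by eventually_elim (auto simp: indicator_def)
 then have "0 \<le> L2_inner M (indicator A) (res \<alpha> (indicator B))"
  unfolding L2_inner_def by (rule integral_nonneg_AE)
 moreover have "(\<lambda>x. indicator A x * indicator B x :: real) = (\<lambda>x. 0)"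
  using d by (auto simp: indicator_def fun_eq_iff)
 then have "L2_inner M (indicator A) (indicator B) = 0" by (simp add: L2_inner_def)
 ultimately show ?thesis using a by (simp add: apx_def mult_nonneg_nonpos)
qed

text \<open>The source of nonnegative row sums: with \<open>B\<close> the union of all level sets,
  the resolvent of its indicator is at most 1, the value of that indicator on
  \<open>A\<close>.\<close>

lemma apx_indicator_subset:
 assumes a: "\<alpha> > 0" and A: "A \<in> sets M" and B: "B \<in> sets M" "emeasure M B < \<infinity>"
  and d: "A \<subseteq> B"
 shows "0 \<le> apx \<alpha> (indicator A) (indicator B)"
proof -
 have A': "emeasure M A < \<infinity>" using emeasure_mono[OF d B(1)] B(2) by (rule le_less_trans)
 note AL = indicator_L2[OF A A'] and BL = indicator_L2[OF B]
 have "AE x in M. 0 \<le> res \<alpha> (indicator B) x \<and> res \<alpha> (indicator B) x \<le> 1"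
  by (rule res_markov[OF a BL]) (auto simp: indicator_def)
 then have "AE x in M. indicator A x * res \<alpha> (indicator B) x \<le> indicator A x * indicator B x"
  by eventually_elim (use d in "auto simp: indicator_def")
 then have "L2_inner M (indicator A) (res \<alpha> (indicator B)) \<le> L2_inner M (indicator A) (indicator B)"
  unfolding L2_inner_def
  by (intro integral_mono_AE L2_integrable_mult AL BL F_L2 res_in a)
 then show ?thesis using a by (simp add: apx_def)
qed

text \<open>One simple function with values in the plane represents two functions over a common
  partition. The level of \<open>(0, 0)\<close> is dropped since it may have infinite measure; every
  other level has finite measure because the sum of the squares of both coordinates is integrable
  and constant there.\<close>

lemma simple_function_level_sets:
 assumes p: "simple_function M p" and L: "(\<lambda>x. fst (p x) :: real) \<in> L2_space M" "(\<lambda>x. snd (p x) :: real) \<in> L2_space M"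
 defines "P \<equiv> p ` space M - {(0, 0)}" and "A \<equiv> \<lambda>z. p -` {z} \<inter> space M"
 shows "finite P" "\<And>z. z \<in> P ==> A z \<in> sets M" "\<And>z. z \<in> P ==> emeasure M (A z) < \<infinity>"
  "\<And>z w. z \<noteq> w ==> A z \<inter> A w = {}"
  "\<And>\<Phi> x. \<Phi> (0, 0) = (0::real) ==> x \<in> space M ==> \<Phi> (p x) = (\<Sum>z\<in>P. \<Phi> z * indicator (A z) x)"
proof -
 show fin: "finite P" using p by (auto simp: P_def simple_function_def)
 show A: "A z \<in> sets M" if "z \<in> P" for z
  using p that by (auto simp: P_def A_def simple_function_def)
 show "A z \<inter> A w = {}" if "z \<noteq> w" for z w using that by (auto simp: A_def)
 show "emeasure M (A z) < \<infinity>" if z: "z \<in> P" for z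
 proof -
  have nz: "(fst z)\<^sup>2 + (snd z)\<^sup>2 > 0" using z by (cases z) (auto simp: P_def sum_power2_gt_zero_iff)
  have "integrable M (\<lambda>x. ((fst (p x))\<^sup>2 + (snd (p x))\<^sup>2) / ((fst z)\<^sup>2 + (snd z)\<^sup>2))"
   using L[THEN L2_integrable_square] by auto
  then have "integrable M (indicator (A z) :: 'a \<Rightarrow> real)"
   by (rule Bochner_Integration.integrable_bound) (use A[OF z] nz in "auto simp: A_def indicator_def")
  then have "emeasure M (A z \<inter> space M) < \<infinity>" by (simp add: integrable_indicator_iff)
  moreover have "A z \<inter> space M = A z" by (auto simp: A_def)
  ultimately show ?thesis by simp
 qed
 show "\<Phi> (p x) = (\<Sum>z\<in>P. \<Phi> z * indicator (A z) x)" if "\<Phi> (0, 0) = (0::real)" "x \<in> space M" for \<Phi> x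
 proof -
  have "(\<Sum>z\<in>P. \<Phi> z * indicator (A z) x) = (\<Sum>z\<in>P. if p x = z then \<Phi> z else 0)"
   using that(2) by (intro sum.cong) (auto simp: A_def indicator_def)
  also have "\<dots> = (if p x \<in> P then \<Phi> (p x) else 0)" using fin by (simp add: sum.delta')
  also have "\<dots> = \<Phi> (p x)" using that by (auto simp: P_def)
  finally show ?thesis by simp
 qed
qed

text \<open>Every function of \<open>p\<close> that vanishes at the origin is a combination of
  indicators of level sets, so on such functions the approximating form is one fixed matrix q.
  Quantifying over \<open>\<Phi>\<close> and \<open>\<Psi>\<close> inside the conclusion allows the
  same q for several functions at once.\<close>

lemma apx_simple:
 assumes a: "\<alpha> > 0" and p: "simple_function M p"
  and L: "(\<lambda>x. fst (p x) :: real) \<in> L2_space M" "(\<lambda>x. snd (p x) :: real) \<in> L2_space M"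
 obtains q where "\<And>z w. z \<in> p ` space M - {(0,0)} ==> w \<in> p ` space M - {(0,0)} ==> q z w = q w z"
  "\<And>z w. z \<in> p ` space M - {(0,0)} ==> w \<in> p ` space M - {(0,0)} ==> z \<noteq> w ==> q z w \<le> (0::real)"
  "\<And>z. z \<in> p ` space M - {(0,0)} ==> 0 \<le> (\<Sum>w\<in>p ` space M - {(0,0)}. q z w)"
  "\<And>\<Phi> \<Psi>. \<Phi> (0,0) = 0 ==> \<Psi> (0,0) = 0 ==> apx \<alpha> (\<lambda>x. \<Phi> (p x)) (\<lambda>x. \<Psi> (p x)) =
   (\<Sum>z\<in>p ` space M - {(0,0)}. \<Sum>w\<in>p ` space M - {(0,0)}. \<Phi> z * \<Psi> w * q z w)"
proof -
 interpret Q: psd_form "L2_space M" "apx \<alpha>" by (rule apx_psd[OF a])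
 define P where "P = p ` space M - {(0, 0)}"
 define A where "A z = p -` {z} \<inter> space M" for z
 note ls = simple_function_level_sets[OF p L, folded P_def A_def]
 define q where "q z w = apx \<alpha> (indicator (A z)) (indicator (A w))" for z w
 have iL: "indicator (A z) \<in> L2_space M" if "z \<in> P" for z using ls(2,3)[OF that] by (rule indicator_L2)
 show ?thesis
 proof (rule that[of q, folded P_def])
  show "q z w = q w z" if "z \<in> P" "w \<in> P" for z w
   unfolding q_def by (rule Q.B_sym[OF iL[OF that(1)] iL[OF that(2)]])
  show "q z w \<le> 0" if "z \<in> P" "w \<in> P" "z \<noteq> w" for z w
   unfolding q_def by (rule apx_indicator_disjoint[OF a ls(2,3)[OF that(1)] ls(2,3)[OF that(2)] ls(4)[OF that(3)]])
  show "0 \<le> (\<Sum>w\<in>P. q z w)" if z: "z \<in> P" for z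
  proof -
   have "indicator (\<Union>w\<in>P. A w) = (\<lambda>x. \<Sum>w\<in>P. indicator (A w) x :: real)"
    using ls(1,4) by (intro ext indicator_UN_disjoint) (auto simp: disjoint_family_on_def)
   then have "(\<Sum>w\<in>P. q z w) = apx \<alpha> (indicator (A z)) (indicator (\<Union>w\<in>P. A w))"
    unfolding q_def using iL z by (simp add: Q.B_sumr)
   moreover have "(\<Union>w\<in>P. A w) \<in> fmeasurable M"
    using ls(1,2,3) by (intro fmeasurable.finite_UN fmeasurableI) auto
   then have "(\<Union>w\<in>P. A w) \<in> sets M" "emeasure M (\<Union>w\<in>P. A w) < \<infinity>"
    by (auto simp: fmeasurable_def)
   ultimately show ?thesis using ls(2)[OF z] z
    by (auto intro!: apx_indicator_subset[OF a])
  qed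
  fix \<Phi> \<Psi> :: "real \<times> real \<Rightarrow> real" assume 0: "\<Phi> (0,0) = 0" "\<Psi> (0,0) = 0"
  have "apx \<alpha> (\<lambda>x. \<Phi> (p x)) (\<lambda>x. \<Psi> (p x)) =
    apx \<alpha> (\<lambda>x. \<Sum>z\<in>P. \<Phi> z * indicator (A z) x) (\<lambda>x. \<Sum>z\<in>P. \<Psi> z * indicator (A z) x)"
   by (rule apx_cong) (simp_all add: ls(5)[of \<Phi>] ls(5)[of \<Psi>] 0)
  also have "\<dots> = (\<Sum>z\<in>P. \<Sum>w\<in>P. \<Phi> z * (\<Psi> w * q z w))"
   using iL by (simp add: Q.B_suml Q.B_sumr Q.V_sum Q.V_scale Q.B_scalel Q.B_scaler q_def sum_distrib_left)
  finally show "apx \<alpha> (\<lambda>x. \<Phi> (p x)) (\<lambda>x. \<Psi> (p x)) = (\<Sum>z\<in>P. \<Sum>w\<in>P. \<Phi> z * \<Psi> w * q z w)"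
   by (simp add: mult.assoc)
 qed
qed

text \<open>The approximants are bounded by twice the absolute value of the function. This factor
  explains the 2 in the rectangle conditions of \<open>contraction\<close> and the 8 in
  \<open>mult_in\<close>.\<close>

lemma L2_simple_approximation:
 assumes "u \<in> L2_space M" "v \<in> L2_space M"
 obtains p :: "nat \<Rightarrow> 'a \<Rightarrow> real \<times> real" where "\<And>k. simple_function M (p k)"
  "\<And>x. x \<in> space M ==> (\<lambda>k. fst (p k x)) ----> u x" "\<And>x. x \<in> space M ==> (\<lambda>k. snd (p k x)) ----> v x"
  "\<And>k x. x \<in> space M ==> \<bar>fst (p k x)\<bar> \<le> 2 * \<bar>u x\<bar>" "\<And>k x. x \<in> space M ==> \<bar>snd (p k x)\<bar> \<le> 2 * \<bar>v x\<bar>"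
proof -
 obtain U where U: "\<And>i. simple_function M (U i)" "\<And>x. x \<in> space M ==> (\<lambda>i. U i x) ----> u x"
  "\<And>i x. x \<in> space M ==> dist (U i x) 0 \<le> 2 * dist (u x) 0"
  using borel_measurable_implies_sequence_metric[OF L2_measurable[OF assms(1)], of 0] by blast
 obtain W where W: "\<And>i. simple_function M (W i)" "\<And>x. x \<in> space M ==> (\<lambda>i. W i x) ----> v x"
  "\<And>i x. x \<in> space M ==> dist (W i x) 0 \<le> 2 * dist (v x) 0"
  using borel_measurable_implies_sequence_metric[OF L2_measurable[OF assms(2)], of 0] by blast
 show ?thesis
  by (rule that[of "\<lambda>k x. (U k x, W k x)"]) (use U W in "auto intro: simple_function_Pair")
qed

lemma simple_function_compose_measurable:
 assumes "simple_function M p" shows "(\<lambda>x. \<Phi> (p x) :: real) \<in> borel_measurable M"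
 using borel_measurable_simple_function[OF simple_function_compose[OF assms, of \<Phi>]] by (simp add: o_def)

lemma apx_tendsto_L2:
 assumes a: "\<alpha> > 0" and "\<And>k. s k \<in> L2_space M" "\<And>k. t k \<in> L2_space M" "f \<in> L2_space M" "g \<in> L2_space M"
  "L2_tendsto M s f" "L2_tendsto M t g"
 shows "(\<lambda>k. apx \<alpha> (s k) (t k)) ----> apx \<alpha> f g"
proof -
 interpret Q: psd_form "L2_space M" "apx \<alpha>" by (rule apx_psd[OF a])
 have "(\<lambda>k. apx \<alpha> (\<lambda>x. s k x - f x) (\<lambda>x. s k x - f x)) ----> 0"
  if "\<And>k. s k \<in> L2_space M" "f \<in> L2_space M" "L2_tendsto M s f" for s f
 proof (rule LIMSEQ_null_bounded)
  show "(\<lambda>k. \<alpha> * quad (L2_inner M) (\<lambda>x. s k x - f x)) ----> 0"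
   using tendsto_mult[OF tendsto_const that(3)] by simp
  show "\<bar>apx \<alpha> (\<lambda>x. s k x - f x) (\<lambda>x. s k x - f x)\<bar> \<le> \<alpha> * quad (L2_inner M) (\<lambda>x. s k x - f x)" for k
   using apx_le_L2[OF a L2.V_diff[OF that(1,2)]] Q.B_nonneg[OF L2.V_diff[OF that(1,2)]] by simp
 qed
 from this[of s f] this[of t g] assms show ?thesis by (intro Q.tendsto_B) auto
qed

lemma contraction_sqrt_bound:
 fixes x a b :: real
 assumes "x\<^sup>2 \<le> K * a\<^sup>2 + L * b\<^sup>2" "0 \<le> K" "0 \<le> L"
 shows "\<bar>x\<bar> \<le> (sqrt K + sqrt L) * (\<bar>a\<bar> + \<bar>b\<bar>)"
proof -
 have "K * a\<^sup>2 + L * b\<^sup>2 \<le> (sqrt K * \<bar>a\<bar> + sqrt L * \<bar>b\<bar>)\<^sup>2"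
  using assms(2,3) by (simp add: power2_sum power_mult_distrib)
 also have "\<dots> \<le> ((sqrt K + sqrt L) * (\<bar>a\<bar> + \<bar>b\<bar>))\<^sup>2"
  using assms(2,3) by (intro power_mono) (auto simp: algebra_simps)
 finally have "\<bar>x\<bar>\<^sup>2 \<le> ((sqrt K + sqrt L) * (\<bar>a\<bar> + \<bar>b\<bar>))\<^sup>2" using assms(1) by simp
 then show ?thesis using assms(2,3) by (intro power2_le_imp_le[of "\<bar>x\<bar>"]) auto
qed

text \<open>The contraction is only required on the rectangle \<open>S \<times> T\<close>, which contains the values of the
 simple functions that approximate \<open>(u, v)\<close>; this covers products of bounded functions.\<close>

theorem contraction:
 assumes u: "u \<in> F" and v: "v \<in> F" and K: "0 \<le> K" "0 \<le> L"
  and S: "\<And>x s. x \<in> space M ==> \<bar>s\<bar> \<le> 2 * \<bar>u x\<bar> ==> s \<in> S"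
  and T: "\<And>x t. x \<in> space M ==> \<bar>t\<bar> \<le> 2 * \<bar>v x\<bar> ==> t \<in> T"
  and \<Phi>: "\<And>s t s' t'. s \<in> S ==> t \<in> T ==> s' \<in> S ==> t' \<in> T ==>
    (\<Phi> s t - \<Phi> s' t')\<^sup>2 \<le> K * (s - s')\<^sup>2 + L * (t - t')\<^sup>2"
  and \<Phi>0: "\<Phi> 0 0 = (0::real)"
 shows "(\<lambda>x. \<Phi> (u x) (v x)) \<in> F"
  and "quad E (\<lambda>x. \<Phi> (u x) (v x)) \<le> K * E u u + L * E v v"
proof -
 let ?f = "\<lambda>x. \<Phi> (u x) (v x)"
 note uL = F_L2[OF u] and vL = F_L2[OF v]
 obtain p where p: "\<And>k. simple_function M (p k)"
  "\<And>x. x \<in> space M ==> (\<lambda>k. fst (p k x)) ----> u x" "\<And>x. x \<in> space M ==> (\<lambda>k. snd (p k x)) ----> v x"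
  "\<And>k x. x \<in> space M ==> \<bar>fst (p k x)\<bar> \<le> 2 * \<bar>u x\<bar>" "\<And>k x. x \<in> space M ==> \<bar>snd (p k x)\<bar> \<le> 2 * \<bar>v x\<bar>"
  using L2_simple_approximation[OF uL vL] by blast
 let ?\<Phi> = "\<lambda>z. \<Phi> (fst z) (snd z)"
 define c where "c = sqrt K + sqrt L"
 have c: "c \<ge> 0" using K by (simp add: c_def)
 have pS: "fst (p k x) \<in> S" "snd (p k x) \<in> T" if "x \<in> space M" for k x
  using S[OF that p(4)[OF that]] T[OF that p(5)[OF that]] by auto
 have uS: "u x \<in> S" "v x \<in> T" "0 \<in> S" "0 \<in> T" if "x \<in> space M" for x using S[OF that] T[OF that] by auto
 have h: "(\<lambda>x. \<bar>u x\<bar> + \<bar>v x\<bar>) \<in> L2_space M"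
  by (intro L2_add L2_abs uL vL)
 have meas: "(\<lambda>x. \<Psi> (p k x) :: real) \<in> borel_measurable M" for \<Psi> k
  by (rule simple_function_compose_measurable[OF p(1)])
 have lim: "(\<lambda>k. ?\<Phi> (p k x)) ----> ?f x" if x: "x \<in> space M" for x
 proof (rule LIMSEQ_I_bounded)
  show "(\<lambda>k. c * (\<bar>fst (p k x) - u x\<bar> + \<bar>snd (p k x) - v x\<bar>)) ----> 0"
   using tendsto_mult[OF tendsto_const tendsto_add[OF tendsto_rabs_zero[OF LIM_zero[OF p(2)[OF x]]]
     tendsto_rabs_zero[OF LIM_zero[OF p(3)[OF x]]]]] by simp
  show "\<bar>?\<Phi> (p k x) - ?f x\<bar> \<le> c * (\<bar>fst (p k x) - u x\<bar> + \<bar>snd (p k x) - v x\<bar>)" for k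
   unfolding c_def using \<Phi>[OF pS[OF x] uS(1,2)[OF x]] K by (intro contraction_sqrt_bound)
 qed
 have fm: "?f \<in> borel_measurable M"
  by (rule borel_measurable_LIMSEQ_real[where u = "\<lambda>k x. ?\<Phi> (p k x)"]) (use lim in blast, rule meas)
 have bound: "\<bar>?\<Phi> (p k x)\<bar> \<le> 2 * c * \<bar>\<bar>u x\<bar> + \<bar>v x\<bar>\<bar>" if x: "x \<in> space M" for x k
 proof -
  have "\<bar>?\<Phi> (p k x)\<bar> \<le> c * (\<bar>fst (p k x)\<bar> + \<bar>snd (p k x)\<bar>)"
   unfolding c_def using \<Phi>[OF pS[OF x] uS(3,4)[OF x]] \<Phi>0 K by (intro contraction_sqrt_bound) auto
  also have "\<dots> \<le> c * (2 * \<bar>u x\<bar> + 2 * \<bar>v x\<bar>)"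
   using c p(4)[OF x, of k] p(5)[OF x, of k] by (intro mult_left_mono add_mono) auto
  finally show ?thesis by (simp add: algebra_simps)
 qed
 have conv: "L2_tendsto M (\<lambda>k x. ?\<Phi> (p k x)) ?f" "?f \<in> L2_space M" "(\<lambda>x. ?\<Phi> (p k x)) \<in> L2_space M" for k
  using L2_dominated_convergence[of "\<lambda>k x. ?\<Phi> (p k x)" M ?f "\<lambda>x. \<bar>u x\<bar> + \<bar>v x\<bar>" "2 * c", OF meas fm h]
   lim bound by (auto intro!: AE_I2)
 have conv1: "L2_tendsto M (\<lambda>k x. fst (p k x)) u" "(\<lambda>x. fst (p k x)) \<in> L2_space M" for k
  using L2_dominated_convergence[of "\<lambda>k x. fst (p k x)" M u u 2, OF meas L2_measurable[OF uL] uL] p(2,4)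
  by (auto intro!: AE_I2)
 have conv2: "L2_tendsto M (\<lambda>k x. snd (p k x)) v" "(\<lambda>x. snd (p k x)) \<in> L2_space M" for k
  using L2_dominated_convergence[of "\<lambda>k x. snd (p k x)" M v v 2, OF meas L2_measurable[OF vL] vL] p(3,5)
  by (auto intro!: AE_I2)
 \<comment> \<open>The matrix inequality holds for the simple approximants and passes to the limit
   by L2 continuity of \<open>apx\<close>; \<open>apx_bounded\<close> then transfers it from
   \<open>apx\<close> to \<open>E\<close>.\<close>
 have ineq: "apx \<alpha> ?f ?f \<le> K * apx \<alpha> u u + L * apx \<alpha> v v" if a: "\<alpha> > 0" for \<alpha>
 proof (rule LIMSEQ_le)
  show "(\<lambda>k. apx \<alpha> (\<lambda>x. ?\<Phi> (p k x)) (\<lambda>x. ?\<Phi> (p k x))) ----> apx \<alpha> ?f ?f"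
   using conv by (intro apx_tendsto_L2 a) auto
  show "(\<lambda>k. K * apx \<alpha> (\<lambda>x. fst (p k x)) (\<lambda>x. fst (p k x)) + L * apx \<alpha> (\<lambda>x. snd (p k x)) (\<lambda>x. snd (p k x)))
    ----> K * apx \<alpha> u u + L * apx \<alpha> v v"
   using conv1 conv2 uL vL by (intro tendsto_intros apx_tendsto_L2 a) auto
  have "apx \<alpha> (\<lambda>x. ?\<Phi> (p k x)) (\<lambda>x. ?\<Phi> (p k x)) \<le>
    K * apx \<alpha> (\<lambda>x. fst (p k x)) (\<lambda>x. fst (p k x)) + L * apx \<alpha> (\<lambda>x. snd (p k x)) (\<lambda>x. snd (p k x))" for k
  proof -
   let ?P = "p k ` space M - {(0, 0)}"
   have PS: "fst z \<in> S \<and> snd z \<in> T \<and> 0 \<in> S \<and> 0 \<in> T" if "z \<in> ?P" for z using that pS uS by auto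
   obtain q where q: "\<And>z w. z \<in> ?P ==> w \<in> ?P ==> q z w = q w z"
    "\<And>z w. z \<in> ?P ==> w \<in> ?P ==> z \<noteq> w ==> q z w \<le> (0::real)"
    "\<And>z. z \<in> ?P ==> 0 \<le> (\<Sum>w\<in>?P. q z w)"
    "\<And>\<Phi> \<Psi>. \<Phi> (0,0) = 0 ==> \<Psi> (0,0) = 0 ==> apx \<alpha> (\<lambda>x. \<Phi> (p k x)) (\<lambda>x. \<Psi> (p k x)) =
     (\<Sum>z\<in>?P. \<Sum>w\<in>?P. \<Phi> z * \<Psi> w * q z w)"
    using apx_simple[OF a p(1) conv1(2) conv2(2)] by blast
   have "(\<Sum>z\<in>?P. \<Sum>w\<in>?P. ?\<Phi> z * ?\<Phi> w * q z w) \<le>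
     K * (\<Sum>z\<in>?P. \<Sum>w\<in>?P. fst z * fst w * q z w) + L * (\<Sum>z\<in>?P. \<Sum>w\<in>?P. snd z * snd w * q z w)"
   proof (rule weighted_form_contraction)
    show "(?\<Phi> z - ?\<Phi> w)\<^sup>2 \<le> K * (fst z - fst w)\<^sup>2 + L * (snd z - snd w)\<^sup>2" if "z \<in> ?P" "w \<in> ?P" for z w
     using PS[OF that(1)] PS[OF that(2)] by (intro \<Phi>) auto
    show "(?\<Phi> z)\<^sup>2 \<le> K * (fst z)\<^sup>2 + L * (snd z)\<^sup>2" if "z \<in> ?P" for z
     using \<Phi>[of "fst z" "snd z" 0 0] PS[OF that] \<Phi>0 by simp
   qed (use q in blast)+
   then show ?thesis using q(4)[of ?\<Phi> ?\<Phi>] q(4)[of fst fst] q(4)[of snd snd] \<Phi>0 by simp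
  qed
  then show "\<exists>N. \<forall>k\<ge>N. apx \<alpha> (\<lambda>x. ?\<Phi> (p k x)) (\<lambda>x. ?\<Phi> (p k x)) \<le>
    K * apx \<alpha> (\<lambda>x. fst (p k x)) (\<lambda>x. fst (p k x)) + L * apx \<alpha> (\<lambda>x. snd (p k x)) (\<lambda>x. snd (p k x))" by blast
 qed
 have "apx (real (Suc n)) ?f ?f \<le> K * E u u + L * E v v" for n
 proof -
  have "K * apx (real (Suc n)) u u + L * apx (real (Suc n)) v v \<le> K * E u u + L * E v v"
   using K u v by (intro add_mono mult_left_mono apx_le) auto
  then show ?thesis using ineq[of "real (Suc n)"] by simp
 qed
 from apx_bounded[OF conv(2) this] show "?f \<in> F" "E ?f ?f \<le> K * E u u + L * E v v" by auto
qed

lemma normal_contraction: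
 assumes u: "u \<in> F" and T: "\<And>s t. \<bar>T s - T t\<bar> \<le> \<bar>s - t\<bar>" "T 0 = (0::real)"
 shows "(\<lambda>x. T (u x)) \<in> F" "quad E (\<lambda>x. T (u x)) \<le> E u u"
proof -
 have sq: "(T s - T s')\<^sup>2 \<le> (s - s')\<^sup>2" for s s' using T(1)[of s s'] by (simp add: abs_le_square_iff)
 show "(\<lambda>x. T (u x)) \<in> F" "quad E (\<lambda>x. T (u x)) \<le> E u u"
  using contraction[OF u domain_zero, of 1 0 UNIV UNIV "\<lambda>s t. T s"] sq T(2) by auto
qed

lemma truncate_contraction: "c \<ge> 0 ==> \<bar>max (- c) (min c s) - max (- c) (min c t)\<bar> \<le> \<bar>s - t\<bar>" for s t c :: real
 by auto

lemma truncate_in: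
 assumes "u \<in> F" "c \<ge> 0"
 shows "truncate c u \<in> F" "E (truncate c u) (truncate c u) \<le> E u u"
 using normal_contraction[OF assms(1), of "\<lambda>t. max (- c) (min c t)"] truncate_contraction[OF assms(2)] assms(2)
 unfolding truncate_def by auto

lemma truncate_bounded: "c \<ge> 0 ==> \<bar>truncate c f x\<bar> \<le> c"
 by (auto simp: truncate_def)

lemma truncate_le: "c \<ge> 0 ==> \<bar>truncate c f x\<bar> \<le> \<bar>f x\<bar>"
 by (auto simp: truncate_def)

text \<open>A product is Lipschitz only on bounded rectangles. The approximants stay within 2c and
  2d, so \<open>(x + y)^2 <= 2 x^2 + 2 y^2\<close> gives the coefficients 2 (2d)^2 and 2
  (2c)^2.\<close>

lemma mult_in:
 assumes u: "u \<in> F" and v: "v \<in> F" and c: "\<And>x. x \<in> space M ==> \<bar>u x\<bar> \<le> c" "\<And>x. x \<in> space M ==> \<bar>v x\<bar> \<le> d"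
 shows "(\<lambda>x. u x * v x) \<in> F"
  "quad E (\<lambda>x. u x * v x) \<le> 8 * d\<^sup>2 * E u u + 8 * c\<^sup>2 * E v v"
proof -
 have b: "(s * t - s' * t')\<^sup>2 \<le> 8 * d\<^sup>2 * (s - s')\<^sup>2 + 8 * c\<^sup>2 * (t - t')\<^sup>2"
  if "\<bar>s\<bar> \<le> 2 * \<bar>c\<bar>" "\<bar>t\<bar> \<le> 2 * \<bar>d\<bar>" "\<bar>s'\<bar> \<le> 2 * \<bar>c\<bar>" "\<bar>t'\<bar> \<le> 2 * \<bar>d\<bar>" for s t s' t'
 proof -
  have sq: "(a + b)\<^sup>2 \<le> 2 * a\<^sup>2 + 2 * b\<^sup>2" for a b :: real
   using zero_le_power2[of "a - b"] by (simp add: power2_diff power2_sum)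
  have "s * t - s' * t' = (s - s') * t + s' * (t - t')" by (simp add: algebra_simps)
  then have "(s * t - s' * t')\<^sup>2 \<le> 2 * ((s - s')\<^sup>2 * t\<^sup>2) + 2 * (s'\<^sup>2 * (t - t')\<^sup>2)"
   using sq[of "(s - s') * t" "s' * (t - t')"] by (simp add: power_mult_distrib)
  moreover have "t\<^sup>2 \<le> (2 * \<bar>d\<bar>)\<^sup>2" "s'\<^sup>2 \<le> (2 * \<bar>c\<bar>)\<^sup>2"
   using power_mono[OF that(2), of 2] power_mono[OF that(3), of 2] by auto
  then have "(s - s')\<^sup>2 * t\<^sup>2 \<le> (s - s')\<^sup>2 * (4 * d\<^sup>2)" "s'\<^sup>2 * (t - t')\<^sup>2 \<le> 4 * c\<^sup>2 * (t - t')\<^sup>2"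
   by (intro mult_left_mono mult_right_mono; simp add: power_mult_distrib)+
  ultimately show ?thesis by (simp add: algebra_simps)
 qed
 have S: "\<bar>s\<bar> \<le> 2 * \<bar>c\<bar>" if "x \<in> space M" "\<bar>s\<bar> \<le> 2 * \<bar>u x\<bar>" for x s using that c(1)[OF that(1)] by linarith
 have T: "\<bar>t\<bar> \<le> 2 * \<bar>d\<bar>" if "x \<in> space M" "\<bar>t\<bar> \<le> 2 * \<bar>v x\<bar>" for x t using that c(2)[OF that(1)] by linarith
 show "(\<lambda>x. u x * v x) \<in> F" "quad E (\<lambda>x. u x * v x) \<le> 8 * d\<^sup>2 * E u u + 8 * c\<^sup>2 * E v v"
  using contraction[OF u v, of "8 * d\<^sup>2" "8 * c\<^sup>2" "{s. \<bar>s\<bar> \<le> 2 * \<bar>c\<bar>}" "{t. \<bar>t\<bar> \<le> 2 * \<bar>d\<bar>}" "\<lambda>s t. s * t"] b S T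
  by auto
qed

text \<open>For bounded u in the domain this is the functional of g that the energy measure of u is
  to represent.\<close>

definition Gamma :: "('a \<Rightarrow> real) \<Rightarrow> ('a \<Rightarrow> real) \<Rightarrow> real" where
 "Gamma u g = 2 * E u (\<lambda>x. u x * g x) - E (\<lambda>x. (u x)\<^sup>2) g"

lemma square_in:
 assumes "u \<in> F" "\<And>x. x \<in> space M ==> \<bar>u x\<bar> \<le> c"
 shows "(\<lambda>x. (u x)\<^sup>2) \<in> F"
 using mult_in(1)[OF assms(1,1) assms(2,2)] by (simp add: power2_eq_square)

abbreviation (input) apx_Gamma :: "real \<Rightarrow> ('a \<Rightarrow> real) \<Rightarrow> ('a \<Rightarrow> real) \<Rightarrow> real" where
 "apx_Gamma \<alpha> u g \<equiv> 2 * apx \<alpha> u (\<lambda>x. u x * g x) - apx \<alpha> (\<lambda>x. (u x)\<^sup>2) g"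

text \<open>Three limits are chained: the matrix inequality on simple functions, L2 convergence of
  these at fixed alpha, and alpha to infinity. The case T = 0 yields positivity, general T the
  monotonicity of energy measures under truncation, and the upper bound the finiteness of these
  measures.\<close>

theorem Gamma_mono:
 assumes u: "u \<in> F" and ub: "\<And>x. x \<in> space M ==> \<bar>u x\<bar> \<le> b"
  and g: "g \<in> F" and gb: "\<And>x. x \<in> space M ==> 0 \<le> g x \<and> g x \<le> c"
  and T: "\<And>s t. \<bar>T s - T t\<bar> \<le> \<bar>s - t\<bar>" "T 0 = (0::real)"
 shows "Gamma (\<lambda>x. T (u x)) g \<le> Gamma u g" "Gamma u g \<le> 2 * c * E u u"
proof -
 note uL = F_L2[OF u] and gL = F_L2[OF g]
 obtain p where p: "\<And>k. simple_function M (p k)"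
  "\<And>x. x \<in> space M ==> (\<lambda>k. fst (p k x)) ----> u x" "\<And>x. x \<in> space M ==> (\<lambda>k. snd (p k x)) ----> g x"
  "\<And>k x. x \<in> space M ==> \<bar>fst (p k x)\<bar> \<le> 2 * \<bar>u x\<bar>" "\<And>k x. x \<in> space M ==> \<bar>snd (p k x)\<bar> \<le> 2 * \<bar>g x\<bar>"
  using L2_simple_approximation[OF uL gL] by blast
 have Tle: "\<bar>T s\<bar> \<le> \<bar>s\<bar>" for s using T(1)[of s 0] T(2) by simp
 have Tcont: "continuous_on UNIV T"
 proof (rule continuous_onI)
  fix x e :: real assume "e > 0"
  then show "\<exists>d>0. \<forall>x'\<in>UNIV. dist x' x < d \<longrightarrow> dist (T x') (T x) \<le> e"
   using order_trans[OF T(1) less_imp_le] by (intro exI[of _ e]) (auto simp: dist_real_def)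
 qed
 have h: "(\<lambda>x. \<bar>u x\<bar> + \<bar>g x\<bar>) \<in> L2_space M"
  by (intro L2_add L2_abs uL gL)
 have conv: "L2_tendsto M (\<lambda>k x. \<Psi> (p k x)) (\<lambda>x. \<Psi> (u x, g x)) \<and> (\<lambda>x. \<Psi> (u x, g x)) \<in> L2_space M \<and>
   (\<forall>k. (\<lambda>x. \<Psi> (p k x)) \<in> L2_space M)"
  if cont: "continuous_on UNIV \<Psi>"
   and C: "\<And>s t x. x \<in> space M ==> \<bar>s\<bar> \<le> 2 * \<bar>u x\<bar> ==> \<bar>t\<bar> \<le> 2 * \<bar>g x\<bar> ==> \<bar>\<Psi> (s, t)\<bar> \<le> C * (\<bar>u x\<bar> + \<bar>g x\<bar>)"
  for \<Psi> :: "real \<times> real \<Rightarrow> real" and C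
 proof -
  have meas: "(\<lambda>x. \<Psi> (p k x) :: real) \<in> borel_measurable M" for k
   by (rule simple_function_compose_measurable[OF p(1)])
  have lim: "(\<lambda>k. \<Psi> (p k x)) ----> \<Psi> (u x, g x)" if x: "x \<in> space M" for x
  proof -
   have "(\<lambda>k. (fst (p k x), snd (p k x))) ----> (u x, g x)" by (intro tendsto_Pair p x)
   then have "(\<lambda>k. p k x) ----> (u x, g x)" by simp
   then show ?thesis using cont by (auto intro: continuous_on_tendsto_compose)
  qed
  have fm: "(\<lambda>x. \<Psi> (u x, g x)) \<in> borel_measurable M"
   by (rule borel_measurable_LIMSEQ_real[where u = "\<lambda>k x. \<Psi> (p k x)"]) (use lim in blast, rule meas)
  have bd: "\<bar>\<Psi> (p k x)\<bar> \<le> C * \<bar>\<bar>u x\<bar> + \<bar>g x\<bar>\<bar>" if "x \<in> space M" for k x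
   using C[OF that p(4)[OF that, of k] p(5)[OF that, of k]] by simp
  show ?thesis
   using L2_dominated_convergence[of "\<lambda>k x. \<Psi> (p k x)" M "\<lambda>x. \<Psi> (u x, g x)" "\<lambda>x. \<bar>u x\<bar> + \<bar>g x\<bar>" C, OF meas fm h]
    lim bd by (auto intro!: AE_I2)
 qed
 \<comment> \<open>The simple approximants of g may leave the range [0,c]. Clipping their second
   coordinate restores the bounds needed for the matrix inequality and does not change the limit
   g.\<close>
 define G where "G z = min c (max 0 (snd z))" for z :: "real \<times> real"
 have G: "0 \<le> G z" "G z \<le> c" if "space M \<noteq> {}" for z
  using that gb by (auto simp: G_def) fastforce
 have Gu: "G (u x, g x) = g x" if "x \<in> space M" for x using gb[OF that] by (auto simp: G_def)
 have bs: "\<bar>s\<bar> \<le> 2 * \<bar>b\<bar>" if "\<bar>s\<bar> \<le> 2 * \<bar>u x\<bar>" "x \<in> space M" for s x using that ub[OF that(2)] by linarith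
 have cG: "continuous_on UNIV G" unfolding G_def by (intro continuous_intros)
 have bG: "\<bar>G (s, t)\<bar> \<le> 2 * (\<bar>u x\<bar> + \<bar>g x\<bar>)" if "x \<in> space M" "\<bar>t\<bar> \<le> 2 * \<bar>g x\<bar>" for s t x
  using that gb[OF that(1)] by (auto simp: G_def)
 have cT: "continuous_on UNIV (\<lambda>z. T' (fst z))" if "continuous_on UNIV T'" for T' :: "real \<Rightarrow> real"
  using that by (intro continuous_on_compose2[OF that]) (auto intro: continuous_intros)
 have main: "\<exists>A. A ----> 2 * apx \<alpha> (\<lambda>x. T' (u x)) (\<lambda>x. T' (u x) * g x) - apx \<alpha> (\<lambda>x. (T' (u x))\<^sup>2) g \<and>
   (\<forall>k. A k = 2 * apx \<alpha> (\<lambda>x. T' (fst (p k x))) (\<lambda>x. T' (fst (p k x)) * G (p k x)) - apx \<alpha> (\<lambda>x. (T' (fst (p k x)))\<^sup>2) (\<lambda>x. G (p k x)))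
   \<and> (\<lambda>k. apx \<alpha> (\<lambda>x. T' (fst (p k x))) (\<lambda>x. T' (fst (p k x)))) ----> apx \<alpha> (\<lambda>x. T' (u x)) (\<lambda>x. T' (u x))"
  if a: "\<alpha> > 0" and T'c: "continuous_on UNIV T'" and T'le: "\<And>s. \<bar>T' s\<bar> \<le> \<bar>s\<bar>" for \<alpha> T'
 proof -
  have 1: "\<bar>T' (fst (s, t))\<bar> \<le> 2 * (\<bar>u x\<bar> + \<bar>g x\<bar>)" if "\<bar>s\<bar> \<le> 2 * \<bar>u x\<bar>" for s t x
   using that T'le[of s] by simp
  have 2: "\<bar>T' (fst (s, t)) * G (s, t)\<bar> \<le> 2 * \<bar>c\<bar> * (\<bar>u x\<bar> + \<bar>g x\<bar>)" if x: "x \<in> space M" "\<bar>s\<bar> \<le> 2 * \<bar>u x\<bar>" for s t x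
  proof -
   have "\<bar>T' s\<bar> * \<bar>G (s, t)\<bar> \<le> (2 * (\<bar>u x\<bar> + \<bar>g x\<bar>)) * \<bar>c\<bar>"
   proof (rule mult_mono)
    have "space M \<noteq> {}" using x(1) by blast
    then show "\<bar>G (s, t)\<bar> \<le> \<bar>c\<bar>" using G[of "(s,t)"] by linarith
   qed (use 1[OF x(2)] in auto)
   then show ?thesis by (simp add: abs_mult algebra_simps)
  qed
  have 3: "\<bar>(T' (fst (s, t)))\<^sup>2\<bar> \<le> 4 * \<bar>b\<bar> * (\<bar>u x\<bar> + \<bar>g x\<bar>)" if x: "x \<in> space M" "\<bar>s\<bar> \<le> 2 * \<bar>u x\<bar>" for s t x
  proof -
   have "\<bar>T' s\<bar> * \<bar>T' s\<bar> \<le> (2 * \<bar>b\<bar>) * (2 * (\<bar>u x\<bar> + \<bar>g x\<bar>))"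
    using 1[OF x(2)] bs[OF x(2,1)] T'le[of s] by (intro mult_mono) auto
   then show ?thesis by (simp add: abs_mult power2_eq_square algebra_simps)
  qed
  note c1 = conv[of "\<lambda>z. T' (fst z)" 2, OF cT[OF T'c] 1]
  note c2 = conv[of "\<lambda>z. T' (fst z) * G z" "2 * \<bar>c\<bar>", OF continuous_on_mult[OF cT[OF T'c] cG] 2]
  note c3 = conv[of "\<lambda>z. (T' (fst z))\<^sup>2" "4 * \<bar>b\<bar>", OF continuous_on_power[OF cT[OF T'c]] 3]
  note c4 = conv[of G 2, OF cG bG]
  have eq: "apx \<alpha> (\<lambda>x. T' (u x)) (\<lambda>x. T' (u x) * G (u x, g x)) = apx \<alpha> (\<lambda>x. T' (u x)) (\<lambda>x. T' (u x) * g x)"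
   "apx \<alpha> (\<lambda>x. (T' (u x))\<^sup>2) (\<lambda>x. G (u x, g x)) = apx \<alpha> (\<lambda>x. (T' (u x))\<^sup>2) g"
   by (intro apx_cong; simp add: Gu)+
  have "(\<lambda>k. 2 * apx \<alpha> (\<lambda>x. T' (fst (p k x))) (\<lambda>x. T' (fst (p k x)) * G (p k x)) - apx \<alpha> (\<lambda>x. (T' (fst (p k x)))\<^sup>2) (\<lambda>x. G (p k x)))
    ----> 2 * apx \<alpha> (\<lambda>x. T' (u x)) (\<lambda>x. T' (u x) * G (u x, g x)) - apx \<alpha> (\<lambda>x. (T' (u x))\<^sup>2) (\<lambda>x. G (u x, g x))"
   using c1 c2 c3 c4 by (intro tendsto_intros apx_tendsto_L2 a) auto
  moreover have "(\<lambda>k. apx \<alpha> (\<lambda>x. T' (fst (p k x))) (\<lambda>x. T' (fst (p k x)))) ----> apx \<alpha> (\<lambda>x. T' (u x)) (\<lambda>x. T' (u x))"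
   using c1 by (intro apx_tendsto_L2 a) auto
  ultimately show ?thesis unfolding eq by blast
 qed
 have ineq: "apx_Gamma \<alpha> (\<lambda>x. T (u x)) g \<le>
   apx_Gamma \<alpha> u g"
  "apx_Gamma \<alpha> u g \<le> 2 * c * apx \<alpha> u u" if a: "\<alpha> > 0" for \<alpha>
 proof -
  from main[OF a Tcont Tle] obtain A where A: "A ----> apx_Gamma \<alpha> (\<lambda>x. T (u x)) g"
   "\<And>k. A k = 2 * apx \<alpha> (\<lambda>x. T (fst (p k x))) (\<lambda>x. T (fst (p k x)) * G (p k x)) - apx \<alpha> (\<lambda>x. (T (fst (p k x)))\<^sup>2) (\<lambda>x. G (p k x))"
   by blast
  from main[OF a continuous_on_id, simplified] obtain B where B: "B ----> apx_Gamma \<alpha> u g"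
   "\<And>k. B k = 2 * apx \<alpha> (\<lambda>x. fst (p k x)) (\<lambda>x. fst (p k x) * G (p k x)) - apx \<alpha> (\<lambda>x. (fst (p k x))\<^sup>2) (\<lambda>x. G (p k x))"
   and D: "(\<lambda>k. apx \<alpha> (\<lambda>x. fst (p k x)) (\<lambda>x. fst (p k x))) ----> apx \<alpha> u u"
   by blast
  have L1: "(\<lambda>x. fst (p k x)) \<in> L2_space M" for k
   using L2_dominated_convergence(3)[of "\<lambda>k x. fst (p k x)" M u u 2] p L2_measurable[OF uL] uL
    simple_function_compose_measurable[OF p(1), of fst] by (auto intro!: AE_I2)
  have L2: "(\<lambda>x. snd (p k x)) \<in> L2_space M" for k
   using L2_dominated_convergence(3)[of "\<lambda>k x. snd (p k x)" M g g 2] p L2_measurable[OF gL] gL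
    simple_function_compose_measurable[OF p(1), of snd] by (auto intro!: AE_I2)
  have AB: "A k \<le> B k \<and> B k \<le> 2 * c * apx \<alpha> (\<lambda>x. fst (p k x)) (\<lambda>x. fst (p k x))" for k
  proof -
   let ?P = "p k ` space M - {(0, 0)}"
   obtain q where q: "\<And>z w. z \<in> ?P ==> w \<in> ?P ==> q z w = q w z"
    "\<And>z w. z \<in> ?P ==> w \<in> ?P ==> z \<noteq> w ==> q z w \<le> (0::real)"
    "\<And>z. z \<in> ?P ==> 0 \<le> (\<Sum>w\<in>?P. q z w)"
    "\<And>\<Phi> \<Psi>. \<Phi> (0,0) = 0 ==> \<Psi> (0,0) = 0 ==> apx \<alpha> (\<lambda>x. \<Phi> (p k x)) (\<lambda>x. \<Psi> (p k x)) =
     (\<Sum>z\<in>?P. \<Sum>w\<in>?P. \<Phi> z * \<Psi> w * q z w)"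
    using apx_simple[OF a p(1) L1 L2] by blast
   \<comment> \<open>On an empty space the hypothesis on g does not force c >= 0, and then
     \<open>G (0, 0) = min c 0\<close> may be negative; but in that case there are no level
     sets.\<close>
   have G0: "G (0, 0) = 0 \<or> ?P = {}"
   proof (cases "space M = {}")
    case False
    then show ?thesis using G[of "(0,0)"] by (simp add: G_def)
   qed simp
   have sqT: "(T (fst z) - T (fst w))\<^sup>2 \<le> (fst z - fst w)\<^sup>2" for z w :: "real \<times> real"
    using T(1)[of "fst z" "fst w"] by (simp add: abs_le_square_iff)
   have sqT0: "(T (fst z))\<^sup>2 \<le> (fst z)\<^sup>2" for z :: "real \<times> real"
    using Tle[of "fst z"] by (simp add: abs_le_square_iff)
   have Gb: "0 \<le> G z \<and> G z \<le> c" if "z \<in> ?P" for z using G[of z] that by auto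
   note m = weighted_form_Gamma_mono[of ?P q "\<lambda>z. T (fst z)" fst G c, OF q(1,2,3) sqT sqT0 Gb]
   show ?thesis
   proof (cases "?P = {}")
    case True
    then have "\<And>x. x \<in> space M ==> p k x = (0, 0)" by (metis Diff_eq_empty_iff image_subset_iff singletonD)
    then have z: "apx \<alpha> (\<lambda>x. \<Phi> (p k x)) (\<lambda>x. \<Psi> (p k x)) = apx \<alpha> (\<lambda>x. \<Phi> (0, 0)) (\<lambda>x. \<Psi> (0, 0))" for \<Phi> \<Psi>
     by (intro apx_cong) auto
    have zz: "apx \<alpha> (\<lambda>x. 0) h = 0" for h by (simp add: apx_def L2_inner_def)
    show ?thesis
     unfolding A(2) B(2) z[of "\<lambda>z. T (fst z)" "\<lambda>z. T (fst z) * G z"] z[of "\<lambda>z. (T (fst z))\<^sup>2" G]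
      z[of fst "\<lambda>z. fst z * G z"] z[of "\<lambda>z. (fst z)\<^sup>2" G] z[of fst fst]
     by (simp add: T zz)
   next
    case False
    then have g0: "G (0,0) = 0" using G0 by simp
    show ?thesis
     unfolding A(2) B(2)
     using m q(4)[of "\<lambda>z. T (fst z)" "\<lambda>z. T (fst z) * G z"] q(4)[of "\<lambda>z. (T (fst z))\<^sup>2" G]
      q(4)[of fst "\<lambda>z. fst z * G z"] q(4)[of "\<lambda>z. (fst z)\<^sup>2" G] q(4)[of fst fst] g0 T(2) by simp
   qed
  qed
  show "apx_Gamma \<alpha> (\<lambda>x. T (u x)) g \<le>
   apx_Gamma \<alpha> u g"
   by (rule LIMSEQ_le[OF A(1) B(1)]) (use AB in blast)
  show "apx_Gamma \<alpha> u g \<le> 2 * c * apx \<alpha> u u"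
   by (rule LIMSEQ_le[OF B(1) tendsto_mult[OF tendsto_const D]]) (use AB in blast)
 qed
 have TuF: "(\<lambda>x. T (u x)) \<in> F" by (rule normal_contraction[OF u T])
 have Tub: "\<bar>T (u x)\<bar> \<le> b" if "x \<in> space M" for x using Tle[of "u x"] ub[OF that] by linarith
 have gb': "\<bar>g x\<bar> \<le> c" if "x \<in> space M" for x using gb[OF that] by simp
 have lims: "(\<lambda>n. 2 * apx (real (Suc n)) w (\<lambda>x. w x * g x) - apx (real (Suc n)) (\<lambda>x. (w x)\<^sup>2) g) ----> Gamma w g"
  if w: "w \<in> F" "\<And>x. x \<in> space M ==> \<bar>w x\<bar> \<le> b" for w
  unfolding Gamma_def using w g mult_in(1)[OF w(1) g w(2) gb'] square_in[OF w]
  by (intro tendsto_intros apx_tendsto) auto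
 show "Gamma (\<lambda>x. T (u x)) g \<le> Gamma u g"
  by (rule LIMSEQ_le[OF lims[OF TuF Tub] lims[OF u ub]]) (use ineq(1) in auto)
 show "Gamma u g \<le> 2 * c * E u u"
  by (rule LIMSEQ_le[OF lims[OF u ub] tendsto_mult[OF tendsto_const apx_tendsto[OF u u]]]) (use ineq(2) in auto)
qed

lemma Gamma_nonneg:
 assumes "u \<in> F" "\<And>x. x \<in> space M ==> \<bar>u x\<bar> \<le> b" "g \<in> F" "\<And>x. x \<in> space M ==> 0 \<le> g x \<and> g x \<le> c"
 shows "0 \<le> Gamma u g"
proof -
 have "Gamma (\<lambda>x. 0) g \<le> Gamma u g" by (rule Gamma_mono(1)[OF assms, of "\<lambda>t. 0"]) auto
 then show ?thesis using assms by (simp add: Gamma_def form.B_zerol domain_zero)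
qed

end

lemma abs_midpoint_le: "\<bar>a\<bar> \<le> c ==> \<bar>b\<bar> \<le> c ==> \<bar>(a + b) / 2\<bar> \<le> c" for a b c :: real
 by (simp add: abs_le_iff)

section \<open>Regular Dirichlet forms on an open subset of a proper space\<close>

lemma compact_open_neighborhood:
 fixes K :: "'a::metric_space set"
 assumes K: "compact K" "K \<subseteq> U" "open U" "K \<noteq> {}"
 obtains e where "e > 0" "\<And>x. infdist x K < e ==> x \<in> U"
proof -
 obtain e where e: "e > 0" "\<And>x. x \<in> K ==> ball x e \<subseteq> U"
 proof (cases "U = UNIV")
  case True
  then show ?thesis using that[of 1] by auto
 next
  case False
  then have ne: "- U \<noteq> {}" by auto
  have "continuous_on K (\<lambda>x. infdist x (- U))" by (intro continuous_intros)
  then obtain x0 where x0: "x0 \<in> K" "\<And>x. x \<in> K ==> infdist x0 (- U) \<le> infdist x (- U)"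
   using continuous_attains_inf[OF K(1,4)] by blast
  have "infdist x0 (- U) > 0"
   using K(2,3) x0(1) ne by (intro infdist_pos_not_in_closed) auto
  moreover have "ball x (infdist x0 (- U)) \<subseteq> U" if "x \<in> K" for x
  proof
   fix y assume "y \<in> ball x (infdist x0 (- U))"
   then have "dist x y < infdist x (- U)" using x0(2)[OF that] by simp
   then show "y \<in> U" using infdist_le[of y "- U" x] by force
  qed
  ultimately show ?thesis using that by blast
 qed
 have "x \<in> U" if x: "infdist x K < e" for x
 proof -
  have "\<exists>y\<in>K. dist x y < e"
   using x K(4) unfolding infdist_notempty[OF K(4)] by (subst (asm) cInf_less_iff) auto
  then obtain y where "y \<in> K" "x \<in> ball y e" by (auto simp: dist_commute)
  then show ?thesis using e(2) by blast
 qed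
 then show ?thesis using that e(1) by blast
qed

text \<open>The state space \<open>X\<close> is an open part of a metric space with compact closed
  balls. Two instances are intended: the form on \<open>D\<close>, and the reflected form on the
  whole completion.\<close>

locale regular_form_space = regular_dirichlet_form M E F
 for M :: "'a::polish_space measure" and E F +
 fixes X :: "'a set"
 assumes open_X: "open X"
  and radon: "radon_measure_on X M"
  and proper: "\<And>x r. compact (cball x r :: 'a set)"
begin

lemma sets_M: "sets M = sets (restrict_space borel X)" using radon by (simp add: radon_measure_on_def)

lemma space_M: "space M = X" using sets_eq_imp_space_eq[OF sets_M] by (simp add: space_restrict_space)

lemma sets_M_iff: "A \<in> sets M \<longleftrightarrow> A \<in> sets borel \<and> A \<subseteq> X"
 unfolding sets_M using open_X by (auto simp: sets_restrict_space_iff)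

lemma compact_bounded_closed:
 fixes K :: "'a set"
 assumes "bounded K" "closed K" shows "compact K"
proof -
 obtain x r where "K \<subseteq> cball x r" using assms(1) unfolding bounded_subset_cball by blast
 then show ?thesis using compact_Int_closed[OF proper[of x r] assms(2)] by (simp add: Int_absorb1)
qed

lemma compact_exhaustion:
 assumes U: "open U"
 obtains K :: "nat \<Rightarrow> 'a set" where "\<And>n. compact (K n)" "incseq K" "(\<Union>n. K n) = U"
  "\<And>L. compact L ==> L \<subseteq> U ==> \<exists>n. L \<subseteq> interior (K n)"
proof -
 obtain x0 :: 'a where True by simp
 \<comment> \<open>The distance condition is an intersection over points of the complement, so that
   \<open>U = UNIV\<close> needs no separate case; \<open>infdist\<close> to the empty set is 0 and
   would give empty sets.\<close>
 define K where "K n = cball x0 (real n) \<inter> (\<Inter>y\<in>-U. {x. dist x y \<ge> inverse (real (Suc n))})" for n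
 have cK: "compact (K n)" for n
  unfolding K_def
  by (intro compact_Int_closed proper closed_INT ballI closed_Collect_le continuous_intros)
 have inc: "incseq K"
 proof (rule incseq_SucI, rule subsetI)
  fix n x assume x: "x \<in> K n"
  have 1: "inverse (real (Suc (Suc n))) \<le> inverse (real (Suc n))" by (simp add: field_simps)
  have "dist x0 x \<le> real n" "\<And>y. y \<in> - U ==> inverse (real (Suc n)) \<le> dist x y" using x by (auto simp: K_def)
  then have "dist x0 x \<le> real (Suc n)" "\<And>y. y \<in> - U ==> inverse (real (Suc (Suc n))) \<le> dist x y"
   using order_trans[OF 1] by auto
  then show "x \<in> K (Suc n)" by (simp only: K_def Int_iff mem_cball INT_iff mem_Collect_eq) blast
 qed
 have sub: "K n \<subseteq> U" for n
 proof
  fix x assume x: "x \<in> K n"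
  show "x \<in> U"
  proof (rule ccontr)
   assume "x \<notin> U"
   then have "x \<in> - U" by simp
   then have "inverse (real (Suc n)) \<le> dist x x" using x unfolding K_def by blast
   moreover have "inverse (real (Suc n)) > 0" by simp
   ultimately show False by (simp del: of_nat_Suc)
  qed
 qed
 have int: "\<exists>n. x \<in> interior (K n)" if x: "x \<in> U" for x
 proof -
  obtain e where e: "e > 0" "ball x e \<subseteq> U" using U x open_contains_ball by blast
  obtain n1 where n1: "inverse (real (Suc n1)) < e / 2" using reals_Archimedean[of "e/2"] e(1) by auto
  obtain n2 :: nat where n2: "real n2 > dist x0 x + e" using reals_Archimedean2 by blast
  define n where "n = max n1 n2"
  have n: "inverse (real (Suc n)) < e / 2" "real n > dist x0 x + e"
  proof -
   have "inverse (real (Suc n)) \<le> inverse (real (Suc n1))" by (simp add: n_def field_simps)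
   then show "inverse (real (Suc n)) < e / 2" using n1 by linarith
   show "real n > dist x0 x + e" using n2 by (simp add: n_def)
  qed
  have "ball x (e/2) \<subseteq> K n"
  proof
   fix y assume y: "y \<in> ball x (e/2)"
   have "dist x0 y \<le> real n" using dist_triangle[of x0 y x] y n(2) e(1) by (simp add: dist_commute)
   moreover have "inverse (real (Suc n)) \<le> dist y z" if "z \<notin> U" for z
   proof -
    have "dist x z \<ge> e" using e(2) that by (meson mem_ball not_le subsetD)
    then show ?thesis using dist_triangle[of x z y] y n(1) by simp
   qed
   ultimately show "y \<in> K n" by (auto simp: K_def)
  qed
  then have "x \<in> interior (K n)" using e(1) by (meson centre_in_ball half_gt_zero interior_maximal open_ball subsetD)
  then show ?thesis by blast
 qed
 have un: "(\<Union>n. K n) = U"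
 proof
  show "(\<Union>n. K n) \<subseteq> U" using sub by blast
  show "U \<subseteq> (\<Union>n. K n)"
  proof
   fix x assume "x \<in> U"
   then obtain n where "x \<in> interior (K n)" using int by blast
   then have "x \<in> K n" by (rule subsetD[OF interior_subset])
   then show "x \<in> (\<Union>n. K n)" by blast
  qed
 qed
 have "\<exists>n. L \<subseteq> interior (K n)" if L: "compact L" "L \<subseteq> U" for L
 proof -
  have "L \<subseteq> (\<Union>n\<in>UNIV. interior (K n))" using L(2) int by blast
  then obtain N where N: "finite N" "L \<subseteq> (\<Union>n\<in>N. interior (K n))"
   using compactE_image[OF L(1), of UNIV "\<lambda>n. interior (K n)"] by auto
  have "interior (K n) \<subseteq> interior (K (Max (insert 0 N)))" if "n \<in> N" for n
   using N(1) that by (intro interior_mono incseqD[OF inc]) auto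
  then show ?thesis using N(2) by blast
 qed
 with cK inc un that show ?thesis by blast
qed

definition core :: "('a \<Rightarrow> real) set" where "core = F \<inter> Cc X"

lemma core_F: "g \<in> core ==> g \<in> F" by (simp add: core_def)

lemma core_continuous: "g \<in> core ==> continuous_on X g" by (simp add: core_def Cc_def)

lemma core_support: "g \<in> core ==> \<exists>K. compact K \<and> K \<subseteq> X \<and> (\<forall>x\<in>X - K. g x = 0)"
 by (simp add: core_def Cc_def)

lemma core_bounded:
 assumes "g \<in> core" obtains c where "c \<ge> 0" "\<And>x. x \<in> X ==> \<bar>g x\<bar> \<le> c"
proof -
 obtain K where K: "compact K" "K \<subseteq> X" "\<forall>x\<in>X - K. g x = 0" using core_support[OF assms] by blast
 have "compact (g ` K)" by (rule compact_continuous_image[OF continuous_on_subset[OF core_continuous[OF assms] K(2)] K(1)])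
 then obtain c where c: "\<And>y. y \<in> g ` K ==> norm y \<le> c" using compact_imp_bounded bounded_iff by metis
 have "\<bar>g x\<bar> \<le> max 0 c" if "x \<in> X" for x using K(3) c[of "g x"] that by (cases "x \<in> K") auto
 then show ?thesis using that[of "max 0 c"] by auto
qed

lemma core_zero: "(\<lambda>x. 0) \<in> core"
 unfolding core_def Cc_def using domain_zero by (auto intro!: exI[of _ "{}"])

lemma core_add: assumes "f \<in> core" "g \<in> core" shows "(\<lambda>x. f x + g x) \<in> core"
proof -
 obtain K where K: "compact K" "K \<subseteq> X" "\<forall>x\<in>X - K. f x = 0" using core_support[OF assms(1)] by blast
 obtain L where L: "compact L" "L \<subseteq> X" "\<forall>x\<in>X - L. g x = 0" using core_support[OF assms(2)] by blast
 have "compact (K \<union> L) \<and> K \<union> L \<subseteq> X \<and> (\<forall>x\<in>X - (K \<union> L). f x + g x = 0)" using K L by auto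
 then show ?thesis using assms[THEN core_F] assms[THEN core_continuous]
  unfolding core_def Cc_def by (blast intro: domain_add continuous_on_add)
qed

lemma core_scale: assumes "f \<in> core" shows "(\<lambda>x. c * f x) \<in> core"
proof -
 obtain K where K: "compact K" "K \<subseteq> X" "\<forall>x\<in>X - K. f x = 0" using core_support[OF assms(1)] by blast
 then have "\<forall>x\<in>X - K. c * f x = 0" by simp
 then show ?thesis using K assms[THEN core_F] assms[THEN core_continuous]
  unfolding core_def Cc_def by (blast intro: domain_scale continuous_on_mult_left)
qed

lemma core_diff: "f \<in> core ==> g \<in> core ==> (\<lambda>x. f x - g x) \<in> core"
 using core_add[of f "\<lambda>x. (-1) * g x"] core_scale[of g "-1"] by simp

lemma core_midpoint: "f \<in> core ==> g \<in> core ==> (\<lambda>x. (f x + g x) / 2) \<in> core"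
 using core_scale[OF core_add, of f g "1/2"] by simp

lemma core_contraction:
 assumes "g \<in> core" and T: "\<And>s t. \<bar>T s - T t\<bar> \<le> \<bar>s - t\<bar>" "T 0 = (0::real)"
 shows "(\<lambda>x. T (g x)) \<in> core"
proof -
 obtain K where K: "compact K" "K \<subseteq> X" "\<forall>x\<in>X - K. g x = 0" using core_support[OF assms(1)] by blast
 have Tc: "continuous_on UNIV T"
 proof (rule continuous_onI)
  fix x e :: real assume "e > 0"
  then show "\<exists>d>0. \<forall>x'\<in>UNIV. dist x' x < d \<longrightarrow> dist (T x') (T x) \<le> e"
   using order_trans[OF T(1) less_imp_le] by (intro exI[of _ e]) (auto simp: dist_real_def)
 qed
 have "continuous_on X (\<lambda>x. T (g x))"
  by (rule continuous_on_compose2[OF Tc core_continuous[OF assms(1)]]) simp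
 moreover have "\<forall>x\<in>X - K. T (g x) = 0" using K T by auto
 ultimately show ?thesis using K normal_contraction(1)[OF core_F[OF assms(1)] T]
  unfolding core_def Cc_def by blast
qed

lemma core_truncate: "g \<in> core ==> c \<ge> 0 ==> truncate c g \<in> core"
 using core_contraction[of g "\<lambda>t. max (- c) (min c t)", OF _ truncate_contraction] by (auto simp: truncate_def[abs_def])

lemma core_mult: assumes "f \<in> core" "g \<in> core" shows "(\<lambda>x. f x * g x) \<in> core"
proof -
 obtain K where K: "compact K" "K \<subseteq> X" "\<forall>x\<in>X - K. f x = 0" using core_support[OF assms(1)] by blast
 obtain c where c1: "\<And>x. x \<in> X ==> \<bar>f x\<bar> \<le> c" using core_bounded[OF assms(1)] by blast
 obtain d where "\<And>x. x \<in> X ==> \<bar>g x\<bar> \<le> d" using core_bounded[OF assms(2)] by blast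
 note c = c1 this
 have "(\<lambda>x. f x * g x) \<in> F" using c assms by (intro mult_in(1)[of f g c d]) (auto simp: core_F space_M)
 moreover have "\<forall>x\<in>X - K. f x * g x = 0" using K by auto
 ultimately show ?thesis using K assms[THEN core_continuous]
  unfolding core_def Cc_def by (blast intro: continuous_on_mult)
qed

lemma core_dense: "f \<in> F ==> e > 0 ==> \<exists>g\<in>core. quad E1 (\<lambda>x. f x - g x) < e"
 using core_dense_domain[of f e] by (simp add: core_def space_M)

lemma clip_contraction: "\<bar>min 1 (max 0 (s - c)) - min 1 (max 0 (t - c))\<bar> \<le> \<bar>s - t\<bar>" for s t c :: real
 by auto

text \<open>Regularity only gives uniform approximation of compactly supported continuous functions.
  To obtain the exact values 1 near \<open>K\<close> and 0 off \<open>L\<close>, a profile with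
  values 0 and 2 is approximated, shifted by 1/2 and clipped, which is a normal contraction.\<close>

lemma cutoff:
 assumes K: "compact K" "K \<subseteq> U" "open U" "U \<subseteq> X"
 obtains \<phi> V L where "\<phi> \<in> core" "\<And>x. x \<in> X ==> 0 \<le> \<phi> x \<and> \<phi> x \<le> 1" "open V" "K \<subseteq> V" "V \<subseteq> L" "compact L" "L \<subseteq> U"
  "\<And>x. x \<in> V ==> \<phi> x = 1" "\<And>x. x \<in> X - L ==> \<phi> x = 0"
proof (cases "K = {}")
 case True
 show ?thesis by (rule that[of "\<lambda>x. 0" "{}" "{}"]) (auto simp: core_zero True)
next
 case False
 obtain e where e: "e > 0" "\<And>x. infdist x K < e ==> x \<in> U" using compact_open_neighborhood[OF K(1-3) False] by blast
 define L where "L = {x. infdist x K \<le> e / 2}"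
 define V where "V = {x. infdist x K < e / 8}"
 \<comment> \<open>Height 2 leaves room for an error of 1/2 at both ends: the shifted approximant is
   at least 1 where \<open>f = 2\<close>, that is on \<open>V\<close>, and at most 0 where
   \<open>f = 0\<close>, that is off \<open>L\<close>.\<close>
 define f where "f x = min 2 (max 0 (3 - (8 / e) * infdist x K))" for x
 have cont: "continuous_on S (\<lambda>x. infdist x K)" for S by (intro continuous_intros)
 have Lc: "closed L" unfolding L_def by (intro closed_Collect_le cont continuous_intros)
 have Lb: "bounded L"
 proof -
  obtain x0 r where r: "K \<subseteq> cball x0 r" using compact_imp_bounded[OF K(1)] unfolding bounded_subset_cball by blast
  have "dist x0 x \<le> r + e" if "x \<in> L" for x
  proof -
   have "infdist x K < e" using that e(1) by (simp add: L_def)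
   then obtain y where y: "y \<in> K" "dist x y < e"
    unfolding infdist_notempty[OF False] using False by (subst (asm) cInf_less_iff) auto
   then show ?thesis using dist_triangle[of x0 x y] r by (auto simp: dist_commute)
  qed
  then show ?thesis unfolding bounded_def by blast
 qed
 have L: "compact L" "L \<subseteq> U" using compact_bounded_closed[OF Lb Lc] e by (auto simp: L_def)
 have V: "open V" unfolding V_def by (intro open_Collect_less cont continuous_intros)
 have VL: "V \<subseteq> L" "K \<subseteq> V" using e(1) by (auto simp: V_def L_def)
 have fV: "f x = 2" if "x \<in> V" for x
 proof -
  have "8 / e * infdist x K < 1" using that e(1) by (simp add: V_def field_simps)
  then show ?thesis by (simp add: f_def)
 qed
 have fL: "f x = 0" if "x \<notin> L" for x
 proof -
  have "8 / e * infdist x K > 4" using that e(1) by (simp add: L_def field_simps)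
  then show ?thesis by (simp add: f_def)
 qed
 have fc: "continuous_on S f" for S unfolding f_def by (intro continuous_intros cont)
 have "f \<in> Cc (space M)" unfolding Cc_def space_M using fc L K(4) fL by blast
 then obtain g where g: "g \<in> core" "\<And>x. x \<in> X ==> \<bar>f x - g x\<bar> < 1/2"
  using core_dense_Cc[of f "1/2"] by (auto simp: core_def space_M)
 define \<phi> where "\<phi> x = min 1 (max 0 (g x - 1/2))" for x
 show ?thesis
 proof (rule that[of \<phi> V L])
  show "\<phi> \<in> core" unfolding \<phi>_def[abs_def] using g(1) clip_contraction by (rule core_contraction) simp
  show "\<phi> x = 1" if "x \<in> V" for x
  proof -
   have "x \<in> X" using that VL L K(4) by blast
   then have "\<bar>2 - g x\<bar> < 1/2" using g(2)[of x] fV[OF that] by simp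
   then have "g x - 1/2 \<ge> 1" by linarith
   then show ?thesis by (simp add: \<phi>_def)
  qed
  show "\<phi> x = 0" if "x \<in> X - L" for x
  proof -
   have "\<bar>0 - g x\<bar> < 1/2" using g(2)[of x] fL[of x] that by simp
   then have "g x - 1/2 \<le> 0" by linarith
   then show ?thesis by (simp add: \<phi>_def)
  qed
 qed (use V VL L in "auto simp: \<phi>_def")
qed

lemma core_measurable: "g \<in> core ==> g \<in> borel_measurable M" using core_F F_measurable by blast

lemma L2_tendsto_le:
 assumes "\<And>n. AE x in M. \<bar>s n x - f x\<bar> \<le> \<bar>t n x - g x\<bar>" "\<And>n. s n \<in> L2_space M" "f \<in> L2_space M"
  "\<And>n. t n \<in> L2_space M" "g \<in> L2_space M" "L2_tendsto M t g"
 shows "L2_tendsto M s f"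
proof (rule LIMSEQ_null_bounded[OF assms(6)])
 fix n
 have "quad (L2_inner M) (\<lambda>x. s n x - f x) \<le> quad (L2_inner M) (\<lambda>x. t n x - g x)"
  unfolding L2_inner_square
 proof (rule integral_mono_AE)
  show "integrable M (\<lambda>x. (s n x - f x)\<^sup>2)" "integrable M (\<lambda>x. (t n x - g x)\<^sup>2)"
   by (intro L2_integrable_square L2.V_diff assms)+
  show "AE x in M. (s n x - f x)\<^sup>2 \<le> (t n x - g x)\<^sup>2"
   using assms(1)[of n] by eventually_elim (simp add: abs_le_square_iff)
 qed
 then show "\<bar>L2_inner M (\<lambda>x. s n x - f x) (\<lambda>x. s n x - f x)\<bar> \<le> quad (L2_inner M) (\<lambda>x. t n x - g x)"
  using L2.B_nonneg[OF L2.V_diff[OF assms(2)[of n] assms(3)]] by simp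
qed

lemma E1_tendsto_L2:
 assumes "\<And>n. s n \<in> F" "f \<in> F" "form_tendsto E1 s f"
 shows "L2_tendsto M s f"
 by (rule LIMSEQ_null_bounded[OF assms(3)])
  (use assms in "simp add: L2_le_E1 form.V_diff L2.B_nonneg F_L2")

lemma E1_tendsto_E:
 assumes "\<And>n. s n \<in> F" "f \<in> F" "form_tendsto E1 s f"
 shows "form_tendsto E s f"
 by (rule LIMSEQ_null_bounded[OF assms(3)])
  (use assms in "simp add: E_le_E1 form.V_diff form_nonneg")

lemma core_sequence:
 assumes "f \<in> F"
 obtains s where "\<And>n. s n \<in> core" "form_tendsto E1 s f"
proof -
 have "\<exists>g\<in>core. quad E1 (\<lambda>x. f x - g x) < inverse (real (Suc n))" for n
  using core_dense[OF assms] by simp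
 then obtain s where s: "\<And>n. s n \<in> core" "\<And>n. quad E1 (\<lambda>x. f x - s n x) < inverse (real (Suc n))"
  by metis
 have "form_tendsto E1 s f"
 proof (rule LIMSEQ_null_bounded[OF LIMSEQ_inverse_real_of_nat])
  fix n
  have "quad E1 (\<lambda>x. s n x - f x) = quad E1 (\<lambda>x. f x - s n x)"
   by (rule form1.B_square_commute[OF core_F[OF s(1)] assms])
  then show "\<bar>E1 (\<lambda>x. s n x - f x) (\<lambda>x. s n x - f x)\<bar> \<le> inverse (real (Suc n))"
   using s(2)[of n] form1.B_nonneg[OF form.V_diff[OF core_F[OF s(1)[of n]] assms]] by simp
 qed
 with s(1) that show ?thesis by blast
qed

lemma form_bounded_of_tendsto:
 assumes "\<And>n. s n \<in> F" "f \<in> F" "form_tendsto E s f"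
 obtains B where "\<And>n. E (s n) (s n) \<le> B"
proof -
 have "(\<lambda>n. E (s n) (s n)) ----> E f f" using form.tendsto_B[OF assms(1,1,2,2,3,3)] .
 then have "Bseq (\<lambda>n. E (s n) (s n))" by (intro convergent_imp_Bseq) (auto simp: convergent_def)
 then obtain K where "\<And>n. norm (E (s n) (s n)) \<le> K" unfolding Bseq_def by blast
 then show ?thesis using that[of K] by (simp add: abs_le_iff)
qed

text \<open>Truncating a core sequence enforces the bound but E1-convergence is not evident
  afterwards. The truncations still converge in L2 with bounded energy, so
  \<open>bounded_energy_closed\<close>, applied to the class of core functions bounded by c,
  recovers it.\<close>

lemma core_sequence_bounded:
 assumes f: "f \<in> F" and c: "AE x in M. \<bar>f x\<bar> \<le> c" "c \<ge> 0"
 obtains s where "\<And>n. s n \<in> core" "\<And>n x. x \<in> X ==> \<bar>s n x\<bar> \<le> c"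
  "form_tendsto E1 s f"
proof -
 obtain t where t: "\<And>n. t n \<in> core" "form_tendsto E1 t f"
  using core_sequence[OF f] by blast
 note tF = t(1)[THEN core_F]
 obtain B where B: "\<And>n. E (t n) (t n) \<le> B" using form_bounded_of_tendsto[OF tF f E1_tendsto_E[OF tF f t(2)]] by blast
 define C where "C = {v \<in> core. \<forall>x\<in>X. \<bar>v x\<bar> \<le> c}"
 have tC: "truncate c (t n) \<in> C" for n
  unfolding C_def using core_truncate[OF t(1) c(2)] by (simp add: truncate_bounded c(2))
 have "\<exists>v. (\<forall>n. v n \<in> C) \<and> form_tendsto E1 v f"
 proof (rule bounded_energy_closed(3)[where w = "\<lambda>n. truncate c (t n)" and K = B])
  show "C \<subseteq> F" by (auto simp: C_def core_F)
  show "(\<lambda>x. (g x + h x) / 2) \<in> C" if "g \<in> C" "h \<in> C" for g h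
  proof -
   have "\<bar>(g x + h x) / 2\<bar> \<le> c" if "x \<in> X" for x
   proof -
    have "\<bar>g x\<bar> \<le> c" "\<bar>h x\<bar> \<le> c" using \<open>g \<in> C\<close> \<open>h \<in> C\<close> that by (auto simp: C_def)
    then show ?thesis by (rule abs_midpoint_le)
   qed
   then show ?thesis using that core_midpoint by (simp add: C_def)
  qed
  show "truncate c (t n) \<in> C" for n by (rule tC)
  show "E (truncate c (t n)) (truncate c (t n)) \<le> B" for n using truncate_in(2)[OF tF c(2)] B order_trans by blast
  show "f \<in> L2_space M" by (rule F_L2[OF f])
  show "L2_tendsto M (\<lambda>n. truncate c (t n)) f"
  proof (rule L2_tendsto_le[where t = t and g = f])
   show "AE x in M. \<bar>truncate c (t n) x - f x\<bar> \<le> \<bar>t n x - f x\<bar>" for n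
    using c(1) by eventually_elim (auto simp: truncate_def)
  qed (use f tF E1_tendsto_L2[OF tF f t(2)] truncate_in(1)[OF tF c(2)] in "auto intro: F_L2")
 qed
 then show ?thesis using that by (auto simp: C_def)
qed

section \<open>Capacity\<close>

abbreviation "cap_open \<equiv> capacity_open M E F"
abbreviation "cap \<equiv> capacity M E F"

lemma openin_X: "openin (top_of_set (space M)) U \<longleftrightarrow> open U \<and> U \<subseteq> X"
 unfolding space_M by (rule openin_open_eq[OF open_X])

lemma cap_open_le: "u \<in> F ==> AE x in M. x \<in> U \<longrightarrow> u x \<ge> 1 ==> cap_open U \<le> ennreal (E1 u u)"
 unfolding capacity_open_def by (rule INF_lower) simp

lemma clip_E1:
 assumes "u \<in> F" shows "(\<lambda>x. min 1 (max 0 (u x))) \<in> F" "quad E1 (\<lambda>x. min 1 (max 0 (u x))) \<le> E1 u u"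
proof -
 show 1: "(\<lambda>x. min 1 (max 0 (u x))) \<in> F" by (rule domain_markov[OF assms])
 have "quad (L2_inner M) (\<lambda>x. min 1 (max 0 (u x))) \<le> L2_inner M u u"
  unfolding L2_inner_square
 proof (rule integral_mono)
  show "(min 1 (max 0 (u x)))\<^sup>2 \<le> (u x)\<^sup>2" for x by (simp add: abs_le_square_iff[symmetric])
 qed (intro L2_integrable_square F_L2 assms 1)+
 then show "quad E1 (\<lambda>x. min 1 (max 0 (u x))) \<le> E1 u u"
  using form_markov[OF assms] by (simp add: E1_eq)
qed

lemma cap_open_lessD:
 assumes "cap_open U < ennreal \<delta>"
 obtains u where "u \<in> F" "AE x in M. x \<in> U \<longrightarrow> u x = 1" "E1 u u < \<delta>" "\<And>x. 0 \<le> u x \<and> u x \<le> 1"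
proof -
 obtain u where u: "u \<in> F" "AE x in M. x \<in> U \<longrightarrow> u x \<ge> 1" "ennreal (E1 u u) < ennreal \<delta>"
  using assms unfolding capacity_open_def by (auto simp: INF_less_iff)
 have d: "E1 u u < \<delta>" using u(3) form1.B_nonneg[OF u(1)] by (simp add: ennreal_less_iff)
 show ?thesis
 proof (rule that[of "\<lambda>x. min 1 (max 0 (u x))"])
  show "AE x in M. x \<in> U \<longrightarrow> min 1 (max 0 (u x)) = 1" using u(2) by eventually_elim auto
  show "quad E1 (\<lambda>x. min 1 (max 0 (u x))) < \<delta>" using clip_E1[OF u(1)] d by linarith
 qed (auto simp: domain_markov u(1))
qed

lemma cap_le: "open U ==> U \<subseteq> X ==> A \<subseteq> U ==> cap A \<le> cap_open U"
 unfolding capacity_def by (rule INF_lower) (simp add: openin_X)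

lemma cap_lessD:
 assumes "cap A < c" obtains U where "open U" "U \<subseteq> X" "A \<subseteq> U" "cap_open U < c"
 using assms unfolding capacity_def by (auto simp: INF_less_iff openin_X)

lemma cap_empty: "cap {} = 0"
proof -
 have "cap {} \<le> cap_open {}" by (rule cap_le) auto
 also have "\<dots> \<le> ennreal (quad E1 (\<lambda>x. 0))" by (rule cap_open_le) (auto simp: domain_zero)
 also have "\<dots> = 0" using form1.B_zerol[OF domain_zero] by simp
 finally show ?thesis by simp
qed

lemma cap_mono: "A \<subseteq> B ==> cap A \<le> cap B"
 unfolding capacity_def by (rule INF_superset_mono) auto

lemma cap_open_Un:
 assumes "cap_open U < ennreal a" "cap_open V < ennreal b"
 shows "cap_open (U \<union> V) < ennreal (2 * a + 2 * b)"
proof -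
 obtain u where u: "u \<in> F" "AE x in M. x \<in> U \<longrightarrow> u x = 1" "E1 u u < a" "\<And>x. 0 \<le> u x \<and> u x \<le> 1"
  using cap_open_lessD[OF assms(1)] by blast
 obtain v where v: "v \<in> F" "AE x in M. x \<in> V \<longrightarrow> v x = 1" "E1 v v < b" "\<And>x. 0 \<le> v x \<and> v x \<le> 1"
  using cap_open_lessD[OF assms(2)] by blast
 have "AE x in M. x \<in> U \<union> V \<longrightarrow> u x + v x \<ge> 1"
  using u(2) v(2)
 proof eventually_elim
  case (elim x)
  then show ?case using u(4)[of x] v(4)[of x] by auto
 qed
 then have "cap_open (U \<union> V) \<le> ennreal (quad E1 (\<lambda>x. u x + v x))"
  by (intro cap_open_le domain_add u v)
 also have "\<dots> < ennreal (2 * a + 2 * b)"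
  using form1.square_add_le[OF u(1) v(1)] u(3) v(3) form1.B_nonneg[OF form.V_add[OF u(1) v(1)]]
  by (intro ennreal_lessI) linarith+
 finally show ?thesis .
qed

text \<open>The competitors for the single sets have E1-norms below delta/2^(i+1), so their sum
  converges in norm with limit of norm at most delta. Being nonnegative, the partial sums dominate
  each competitor, and an a.e. convergent subsequence shows that the limit is at least 1 on the
  union.\<close>

lemma cap_open_UN:
 assumes d: "\<delta> > 0" and U: "\<And>i. cap_open (U i) < ennreal ((\<delta> * (1/2) ^ Suc i)\<^sup>2)"
 shows "cap_open (\<Union>i. U i) \<le> ennreal (\<delta>\<^sup>2)"
proof -
 define P where "P i u \<longleftrightarrow> u \<in> F \<and> (AE x in M. x \<in> U i \<longrightarrow> u x = 1) \<and> E1 u u < (\<delta> * (1/2) ^ Suc i)\<^sup>2 \<and> (\<forall>x. 0 \<le> u x)"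
  for i u
 have "\<exists>u. P i u" for i
  by (rule cap_open_lessD[OF U[of i]]) (auto simp: P_def)
 then obtain u where P: "\<And>i. P i (u i)" by metis
 have u: "u i \<in> F" "AE x in M. x \<in> U i \<longrightarrow> u i x = 1" "E1 (u i) (u i) < (\<delta> * (1/2) ^ Suc i)\<^sup>2" "0 \<le> u i x" for i x
  using P[of i] by (auto simp: P_def)
 have sq: "sqrt (E1 (u i) (u i)) \<le> \<delta> * (1/2) ^ Suc i" for i
  using u(3)[of i] d by (intro real_le_lsqrt) auto
 define s where "s n = (\<lambda>x. \<Sum>i<n. u i x)" for n
 have sF: "s n \<in> F" for n unfolding s_def by (rule form.V_sum[OF u(1)])
 have gsum: "(\<Sum>i\<in>{n..<n+k}. \<delta> * (1/2) ^ Suc i) = \<delta> * (1/2)^n * (1 - (1/2)^k)" for n k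
  by (induction k) (auto simp: algebra_simps power_add)
 have part: "sqrt (quad E1 (\<lambda>x. \<Sum>i\<in>I. u i x)) \<le> (\<Sum>i\<in>I. \<delta> * (1/2) ^ Suc i)" if "finite I" for I
  using that
 proof (induction I)
  case empty then show ?case using form1.B_zerol[OF domain_zero] by simp
 next
  case (insert i I)
  then have "(\<lambda>x. \<Sum>j\<in>insert i I. u j x) = (\<lambda>x. u i x + (\<Sum>j\<in>I. u j x))" by auto
  then show ?case using insert form1.triangle[OF u(1)[of i] form.V_sum[of I u, OF u(1)]] sq[of i] by simp
 qed
 have tail: "sqrt (quad E1 (\<lambda>x. s (n + k) x - s n x)) \<le> \<delta> * (1/2)^n" for n k
 proof -
  have "(\<lambda>x. s (n + k) x - s n x) = (\<lambda>x. \<Sum>i\<in>{n..<n+k}. u i x)"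
   unfolding s_def by (auto simp: sum_diff_nat_ivl[of 0 n "n + k", symmetric] lessThan_atLeast0 fun_eq_iff)
  then have "sqrt (quad E1 (\<lambda>x. s (n + k) x - s n x)) \<le> \<delta> * (1/2)^n * (1 - (1/2)^k)"
   using part[of "{n..<n+k}"] gsum[of n k] by simp
  also have "\<dots> \<le> \<delta> * (1/2)^n * 1" using d by (intro mult_left_mono) auto
  finally show ?thesis by simp
 qed
 have Cau: "\<exists>N. \<forall>i\<ge>N. \<forall>j\<ge>N. quad E1 (\<lambda>x. s i x - s j x) < \<epsilon>" if e: "\<epsilon> > 0" for \<epsilon> :: real
 proof -
  have "(\<lambda>n. \<delta> * (1/2::real)^n) ----> \<delta> * 0" by (intro tendsto_intros) simp
  then obtain N where N: "\<And>n. n \<ge> N ==> \<delta> * (1/2)^n < sqrt \<epsilon>"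
   using order_tendstoD(2)[of "\<lambda>n. \<delta> * (1/2::real)^n" 0 sequentially "sqrt \<epsilon>"] e by (auto simp: eventually_sequentially)
  have k: "quad E1 (\<lambda>x. s i x - s j x) < \<epsilon>" if "j \<ge> N" "i \<ge> j" for i j
  proof -
   have "sqrt (quad E1 (\<lambda>x. s i x - s j x)) \<le> \<delta> * (1/2)^j"
    using tail[of j "i - j"] that(2) by simp
   also have "\<dots> < sqrt \<epsilon>" by (rule N[OF that(1)])
   finally show ?thesis by simp
  qed
  have "quad E1 (\<lambda>x. s i x - s j x) < \<epsilon>" if "i \<ge> N" "j \<ge> N" for i j
   using k[of i j] k[of j i] form1.B_square_commute[OF sF[of i] sF[of j]] that by (cases "i \<le> j") auto
  then show ?thesis by blast
 qed
 from form_closed[OF sF Cau] obtain f where f: "f \<in> F" "form_tendsto E1 s f" by blast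
 obtain r where r: "strict_mono r" "AE x in M. (\<lambda>n. s (r n) x) ----> f x"
  using L2_tendsto_AE_subseq[OF F_L2[OF sF] F_L2[OF f(1)] E1_tendsto_L2[OF sF f]] by blast
 have "AE x in M. \<forall>i. x \<in> U i \<longrightarrow> u i x = 1" using u(2) by (simp add: AE_all_countable)
 then have "AE x in M. x \<in> (\<Union>i. U i) \<longrightarrow> f x \<ge> 1"
  using r(2)
 proof eventually_elim
  case (elim x)
  have "f x \<ge> 1" if x: "x \<in> U i" for i
  proof (rule LIMSEQ_le_const[OF elim(2)])
   have "1 \<le> s (r n) x" if "n \<ge> Suc i" for n
   proof -
    have "i < r n" using seq_suble[OF r(1), of n] that by simp
    then have "u i x \<le> s (r n) x" unfolding s_def by (intro member_le_sum) (auto simp: u(4))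
    then show ?thesis using elim(1) x by simp
   qed
   then show "\<exists>N. \<forall>n\<ge>N. 1 \<le> s (r n) x" by blast
  qed
  then show ?case by blast
 qed
 then have "cap_open (\<Union>i. U i) \<le> ennreal (E1 f f)" by (rule cap_open_le[OF f(1)])
 also have "E1 f f \<le> \<delta>\<^sup>2"
 proof (rule LIMSEQ_le_const2)
  show "(\<lambda>n. E1 (s n) (s n)) ----> E1 f f" by (rule form1.tendsto_B[OF sF sF f(1,1,2,2)])
  have "E1 (s n) (s n) \<le> \<delta>\<^sup>2" for n
   using tail[of 0 n] d by (intro sqrt_le_D) (simp add: s_def)
  then show "\<exists>N. \<forall>n\<ge>N. E1 (s n) (s n) \<le> \<delta>\<^sup>2" by blast
 qed
 then have "ennreal (E1 f f) \<le> ennreal (\<delta>\<^sup>2)" by (rule ennreal_leI)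
 finally show ?thesis .
qed

lemma cap_Chebyshev:
 assumes h: "h \<in> F" and l: "a > 0"
 shows "cap_open {x \<in> X. \<bar>h x\<bar> > a} \<le> ennreal (E1 h h / a\<^sup>2)"
proof -
 let ?u = "\<lambda>x. inverse a * \<bar>h x\<bar>"
 have a: "(\<lambda>x. \<bar>h x\<bar>) \<in> F" "quad E (\<lambda>x. \<bar>h x\<bar>) \<le> E h h"
  using normal_contraction[OF h, of abs] by auto
 have "AE x in M. x \<in> {x \<in> X. \<bar>h x\<bar> > a} \<longrightarrow> ?u x \<ge> 1" using l by (auto simp: field_simps)
 then have "cap_open {x \<in> X. \<bar>h x\<bar> > a} \<le> ennreal (E1 ?u ?u)" by (intro cap_open_le domain_scale a)
 also have "E1 ?u ?u \<le> E1 h h / a\<^sup>2"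
 proof -
  have "quad E1 (\<lambda>x. \<bar>h x\<bar>) \<le> E1 h h" using a(2) by (simp add: E1_eq L2_inner_square)
  then have "inverse a ^ 2 * quad E1 (\<lambda>x. \<bar>h x\<bar>) \<le> inverse a ^ 2 * E1 h h" by (intro mult_left_mono) auto
  moreover have "E1 ?u ?u = inverse a ^ 2 * quad E1 (\<lambda>x. \<bar>h x\<bar>)" by (rule form1.B_square_scale[OF a(1)])
  ultimately show ?thesis by (simp add: field_simps)
 qed
 then have "ennreal (E1 ?u ?u) \<le> ennreal (E1 h h / a\<^sup>2)" by (rule ennreal_leI)
 finally show ?thesis .
qed

text \<open>The competitor u equals 1 on \<open>U\<close> only almost everywhere and is not in the
  core. Its core approximants are overwritten by 1 near \<open>K\<close> with a cutoff inside
  \<open>U\<close>. They keep bounded energy and L2 convergence, and the condition of being at least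
  1 on \<open>K\<close> is stable under midpoints.\<close>

lemma cap_open_compact:
 assumes U: "open U" "U \<subseteq> X" "cap_open U < ennreal d" and K: "compact K" "K \<subseteq> U"
 obtains h where "h \<in> core" "\<And>x. x \<in> X ==> 0 \<le> h x \<and> h x \<le> 1" "\<And>x. x \<in> K ==> h x = 1" "E1 h h < d"
proof -
 obtain u where u: "u \<in> F" "AE x in M. x \<in> U \<longrightarrow> u x = 1" "E1 u u < d" "\<And>x. 0 \<le> u x \<and> u x \<le> 1"
  using cap_open_lessD[OF U(3)] by blast
 have ub: "AE x in M. \<bar>u x\<bar> \<le> 1" using u(4) by (simp add: abs_le_iff)
 obtain s where s: "\<And>n. s n \<in> core" "\<And>n x. x \<in> X ==> \<bar>s n x\<bar> \<le> 1"
  "form_tendsto E1 s u"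
  using core_sequence_bounded[OF u(1) ub zero_le_one] by blast
 note sF = s(1)[THEN core_F]
 obtain B where B: "\<And>n. E (s n) (s n) \<le> B" using form_bounded_of_tendsto[OF sF u(1) E1_tendsto_E[OF sF u(1) s(3)]] by blast
 obtain \<phi> V L where \<phi>: "\<phi> \<in> core" "\<And>x. x \<in> X ==> 0 \<le> \<phi> x \<and> \<phi> x \<le> 1" "K \<subseteq> V" "L \<subseteq> U" "V \<subseteq> L"
  "\<And>x. x \<in> V ==> \<phi> x = 1" "\<And>x. x \<in> X - L ==> \<phi> x = 0"
  by (rule cutoff[OF K U(1,2)]) blast
 note \<phi>F = core_F[OF \<phi>(1)]
 define C where "C = {v \<in> core. \<forall>x\<in>K. v x \<ge> 1}"
 define w where "w n = (\<lambda>x. (s n x - s n x * \<phi> x) + \<phi> x)" for n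
 have wc: "w n \<in> core" for n unfolding w_def by (intro core_add core_diff core_mult s \<phi>)
 have wF: "w n \<in> F" for n by (rule core_F[OF wc])
 have "\<exists>v. (\<forall>n. v n \<in> C) \<and> form_tendsto E1 v u"
 proof (rule bounded_energy_closed(3)[where w = w and K = "2 * (2 * B + 2 * (8 * B + 8 * E \<phi> \<phi>)) + 2 * E \<phi> \<phi>"])
  show "C \<subseteq> F" by (auto simp: C_def core_F)
  show "(\<lambda>x. (g x + h x) / 2) \<in> C" if "g \<in> C" "h \<in> C" for g h
  proof -
   have "(g x + h x) / 2 \<ge> 1" if "x \<in> K" for x
   proof -
    have "g x \<ge> 1" "h x \<ge> 1" using \<open>g \<in> C\<close> \<open>h \<in> C\<close> that by (auto simp: C_def)
    then show ?thesis by simp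
   qed
   then show ?thesis using that core_midpoint by (simp add: C_def)
  qed
  show "w n \<in> C" for n using wc \<phi>(3,6) by (auto simp: C_def w_def)
  show "E (w n) (w n) \<le> 2 * (2 * B + 2 * (8 * B + 8 * E \<phi> \<phi>)) + 2 * E \<phi> \<phi>" for n
  proof -
   have m: "(\<lambda>x. s n x * \<phi> x) \<in> F" "quad E (\<lambda>x. s n x * \<phi> x) \<le> 8 * 1\<^sup>2 * E (s n) (s n) + 8 * 1\<^sup>2 * E \<phi> \<phi>"
    using mult_in[OF sF \<phi>F, of n 1 1] s(2) \<phi>(2) by (auto simp: space_M)
   have "E (w n) (w n) \<le> 2 * quad E (\<lambda>x. s n x - s n x * \<phi> x) + 2 * E \<phi> \<phi>"
    unfolding w_def by (intro form.square_add_le form.V_diff sF m \<phi>F)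
   moreover have "quad E (\<lambda>x. s n x - s n x * \<phi> x) \<le> 2 * E (s n) (s n) + 2 * quad E (\<lambda>x. s n x * \<phi> x)"
    by (intro form.square_diff_le sF m)
   ultimately show ?thesis using m(2) B[of n] by simp
  qed
  show "u \<in> L2_space M" by (rule F_L2[OF u(1)])
  show "L2_tendsto M w u"
  proof (rule L2_tendsto_le[where t = s and g = u])
   show "AE x in M. \<bar>w n x - u x\<bar> \<le> \<bar>s n x - u x\<bar>" for n
    using u(2) AE_space
   proof eventually_elim
    case (elim x)
    have x: "x \<in> X" using elim(2) by (simp add: space_M)
    \<comment> \<open>Since u is 1 on \<open>U\<close> and the cutoff lives in \<open>L\<close>, a
      subset of \<open>U\<close>, overwriting by 1 never increases the distance to u.\<close>
    have "(1 - u x) * \<phi> x = 0" using elim(1) \<phi>(4) \<phi>(7)[of x] x by (cases "x \<in> L") auto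
    then have "w n x - u x = (s n x - u x) * (1 - \<phi> x)" by (simp add: w_def algebra_simps)
    moreover have "\<bar>s n x - u x\<bar> * \<bar>1 - \<phi> x\<bar> \<le> \<bar>s n x - u x\<bar> * 1"
     using \<phi>(2)[OF x] by (intro mult_left_mono) auto
    ultimately show ?case by (simp add: abs_mult)
   qed
  qed (use sF wF u(1) E1_tendsto_L2[OF sF u(1) s(3)] in "auto intro: F_L2")
 qed
 then obtain v where v: "\<And>n. v n \<in> C" "form_tendsto E1 v u" by blast
 have vF: "v n \<in> F" for n using v(1)[of n] by (simp add: C_def core_F)
 have "(\<lambda>n. E1 (v n) (v n)) ----> E1 u u" by (rule form1.tendsto_B[OF vF vF u(1,1) v(2,2)])
 then have "\<forall>\<^sub>F n in sequentially. E1 (v n) (v n) < d" using u(3) by (rule order_tendstoD)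
 then obtain n where n: "E1 (v n) (v n) < d" by (auto simp: eventually_sequentially)
 have vc: "v n \<in> core" "\<And>x. x \<in> K ==> v n x \<ge> 1" using v(1)[of n] by (auto simp: C_def)
 show ?thesis
 proof (rule that[of "\<lambda>x. min 1 (max 0 (v n x))"])
  show "(\<lambda>x. min 1 (max 0 (v n x))) \<in> core"
   using core_contraction[OF vc(1), of "\<lambda>t. min 1 (max 0 (t - 0))", OF clip_contraction] by simp
  show "min 1 (max 0 (v n x)) = 1" if "x \<in> K" for x using vc(2)[OF that] by simp
  show "quad E1 (\<lambda>x. min 1 (max 0 (v n x))) < d" using clip_E1(2)[OF vF, of n] n by linarith
 qed auto
qed

end

section \<open>Quasi-everywhere convergence, and measures that do not charge sets of zero
  capacity\<close>

lemma fast_subsequence: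
 fixes a :: "nat \<Rightarrow> real"
 assumes "a ----> 0" "\<And>n. e n > 0"
 obtains r :: "nat \<Rightarrow> nat" where "strict_mono r" "\<And>n. a (r n) < e n"
proof -
 have ex: "\<exists>m>k. a m < e n" for k n
 proof -
  have "eventually (\<lambda>m. a m < e n) sequentially" using assms by (intro order_tendstoD(2)) auto
  then have "eventually (\<lambda>m. m > k \<and> a m < e n) sequentially"
   using eventually_gt_at_top[of k] by eventually_elim auto
  then show ?thesis by (auto simp: eventually_sequentially)
 qed
 have "\<exists>r. \<forall>n. a (r n) < e n \<and> r n < r (Suc n)"
 proof (rule dependent_nat_choice)
  show "\<exists>x. a x < e 0" using ex[of 0 0] by blast
  show "\<exists>y. a y < e (Suc n) \<and> x < y" for x n using ex[of x "Suc n"] by blast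
 qed
 then show ?thesis using that by (auto simp: strict_mono_Suc_iff)
qed

context regular_form_space
begin

text \<open>Off open sets of small capacity a fast subsequence converges uniformly, so its limit is
  continuous there. The real point is to identify this limit with the given version g: they agree
  a.e., the set where they differ is relatively open, and an open set may be enlarged by a null set
  of the measure, as long as it stays open, without raising its capacity.\<close>

theorem quasi_everywhere_convergence:
 assumes h: "\<And>n. h n \<in> F" "\<And>n. continuous_on X (h n)" and f: "f \<in> F"
  and lim: "form_tendsto E1 h f"
  and g: "quasi_continuous M E F g" "AE x in M. f x = g x"
 obtains r N where "strict_mono r" "cap N = 0" "\<And>x. x \<in> X - N ==> (\<lambda>n. h (r n) x) ----> g x"
proof -
 obtain r1 where r1: "strict_mono r1" "AE x in M. (\<lambda>n. h (r1 n) x) ----> f x"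
  using L2_tendsto_AE_subseq[OF F_L2[OF h(1)] F_L2[OF f] E1_tendsto_L2[OF h(1) f lim]] by blast
 have "(\<lambda>n. quad E1 (\<lambda>x. h (r1 n) x - f x)) ----> 0"
  using LIMSEQ_subseq_LIMSEQ[OF lim r1(1)] by (simp add: o_def)
 then obtain r2 where r2: "strict_mono r2"
  "\<And>n. quad E1 (\<lambda>x. h (r1 (r2 n)) x - f x) < (1/64)^n / 4"
  using fast_subsequence[of "\<lambda>n. quad E1 (\<lambda>x. h (r1 n) x - f x)" "\<lambda>n. (1/64)^n / 4"] by auto
 define k where "k n = h (r1 (r2 n))" for n
 have kF: "k n \<in> F" and kc: "continuous_on X (k n)" for n by (auto simp: k_def h)
 have kf: "quad E1 (\<lambda>x. k n x - f x) < (1/64)^n / 4" for n using r2(2) by (simp add: k_def)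
 have kAE: "AE x in M. (\<lambda>n. k n x) ----> f x"
  using r1(2) by eventually_elim (use LIMSEQ_subseq_LIMSEQ[OF _ r2(1)] in "auto simp: o_def k_def")
 have diff: "quad E1 (\<lambda>x. k (Suc n) x - k n x) < (1/64)^n" for n
 proof -
  have 1: "quad E1 (\<lambda>x. (k (Suc n) x - f x) - (k n x - f x)) \<le>
    2 * quad E1 (\<lambda>x. k (Suc n) x - f x) + 2 * quad E1 (\<lambda>x. k n x - f x)"
   by (intro form1.square_diff_le form.V_diff kF f)
  have arith: "e < c" if "e \<le> 2 * a + 2 * b" "a < (1/64) * c / 4" "b < c / 4" "0 < c" for a b c e :: real
   using that by linarith
  have c: "(0::real) < (1/64)^n" by simp
  show ?thesis using arith[OF 1 kf[of "Suc n", unfolded power_Suc] kf[of n] c] by simp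
 qed
 define U where "U n = {x \<in> X. \<bar>k (Suc n) x - k n x\<bar> > (1/2)^n}" for n
 have Uo: "open (U n)" for n
 proof -
  have "openin (top_of_set X) (X \<inter> (\<lambda>x. \<bar>k (Suc n) x - k n x\<bar>) -` {(1/2)^n<..})"
   by (intro continuous_openin_preimage_gen continuous_intros kc)
  moreover have "X \<inter> (\<lambda>x. \<bar>k (Suc n) x - k n x\<bar>) -` {(1/2)^n<..} = U n" by (auto simp: U_def)
  ultimately show ?thesis using openin_X by (simp add: space_M)
 qed
 have UX: "U n \<subseteq> X" for n by (auto simp: U_def)
 have Ucap: "cap_open (U n) < ennreal (((1/4)^n)\<^sup>2)" for n
 proof -
  have "cap_open (U n) \<le> ennreal (quad E1 (\<lambda>x. k (Suc n) x - k n x) / ((1/2)^n)\<^sup>2)"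
   unfolding U_def by (intro cap_Chebyshev form.V_diff kF) simp
  also have "\<dots> < ennreal ((1/64)^n / ((1/2)^n)\<^sup>2)"
   using diff[of n] by (intro ennreal_lessI divide_strict_right_mono) auto
  also have "(1/64)^n / ((1/2)^n)\<^sup>2 = ((1/4::real)^n)\<^sup>2"
  proof -
   have "((1/4::real)^n)\<^sup>2 * ((1/2)^n)\<^sup>2 = ((1/4) * (1/4) * ((1/2) * (1/2)))^n"
    by (simp only: power2_eq_square power_mult_distrib)
   then have "((1/4::real)^n)\<^sup>2 * ((1/2)^n)\<^sup>2 = (1/64)^n" by simp
   then show ?thesis by (simp add: field_simps)
  qed
  finally show ?thesis .
 qed
 have step: "\<exists>W. open W \<and> W \<subseteq> X \<and> cap_open W < ennreal \<epsilon> \<and> (\<forall>x\<in>X - W. (\<lambda>n. k n x) ----> g x)"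
  if e: "\<epsilon> > 0" for \<epsilon>
 proof -
  have "(\<lambda>m. (4 * (1/4::real)^m)\<^sup>2) ----> (4 * 0)\<^sup>2" by (intro tendsto_intros) simp
  then have "\<forall>\<^sub>F m in sequentially. (4 * (1/4::real)^m)\<^sup>2 < \<epsilon>/4"
   using e by (intro order_tendstoD(2)[where y = "0::real"]) auto
  then obtain m where m: "(4 * (1/4::real)^m)\<^sup>2 < \<epsilon>/4" by (auto simp: eventually_sequentially)
  define V where "V = (\<Union>j. U (m + j))"
  have Vcap: "cap_open V < ennreal (\<epsilon>/4)"
  proof -
   have "cap_open V \<le> ennreal ((4 * (1/4)^m)\<^sup>2)"
    unfolding V_def
   proof (rule cap_open_UN)
    show "cap_open (U (m + j)) < ennreal ((4 * (1/4)^m * (1/2)^Suc j)\<^sup>2)" for j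
    proof -
     have "(1/4::real)^j \<le> (1/2)^j" by (intro power_mono) auto
     also have "\<dots> \<le> 2 * (1/2)^j" by simp
     finally have "(1/4::real)^(m + j) \<le> 4 * (1/4)^m * (1/2)^Suc j"
      by (simp add: power_add)
     then have "((1/4::real)^(m + j))\<^sup>2 \<le> (4 * (1/4)^m * (1/2)^Suc j)\<^sup>2" by (intro power_mono) auto
     then show ?thesis using Ucap[of "m + j"] ennreal_leI less_le_trans by blast
    qed
   qed simp
   also have "\<dots> < ennreal (\<epsilon>/4)" using m by (intro ennreal_lessI) (auto simp: e)
   finally show ?thesis .
  qed
  have "\<epsilon>/4 > 0" using e by simp
  then obtain O0 where O0: "open O0" "O0 \<subseteq> X" "cap O0 < ennreal (\<epsilon>/4)" "continuous_on (X - O0) g"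
   using g(1) unfolding quasi_continuous_def openin_X unfolding space_M by blast
  obtain O1 where O1: "open O1" "O1 \<subseteq> X" "O0 \<subseteq> O1" "cap_open O1 < ennreal (\<epsilon>/4)"
   using cap_lessD[OF O0(3)] by blast
  define Z where "Z = V \<union> O1"
  have Zo: "open Z" "Z \<subseteq> X" using Uo UX O1 by (auto simp: Z_def V_def)
  have Zcap: "cap_open Z < ennreal \<epsilon>"
   using cap_open_Un[OF Vcap O1(4)] by (simp add: Z_def)
  define S where "S = X - Z"
  have small: "\<bar>k (Suc n) x - k n x\<bar> \<le> (1/2)^n" if "x \<in> S" "n \<ge> m" for x n
  proof -
   have "x \<notin> U (m + (n - m))" using that(1) unfolding S_def Z_def V_def by blast
   then show ?thesis using that by (auto simp: U_def S_def)
  qed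
  have tele: "\<bar>k (n + p) x - k n x\<bar> \<le> 2 * (1/2)^n - 2 * (1/2)^(n + p)" if "x \<in> S" "n \<ge> m" for x n p
  proof (induction p)
   case (Suc p)
   have "\<bar>k (Suc (n + p)) x - k (n + p) x\<bar> \<le> (1/2)^(n + p)" using that by (intro small) auto
   then show ?case using Suc by (simp add: abs_le_iff)
  qed simp
  have tele': "\<bar>k (n + p) x - k n x\<bar> \<le> 2 * (1/2)^n" if "x \<in> S" "n \<ge> m" for x n p
   by (rule order_trans[OF tele[OF that, of p]]) simp
  define kk where "kk x = lim (\<lambda>n. k n x)" for x
  have conv: "(\<lambda>n. k n x) ----> kk x" if x: "x \<in> S" for x
  proof -
   have "Cauchy (\<lambda>n. k n x)"
    unfolding Cauchy_def
   proof (intro allI impI)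
    fix e :: real assume "e > 0"
    have "(\<lambda>n. 4 * (1/2::real)^n) ----> 4 * 0" by (intro tendsto_intros) simp
    then have "\<forall>\<^sub>F n in sequentially. 4 * (1/2::real)^n < e"
     using \<open>e > 0\<close> by (intro order_tendstoD(2)[where y = "0::real"]) auto
    then obtain n0 where n0: "\<And>n. n \<ge> n0 ==> 4 * (1/2::real)^n < e" by (auto simp: eventually_sequentially)
    define N where "N = max n0 m"
    have b: "\<bar>k n x - k N x\<bar> \<le> 2 * (1/2)^N" if "n \<ge> N" for n
    proof -
     have "\<bar>k (N + (n - N)) x - k N x\<bar> \<le> 2 * (1/2)^N"
      by (rule tele'[OF x]) (simp add: N_def)
     then show ?thesis using that by simp
    qed
    have "dist (k i x) (k j x) < e" if "i \<ge> N" "j \<ge> N" for i j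
    proof -
     have "\<bar>k i x - k j x\<bar> \<le> 4 * (1/2)^N" using b[OF that(1)] b[OF that(2)] by simp
     also have "\<dots> < e" by (rule n0) (simp add: N_def)
     finally show ?thesis by (simp add: dist_real_def)
    qed
    then show "\<exists>M. \<forall>i\<ge>M. \<forall>j\<ge>M. dist (k i x) (k j x) < e" by blast
   qed
   then show ?thesis unfolding kk_def by (simp add: Cauchy_convergent_iff convergent_LIMSEQ_iff)
  qed
  have unif: "\<bar>k n x - kk x\<bar> \<le> 2 * (1/2)^n" if x: "x \<in> S" "n \<ge> m" for x n
  proof (rule LIMSEQ_le_const2)
   show "(\<lambda>p. \<bar>k n x - k (n + p) x\<bar>) ----> \<bar>k n x - kk x\<bar>"
    using LIMSEQ_ignore_initial_segment[OF conv[OF x(1)], of n]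
    by (intro tendsto_intros) (simp add: add.commute)
   have "\<bar>k n x - k (n + p) x\<bar> \<le> 2 * (1/2)^n" for p
    using tele'[OF x, of p] by (simp add: abs_minus_commute)
   then show "\<exists>N. \<forall>p\<ge>N. \<bar>k n x - k (n + p) x\<bar> \<le> 2 * (1/2)^n" by blast
  qed
  have "uniform_limit S k kk sequentially"
  proof (rule uniform_limitI)
   fix e :: real assume "e > 0"
   have "(\<lambda>n. 2 * (1/2::real)^n) ----> 2 * 0" by (intro tendsto_intros) simp
   then have "\<forall>\<^sub>F n in sequentially. 2 * (1/2::real)^n < e"
    using \<open>e > 0\<close> by (intro order_tendstoD(2)[where y = "0::real"]) auto
   then show "\<forall>\<^sub>F n in sequentially. \<forall>x\<in>S. dist (k n x) (kk x) < e"
    using eventually_ge_at_top[of m]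
   proof eventually_elim
    case (elim n)
    show ?case
    proof
     fix x assume "x \<in> S"
     then have "\<bar>k n x - kk x\<bar> \<le> 2 * (1/2)^n" using elim(2) by (rule unif)
     also have "\<dots> < e" by (rule elim(1))
     finally show "dist (k n x) (kk x) < e" by (simp add: dist_real_def)
    qed
   qed
  qed
  then have kkc: "continuous_on S kk"
   by (rule uniform_limit_theorem[rotated])
    (auto intro!: always_eventually continuous_on_subset[OF kc] simp: S_def)
  have gc: "continuous_on S g" by (rule continuous_on_subset[OF O0(4)]) (use O1(3) in "auto simp: S_def Z_def")
  have "openin (top_of_set S) (S \<inter> (\<lambda>x. kk x - g x) -` (- {0}))"
   by (intro continuous_openin_preimage_gen continuous_on_diff kkc gc) auto
  then obtain T where T: "open T" "S \<inter> (\<lambda>x. kk x - g x) -` (- {0}) = S \<inter> T" by (auto simp: openin_open)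
  \<comment> \<open>The added set, where the continuous limit and g disagree off \<open>Z\<close>,
    is null for \<open>M\<close>; so the competitor u for \<open>Z\<close> also serves
    \<open>W\<close>.\<close>
  define W where "W = Z \<union> (X \<inter> T)"
  have eq: "kk x = g x \<longleftrightarrow> x \<notin> T" if "x \<in> S" for x using T(2) that by auto
  obtain u where u: "u \<in> F" "AE x in M. x \<in> Z \<longrightarrow> u x = 1" "E1 u u < \<epsilon>" "\<And>x. 0 \<le> u x \<and> u x \<le> 1"
   using cap_open_lessD[OF Zcap] by blast
  have "AE x in M. x \<in> W \<longrightarrow> u x \<ge> 1"
   using u(2) kAE g(2)
  proof eventually_elim
   case (elim x)
   show ?case
   proof
    assume xW: "x \<in> W"
    have "x \<in> Z"
    proof (rule ccontr)
     assume "x \<notin> Z"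
     then have xS: "x \<in> S" "x \<in> T" using xW by (auto simp: W_def S_def)
     have "kk x = f x" using LIMSEQ_unique[OF conv[OF xS(1)] elim(2)] .
     then show False using eq[OF xS(1)] xS(2) elim(3) by simp
    qed
    then show "u x \<ge> 1" using elim(1) by simp
   qed
  qed
  then have "cap_open W \<le> ennreal (E1 u u)" by (rule cap_open_le[OF u(1)])
  also have "\<dots> < ennreal \<epsilon>" using u(3) e by (intro ennreal_lessI) auto
  finally have "cap_open W < ennreal \<epsilon>" .
  moreover have "open W" "W \<subseteq> X" using Zo T(1) open_X by (auto simp: W_def)
  moreover have "(\<lambda>n. k n x) ----> g x" if "x \<in> X - W" for x
  proof -
   have "x \<in> S" "x \<notin> T" using that by (auto simp: W_def S_def)
   then show ?thesis using conv[of x] eq[of x] by simp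
  qed
  ultimately show ?thesis by blast
 qed
 define P where "P i W \<longleftrightarrow> open W \<and> W \<subseteq> X \<and> cap_open W < ennreal (inverse (real (Suc i))) \<and>
   (\<forall>x\<in>X - W. (\<lambda>n. k n x) ----> g x)" for i :: nat and W
 have "\<exists>W. P i W" for i unfolding P_def by (rule step) simp
 then obtain W where "\<And>i. P i (W i)" by metis
 then have W: "open (W i)" "W i \<subseteq> X" "cap_open (W i) < ennreal (inverse (real (Suc i)))"
  "\<forall>x\<in>X - W i. (\<lambda>n. k n x) ----> g x" for i
  unfolding P_def by blast+
 have b: "cap (\<Inter>i. W i) \<le> ennreal (inverse (real (Suc i)))" for i
  by (rule order_trans[OF cap_le[OF W(1,2)] less_imp_le[OF W(3)]]) blast
 have "(\<lambda>i. ennreal (inverse (real (Suc i)))) ----> ennreal 0"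
  by (intro tendsto_ennrealI LIMSEQ_inverse_real_of_nat)
 then have "cap (\<Inter>i. W i) \<le> ennreal 0" using b by (intro LIMSEQ_le_const) auto
 then have "cap (\<Inter>i. W i) = 0" by simp
 moreover have "strict_mono (r1 \<circ> r2)" using r1(1) r2(1) by (rule strict_mono_o)
 moreover have "(\<lambda>n. h ((r1 \<circ> r2) n) x) ----> g x" if x: "x \<in> X - (\<Inter>i. W i)" for x
 proof -
  obtain i where "x \<in> X - W i" using x by blast
  then show ?thesis using W(4)[of i] by (auto simp: k_def)
 qed
 ultimately show ?thesis using that by blast
qed

text \<open>The criterion used twice, for energy measures and for the boundary measure. Smallness is
  only assumed on sets \<open>{h = 1}\<close> of core functions and reaches open sets through
  compact exhaustion. As \<open>N\<close> need not be measurable, the conclusion is a null cover, a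
  countable intersection of open sets.\<close>

lemma capacity_null:
 assumes \<mu>: "sets \<mu> = sets M"
  and small: "\<And>\<epsilon>. \<epsilon> > 0 ==> \<exists>\<delta>>0. \<forall>h\<in>core. (\<forall>x\<in>X. 0 \<le> h x \<and> h x \<le> 1) \<longrightarrow> E1 h h < \<delta> \<longrightarrow>
   emeasure \<mu> {x \<in> X. h x = 1} \<le> ennreal \<epsilon>"
  and N: "cap N = 0"
 obtains G where "G \<in> null_sets \<mu>" "N \<subseteq> G"
proof -
 have step: "\<exists>U. open U \<and> U \<subseteq> X \<and> N \<subseteq> U \<and> emeasure \<mu> U \<le> ennreal \<epsilon>" if e: "\<epsilon> > 0" for \<epsilon>
 proof -
  obtain \<delta> where d: "\<delta> > 0" "\<And>h. h \<in> core ==> (\<forall>x\<in>X. 0 \<le> h x \<and> h x \<le> 1) ==> E1 h h < \<delta> ==>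
   emeasure \<mu> {x \<in> X. h x = 1} \<le> ennreal \<epsilon>" using small[OF e] by blast
  have "cap N < ennreal \<delta>" using N d(1) by simp
  then obtain U where U: "open U" "U \<subseteq> X" "N \<subseteq> U" "cap_open U < ennreal \<delta>" using cap_lessD by blast
  obtain K where K: "\<And>n. compact (K n)" "incseq K" "(\<Union>n. K n) = U"
   by (rule compact_exhaustion[OF U(1)], rule that)
  have KU: "K n \<subseteq> U" for n using K(3) by auto
  have Ks: "K n \<in> sets \<mu>" for n using K(1)[of n] KU[of n] U(2) unfolding \<mu> sets_M_iff by (auto intro: borel_compact)
  have "emeasure \<mu> (K n) \<le> ennreal \<epsilon>" for n
  proof -
   obtain h where h: "h \<in> core" "\<And>x. x \<in> X ==> 0 \<le> h x \<and> h x \<le> 1" "\<And>x. x \<in> K n ==> h x = 1" "E1 h h < \<delta>"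
    using cap_open_compact[OF U(1,2,4) K(1) KU] by blast
   have "K n \<subseteq> {x \<in> X. h x = 1}" using h(3) KU[of n] U(2) by blast
   moreover have "{x \<in> X. h x = 1} \<in> sets \<mu>"
   proof -
    have "h -` {1} \<inter> space M \<in> sets M" using core_measurable[OF h(1)] by (rule measurable_sets) simp
    moreover have "h -` {1} \<inter> space M = {x \<in> X. h x = 1}" by (auto simp: space_M)
    ultimately show ?thesis by (simp add: \<mu>)
   qed
   ultimately have "emeasure \<mu> (K n) \<le> emeasure \<mu> {x \<in> X. h x = 1}" by (rule emeasure_mono)
   also have "\<dots> \<le> ennreal \<epsilon>" using h by (intro d(2)) auto
   finally show ?thesis .
  qed
  moreover have "(\<lambda>n. emeasure \<mu> (K n)) ----> emeasure \<mu> (\<Union>n. K n)"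
   using Ks K(2) by (intro Lim_emeasure_incseq) auto
  ultimately have "emeasure \<mu> U \<le> ennreal \<epsilon>" unfolding K(3) by (intro LIMSEQ_le_const2) auto
  then show ?thesis using U by blast
 qed
 define P where "P i U \<longleftrightarrow> open U \<and> U \<subseteq> X \<and> N \<subseteq> U \<and> emeasure \<mu> U \<le> ennreal (inverse (real (Suc i)))"
  for i :: nat and U
 have "\<exists>U. P i U" for i unfolding P_def by (rule step) simp
 then obtain U where "\<And>i. P i (U i)" by metis
 then have U: "open (U i)" "U i \<subseteq> X" "N \<subseteq> U i" "emeasure \<mu> (U i) \<le> ennreal (inverse (real (Suc i)))" for i
  unfolding P_def by blast+
 have Us: "U i \<in> sets \<mu>" for i using U(1,2) unfolding \<mu> sets_M_iff by auto
 then have Gs: "(\<Inter>i. U i) \<in> sets \<mu>" by auto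
 have b: "emeasure \<mu> (\<Inter>i. U i) \<le> ennreal (inverse (real (Suc i)))" for i
  by (rule order_trans[OF emeasure_mono[OF _ Us[of i]] U(4)[of i]]) blast
 have "(\<lambda>i. ennreal (inverse (real (Suc i)))) ----> ennreal 0"
  by (intro tendsto_ennrealI LIMSEQ_inverse_real_of_nat)
 then have "emeasure \<mu> (\<Inter>i. U i) \<le> ennreal 0" using b by (intro LIMSEQ_le_const) auto
 then have "(\<Inter>i. U i) \<in> null_sets \<mu>" using Gs by (intro null_setsI) auto
 then show ?thesis using that U(3) by blast
qed

section \<open>Riesz representation of positive functionals on the core\<close>

lemma sets_M_sigma: "sets M = sigma_sets X {U. open U \<and> U \<subseteq> X}"
proof
 have "A \<inter> X \<in> sigma_sets X {U. open U \<and> U \<subseteq> X}" if "A \<in> sigma_sets UNIV {U :: 'a set. open U}" for A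
  using that
 proof induction
  case (Basic A)
  then show ?case using open_X by (intro sigma_sets.Basic) auto
 next
  case Empty
  then show ?case by (simp add: sigma_sets.Empty)
 next
  case (Compl A)
  have "(UNIV - A) \<inter> X = X - A \<inter> X" by auto
  then show ?case using Compl by (simp add: sigma_sets.Compl)
 next
  case (Union A)
  have "(\<Union>i. A i \<inter> X) \<in> sigma_sets X {U. open U \<and> U \<subseteq> X}" by (rule sigma_sets.Union) (rule Union)
  moreover have "(\<Union>(range A)) \<inter> X = (\<Union>i. A i \<inter> X)" by auto
  ultimately show ?case by (simp only:)
 qed
 then show "sets M \<subseteq> sigma_sets X {U. open U \<and> U \<subseteq> X}"
  unfolding sets_M sets_restrict_space borel_def by (auto simp: Int_commute)
 show "sigma_sets X {U. open U \<and> U \<subseteq> X} \<subseteq> sets M"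
 proof -
  have "{U. open U \<and> U \<subseteq> X} \<subseteq> sets M" by (auto simp: sets_M_iff)
  from sets.sigma_sets_subset[OF this] show ?thesis by (simp add: space_M)
 qed
qed

text \<open>These play the role of compactly supported functions between 0 and 1 in the Riesz
  construction: the functional is given on the core only, so the suprema run over core
  functions.\<close>

definition supported :: "'a set \<Rightarrow> ('a \<Rightarrow> real) set" where
 "supported U = {g \<in> core. (\<forall>x\<in>X. 0 \<le> g x \<and> g x \<le> 1) \<and> (\<exists>K. compact K \<and> K \<subseteq> U \<and> (\<forall>x\<in>X - K. g x = 0))}"

definition riesz_open :: "(('a \<Rightarrow> real) \<Rightarrow> real) \<Rightarrow> 'a set \<Rightarrow> ennreal" where
 "riesz_open H U = (SUP g\<in>supported U. ennreal (H g))"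

definition riesz_outer :: "(('a \<Rightarrow> real) \<Rightarrow> real) \<Rightarrow> 'a set \<Rightarrow> ennreal" where
 "riesz_outer H A = (INF U\<in>{U. open U \<and> U \<subseteq> X \<and> A \<subseteq> U}. riesz_open H U)"

definition riesz :: "(('a \<Rightarrow> real) \<Rightarrow> real) \<Rightarrow> 'a measure" where
 "riesz H = measure_of X (sets M) (riesz_outer H)"

lemma zero_supported: "(\<lambda>x. 0) \<in> supported U"
 unfolding supported_def using core_zero by (auto intro!: exI[of _ "{}"])

lemma supported_mono: "U \<subseteq> V ==> supported U \<subseteq> supported V"
 unfolding supported_def by blast

lemma riesz_open_mono: "U \<subseteq> V ==> riesz_open H U \<le> riesz_open H V"
 unfolding riesz_open_def by (intro SUP_subset_mono supported_mono) auto

lemma riesz_outer_mono: "A \<subseteq> B ==> riesz_outer H A \<le> riesz_outer H B"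
 unfolding riesz_outer_def by (rule INF_superset_mono) auto

lemma riesz_outer_open: "open U ==> U \<subseteq> X ==> riesz_outer H U = riesz_open H U"
 unfolding riesz_outer_def
 by (intro antisym INF_lower INF_greatest) (auto intro: riesz_open_mono)

lemma riesz_sets: "sets (riesz H) = sets M"
 unfolding riesz_def using sets.space_closed[of M] by (simp add: space_M sets.sigma_sets_eq[of M, unfolded space_M])

lemma riesz_space: "space (riesz H) = X"
 using sets_eq_imp_space_eq[OF riesz_sets] space_M by simp

end

text \<open>The bound \<open>B\<close> on functions with values in [0,1] makes the representing
  measure finite; no continuity of \<open>H\<close> is assumed beyond it.\<close>

locale positive_functional = regular_form_space M E F X
 for M :: "'a::polish_space measure" and E F X +
 fixes H :: "('a \<Rightarrow> real) \<Rightarrow> real" and B :: real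
 assumes add: "f \<in> core ==> g \<in> core ==> H (\<lambda>x. f x + g x) = H f + H g"
  and scale: "f \<in> core ==> H (\<lambda>x. c * f x) = c * H f"
  and pos: "f \<in> core ==> (\<And>x. x \<in> X ==> 0 \<le> f x) ==> 0 \<le> H f"
  and bound: "f \<in> core ==> (\<And>x. x \<in> X ==> 0 \<le> f x \<and> f x \<le> 1) ==> H f \<le> B"
begin

lemma diff: "f \<in> core ==> g \<in> core ==> H (\<lambda>x. f x - g x) = H f - H g"
 using add[of f "\<lambda>x. (-1) * g x"] scale[of g "-1"] core_scale[of g "-1"] by simp

lemma mono: "f \<in> core ==> g \<in> core ==> (\<And>x. x \<in> X ==> f x \<le> g x) ==> H f \<le> H g"
 using pos[OF core_diff[of g f]] diff[of g f] by simp

lemma zero: "H (\<lambda>x. 0) = 0" using scale[OF core_zero, of 0] by simp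

lemma sum: "finite I ==> (\<And>i. i \<in> I ==> f i \<in> core) ==>
  (\<lambda>x. \<Sum>i\<in>I. f i x) \<in> core \<and> H (\<lambda>x. \<Sum>i\<in>I. f i x) = (\<Sum>i\<in>I. H (f i))"
 by (induction I rule: finite_induct) (auto simp: zero core_zero core_add add)

lemma supported_pos: "g \<in> supported U ==> 0 \<le> H g" by (intro pos) (auto simp: supported_def)

lemma riesz_open_upper: "g \<in> supported U ==> ennreal (H g) \<le> riesz_open H U"
 unfolding riesz_open_def by (rule SUP_upper)

lemma riesz_open_finite: "riesz_open H U \<le> ennreal B"
 unfolding riesz_open_def by (intro SUP_least ennreal_leI bound) (auto simp: supported_def)

lemma riesz_outer_finite: "A \<subseteq> X ==> riesz_outer H A < \<infinity>"
proof -
 assume "A \<subseteq> X"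
 then have "riesz_outer H A \<le> riesz_open H X" unfolding riesz_outer_def using open_X by (intro INF_lower) auto
 also have "\<dots> \<le> ennreal B" by (rule riesz_open_finite)
 finally show ?thesis by (simp add: le_less_trans)
qed

text \<open>A function supported in the union is split by a cutoff that is 1 near the part of its
  support outside \<open>V\<close>: the product with the cutoff lives in \<open>U\<close>, the
  remainder in \<open>V\<close>.\<close>

lemma riesz_open_Un:
 assumes U: "open U" "U \<subseteq> X" and V: "open V" "V \<subseteq> X"
 shows "riesz_open H (U \<union> V) \<le> riesz_open H U + riesz_open H V"
 unfolding riesz_open_def[of H "U \<union> V"]
proof (rule SUP_least)
 fix g assume "g \<in> supported (U \<union> V)"
 then obtain K where g: "g \<in> core" "\<And>x. x \<in> X ==> 0 \<le> g x \<and> g x \<le> 1" and K: "compact K" "K \<subseteq> U \<union> V" "\<And>x. x \<in> X - K ==> g x = 0"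
  unfolding supported_def by blast
 have "compact (K - V)" "K - V \<subseteq> U" using K V(1) by (auto intro: compact_diff)
 then obtain \<phi> W L where \<phi>: "\<phi> \<in> core" "\<And>x. x \<in> X ==> 0 \<le> \<phi> x \<and> \<phi> x \<le> 1" "open W" "K - V \<subseteq> W" "compact L" "L \<subseteq> U"
  "\<And>x. x \<in> W ==> \<phi> x = 1" "\<And>x. x \<in> X - L ==> \<phi> x = 0"
  by (rule cutoff[OF _ _ U]) blast
 let ?a = "\<lambda>x. g x * \<phi> x" and ?b = "\<lambda>x. g x - g x * \<phi> x"
 have c: "?a \<in> core" "?b \<in> core" by (intro core_mult core_diff g \<phi>)+
 have r: "0 \<le> ?a x \<and> ?a x \<le> 1" "0 \<le> ?b x \<and> ?b x \<le> 1" if "x \<in> X" for x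
 proof -
  have "0 \<le> ?a x" "?a x \<le> g x * 1" using g(2)[OF that] \<phi>(2)[OF that] by (auto simp: mult_left_le)
  then show "0 \<le> ?a x \<and> ?a x \<le> 1" "0 \<le> ?b x \<and> ?b x \<le> 1" using g(2)[OF that] by auto
 qed
 have "?a \<in> supported U"
  unfolding supported_def using c(1) r(1) \<phi>(5,6,8) by (auto intro!: exI[of _ L])
 moreover have "?b \<in> supported V"
 proof -
  have "compact (K - W)" "K - W \<subseteq> V" using K(1) \<phi>(3,4) by (auto intro: compact_diff)
  moreover have "?b x = 0" if "x \<in> X - (K - W)" for x using that K(3)[of x] \<phi>(7)[of x] by auto
  ultimately show ?thesis unfolding supported_def using c(2) r(2) by blast
 qed
 moreover have "H g = H ?a + H ?b" using add[OF c] by simp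
 ultimately show "ennreal (H g) \<le> riesz_open H U + riesz_open H V"
  by (simp add: ennreal_plus supported_pos add_mono riesz_open_upper)
qed

lemma riesz_open_empty: "riesz_open H {} = 0"
proof -
 have "H g \<le> 0" if "g \<in> supported {}" for g
  using that zero by (intro order_trans[OF mono[of g "\<lambda>x. 0"]]) (auto simp: supported_def core_zero)
 then have "riesz_open H {} \<le> 0" unfolding riesz_open_def by (intro SUP_least) (simp add: ennreal_neg)
 then show ?thesis by simp
qed

text \<open>Each test function has compact support, so only finitely many of the sets matter for it
  and the case of two sets suffices by induction.\<close>

lemma riesz_open_UN:
 assumes U: "\<And>i::nat. open (U i)" "\<And>i. U i \<subseteq> X"
 shows "riesz_open H (\<Union>i. U i) \<le> (\<Sum>i. riesz_open H (U i))"
proof -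
 have fin: "riesz_open H (\<Union>i<n. U i) \<le> (\<Sum>i<n. riesz_open H (U i))" for n
 proof (induction n)
  case (Suc n)
  have "riesz_open H ((\<Union>i<n. U i) \<union> U n) \<le> riesz_open H (\<Union>i<n. U i) + riesz_open H (U n)"
   using U by (intro riesz_open_Un) auto
  also have "\<dots> \<le> (\<Sum>i<n. riesz_open H (U i)) + riesz_open H (U n)" by (intro add_mono Suc) simp
  also have "\<dots> = (\<Sum>i<Suc n. riesz_open H (U i))" by simp
  finally show ?case by (simp add: lessThan_Suc Un_commute)
 qed (simp add: riesz_open_empty)
 show ?thesis
  unfolding riesz_open_def[of H "\<Union>i. U i"]
 proof (rule SUP_least)
  fix g assume g: "g \<in> supported (\<Union>i. U i)"
  then obtain K where K: "compact K" "K \<subseteq> (\<Union>i. U i)" "\<And>x. x \<in> X - K ==> g x = 0" unfolding supported_def by blast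
  obtain I where I: "finite I" "K \<subseteq> (\<Union>i\<in>I. U i)" using compactE_image[OF K(1), of UNIV U] U(1) K(2) by auto
  have "(\<Union>i\<in>I. U i) \<subseteq> (\<Union>i<Suc (Max (insert 0 I)). U i)"
   by (intro UN_mono) (use I(1) in "auto simp: less_Suc_eq_le intro: Max_ge")
  with I(2) have KJ: "K \<subseteq> (\<Union>i<Suc (Max (insert 0 I)). U i)" by (rule order_trans)
  have "g \<in> core" "\<forall>x\<in>X. 0 \<le> g x \<and> g x \<le> 1" using g by (auto simp: supported_def)
  moreover have "\<exists>K. compact K \<and> K \<subseteq> (\<Union>i<Suc (Max (insert 0 I)). U i) \<and> (\<forall>x\<in>X - K. g x = 0)"
   using K(1,3) KJ by (intro exI[of _ K]) simp
  ultimately have "g \<in> supported (\<Union>i<Suc (Max (insert 0 I)). U i)" by (simp only: supported_def mem_Collect_eq)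
  then have "ennreal (H g) \<le> riesz_open H (\<Union>i<Suc (Max (insert 0 I)). U i)" by (rule riesz_open_upper)
  also have "\<dots> \<le> (\<Sum>i<Suc (Max (insert 0 I)). riesz_open H (U i))" by (rule fin)
  also have "\<dots> \<le> (\<Sum>i. riesz_open H (U i))" by (rule sum_le_suminf) auto
  finally show "ennreal (H g) \<le> (\<Sum>i. riesz_open H (U i))" .
 qed
qed

lemma riesz_outer_measure: "outer_measure_space (Pow X) (riesz_outer H)"
 unfolding outer_measure_space_def
proof (intro conjI)
 show "positive (Pow X) (riesz_outer H)"
  unfolding positive_def by (simp add: riesz_outer_open riesz_open_empty)
 show "increasing (Pow X) (riesz_outer H)"
  unfolding increasing_def by (auto intro: riesz_outer_mono)
 show "countably_subadditive (Pow X) (riesz_outer H)"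
  unfolding countably_subadditive_def
 proof (intro allI impI)
  fix A :: "nat \<Rightarrow> 'a set" assume A: "range A \<subseteq> Pow X"
  show "riesz_outer H (\<Union>i. A i) \<le> (\<Sum>i. riesz_outer H (A i))"
  proof (rule ennreal_le_epsilon)
   fix e :: real assume e: "e > 0"
   \<comment> \<open>Almost optimal open covers with errors that sum to e; strict inequality is
     available since the outer measure of a subset of \<open>X\<close> is finite.\<close>
   define P where "P i U \<longleftrightarrow> open U \<and> U \<subseteq> X \<and> A i \<subseteq> U \<and> riesz_open H U < riesz_outer H (A i) + ennreal (e * (1/2)^Suc i)" for i U
   have "\<exists>U. P i U" for i
   proof -
    have "riesz_outer H (A i) < \<infinity>" using A by (intro riesz_outer_finite) auto
    then have "riesz_outer H (A i) < riesz_outer H (A i) + ennreal (e * (1/2)^Suc i)"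
     using e by (simp add: ennreal_lessI less_top[symmetric])
    then have "\<exists>U\<in>{U. open U \<and> U \<subseteq> X \<and> A i \<subseteq> U}. riesz_open H U < riesz_outer H (A i) + ennreal (e * (1/2)^Suc i)"
     unfolding riesz_outer_def[of H "A i"] INF_less_iff[symmetric] .
    then show ?thesis unfolding P_def by blast
   qed
   then obtain U where "\<And>i. P i (U i)" by metis
   then have U: "open (U i)" "U i \<subseteq> X" "A i \<subseteq> U i"
    "riesz_open H (U i) < riesz_outer H (A i) + ennreal (e * (1/2)^Suc i)" for i
    unfolding P_def by blast+
   have "riesz_outer H (\<Union>i. A i) \<le> riesz_open H (\<Union>i. U i)"
   proof -
    have "open (\<Union>i. U i)" "(\<Union>i. U i) \<subseteq> X" using U(1,2) by auto
    moreover have "(\<Union>i. A i) \<subseteq> (\<Union>i. U i)" using U(3) by (intro UN_mono) auto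
    ultimately show ?thesis unfolding riesz_outer_def by (intro INF_lower) simp
   qed
   also have "\<dots> \<le> (\<Sum>i. riesz_open H (U i))" by (rule riesz_open_UN[OF U(1,2)])
   also have "\<dots> \<le> (\<Sum>i. riesz_outer H (A i) + ennreal (e * (1/2)^Suc i))"
    using U(4) by (intro suminf_le) (auto intro: less_imp_le)
   also have "\<dots> = (\<Sum>i. riesz_outer H (A i)) + (\<Sum>i. ennreal (e * (1/2)^Suc i))"
    by (rule suminf_add[symmetric]) auto
   also have "(\<Sum>i. ennreal (e * (1/2)^Suc i)) = ennreal e"
    using sums_mult[OF power_half_series, of e] e by (intro suminf_ennreal_eq) auto
   finally show "riesz_outer H (\<Union>i. A i) \<le> (\<Sum>i. riesz_outer H (A i)) + ennreal e" .
  qed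
 qed
qed

text \<open>Given an open cover \<open>V\<close> of \<open>T\<close>, choose first g supported on a
  compact \<open>K\<close> inside the part of \<open>V\<close> in \<open>U\<close>, then h supported
  in \<open>V - K\<close>, an open cover of the part of \<open>T\<close> outside \<open>U\<close>.
  The supports are disjoint, so g + h is again an admissible test function for
  \<open>V\<close>.\<close>

lemma riesz_lambda_system:
 assumes U: "open U" "U \<subseteq> X"
 shows "U \<in> lambda_system X (Pow X) (riesz_outer H)"
proof -
 interpret P: sigma_algebra X "Pow X" by (rule sigma_algebra_Pow)
 have oms: "positive (Pow X) (riesz_outer H)" "countably_subadditive (Pow X) (riesz_outer H)"
  using riesz_outer_measure by (auto simp: outer_measure_space_def)
 have sub: "subadditive (Pow X) (riesz_outer H)"
  using P.countably_subadditive_subadditive[OF oms] .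
 have "riesz_outer H (U \<inter> T) + riesz_outer H ((X - U) \<inter> T) = riesz_outer H T" if T: "T \<subseteq> X" for T
 proof (rule antisym)
  show "riesz_outer H (U \<inter> T) + riesz_outer H ((X - U) \<inter> T) \<le> riesz_outer H T"
   unfolding riesz_outer_def[of H T]
  proof (rule INF_greatest)
   fix V assume "V \<in> {U. open U \<and> U \<subseteq> X \<and> T \<subseteq> U}"
   then have V: "open V" "V \<subseteq> X" "T \<subseteq> V" by auto
   let ?c = "riesz_outer H ((X - U) \<inter> T)"
   have ne: "supported W \<noteq> {}" for W using zero_supported by blast
   have "riesz_outer H (U \<inter> T) \<le> riesz_open H (U \<inter> V)"
    unfolding riesz_outer_def using U V by (intro INF_lower) auto
   then have "riesz_outer H (U \<inter> T) + ?c \<le> riesz_open H (U \<inter> V) + ?c" by (rule add_right_mono)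
   also have "\<dots> = (SUP g\<in>supported (U \<inter> V). ennreal (H g) + ?c)"
    unfolding riesz_open_def by (rule ennreal_SUP_add_left[OF ne, symmetric])
   also have "\<dots> \<le> riesz_open H V"
   proof (rule SUP_least)
    fix g assume g: "g \<in> supported (U \<inter> V)"
    then obtain K where K: "compact K" "K \<subseteq> U \<inter> V" "\<And>x. x \<in> X - K ==> g x = 0" unfolding supported_def by blast
    have "?c \<le> riesz_open H (V - K)"
     unfolding riesz_outer_def using V K T compact_imp_closed[OF K(1)] by (intro INF_lower) auto
    then have "ennreal (H g) + ?c \<le> ennreal (H g) + riesz_open H (V - K)" by (rule add_left_mono)
    also have "\<dots> = (SUP h\<in>supported (V - K). ennreal (H g) + ennreal (H h))"
     unfolding riesz_open_def by (rule ennreal_SUP_add_right[OF ne])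
    also have "\<dots> \<le> riesz_open H V"
    proof (rule SUP_least)
     fix h assume h: "h \<in> supported (V - K)"
     then obtain L where L: "compact L" "L \<subseteq> V - K" "\<And>x. x \<in> X - L ==> h x = 0" unfolding supported_def by blast
     have gh: "g \<in> core" "h \<in> core" using g h by (auto simp: supported_def)
     have "0 \<le> g x + h x \<and> g x + h x \<le> 1" if "x \<in> X" for x
     proof (cases "x \<in> K")
      case True
      then have "h x = 0" using L that by blast
      then show ?thesis using g that by (simp add: supported_def)
     next
      case False
      then have "g x = 0" using K that by blast
      then show ?thesis using h that by (simp add: supported_def)
     qed
     moreover have "\<exists>J. compact J \<and> J \<subseteq> V \<and> (\<forall>x\<in>X - J. g x + h x = 0)"
      using K L by (intro exI[of _ "K \<union> L"]) auto
     ultimately have "(\<lambda>x. g x + h x) \<in> supported V" using core_add[OF gh] by (simp add: supported_def)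
     then have "ennreal (H (\<lambda>x. g x + h x)) \<le> riesz_open H V" by (rule riesz_open_upper)
     then show "ennreal (H g) + ennreal (H h) \<le> riesz_open H V"
      by (simp add: add[OF gh] ennreal_plus supported_pos[OF g] supported_pos[OF h])
    qed
    finally show "ennreal (H g) + ?c \<le> riesz_open H V" .
   qed
   finally show "riesz_outer H (U \<inter> T) + ?c \<le> riesz_open H V" .
  qed
  have "riesz_outer H (U \<inter> T \<union> (X - U) \<inter> T) \<le> riesz_outer H (U \<inter> T) + riesz_outer H ((X - U) \<inter> T)"
   using T by (intro sub[unfolded subadditive_def, rule_format]) auto
  moreover have "U \<inter> T \<union> (X - U) \<inter> T = T" using T by auto
  ultimately show "riesz_outer H T \<le> riesz_outer H (U \<inter> T) + riesz_outer H ((X - U) \<inter> T)" by simp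
 qed
 then show ?thesis using U(2) by (simp add: lambda_system_def)
qed

lemma riesz_measure_space: "measure_space X (sets M) (riesz_outer H)"
proof -
 interpret P: sigma_algebra X "Pow X" by (rule sigma_algebra_Pow)
 have ms: "measure_space X (lambda_system X (Pow X) (riesz_outer H)) (riesz_outer H)"
  by (rule P.caratheodory_lemma[OF riesz_outer_measure])
 then have sa: "sigma_algebra X (lambda_system X (Pow X) (riesz_outer H))" by (simp add: measure_space_def)
 have "sets M \<subseteq> lambda_system X (Pow X) (riesz_outer H)"
  unfolding sets_M_sigma by (rule sigma_algebra.sigma_sets_subset[OF sa]) (auto intro: riesz_lambda_system)
 moreover have "sigma_algebra X (sets M)" using sets.sigma_algebra_axioms[of M] by (simp add: space_M)
 ultimately show ?thesis using ms by (intro measure_down[OF ms])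
qed

lemma emeasure_riesz: "A \<in> sets M ==> emeasure (riesz H) A = riesz_outer H A"
proof -
 assume A: "A \<in> sets M"
 have m: "countably_additive (sets M) (riesz_outer H)" "positive (sets M) (riesz_outer H)"
  using riesz_measure_space by (auto simp: measure_space_def)
 show ?thesis
  by (rule emeasure_measure_of[OF riesz_def]) (use m A riesz_sets sets.space_closed[of M] in "auto simp: space_M")
qed

lemma emeasure_riesz_open: "open U ==> U \<subseteq> X ==> emeasure (riesz H) U = riesz_open H U"
 by (simp add: emeasure_riesz sets_M_iff riesz_outer_open)

lemma finite_riesz: "finite_measure (riesz H)"
proof
 have "emeasure (riesz H) X \<le> ennreal B" using emeasure_riesz_open[OF open_X] riesz_open_finite by simp
 then show "emeasure (riesz H) (space (riesz H)) \<noteq> \<infinity>" unfolding riesz_space by (auto simp: top_unique)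
qed

end

section \<open>Integration against the Riesz measure, by slicing, and its uniqueness\<close>

lemma sum_slices:
 fixes t c :: real
 assumes "0 \<le> t" "0 < c"
 shows "(\<Sum>k<n. min c (max 0 (t - real k * c))) = min t (real n * c)"
proof (induction n)
 case (Suc n)
 have "min t (real n * c) + min c (max 0 (t - real n * c)) = min t (real (Suc n) * c)"
 proof (cases "t \<le> real n * c")
  case True
  then have "t \<le> real (Suc n) * c" using assms by (simp add: algebra_simps)
  then show ?thesis using True assms by (simp add: min_def)
 next
  case False
  then show ?thesis using assms by (simp add: min_def max_def algebra_simps)
 qed
 then show ?case using Suc by simp
qed (use assms in simp)

lemma sum_telescope_2:
 fixes a :: "nat \<Rightarrow> real"
 shows "(\<Sum>k<n. a k - a (Suc (Suc k))) = a 0 + a 1 - a n - a (Suc n)"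
 by (induction n) auto

lemma slice_contraction: "0 \<le> c ==> \<bar>min c (max 0 (s - d)) - min c (max 0 (t - d))\<bar> \<le> \<bar>s - t\<bar>" for s t c d :: real
 by auto

context positive_functional
begin

lemma supported_cmult_le:
 assumes c: "c > 0" and g: "g \<in> core" and W: "open W" "W \<subseteq> X" and ge: "\<And>x. x \<in> W ==> c \<le> g x" "\<And>x. x \<in> X ==> 0 \<le> g x"
 shows "c * measure (riesz H) W \<le> H g"
proof -
 interpret R: finite_measure "riesz H" by (rule finite_riesz)
 have "riesz_open H W \<le> ennreal (H g / c)"
  unfolding riesz_open_def
 proof (intro SUP_least ennreal_leI)
  fix h assume h: "h \<in> supported W"
  then obtain K where K: "K \<subseteq> W" "\<forall>x\<in>X - K. h x = 0" and hc: "h \<in> core" "\<forall>x\<in>X. 0 \<le> h x \<and> h x \<le> 1"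
   unfolding supported_def by blast
  have "c * h x \<le> g x" if x: "x \<in> X" for x
  proof (cases "x \<in> W")
   case True
   have "c * h x \<le> c * 1" using c hc(2) x by (intro mult_left_mono) auto
   then show ?thesis using ge(1)[OF True] by simp
  next
   case False
   then have "h x = 0" using K x by blast
   then show ?thesis using ge(2)[OF x] by simp
  qed
  then have "H (\<lambda>x. c * h x) \<le> H g" by (intro mono core_scale hc g)
  then show "H h \<le> H g / c" using c by (simp add: scale[OF hc(1)] field_simps)
 qed
 then have "emeasure (riesz H) W \<le> ennreal (H g / c)" by (simp add: emeasure_riesz_open[OF W])
 moreover have "0 \<le> H g / c" using c pos[OF g ge(2)] by simp
 ultimately have "measure (riesz H) W \<le> H g / c" by (simp add: R.emeasure_eq_measure)
 then show ?thesis using c by (simp add: field_simps)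
qed

lemma supported_cmult_ge:
 assumes c: "c > 0" and g: "g \<in> core" and W: "open W" "W \<subseteq> X" and ge: "\<And>x. x \<in> X ==> 0 \<le> g x \<and> g x \<le> c"
  and K: "compact K" "K \<subseteq> W" "\<And>x. x \<in> X - K ==> g x = 0"
 shows "H g \<le> c * measure (riesz H) W"
proof -
 interpret R: finite_measure "riesz H" by (rule finite_riesz)
 have "0 \<le> inverse c * g x \<and> inverse c * g x \<le> 1" if "x \<in> X" for x
  using ge[OF that] c by (auto simp: field_simps)
 moreover have "\<forall>x\<in>X - K. inverse c * g x = 0" using K(3) by simp
 ultimately have "(\<lambda>x. inverse c * g x) \<in> supported W"
  unfolding supported_def using core_scale[OF g] K(1,2) by blast
 then have "ennreal (H (\<lambda>x. inverse c * g x)) \<le> emeasure (riesz H) W"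
  unfolding emeasure_riesz_open[OF W] by (rule riesz_open_upper)
 then have "inverse c * H g \<le> measure (riesz H) W"
  by (simp add: R.emeasure_eq_measure scale[OF g])
 then show ?thesis using c by (simp add: field_simps)
qed

lemma riesz_measurable: "f \<in> borel_measurable (riesz H) \<longleftrightarrow> f \<in> borel_measurable M" for f :: "'a \<Rightarrow> real"
 by (simp add: measurable_cong_sets[OF riesz_sets refl])

lemma integrable_riesz:
 fixes f :: "'a \<Rightarrow> real"
 assumes "f \<in> borel_measurable M" "\<And>x. x \<in> X ==> \<bar>f x\<bar> \<le> c"
 shows "integrable (riesz H) f"
proof -
 interpret R: finite_measure "riesz H" by (rule finite_riesz)
 show ?thesis using assms by (intro R.integrable_const_bound[of _ c]) (auto simp: riesz_measurable riesz_space intro!: AE_I2)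
qed

text \<open>Layer-cake estimate. Cut g into slices of height c = 1/(n+1). Both the functional and
  the integral of slice k lie between \<open>c * a (k + 2)\<close> and \<open>c * a k\<close>, where
  \<open>a k\<close> is the measure of \<open>W k\<close>. The differences telescope with step 2, so
  the total error is at most 2bc.\<close>

lemma integral_riesz_unit:
 assumes g: "g \<in> core" "\<And>x. x \<in> X ==> 0 \<le> g x \<and> g x \<le> 1"
 shows "(\<integral>x. g x \<partial>riesz H) = H g"
proof -
 interpret R: finite_measure "riesz H" by (rule finite_riesz)
 define b where "b = measure (riesz H) X"
 obtain K where K: "compact K" "K \<subseteq> X" "\<And>x. x \<in> X - K ==> g x = 0" using core_support[OF g(1)] by blast
 have est: "\<bar>H g - (\<integral>x. g x \<partial>riesz H)\<bar> \<le> 2 * b * inverse (real (Suc n))" for n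
 proof -
  define c where "c = inverse (real (Suc n))"
  have c: "c > 0" "real (Suc n) * c = 1" by (auto simp: c_def)
  define s where "s k = (\<lambda>x. min c (max 0 (g x - real k * c)))" for k
  have sc: "s k \<in> core" for k
   unfolding s_def
   by (rule core_contraction[OF g(1), of "\<lambda>t. min c (max 0 (t - real k * c))"]) (use c(1) slice_contraction in auto)
  have sr: "0 \<le> s k x \<and> s k x \<le> c" for k x using c(1) by (auto simp: s_def)
  define U where "U k = {x \<in> X. g x > real k * c}" for k
  have Uo: "open (U k)" for k
  proof -
   have "openin (top_of_set X) (X \<inter> g -` {real k * c<..})"
    by (intro continuous_openin_preimage_gen core_continuous g) auto
   moreover have "X \<inter> g -` {real k * c<..} = U k" by (auto simp: U_def)
   ultimately show ?thesis using openin_X by (simp add: space_M)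
  qed
  \<comment> \<open>The index is shifted by one level: slice k is supported in the closed set where
    \<open>g >= k * c\<close>, which must lie inside an open set, namely where
    \<open>g > (k - 1) * c\<close>. For k = 0 this is all of \<open>X\<close>.\<close>
  define W where "W k = (case k of 0 \<Rightarrow> X | Suc j \<Rightarrow> U j)" for k
  have W: "open (W k)" "W k \<subseteq> X" for k using Uo open_X by (auto simp: W_def U_def split: nat.split)
  have Wm: "W k \<in> sets (riesz H)" for k using W[of k] by (simp add: riesz_sets sets_M_iff)
  have low: "c \<le> s k x" if "x \<in> W (Suc (Suc k))" for k x
  proof -
   have "real (Suc k) * c < g x" using that by (simp add: W_def U_def)
   then show ?thesis using c(1) by (simp add: s_def algebra_simps)
  qed
  have sup: "x \<in> W k" if "x \<in> X" "g x > real k * c" for k x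
  proof (cases k)
   case (Suc j)
   have "real j * c \<le> real k * c" using c(1) Suc by (intro mult_right_mono) auto
   then show ?thesis using that Suc by (simp add: W_def U_def)
  qed (use that in "simp add: W_def")
  define a where "a k = measure (riesz H) (W k)" for k
  have L1: "c * a (Suc (Suc k)) \<le> H (s k)" for k
   unfolding a_def using low sr by (intro supported_cmult_le c sc W) auto
  have L2: "H (s k) \<le> c * a k" for k
  proof -
   \<comment> \<open>A compact set carrying slice k. For k = 0 the condition \<open>g >= 0\<close>
     holds everywhere, so the support \<open>K\<close> of g itself is taken.\<close>
   define J where "J = (case k of 0 \<Rightarrow> K | Suc j \<Rightarrow> K \<inter> g -` {real k * c..})"
   have "closedin (top_of_set K) (K \<inter> g -` {real k * c..})"
    by (intro continuous_closedin_preimage continuous_on_subset[OF core_continuous[OF g(1)] K(2)]) auto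
   then have "compact (K \<inter> g -` {real k * c..})" by (rule closedin_compact[OF K(1)])
   then have "compact J" using K(1) by (cases k) (simp_all add: J_def)
   moreover have "J \<subseteq> W k"
   proof (cases k)
    case (Suc j)
    show ?thesis
    proof
     fix x assume "x \<in> J"
     then have x: "x \<in> K" "real k * c \<le> g x" by (auto simp: J_def Suc)
     have "real j * c < real k * c" using c(1) Suc by (intro mult_strict_right_mono) auto
     then show "x \<in> W k" using x K(2) by (auto simp: W_def U_def Suc)
    qed
   qed (use K in "simp add: J_def W_def")
   moreover have "s k x = 0" if xJ: "x \<in> X - J" for x
   proof (cases "x \<in> K")
    case True
    then have "g x < real k * c" using xJ by (cases k) (auto simp: J_def)
    then show ?thesis using c(1) by (simp add: s_def)
   next
    case False
    then have "g x = 0" using K(3) that by blast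
    then show ?thesis using c(1) by (simp add: s_def)
   qed
   ultimately show ?thesis unfolding a_def using sr by (intro supported_cmult_ge[where K = J] c sc W) auto
  qed
  have int: "integrable (riesz H) (s k)" for k
   using sr by (intro integrable_riesz[where c = c] core_measurable sc) auto
  have iW: "integrable (riesz H) (\<lambda>x. c * indicator (W k) x)" for k
   using Wm by (intro integrable_mult_right R.integrable_const_bound[where B = 1]) (auto simp: indicator_def)
  have iW': "(\<integral>x. c * indicator (W k) x \<partial>riesz H) = c * a k" for k
  proof -
   have "W k \<inter> space (riesz H) = W k" using W(2)[of k] by (auto simp: riesz_space)
   then show ?thesis by (simp add: a_def)
  qed
  have I1: "c * a (Suc (Suc k)) \<le> (\<integral>x. s k x \<partial>riesz H)" for k
   unfolding iW'[symmetric] by (intro integral_mono iW int) (use low sr in "auto simp: indicator_def")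
  have I2: "(\<integral>x. s k x \<partial>riesz H) \<le> c * a k" for k
   unfolding iW'[symmetric]
  proof (intro integral_mono iW int)
   fix x assume "x \<in> space (riesz H)"
   then have x: "x \<in> X" by (simp add: riesz_space)
   show "s k x \<le> c * indicator (W k) x"
   proof (cases "g x > real k * c")
    case True
    then show ?thesis using sup[OF x True] sr[of k x] by simp
   next
    case False
    then have "s k x = 0" using c(1) by (simp add: s_def)
    then show ?thesis using c(1) by simp
   qed
  qed
  have gs: "g x = (\<Sum>k<Suc n. s k x)" if "x \<in> X" for x
   using sum_slices[of "g x" c "Suc n"] g(2)[OF that] c by (simp add: s_def del: of_nat_Suc sum.lessThan_Suc)
  have sumc: "(\<lambda>x. \<Sum>k<Suc n. s k x) \<in> core" "H (\<lambda>x. \<Sum>k<Suc n. s k x) = (\<Sum>k<Suc n. H (s k))"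
   using sum[of "{..<Suc n}" s] sc by auto
  have "H g = H (\<lambda>x. \<Sum>k<Suc n. s k x)"
   by (intro antisym mono g sumc) (simp_all only: gs order_refl)
  then have Lg: "H g = (\<Sum>k<Suc n. H (s k))" using sumc(2) by simp
  have "(\<integral>x. g x \<partial>riesz H) = (\<integral>x. (\<Sum>k<Suc n. s k x) \<partial>riesz H)"
   by (intro Bochner_Integration.integral_cong) (simp_all only: gs riesz_space)
  also have "\<dots> = (\<Sum>k<Suc n. \<integral>x. s k x \<partial>riesz H)" by (intro Bochner_Integration.integral_sum int)
  finally have Ig: "(\<integral>x. g x \<partial>riesz H) = (\<Sum>k<Suc n. \<integral>x. s k x \<partial>riesz H)" .
  have "\<bar>H g - (\<integral>x. g x \<partial>riesz H)\<bar> = \<bar>\<Sum>k<Suc n. H (s k) - (\<integral>x. s k x \<partial>riesz H)\<bar>"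
   unfolding Lg Ig by (simp add: sum_subtractf)
  also have "\<dots> \<le> (\<Sum>k<Suc n. \<bar>H (s k) - (\<integral>x. s k x \<partial>riesz H)\<bar>)" by (rule sum_abs)
  also have "\<dots> \<le> (\<Sum>k<Suc n. c * (a k - a (Suc (Suc k))))"
  proof (rule sum_mono)
   fix k
   show "\<bar>H (s k) - (\<integral>x. s k x \<partial>riesz H)\<bar> \<le> c * (a k - a (Suc (Suc k)))"
    using L1[of k] L2[of k] I1[of k] I2[of k] by (simp add: right_diff_distrib abs_le_iff)
  qed
  also have "\<dots> = c * (a 0 + a 1 - a (Suc n) - a (Suc (Suc n)))"
   by (simp only: sum_distrib_left[symmetric] sum_telescope_2)
  also have "\<dots> \<le> c * (2 * b)"
  proof (rule mult_left_mono)
   have "a k \<le> b" "0 \<le> a k" for k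
    unfolding a_def b_def using W(2)[of k] Wm[of k] Wm[of 0]
    by (auto intro!: R.finite_measure_mono simp: W_def)
   then show "a 0 + a 1 - a (Suc n) - a (Suc (Suc n)) \<le> 2 * b"
    by (smt (verit))
  qed (use c in simp)
  finally show ?thesis by (simp add: c_def mult.commute)
 qed
 have "(\<lambda>n. 2 * b * inverse (real (Suc n))) ----> 2 * b * 0"
  by (intro tendsto_mult tendsto_const LIMSEQ_inverse_real_of_nat)
 then have "\<bar>H g - (\<integral>x. g x \<partial>riesz H)\<bar> \<le> 2 * b * 0"
  by (rule LIMSEQ_le_const) (use est in blast)
 then show ?thesis by simp
qed

lemma integral_riesz:
 assumes g: "g \<in> core"
 shows "(\<integral>x. g x \<partial>riesz H) = H g"
proof -
 obtain c0 where c0: "c0 \<ge> 0" "\<And>x. x \<in> X ==> \<bar>g x\<bar> \<le> c0" using core_bounded[OF g] by blast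
 define c where "c = c0 + 1"
 have c: "c > 0" "\<bar>g x\<bar> \<le> c" if "x \<in> X" for x
  using c0(2)[OF that] by (auto simp: c_def)
 have c1: "c > 0" using c0(1) by (simp add: c_def)
 let ?p = "\<lambda>x. inverse c * max 0 (g x)" and ?q = "\<lambda>x. inverse c * max 0 (- g x)"
 have cp: "(\<lambda>x. max 0 (g x)) \<in> core" "(\<lambda>x. max 0 (- g x)) \<in> core"
  using core_contraction[OF g, of "\<lambda>t. max 0 t"] core_contraction[OF g, of "\<lambda>t. max 0 (- t)"] by (auto simp: max_def abs_if)
 have p: "?p \<in> core" "?q \<in> core" by (intro core_scale cp)+
 have r: "0 \<le> ?p x \<and> ?p x \<le> 1" "0 \<le> ?q x \<and> ?q x \<le> 1" if "x \<in> X" for x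
  using c(2)[OF that] c1 by (auto simp: field_simps abs_le_iff max_def)
 have eq: "g = (\<lambda>x. c * (?p x - ?q x))" using c1 by (auto simp: fun_eq_iff max_def)
 have i: "integrable (riesz H) ?p" "integrable (riesz H) ?q"
  using r by (intro integrable_riesz[where c = 1] core_measurable p; auto simp: abs_le_iff)+
 have "(\<integral>x. g x \<partial>riesz H) = c * ((\<integral>x. ?p x \<partial>riesz H) - (\<integral>x. ?q x \<partial>riesz H))"
  using i by (subst eq) (simp only: integral_mult_right_zero Bochner_Integration.integral_diff)
 also have "\<dots> = c * (H ?p - H ?q)"
  using integral_riesz_unit[OF p(1) r(1)] integral_riesz_unit[OF p(2) r(2)] by simp
 also have "\<dots> = H (\<lambda>x. c * (?p x - ?q x))" using scale[OF core_diff[OF p]] diff[OF p] by simp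
 also have "\<dots> = H g" using eq by simp
 finally show ?thesis .
qed

text \<open>No regularity of the other measure is assumed. On open sets it is determined by its
  integrals: compact exhaustion with cutoffs gives one inequality, test functions below the
  indicator the other. Open sets form a generator stable under intersection, and \<open>X\<close>
  has finite measure.\<close>

lemma riesz_unique:
 assumes \<mu>: "radon_measure_on X \<mu>" and eq: "\<And>g. g \<in> core ==> (\<integral>x. g x \<partial>\<mu>) = H g"
 shows "\<mu> = riesz H"
proof -
 have s: "sets \<mu> = sets M" using \<mu> sets_M by (simp add: radon_measure_on_def)
 have sp: "space \<mu> = X" using sets_eq_imp_space_eq[OF s] space_M by simp
 have meas: "g \<in> borel_measurable \<mu>" if "g \<in> core" for g
  using core_measurable[OF that] by (simp add: measurable_cong_sets[OF s refl])
 have opn: "emeasure \<mu> U = riesz_open H U" if U: "open U" "U \<subseteq> X" for U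
 proof (rule antisym)
  obtain K where K: "\<And>n. compact (K n)" "incseq K" "(\<Union>n. K n) = U"
   by (rule compact_exhaustion[OF U(1)], rule that)
  have KU: "K n \<subseteq> U" for n using K(3) by auto
  have Ks: "K n \<in> sets \<mu>" for n using K(1)[of n] KU[of n] U(2) unfolding s sets_M_iff by (auto intro: borel_compact)
  have "emeasure \<mu> (K n) \<le> riesz_open H U" for n
  proof -
   obtain \<phi> V L where \<phi>: "\<phi> \<in> core" "\<And>x. x \<in> X ==> 0 \<le> \<phi> x \<and> \<phi> x \<le> 1" "K n \<subseteq> V" "compact L" "L \<subseteq> U"
    "\<And>x. x \<in> V ==> \<phi> x = 1" "\<And>x. x \<in> X - L ==> \<phi> x = 0"
    by (rule cutoff[OF K(1)[of n] KU U]) blast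
   have Ls: "L \<in> sets \<mu>" using \<phi>(4,5) U(2) unfolding s sets_M_iff by (auto intro: borel_compact)
   have Lf: "emeasure \<mu> L < \<infinity>" using \<mu> \<phi>(4,5) U(2) unfolding radon_measure_on_def by blast
   have nn: "emeasure \<mu> (K n) \<le> (\<integral>\<^sup>+x. ennreal (\<phi> x) \<partial>\<mu>)"
   proof -
    have "emeasure \<mu> (K n) = (\<integral>\<^sup>+x. indicator (K n) x \<partial>\<mu>)" using Ks by simp
    also have "\<dots> \<le> (\<integral>\<^sup>+x. ennreal (\<phi> x) \<partial>\<mu>)"
     using \<phi>(3,6) by (intro nn_integral_mono) (auto simp: indicator_def)
    finally show ?thesis .
   qed
   have "(\<integral>\<^sup>+x. ennreal (\<phi> x) \<partial>\<mu>) \<le> (\<integral>\<^sup>+x. indicator L x \<partial>\<mu>)"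
   proof (rule nn_integral_mono)
    fix x assume "x \<in> space \<mu>"
    then have "x \<in> X" by (simp add: sp)
    then show "ennreal (\<phi> x) \<le> indicator L x"
     using \<phi>(2)[of x] \<phi>(7)[of x] by (cases "x \<in> L") (auto intro: ennreal_leI[of _ 1, simplified])
   qed
   also have "\<dots> < \<infinity>" using Lf Ls by simp
   finally have fin: "(\<integral>\<^sup>+x. ennreal (\<phi> x) \<partial>\<mu>) < \<infinity>" .
   have "(\<integral>x. \<phi> x \<partial>\<mu>) = enn2real (\<integral>\<^sup>+x. ennreal (\<phi> x) \<partial>\<mu>)"
    using meas[OF \<phi>(1)] \<phi>(2) by (intro integral_eq_nn_integral) (auto intro!: AE_I2 simp: sp)
   then have "(\<integral>\<^sup>+x. ennreal (\<phi> x) \<partial>\<mu>) = ennreal (H \<phi>)"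
    using fin eq[OF \<phi>(1)] by (simp add: less_top)
   moreover have "\<phi> \<in> supported U" unfolding supported_def using \<phi> by blast
   ultimately show ?thesis using nn riesz_open_upper by (metis order_trans)
  qed
  moreover have "(\<lambda>n. emeasure \<mu> (K n)) ----> emeasure \<mu> (\<Union>n. K n)"
   using Ks K(2) by (intro Lim_emeasure_incseq) auto
  ultimately show "emeasure \<mu> U \<le> riesz_open H U" unfolding K(3) by (intro LIMSEQ_le_const2) auto
  have Us: "U \<in> sets \<mu>" using U by (simp add: s sets_M_iff)
  show "riesz_open H U \<le> emeasure \<mu> U"
   unfolding riesz_open_def
  proof (rule SUP_least)
   fix g assume "g \<in> supported U"
   then obtain K where g: "g \<in> core" "\<forall>x\<in>X. 0 \<le> g x \<and> g x \<le> 1" and K: "K \<subseteq> U" "\<forall>x\<in>X - K. g x = 0"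
    unfolding supported_def by blast
   have "(\<integral>x. g x \<partial>\<mu>) = enn2real (\<integral>\<^sup>+x. ennreal (g x) \<partial>\<mu>)"
    using meas[OF g(1)] g(2) by (intro integral_eq_nn_integral) (auto intro!: AE_I2 simp: sp)
   then have "ennreal (H g) \<le> (\<integral>\<^sup>+x. ennreal (g x) \<partial>\<mu>)"
    using eq[OF g(1)] by (cases "\<integral>\<^sup>+x. ennreal (g x) \<partial>\<mu>") auto
   also have "\<dots> \<le> (\<integral>\<^sup>+x. indicator U x \<partial>\<mu>)"
   proof (rule nn_integral_mono)
    fix x assume "x \<in> space \<mu>"
    then have x: "x \<in> X" by (simp add: sp)
    show "ennreal (g x) \<le> indicator U x"
    proof (cases "x \<in> U")
     case True
     then show ?thesis using g(2) x ennreal_leI[of "g x" 1] by simp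
    next
     case False
     then have "g x = 0" using K x by blast
     then show ?thesis by simp
    qed
   qed
   also have "\<dots> = emeasure \<mu> U" using Us by simp
   finally show "ennreal (H g) \<le> emeasure \<mu> U" .
  qed
 qed
 show ?thesis
 proof (rule measure_eqI_generator_eq[where E = "{U. open U \<and> U \<subseteq> X}" and \<Omega> = X and A = "\<lambda>_. X"])
  show "Int_stable {U. open U \<and> U \<subseteq> X}" by (auto simp: Int_stable_def)
  show "{U. open U \<and> U \<subseteq> X} \<subseteq> Pow X" by auto
  show "emeasure \<mu> U = emeasure (riesz H) U" if "U \<in> {U. open U \<and> U \<subseteq> X}" for U
   using that opn emeasure_riesz_open by simp
  show "sets \<mu> = sigma_sets X {U. open U \<and> U \<subseteq> X}" "sets (riesz H) = sigma_sets X {U. open U \<and> U \<subseteq> X}"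
   using s riesz_sets sets_M_sigma by auto
  show "range (\<lambda>_::nat. X) \<subseteq> {U. open U \<and> U \<subseteq> X}" using open_X by auto
  show "emeasure \<mu> X \<noteq> \<infinity>" for i :: nat
   using opn[OF open_X order_refl] riesz_open_finite[of X] by (auto simp: top_unique)
 qed simp
qed

end

section \<open>Comparison of Riesz measures, and truncation in the energy\<close>

context regular_form_space
begin

text \<open>Open covers of a subset of \<open>W\<close> may be intersected with \<open>W\<close>, so
  only the values of the functional on test functions supported in \<open>W\<close> matter. Locality
  of energy measures is read off from this.\<close>

lemma riesz_outer_local:
 assumes W: "open W" "W \<subseteq> X" and eq: "\<And>g. g \<in> supported W ==> H g = H' g" and A: "A \<subseteq> W"
 shows "riesz_outer H A = riesz_outer H' A"
proof -
 have *: "riesz_outer H A \<le> riesz_outer H' A" if eq: "\<And>g. g \<in> supported W ==> H g = H' g" for H H'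
  unfolding riesz_outer_def[of H']
 proof (rule INF_greatest)
  fix U assume "U \<in> {U. open U \<and> U \<subseteq> X \<and> A \<subseteq> U}"
  then have U: "open U" "U \<subseteq> X" "A \<subseteq> U" by auto
  have "riesz_outer H A \<le> riesz_open H (U \<inter> W)"
   unfolding riesz_outer_def using U W A by (intro INF_lower) auto
  also have "riesz_open H (U \<inter> W) = riesz_open H' (U \<inter> W)"
   unfolding riesz_open_def
  proof (rule SUP_cong[OF refl])
   fix g assume "g \<in> supported (U \<inter> W)"
   then have "g \<in> supported W" using supported_mono[of "U \<inter> W" W] by blast
   then show "ennreal (H g) = ennreal (H' g)" using eq by simp
  qed
  also have "\<dots> \<le> riesz_open H' U" by (rule riesz_open_mono) blast
  finally show "riesz_outer H A \<le> riesz_open H' U" .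
 qed
 show ?thesis by (intro antisym *) (use eq in auto)
qed

lemma riesz_outer_functional_mono:
 assumes "\<And>g. g \<in> supported X ==> H g \<le> H' g"
 shows "riesz_outer H A \<le> riesz_outer H' A"
 unfolding riesz_outer_def
proof (rule INF_mono)
 fix U assume U: "U \<in> {U. open U \<and> U \<subseteq> X \<and> A \<subseteq> U}"
 have "riesz_open H U \<le> riesz_open H' U"
  unfolding riesz_open_def
 proof (rule SUP_mono)
  fix g assume "g \<in> supported U"
  then have "g \<in> supported X" "g \<in> supported U" using supported_mono[of U X] U by auto
  then show "\<exists>h\<in>supported U. ennreal (H g) \<le> ennreal (H' h)" using assms ennreal_leI by blast
 qed
 with U show "\<exists>V\<in>{U. open U \<and> U \<subseteq> X \<and> A \<subseteq> U}. riesz_open H V \<le> riesz_open H' U" by blast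
qed

lemma quasi_continuous_continuous:
 assumes "continuous_on X g" shows "quasi_continuous M E F g"
 unfolding quasi_continuous_def space_M
 using assms cap_empty by (auto intro!: exI[of _ "{}"])

lemma quasi_continuous_mult:
 assumes "quasi_continuous M E F g" "continuous_on X h" shows "quasi_continuous M E F (\<lambda>x. g x * h x)"
 unfolding quasi_continuous_def space_M
proof (intro allI impI)
 fix e :: real assume "e > 0"
 then obtain U where "openin (top_of_set X) U" "cap U < ennreal e" "continuous_on (X - U) g"
  using assms(1) unfolding quasi_continuous_def space_M by blast
 moreover have "continuous_on (X - U) h" by (rule continuous_on_subset[OF assms(2)]) auto
 ultimately show "\<exists>U. openin (top_of_set X) U \<and> cap U < ennreal e \<and> continuous_on (X - U) (\<lambda>x. g x * h x)"
  by (blast intro: continuous_on_mult)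
qed

lemma truncate_measurable: "f \<in> borel_measurable M ==> truncate c f \<in> borel_measurable M" for f :: "'a \<Rightarrow> real"
 unfolding truncate_def[abs_def] by (intro borel_measurable_max borel_measurable_min borel_measurable_const)

lemma truncate_tendsto_L2:
 assumes u: "u \<in> F"
 shows "L2_tendsto M (\<lambda>n. truncate (real n) u) u"
proof (rule L2_dominated_convergence(1)[where h = u and c = 1])
 show "AE x in M. (\<lambda>n. truncate (real n) u x) ----> u x"
 proof (rule AE_I2)
  fix x
  obtain N :: nat where N: "\<bar>u x\<bar> \<le> real N" using real_arch_simple by blast
  have "truncate (real n) u x = u x" if "n \<ge> N" for n
   using N that by (auto simp: truncate_def abs_le_iff)
  then show "(\<lambda>n. truncate (real n) u x) ----> u x"
   by (intro tendsto_eventually) (auto simp: eventually_sequentially)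
 qed
 show "truncate (real n) u \<in> borel_measurable M" for n by (rule truncate_measurable[OF F_measurable[OF u]])
 show "u \<in> borel_measurable M" "u \<in> L2_space M" using u by (auto intro: F_measurable F_L2)
 show "AE x in M. \<bar>truncate (real n) u x\<bar> \<le> 1 * \<bar>u x\<bar>" for n by (simp add: truncate_le)
qed

text \<open>Truncation does not raise energy, so
  \<open>E (u - T u) <= 2 * (E u u - E (T u) u)\<close>, and the right side tends to 0 by weak
  convergence alone.\<close>

lemma truncate_tendsto_E:
 assumes u: "u \<in> F"
 shows "(\<lambda>n. quad E (\<lambda>x. u x - truncate (real n) u x)) ----> 0"
proof -
 have t: "truncate (real n) u \<in> F" "E (truncate (real n) u) (truncate (real n) u) \<le> E u u" for n
  using truncate_in[OF u] by auto
 have "(\<lambda>n. E (truncate (real n) u) u) ----> E u u"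
  by (rule weak_convergence(2)[OF t F_L2[OF u] truncate_tendsto_L2[OF u] u])
 then have "(\<lambda>n. 2 * (E u u - E (truncate (real n) u) u)) ----> 2 * (E u u - E u u)"
  by (intro tendsto_intros)
 then have l: "(\<lambda>n. 2 * (E u u - E (truncate (real n) u) u)) ----> 0" by simp
 show ?thesis
 proof (rule LIMSEQ_null_bounded[OF l])
  fix n
  have "quad E (\<lambda>x. u x - truncate (real n) u x) \<le> 2 * (E u u - E (truncate (real n) u) u)"
   using t(2)[of n] form.B_square_diff[OF u t(1)[of n]] form_sym[OF u t(1)[of n]] by simp
  then show "\<bar>E (\<lambda>x. u x - truncate (real n) u x) (\<lambda>x. u x - truncate (real n) u x)\<bar> \<le> 2 * (E u u - E (truncate (real n) u) u)"
   using form_nonneg[OF form.V_diff[OF u t(1)[of n]]] by simp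
 qed
qed

lemma sigma_finite_M: "sigma_finite_measure M"
proof
 obtain K where K: "\<And>n. compact (K n)" "incseq K" "(\<Union>n. K n) = X"
  by (rule compact_exhaustion[OF open_X], rule that)
 have KX: "K n \<subseteq> X" for n using K(3) by auto
 show "\<exists>A. countable A \<and> A \<subseteq> sets M \<and> \<Union>A = space M \<and> (\<forall>a\<in>A. emeasure M a \<noteq> \<infinity>)"
 proof (intro exI[of _ "range K"] conjI ballI)
  show "range K \<subseteq> sets M" using borel_compact[OF K(1)] KX by (auto simp: sets_M_iff)
  show "\<Union>(range K) = space M" using K(3) by (simp add: space_M)
  show "emeasure M a \<noteq> \<infinity>" if a: "a \<in> range K" for a
  proof -
   obtain n where "a = K n" using a by blast
   then show ?thesis using K(1)[of n] KX[of n] radon unfolding radon_measure_on_def by auto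
  qed
 qed simp
qed

end

section \<open>Energy measures of strongly local forms\<close>

locale local_form_space = regular_form_space M E F X
 for M :: "'a::polish_space measure" and E F X +
 assumes strongly_local: "strongly_local M E F"
begin

text \<open>The essential support is \<open>K\<close> minus the union of all open sets on which v
  vanishes a.e., hence closed in a compact set. The union may be uncountable, but only its openness
  is used.\<close>

lemma ess_support_compact:
 assumes K: "compact K" "K \<subseteq> X" "\<And>x. x \<in> X - K ==> v x = 0"
 shows "compact (ess_support M v)" "ess_support M v \<subseteq> K"
proof -
 define N where "N = \<Union>{U. open U \<and> U \<subseteq> X \<and> (AE y in M. y \<in> U \<longrightarrow> v y = 0)}"
 have eq: "ess_support M v = X - N"
  unfolding ess_support_def openin_X N_def by (auto simp: space_M)
 have "X - K \<subseteq> N"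
  unfolding N_def using open_X K compact_imp_closed[OF K(1)] by (intro Union_upper) auto
 then have eq2: "ess_support M v = K - N" using eq K(2) by auto
 show "ess_support M v \<subseteq> K" using eq2 by auto
 have "open N" unfolding N_def by (intro open_Union) auto
 then show "compact (ess_support M v)" unfolding eq2 using K(1) by (intro compact_diff)
qed

lemma strong_locality:
 assumes u: "u \<in> F" "compact K" "K \<subseteq> X" "\<And>x. x \<in> X - K ==> u x = 0"
  and v: "v \<in> F" "compact L" "L \<subseteq> X" "\<And>x. x \<in> X - L ==> v x = 0"
  and V: "open V" "V \<subseteq> X" "K \<subseteq> V" "\<And>x. x \<in> V ==> v x = 0"
 shows "E u v = 0"
proof -
 have su: "compact (ess_support M u)" "ess_support M u \<subseteq> K"
  using ess_support_compact[where v = u, OF u(2-4)] by auto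
 have sv: "compact (ess_support M v)"
  by (rule ess_support_compact(1)[where v = v, OF v(2-4)])
 have "openin (top_of_set (space M)) V \<and> ess_support M u \<subseteq> V \<and> (AE y in M. y \<in> V \<longrightarrow> v y = 0)"
  using V su(2) openin_X by auto
 then have "\<exists>U c. openin (top_of_set (space M)) U \<and> ess_support M u \<subseteq> U \<and> (AE y in M. y \<in> U \<longrightarrow> v y = c)"
  by blast
 then show ?thesis
  using strongly_local u(1) v(1) su(1) sv unfolding strongly_local_def by blast
qed

text \<open>f itself has no compact support, so strong locality is applied to core approximants:
  \<open>s n - s n * \<phi>\<close> vanishes near the support of v and is orthogonal to it. Uniform
  bounds keep the energies of the products bounded, and weak convergence passes to f.\<close>

lemma form_cutoff:
 assumes f: "f \<in> F" "\<And>x. x \<in> X ==> \<bar>f x\<bar> \<le> c" "c \<ge> 0"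
  and v: "v \<in> F" "compact K" "K \<subseteq> X" "\<And>x. x \<in> X - K ==> v x = 0"
  and V: "open V" "V \<subseteq> X" "K \<subseteq> V"
  and \<phi>: "\<phi> \<in> core" "\<And>x. x \<in> X ==> 0 \<le> \<phi> x \<and> \<phi> x \<le> 1" "\<And>x. x \<in> V ==> \<phi> x = 1"
 shows "(\<lambda>x. f x * \<phi> x) \<in> F" "E (\<lambda>x. f x * \<phi> x) v = E f v"
proof -
 note \<phi>F = core_F[OF \<phi>(1)]
 have \<phi>b: "\<bar>\<phi> x\<bar> \<le> 1" if "x \<in> space M" for x using \<phi>(2)[of x] that by (simp add: space_M)
 have fb: "\<bar>f x\<bar> \<le> c" if "x \<in> space M" for x using f(2)[of x] that by (simp add: space_M)
 show fphi: "(\<lambda>x. f x * \<phi> x) \<in> F" by (rule mult_in(1)[OF f(1) \<phi>F fb \<phi>b])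
 have fAE: "AE x in M. \<bar>f x\<bar> \<le> c" using fb by (intro AE_I2)
 obtain s where s: "\<And>n. s n \<in> core" "\<And>n x. x \<in> X ==> \<bar>s n x\<bar> \<le> c"
  "form_tendsto E1 s f"
  by (rule core_sequence_bounded[OF f(1) fAE f(3)], rule that)
 note sF = s(1)[THEN core_F]
 obtain B where B: "\<And>n. E (s n) (s n) \<le> B" using form_bounded_of_tendsto[OF sF f(1) E1_tendsto_E[OF sF f(1) s(3)]] by blast
 have sb: "\<bar>s n x\<bar> \<le> c" if "x \<in> space M" for n x using s(2)[of x n] that by (simp add: space_M)
 have sphi: "(\<lambda>x. s n x * \<phi> x) \<in> F" for n by (rule mult_in(1)[OF sF \<phi>F sb \<phi>b])
 have sphi_b: "quad E (\<lambda>x. s n x * \<phi> x) \<le> 8 * B + 8 * c\<^sup>2 * E \<phi> \<phi>" for n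
  using mult_in(2)[OF sF \<phi>F sb \<phi>b, of n] B[of n] by simp
 define w where "w n = (\<lambda>x. s n x - s n x * \<phi> x)" for n
 have wc: "w n \<in> core" for n unfolding w_def by (intro core_diff core_mult s \<phi>)
 have w0: "E v (w n) = 0" for n
 proof -
  obtain L where L: "compact L" "L \<subseteq> X" "\<forall>x\<in>X - L. w n x = 0" using core_support[OF wc] by blast
  show ?thesis
   by (rule strong_locality[OF v core_F[OF wc] L(1,2) _ V]) (use L(3) \<phi>(3) in "auto simp: w_def")
 qed
 have lim: "(\<lambda>n. E (w n) v) ----> E (\<lambda>x. f x - f x * \<phi> x) v"
 proof (rule weak_convergence(2)[OF core_F[OF wc] _ _ _ v(1)])
  show "E (w n) (w n) \<le> 2 * B + 2 * (8 * B + 8 * c\<^sup>2 * E \<phi> \<phi>)" for n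
   using form.square_diff_le[OF sF[of n] sphi[of n]] B[of n] sphi_b[of n] by (simp add: w_def)
  show "(\<lambda>x. f x - f x * \<phi> x) \<in> L2_space M" by (intro F_L2 form.V_diff f fphi)
  show "L2_tendsto M w (\<lambda>x. f x - f x * \<phi> x)"
  proof (rule L2_tendsto_le[where t = s and g = f])
   show "AE x in M. \<bar>w n x - (f x - f x * \<phi> x)\<bar> \<le> \<bar>s n x - f x\<bar>" for n
   proof (rule AE_I2)
    fix x assume "x \<in> space M"
    then have x: "0 \<le> \<phi> x" "\<phi> x \<le> 1" using \<phi>(2)[of x] by (auto simp: space_M)
    have "w n x - (f x - f x * \<phi> x) = (s n x - f x) * (1 - \<phi> x)" by (simp add: w_def algebra_simps)
    moreover have "\<bar>s n x - f x\<bar> * \<bar>1 - \<phi> x\<bar> \<le> \<bar>s n x - f x\<bar> * 1" using x by (intro mult_left_mono) auto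
    ultimately show "\<bar>w n x - (f x - f x * \<phi> x)\<bar> \<le> \<bar>s n x - f x\<bar>" by (simp add: abs_mult)
   qed
  qed (use sF f(1) fphi core_F[OF wc] E1_tendsto_L2[OF sF f(1) s(3)] in "auto intro!: F_L2 form.V_diff")
 qed
 have "E (w n) v = 0" for n using w0[of n] form_sym[OF core_F[OF wc] v(1)] by simp
 with lim have "E (\<lambda>x. f x - f x * \<phi> x) v = 0" by (simp add: LIMSEQ_const_iff)
 then show "E (\<lambda>x. f x * \<phi> x) v = E f v" using form.B_diffl[OF f(1) fphi v(1)] by simp
qed

lemma core_cutoff:
 assumes "compact K" "K \<subseteq> W" "open W" "W \<subseteq> X"
 obtains \<phi> V L where "\<phi> \<in> core" "\<And>x. x \<in> X ==> 0 \<le> \<phi> x \<and> \<phi> x \<le> 1" "open V" "V \<subseteq> X" "K \<subseteq> V" "L \<subseteq> W"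
  "\<And>x. x \<in> V ==> \<phi> x = 1" "\<And>x. x \<in> X - L ==> \<phi> x = 0"
proof (rule cutoff[OF assms])
 fix \<phi> V L
 assume a: "\<phi> \<in> core" "\<And>x. x \<in> X ==> 0 \<le> \<phi> x \<and> \<phi> x \<le> 1" "open V" "K \<subseteq> V" "V \<subseteq> L" "compact L" "L \<subseteq> W"
  "\<And>x. x \<in> V ==> \<phi> x = 1" "\<And>x. x \<in> X - L ==> \<phi> x = 0"
 have VX: "V \<subseteq> X" using a(5,7) assms(4) by auto
 show thesis by (rule that[OF a(1,2,3) VX a(4,7,8,9)])
qed

text \<open>Almost everywhere convergence does not give L2 convergence on a space of infinite
  measure. Since v has compact support, \<open>z n\<close> may be cut off near it, and then it is
  dominated by a multiple of the cutoff, which is square integrable.\<close>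

lemma bounded_weak_null:
 assumes z: "\<And>n. z n \<in> F" "\<And>n x. x \<in> X ==> \<bar>z n x\<bar> \<le> c" "\<And>n. E (z n) (z n) \<le> B" "c \<ge> 0"
  and lim: "AE x in M. (\<lambda>n. z n x) ----> 0" and v: "v \<in> core"
 shows "(\<lambda>n. E (z n) v) ----> 0"
proof -
 obtain K where K: "compact K" "K \<subseteq> X" "\<And>x. x \<in> X - K ==> v x = 0" using core_support[OF v] by blast
 obtain \<phi> V L where \<phi>: "\<phi> \<in> core" "\<And>x. x \<in> X ==> 0 \<le> \<phi> x \<and> \<phi> x \<le> 1" "open V" "V \<subseteq> X" "K \<subseteq> V"
  "\<And>x. x \<in> V ==> \<phi> x = 1"
  by (rule core_cutoff[OF K(1,2) open_X order_refl], rule that)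
 note cut = form_cutoff[OF z(1,2,4) core_F[OF v] K \<phi>(3,4,5,1,2,6)]
 have "(\<lambda>n. E (\<lambda>x. z n x * \<phi> x) v) ----> E (\<lambda>x. 0) v"
 proof (rule weak_convergence(2)[OF cut(1) _ L2_zero _ core_F[OF v]])
  show "quad E (\<lambda>x. z n x * \<phi> x) \<le> 8 * B + 8 * c\<^sup>2 * E \<phi> \<phi>" for n
  proof -
   have "quad E (\<lambda>x. z n x * \<phi> x) \<le> 8 * 1\<^sup>2 * E (z n) (z n) + 8 * c\<^sup>2 * E \<phi> \<phi>"
    using z(2) \<phi>(2) by (intro mult_in(2) z core_F \<phi>) (auto simp: space_M)
   then show ?thesis using z(3)[of n] by simp
  qed
  show "L2_tendsto M (\<lambda>n x. z n x * \<phi> x) (\<lambda>x. 0)"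
  proof (rule L2_dominated_convergence(1)[where h = \<phi> and c = c])
   show "(\<lambda>x. z n x * \<phi> x) \<in> borel_measurable M" for n by (rule F_measurable[OF cut(1)])
   show "\<phi> \<in> L2_space M" by (intro F_L2 core_F \<phi>)
   show "AE x in M. (\<lambda>n. z n x * \<phi> x) ----> 0"
    using lim by eventually_elim (auto intro: tendsto_mult_left_zero)
   show "AE x in M. \<bar>z n x * \<phi> x\<bar> \<le> c * \<bar>\<phi> x\<bar>" for n
    using z(2) by (intro AE_I2) (auto simp: space_M abs_mult intro!: mult_right_mono)
  qed simp
 qed
 then show ?thesis using cut(2) form.B_zerol[OF core_F[OF v]] by simp
qed

text \<open>Closability along almost everywhere convergent sequences. By strong locality the energy of a
 uniformly bounded sequence can be tested locally, so the sequence is replaced by the bounded one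
 \<open>T(w\<^sub>k) + T(w\<^sub>n - w\<^sub>k)\<close> with an odd truncation \<open>T\<close>, which still tends to \<open>0\<close>.\<close>

lemma Cauchy_AE_null_weak:
 assumes w: "\<And>n. w n \<in> F" "form.Cauchy_seq w" and lim: "AE x in M. (\<lambda>n. w n x) ----> 0" and v: "v \<in> core"
 shows "(\<lambda>n. E (w n) v) ----> 0"
proof (rule LIMSEQ_I)
 fix \<eta> :: real assume \<eta>: "\<eta> > 0"
 obtain B where B: "B \<ge> 0" "\<And>n. E (w n) (w n) \<le> B" using form.Cauchy_seq_bounded[OF w(2,1)] by blast
 note vF = core_F[OF v]
 define e where "e = \<eta> / (4 * (sqrt (E v v) + 1))"
 have sv: "sqrt (E v v) \<ge> 0" using form_nonneg[OF vF] by simp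
 then have sv1: "sqrt (E v v) + 1 > 0" by linarith
 have e: "e > 0" using \<eta> sv1 by (simp add: e_def)
 have e2: "2 * e * sqrt (E v v) \<le> \<eta> / 2"
 proof -
  have "e * sqrt (E v v) \<le> e * (sqrt (E v v) + 1)" using e by (intro mult_left_mono) auto
  also have "\<dots> = \<eta> / 4"
  proof -
   have "\<eta> / (4 * S) * S = \<eta> / 4" if "S > 0" for S :: real using that by simp
   from this[OF sv1] show ?thesis unfolding e_def .
  qed
  finally show ?thesis by simp
 qed
 have ee: "e\<^sup>2 > 0" using e by simp
 obtain k where k: "\<And>n. n \<ge> k ==> quad E (\<lambda>x. w n x - w k x) < e\<^sup>2"
  using w(2)[unfolded form.Cauchy_seq_def, rule_format, OF ee] by auto
 have "\<forall>\<^sub>F m in sequentially. quad E (\<lambda>x. w k x - truncate (real m) (w k) x) < e\<^sup>2"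
  by (rule order_tendstoD(2)[OF truncate_tendsto_E[OF w(1)] ee])
 then obtain m where m: "quad E (\<lambda>x. w k x - truncate (real m) (w k) x) < e\<^sup>2"
  by (auto simp: eventually_sequentially)
 define d where "d n = (\<lambda>x. w (n + k) x - w k x)" for n
 have dF: "d n \<in> F" for n unfolding d_def by (intro form.V_diff w)
 have tF: "truncate (real m) (w k) \<in> F" "truncate (real m) (d n) \<in> F" for n using truncate_in(1) w dF by auto
 define z where "z n = (\<lambda>x. truncate (real m) (w k) x + truncate (real m) (d n) x)" for n
 have zF: "z n \<in> F" for n unfolding z_def by (intro form.V_add tF)
 have diff: "sqrt (quad E (\<lambda>x. w (n + k) x - z n x)) \<le> 2 * e" for n
 proof -
  have eq: "(\<lambda>x. w (n + k) x - z n x) = (\<lambda>x. (w k x - truncate (real m) (w k) x) + (d n x - truncate (real m) (d n) x))"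
   by (auto simp: z_def d_def)
  \<comment> \<open>The remainder \<open>t - T t\<close> of the truncation is itself a normal
    contraction, so truncating \<open>d n\<close> costs at most the energy of
    \<open>d n\<close>.\<close>
  have "quad E (\<lambda>x. d n x - truncate (real m) (d n) x) \<le> E (d n) (d n)"
   unfolding truncate_def by (rule normal_contraction(2)[OF dF, of "\<lambda>t. t - max (- real m) (min (real m) t)"]) auto
  also have "\<dots> < e\<^sup>2" unfolding d_def by (rule k) simp
  finally have "sqrt (quad E (\<lambda>x. d n x - truncate (real m) (d n) x)) \<le> e"
   using e by (intro real_le_lsqrt) auto
  moreover have "sqrt (quad E (\<lambda>x. w k x - truncate (real m) (w k) x)) \<le> e"
   using e m by (intro real_le_lsqrt) auto
  ultimately show ?thesis
   unfolding eq using form.triangle[OF form.V_diff[OF w(1)[of k] tF(1)] form.V_diff[OF dF[of n] tF(2)[of n]]] by linarith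
 qed
 have zlim: "(\<lambda>n. E (z n) v) ----> 0"
 proof (rule bounded_weak_null[OF zF _ _ _ _ v])
  show "\<bar>z n x\<bar> \<le> 2 * real m" for n x
   using truncate_bounded[of "real m" "w k" x] truncate_bounded[of "real m" "d n" x] by (simp add: z_def abs_le_iff)
  show "E (z n) (z n) \<le> 2 * B + 2 * (2 * B + 2 * B)" for n
  proof -
   have "E (z n) (z n) \<le> 2 * E (truncate (real m) (w k)) (truncate (real m) (w k)) + 2 * E (truncate (real m) (d n)) (truncate (real m) (d n))"
    unfolding z_def by (intro form.square_add_le tF)
   also have "\<dots> \<le> 2 * E (w k) (w k) + 2 * E (d n) (d n)"
    by (intro add_mono mult_left_mono truncate_in w dF) auto
   also have "\<dots> \<le> 2 * B + 2 * (2 * B + 2 * B)"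
   proof -
    have "E (d n) (d n) \<le> 2 * E (w (n + k)) (w (n + k)) + 2 * E (w k) (w k)"
     unfolding d_def by (intro form.square_diff_le w)
    then show ?thesis using B(2)[of k] B(2)[of "n + k"] by simp
   qed
   finally show ?thesis .
  qed
  show "AE x in M. (\<lambda>n. z n x) ----> 0"
   using lim
  proof eventually_elim
   case (elim x)
   have "(\<lambda>n. d n x) ----> 0 - w k x"
    unfolding d_def by (intro tendsto_diff LIMSEQ_ignore_initial_segment[OF elim] tendsto_const)
   then have "(\<lambda>n. truncate (real m) (w k) x + max (- real m) (min (real m) (d n x))) ---->
     truncate (real m) (w k) x + max (- real m) (min (real m) (0 - w k x))"
    by (intro tendsto_intros)
   moreover have "truncate (real m) (w k) x + max (- real m) (min (real m) (0 - w k x)) = 0"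
    by (auto simp: truncate_def)
   ultimately show ?case by (simp add: z_def truncate_def)
  qed
 qed simp
 have "\<forall>\<^sub>F n in sequentially. \<bar>E (z n) v\<bar> < \<eta> / 2"
  using order_tendstoD(2)[OF tendsto_rabs_zero[OF zlim], of "\<eta>/2"] \<eta> by simp
 then obtain N where N: "\<And>n. n \<ge> N ==> \<bar>E (z n) v\<bar> < \<eta> / 2" by (auto simp: eventually_sequentially)
 have b: "\<bar>E (w (n + k)) v\<bar> < \<eta>" if "n \<ge> N" for n
 proof -
  have "E (w (n + k)) v = E (z n) v + E (\<lambda>x. w (n + k) x - z n x) v"
   using form.B_diffl[OF w(1)[of "n + k"] zF[of n] vF] by simp
  moreover have "\<bar>E (\<lambda>x. w (n + k) x - z n x) v\<bar> \<le> 2 * e * sqrt (E v v)"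
   by (rule order_trans[OF form.Cauchy_Schwarz[OF form.V_diff[OF w(1) zF] vF] mult_right_mono[OF diff sv]])
  ultimately show ?thesis using N[OF that] e2 by linarith
 qed
 have "norm (E (w n) v - 0) < \<eta>" if "n \<ge> N + k" for n using b[of "n - k"] that by simp
 then show "\<exists>N. \<forall>n\<ge>N. norm (E (w n) v - 0) < \<eta>" by blast
qed

text \<open>Split \<open>E (w n) (w n)\<close> along \<open>w n - w k\<close>,
  \<open>w k - v\<close> and a core function v near \<open>w k\<close>. The first two terms are
  small by Cauchy-Schwarz, the last by the weak statement. This closability makes the extended form
  independent of approximating sequences.\<close>

lemma Cauchy_AE_null:
 assumes w: "\<And>n. w n \<in> F" "form.Cauchy_seq w" and lim: "AE x in M. (\<lambda>n. w n x) ----> 0"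
 shows "(\<lambda>n. E (w n) (w n)) ----> 0"
proof (rule LIMSEQ_I)
 fix \<eta> :: real assume \<eta>: "\<eta> > 0"
 obtain B where B: "B \<ge> 0" "\<And>n. E (w n) (w n) \<le> B" using form.Cauchy_seq_bounded[OF w(2,1)] by blast
 define S where "S = sqrt B + 1"
 have "sqrt (E (w n) (w n)) \<le> S" for n using real_sqrt_le_mono[OF B(2)[of n]] unfolding S_def by linarith
 moreover have "S > 0" using B(1) by (simp add: S_def add_nonneg_pos)
 ultimately have S: "S > 0" "\<And>n. sqrt (E (w n) (w n)) \<le> S" by auto
 define e where "e = \<eta> / (4 * S)"
 have e: "e > 0" "S * e = \<eta> / 4" using \<eta> S(1) by (auto simp: e_def)
 have ee: "e\<^sup>2 > 0" using e by simp
 obtain k where k: "\<And>n. n \<ge> k ==> quad E (\<lambda>x. w n x - w k x) < e\<^sup>2"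
  using w(2)[unfolded form.Cauchy_seq_def, rule_format, OF ee] by auto
 obtain v where v: "v \<in> core" "quad E1 (\<lambda>x. w k x - v x) < e\<^sup>2" using core_dense[OF w(1) ee] by blast
 note vF = core_F[OF v(1)]
 have kv: "quad E (\<lambda>x. w k x - v x) < e\<^sup>2"
  using E_le_E1[OF form.V_diff[OF w(1)[of k] vF]] v(2) by linarith
 have "\<forall>\<^sub>F n in sequentially. \<bar>E (w n) v\<bar> < \<eta> / 4"
  using order_tendstoD(2)[OF tendsto_rabs_zero[OF Cauchy_AE_null_weak[OF w lim v(1)]], of "\<eta>/4"] \<eta> by simp
 then obtain N where N: "\<And>n. n \<ge> N ==> \<bar>E (w n) v\<bar> < \<eta> / 4" by (auto simp: eventually_sequentially)
 have sm: "\<bar>E (w n) h\<bar> \<le> \<eta> / 4" if "h \<in> F" "E h h < e\<^sup>2" for n h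
 proof -
  have "sqrt (E h h) \<le> e" using e(1) that by (intro real_le_lsqrt) auto
  then have "sqrt (E (w n) (w n)) * sqrt (E h h) \<le> S * e"
   using S e form_nonneg[OF that(1)] by (intro mult_mono) auto
  then show ?thesis using form.Cauchy_Schwarz[OF w(1)[of n] that(1)] e(2) by linarith
 qed
 have "norm (E (w n) (w n) - 0) < \<eta>" if n: "n \<ge> max N k" for n
 proof -
  have "E (w n) (w n) = E (w n) (\<lambda>x. w n x - w k x) + E (w n) (\<lambda>x. w k x - v x) + E (w n) v"
   using form.B_diffr[OF w(1)[of n] w(1)[of k] w(1)[of n]] form.B_diffr[OF w(1)[of k] vF w(1)[of n]] by simp
  moreover have "\<bar>E (w n) (\<lambda>x. w n x - w k x)\<bar> \<le> \<eta> / 4"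
   using n by (intro sm form.V_diff w k) auto
  moreover have "\<bar>E (w n) (\<lambda>x. w k x - v x)\<bar> \<le> \<eta> / 4" by (intro sm form.V_diff w vF kv)
  moreover have "\<bar>E (w n) v\<bar> < \<eta> / 4" using N n by simp
  ultimately have "\<bar>E (w n) (w n)\<bar> < \<eta>" using \<eta> by linarith
  then show ?thesis by simp
 qed
 then show "\<exists>N. \<forall>n\<ge>N. norm (E (w n) (w n) - 0) < \<eta>" by blast
qed

section \<open>The extended Dirichlet space\<close>

lemma approximating_seqD:
 assumes "approximating_seq M E F f s"
 shows "\<And>n. s n \<in> F" "form.Cauchy_seq s" "AE x in M. (\<lambda>n. s n x) ----> f x"
 using assms by (auto simp: approximating_seq_def form.Cauchy_seq_def)

lemma approximating_seq_const: "f \<in> F ==> approximating_seq M E F f (\<lambda>n. f)"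
 unfolding approximating_seq_def using form.B_zerol[OF domain_zero] by simp

text \<open>Resolves the definite description in \<open>extended_form\<close>: two approximating
  sequences of one function differ by a Cauchy sequence tending to 0 a.e., whose energy vanishes in
  the limit, so all limits coincide.\<close>

lemma extended_form_limit:
 assumes s: "approximating_seq M E F f s" and t: "approximating_seq M E F g t"
 shows "(\<lambda>n. E (s n) (t n)) ----> extended_form M E F f g"
proof -
 note sD = approximating_seqD[OF s] and tD = approximating_seqD[OF t]
 obtain c where c: "(\<lambda>n. E (s n) (t n)) ----> c"
  using form.convergent_B[OF sD(2) tD(2) sD(1) tD(1)] unfolding convergent_def by blast
 have other: "(\<lambda>n. E (s' n) (t' n)) ----> c" if s': "approximating_seq M E F f s'" and t': "approximating_seq M E F g t'" for s' t'
 proof -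
  note sD' = approximating_seqD[OF s'] and tD' = approximating_seqD[OF t']
  have null: "(\<lambda>n. sqrt (quad E (\<lambda>x. a n x - b n x))) ----> 0"
   if a: "approximating_seq M E F h a" and b: "approximating_seq M E F h b" for h a b
  proof -
   note aD = approximating_seqD[OF a] and bD = approximating_seqD[OF b]
   have "AE x in M. (\<lambda>n. a n x - b n x) ----> 0"
    using aD(3) bD(3)
   proof eventually_elim
    case (elim x)
    then show ?case using tendsto_diff[of "\<lambda>n. a n x" "h x" sequentially "\<lambda>n. b n x" "h x"] by simp
   qed
   then have "(\<lambda>n. quad E (\<lambda>x. a n x - b n x)) ----> 0"
    by (intro Cauchy_AE_null form.V_diff aD bD form.Cauchy_seq_diff)
   then show ?thesis using tendsto_real_sqrt by fastforce
  qed
  obtain B where B: "\<And>n. E (t n) (t n) \<le> B" using form.Cauchy_seq_bounded[OF tD(2,1)] by blast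
  obtain B' where B': "\<And>n. E (s' n) (s' n) \<le> B'" using form.Cauchy_seq_bounded[OF sD'(2,1)] by blast
  have "(\<lambda>n. sqrt (quad E (\<lambda>x. s' n x - s n x)) * sqrt B
    + sqrt B' * sqrt (quad E (\<lambda>x. t' n x - t n x))) ----> 0 * sqrt B + sqrt B' * 0"
   by (intro tendsto_intros null[OF s' s] null[OF t' t])
  then have l: "(\<lambda>n. sqrt (quad E (\<lambda>x. s' n x - s n x)) * sqrt B
    + sqrt B' * sqrt (quad E (\<lambda>x. t' n x - t n x))) ----> 0" by simp
  have "(\<lambda>n. E (s' n) (t' n) - E (s n) (t n)) ----> 0"
  proof (rule LIMSEQ_null_bounded[OF l])
   fix n
   have "E (s' n) (t' n) - E (s n) (t n) = E (\<lambda>x. s' n x - s n x) (t n) + E (s' n) (\<lambda>x. t' n x - t n x)"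
    by (simp add: form.B_diffl form.B_diffr sD tD sD' tD')
   moreover have "\<bar>E (\<lambda>x. s' n x - s n x) (t n)\<bar> \<le> sqrt (quad E (\<lambda>x. s' n x - s n x)) * sqrt B"
    by (rule order_trans[OF form.Cauchy_Schwarz[OF form.V_diff[OF sD'(1) sD(1)] tD(1)]])
     (intro mult_left_mono real_sqrt_le_mono B real_sqrt_ge_zero form_nonneg form.V_diff sD sD')
   moreover have "\<bar>E (s' n) (\<lambda>x. t' n x - t n x)\<bar> \<le> sqrt B' * sqrt (quad E (\<lambda>x. t' n x - t n x))"
    by (rule order_trans[OF form.Cauchy_Schwarz[OF sD'(1) form.V_diff[OF tD'(1) tD(1)]]])
     (intro mult_right_mono real_sqrt_le_mono B' real_sqrt_ge_zero form_nonneg form.V_diff tD tD')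
   ultimately show "\<bar>E (s' n) (t' n) - E (s n) (t n)\<bar> \<le> sqrt (quad E (\<lambda>x. s' n x - s n x)) * sqrt B
    + sqrt B' * sqrt (quad E (\<lambda>x. t' n x - t n x))" by linarith
  qed
  from tendsto_add[OF this c] show ?thesis by simp
 qed
 have "extended_form M E F f g = c"
  unfolding extended_form_def
 proof (rule the_equality)
  show "\<forall>s t. approximating_seq M E F f s \<and> approximating_seq M E F g t \<longrightarrow> (\<lambda>n. E (s n) (t n)) ----> c"
   using other by blast
  fix c' assume "\<forall>s t. approximating_seq M E F f s \<and> approximating_seq M E F g t \<longrightarrow> (\<lambda>n. E (s n) (t n)) ----> c'"
  then have "(\<lambda>n. E (s n) (t n)) ----> c'" using s t by blast
  then show "c' = c" using c by (rule LIMSEQ_unique)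
 qed
 then show ?thesis using c by simp
qed

lemma extended_form_eq: "f \<in> F ==> g \<in> F ==> extended_form M E F f g = E f g"
 using extended_form_limit[OF approximating_seq_const approximating_seq_const, of f g]
 by (simp add: LIMSEQ_const_iff)

text \<open>g need not be square integrable, so closeness is measured by the integral of
  \<open>|v - g|\<close> against a strictly positive integrable weight, which is finite for bounded
  functions. This constraint is convex and compatible with the bound c; energy near-minimizers under
  it are Cauchy, and a subsequence converges to g almost everywhere.\<close>

lemma extended_space_bounded_sequence:
 assumes g: "g \<in> extended_space M E F" "\<And>x. x \<in> X ==> \<bar>g x\<bar> \<le> c" "c \<ge> 0"
 obtains s where "\<And>n. s n \<in> core" "\<And>n x. x \<in> X ==> \<bar>s n x\<bar> \<le> c" "approximating_seq M E F g s"
proof -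
 interpret sigma_finite_measure M by (rule sigma_finite_M)
 have gm[measurable]: "g \<in> borel_measurable M" using g(1) by (simp add: extended_space_def)
 obtain t where t: "approximating_seq M E F g t" using g(1) by (auto simp: extended_space_def)
 note tD = approximating_seqD[OF t]
 obtain B where B: "B \<ge> 0" "\<And>n. E (t n) (t n) \<le> B" using form.Cauchy_seq_bounded[OF tD(2,1)] by blast
 have "\<exists>h\<in>core. quad E1 (\<lambda>x. t n x - h x) < inverse (real (Suc n))" for n
  by (rule core_dense[OF tD(1)]) simp
 then obtain t' where t': "\<And>n. t' n \<in> core" "\<And>n. quad E1 (\<lambda>x. t n x - t' n x) < inverse (real (Suc n))"
  by metis
 note t'F = t'(1)[THEN core_F]
 note dF = form.V_diff[OF tD(1) t'F]
 have t'B: "E (t' n) (t' n) \<le> 2 * B + 2" for n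
 proof -
  have "quad E (\<lambda>x. t n x - (t n x - t' n x)) \<le>
    2 * E (t n) (t n) + 2 * quad E (\<lambda>x. t n x - t' n x)"
   by (intro form.square_diff_le tD dF)
  moreover have "inverse (real (Suc n)) \<le> 1" by (simp add: field_simps)
  ultimately show ?thesis using E_le_E1[OF dF[of n n]] t'(2)[of n] B(2)[of n] by simp
 qed
 \<comment> \<open>The core replacements \<open>t' n\<close> differ from \<open>t n\<close> by an L2
   null sequence; a subsequence therefore has the same a.e. limit g, and truncation at c preserves
   that limit.\<close>
 have "(\<lambda>n. quad (L2_inner M) (\<lambda>x. (t n x - t' n x) - 0)) ----> 0"
 proof (rule LIMSEQ_null_bounded[OF LIMSEQ_inverse_real_of_nat])
  show "\<bar>L2_inner M (\<lambda>x. (t n x - t' n x) - 0) (\<lambda>x. (t n x - t' n x) - 0)\<bar> \<le> inverse (real (Suc n))" for n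
   using L2_le_E1[OF dF[of n n]] t'(2)[of n] L2.B_nonneg[OF F_L2[OF dF[of n n]]] by simp
 qed
 then obtain r :: "nat \<Rightarrow> nat" where r: "strict_mono r" "AE x in M. (\<lambda>n. t (r n) x - t' (r n) x) ----> 0"
  using L2_tendsto_AE_subseq[of "\<lambda>n x. t n x - t' n x" M "\<lambda>x. 0"] F_L2[OF dF] L2_zero by blast
 have lim: "AE x in M. (\<lambda>n. truncate c (t' (r n)) x) ----> g x"
  using r(2) tD(3) AE_space
 proof eventually_elim
  case (elim x)
  have "(\<lambda>n. t (r n) x - (t (r n) x - t' (r n) x)) ----> g x - 0"
   using LIMSEQ_subseq_LIMSEQ[OF elim(2) r(1)] elim(1) by (intro tendsto_diff) (auto simp: o_def)
  then have "(\<lambda>n. max (- c) (min c (t' (r n) x))) ----> max (- c) (min c (g x))"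
   by (intro tendsto_intros) simp
  moreover have "max (- c) (min c (g x)) = g x" using g(2)[of x] elim(3) by (auto simp: space_M abs_le_iff)
  ultimately show ?case by (simp add: truncate_def)
 qed
 obtain \<eta> :: "'a \<Rightarrow> real" where \<eta>: "\<eta> \<in> borel_measurable M" "\<And>x. \<eta> x > 0" "\<And>x. \<eta> x \<le> 1" "integrable M \<eta>"
  using obtain_positive_integrable_function by blast
 note [measurable] = \<eta>(1)
 have int: "integrable M (\<lambda>x. \<bar>v x - g x\<bar> * \<eta> x)" if "v \<in> core" "\<And>x. x \<in> X ==> \<bar>v x\<bar> \<le> c" for v
 proof (rule Bochner_Integration.integrable_bound)
  show "integrable M (\<lambda>x. 2 * c * \<eta> x)" using \<eta>(4) by simp
  have [measurable]: "v \<in> borel_measurable M" by (rule core_measurable[OF that(1)])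
  show "(\<lambda>x. \<bar>v x - g x\<bar> * \<eta> x) \<in> borel_measurable M" by measurable
  show "AE x in M. norm (\<bar>v x - g x\<bar> * \<eta> x) \<le> norm (2 * c * \<eta> x)"
  proof (rule AE_I2)
   fix x assume "x \<in> space M"
   then have "\<bar>v x\<bar> \<le> c" "\<bar>g x\<bar> \<le> c" using that(2) g(2) by (auto simp: space_M)
   then have "\<bar>v x - g x\<bar> \<le> 2 * c" by linarith
   then have "\<bar>v x - g x\<bar> * \<eta> x \<le> 2 * c * \<eta> x" using \<eta>(2)[of x] by (intro mult_right_mono) auto
   then show "norm (\<bar>v x - g x\<bar> * \<eta> x) \<le> norm (2 * c * \<eta> x)" using \<eta>(2)[of x] by (simp add: abs_mult)
  qed
 qed
 define C where "C n = {v \<in> core. (\<forall>x\<in>X. \<bar>v x\<bar> \<le> c) \<and> (\<integral>x. \<bar>v x - g x\<bar> * \<eta> x \<partial>M) \<le> inverse (real (Suc n))}" for n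
 have tc: "truncate c (t' n) \<in> core" for n by (rule core_truncate[OF t'(1) g(3)])
 have tb: "\<bar>truncate c (t' n) x\<bar> \<le> c" for n x by (rule truncate_bounded[OF g(3)])
 have Ilim: "(\<lambda>n. \<integral>x. \<bar>truncate c (t' (r n)) x - g x\<bar> * \<eta> x \<partial>M) ----> (\<integral>x. 0 \<partial>M)"
 proof (rule integral_dominated_convergence[where w = "\<lambda>x. 2 * c * \<eta> x"])
  have [measurable]: "truncate c (t' n) \<in> borel_measurable M" for n by (rule core_measurable[OF tc])
  show "(\<lambda>x. \<bar>truncate c (t' (r n)) x - g x\<bar> * \<eta> x) \<in> borel_measurable M" for n by measurable
  show "integrable M (\<lambda>x. 2 * c * \<eta> x)" using \<eta>(4) by simp
  show "AE x in M. (\<lambda>n. \<bar>truncate c (t' (r n)) x - g x\<bar> * \<eta> x) ----> 0"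
   using lim
  proof eventually_elim
   case (elim x)
   have "(\<lambda>n. \<bar>truncate c (t' (r n)) x - g x\<bar> * \<eta> x) ----> \<bar>g x - g x\<bar> * \<eta> x" by (intro tendsto_intros elim)
   then show ?case by simp
  qed
  show "AE x in M. norm (\<bar>truncate c (t' (r n)) x - g x\<bar> * \<eta> x) \<le> 2 * c * \<eta> x" for n
  proof (rule AE_I2)
   fix x assume "x \<in> space M"
   then have "\<bar>truncate c (t' (r n)) x - g x\<bar> \<le> 2 * c" using tb[of "r n" x] g(2)[of x] by (auto simp: space_M)
   then have "\<bar>truncate c (t' (r n)) x - g x\<bar> * \<eta> x \<le> 2 * c * \<eta> x" using \<eta>(2)[of x] by (intro mult_right_mono) auto
   then show "norm (\<bar>truncate c (t' (r n)) x - g x\<bar> * \<eta> x) \<le> 2 * c * \<eta> x" using \<eta>(2)[of x] by (simp add: abs_mult)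
  qed
 qed simp
 obtain v where v: "\<And>n. v n \<in> C n" "form.Cauchy_seq v"
 proof (rule form.minimizing_Cauchy_seq[of C "2 * B + 2"])
  show "C n \<subseteq> F" for n by (auto simp: C_def core_F)
  have "inverse (real (Suc (Suc n))) \<le> inverse (real (Suc n))" for n by (simp add: field_simps)
  then show "C (Suc n) \<subseteq> C n" for n unfolding C_def using order_trans by blast
  show "(\<lambda>x. (a x + b x) / 2) \<in> C n" if a: "a \<in> C n" and b: "b \<in> C n" for a b n
  proof -
   have ab: "a \<in> core" "b \<in> core" "\<And>x. x \<in> X ==> \<bar>a x\<bar> \<le> c" "\<And>x. x \<in> X ==> \<bar>b x\<bar> \<le> c"
    and i: "(\<integral>x. \<bar>a x - g x\<bar> * \<eta> x \<partial>M) \<le> inverse (real (Suc n))" "(\<integral>x. \<bar>b x - g x\<bar> * \<eta> x \<partial>M) \<le> inverse (real (Suc n))"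
    using a b by (auto simp: C_def)
   have mc: "(\<lambda>x. (a x + b x) / 2) \<in> core" by (rule core_midpoint[OF ab(1,2)])
   have mb: "\<bar>(a x + b x) / 2\<bar> \<le> c" if "x \<in> X" for x by (rule abs_midpoint_le[OF ab(3,4)[OF that]])
   have "(\<integral>x. \<bar>(a x + b x) / 2 - g x\<bar> * \<eta> x \<partial>M) \<le> (\<integral>x. (\<bar>a x - g x\<bar> * \<eta> x + \<bar>b x - g x\<bar> * \<eta> x) / 2 \<partial>M)"
   proof (rule integral_mono)
    show "integrable M (\<lambda>x. \<bar>(a x + b x) / 2 - g x\<bar> * \<eta> x)" by (rule int[OF mc mb])
    show "integrable M (\<lambda>x. (\<bar>a x - g x\<bar> * \<eta> x + \<bar>b x - g x\<bar> * \<eta> x) / 2)"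
     using int[OF ab(1,3)] int[OF ab(2,4)] by simp
    fix x
    have "\<bar>(p + q) / 2 - y\<bar> \<le> (\<bar>p - y\<bar> + \<bar>q - y\<bar>) / 2" for p q y :: real by (simp add: abs_if field_simps)
    then have "\<bar>(a x + b x) / 2 - g x\<bar> * \<eta> x \<le> (\<bar>a x - g x\<bar> + \<bar>b x - g x\<bar>) / 2 * \<eta> x"
     using \<eta>(2)[of x] by (intro mult_right_mono) auto
    then show "\<bar>(a x + b x) / 2 - g x\<bar> * \<eta> x \<le> (\<bar>a x - g x\<bar> * \<eta> x + \<bar>b x - g x\<bar> * \<eta> x) / 2"
     by (simp add: algebra_simps)
   qed
   also have "\<dots> = ((\<integral>x. \<bar>a x - g x\<bar> * \<eta> x \<partial>M) + (\<integral>x. \<bar>b x - g x\<bar> * \<eta> x \<partial>M)) / 2"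
    using int[OF ab(1,3)] int[OF ab(2,4)] by simp
   also have "\<dots> \<le> inverse (real (Suc n))" using i by simp
   finally show ?thesis using mc mb by (simp add: C_def)
  qed
  show "\<exists>f\<in>C n. E f f \<le> 2 * B + 2" for n
  proof -
   have "\<forall>\<^sub>F m in sequentially. (\<integral>x. \<bar>truncate c (t' (r m)) x - g x\<bar> * \<eta> x \<partial>M) < inverse (real (Suc n))"
    using order_tendstoD(2)[OF Ilim, of "inverse (real (Suc n))"] by simp
   then obtain m where "(\<integral>x. \<bar>truncate c (t' (r m)) x - g x\<bar> * \<eta> x \<partial>M) < inverse (real (Suc n))"
    by (auto simp: eventually_sequentially)
   then have "truncate c (t' (r m)) \<in> C n" using tc tb by (simp add: C_def)
   moreover have "E (truncate c (t' (r m))) (truncate c (t' (r m))) \<le> 2 * B + 2"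
    by (rule order_trans[OF truncate_in(2)[OF t'F g(3)] t'B])
   ultimately show ?thesis by blast
  qed
 qed blast
 have vc: "v n \<in> core" "\<And>x. x \<in> X ==> \<bar>v n x\<bar> \<le> c" "(\<integral>x. \<bar>v n x - g x\<bar> * \<eta> x \<partial>M) \<le> inverse (real (Suc n))" for n
  using v(1)[of n] by (auto simp: C_def)
 have "(\<lambda>n. \<integral>x. norm (\<bar>v n x - g x\<bar> * \<eta> x) \<partial>M) ----> 0"
 proof (rule LIMSEQ_null_bounded[OF LIMSEQ_inverse_real_of_nat])
  fix n
  have "norm (\<bar>v n x - g x\<bar> * \<eta> x) = \<bar>v n x - g x\<bar> * \<eta> x" for x using \<eta>(2)[of x] by (simp add: abs_mult)
  moreover have "0 \<le> (\<integral>x. \<bar>v n x - g x\<bar> * \<eta> x \<partial>M)" using less_imp_le[OF \<eta>(2)] by (intro Bochner_Integration.integral_nonneg mult_nonneg_nonneg) auto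
  ultimately show "\<bar>\<integral>x. norm (\<bar>v n x - g x\<bar> * \<eta> x) \<partial>M\<bar> \<le> inverse (real (Suc n))" using vc(3)[of n] by simp
 qed
 from tendsto_L1_AE_subseq[OF int[OF vc(1,2)] this]
 obtain q :: "nat \<Rightarrow> nat" where q: "strict_mono q" "AE x in M. (\<lambda>n. \<bar>v (q n) x - g x\<bar> * \<eta> x) ----> 0" by blast
 have "approximating_seq M E F g (\<lambda>n. v (q n))"
  unfolding approximating_seq_def
 proof (intro conjI allI impI)
  show "v (q n) \<in> F" for n by (rule core_F[OF vc(1)])
  fix e :: real assume "e > 0"
  then obtain N where N: "\<And>i j. i \<ge> N ==> j \<ge> N ==> quad E (\<lambda>x. v i x - v j x) < e"
   using v(2) unfolding form.Cauchy_seq_def by blast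
  have "q i \<ge> N" if "i \<ge> N" for i using seq_suble[OF q(1), of i] that by simp
  then show "\<exists>N. \<forall>i\<ge>N. \<forall>j\<ge>N. quad E (\<lambda>x. v (q i) x - v (q j) x) < e" using N by blast
 next
  show "AE x in M. (\<lambda>n. v (q n) x) ----> g x"
   using q(2)
  proof eventually_elim
   case (elim x)
   have "(\<lambda>n. \<bar>v (q n) x - g x\<bar> * \<eta> x / \<eta> x) ----> 0 / \<eta> x" using \<eta>(2)[of x] by (intro tendsto_divide elim tendsto_const) auto
   then have "(\<lambda>n. \<bar>v (q n) x - g x\<bar>) ----> 0" using \<eta>(2)[of x] by (simp add: less_imp_neq[symmetric])
   then have "(\<lambda>n. v (q n) x - g x) ----> 0" by (rule tendsto_rabs_zero_cancel)
   then show ?case by (simp add: LIM_zero_iff)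
  qed
 qed
 then show ?thesis using vc by (intro that[of "\<lambda>n. v (q n)"]) auto
qed


section \<open>Energy measures of bounded functions\<close>

lemma Gamma_functional:
 assumes u: "u \<in> F" "\<And>x. x \<in> X ==> \<bar>u x\<bar> \<le> b"
 shows "positive_functional M E F X (Gamma u) (2 * E u u)"
proof
 have ub: "\<bar>u x\<bar> \<le> b" if "x \<in> space M" for x using u(2) that by (simp add: space_M)
 note u2 = square_in[OF u(1) ub]
 have ug: "(\<lambda>x. u x * g x) \<in> F" if g: "g \<in> core" for g
 proof -
  obtain c where "\<And>x. x \<in> X ==> \<bar>g x\<bar> \<le> c" using core_bounded[OF g] by blast
  then have "\<bar>g x\<bar> \<le> c" if "x \<in> space M" for x using that by (simp add: space_M)
  from mult_in(1)[OF u(1) core_F[OF g] ub this] show ?thesis .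
 qed
 show "Gamma u (\<lambda>x. f x + g x) = Gamma u f + Gamma u g" if fg: "f \<in> core" "g \<in> core" for f g
 proof -
  have eq: "(\<lambda>x. u x * (f x + g x)) = (\<lambda>x. u x * f x + u x * g x)" by (simp add: distrib_left)
  show ?thesis unfolding Gamma_def eq
   using form.B_addr[OF ug[OF fg(1)] ug[OF fg(2)] u(1)] form.B_addr[OF core_F[OF fg(1)] core_F[OF fg(2)] u2] by simp
 qed
 show "Gamma u (\<lambda>x. c * f x) = c * Gamma u f" if f: "f \<in> core" for f c
 proof -
  have eq: "(\<lambda>x. u x * (c * f x)) = (\<lambda>x. c * (u x * f x))" by (simp add: mult.left_commute)
  show ?thesis unfolding Gamma_def eq
   using form.B_scaler[OF ug[OF f] u(1)] form.B_scaler[OF core_F[OF f] u2] by (simp add: algebra_simps)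
 qed
 show "0 \<le> Gamma u f" if f: "f \<in> core" "\<And>x. x \<in> X ==> 0 \<le> f x" for f
 proof -
  obtain c where "\<And>x. x \<in> X ==> \<bar>f x\<bar> \<le> c" using core_bounded[OF f(1)] by blast
  then have "0 \<le> f x \<and> f x \<le> c" if "x \<in> space M" for x
   using that f(2)[of x] by (fastforce simp: space_M)
  from Gamma_nonneg[OF u(1) ub core_F[OF f(1)] this] show ?thesis .
 qed
 show "Gamma u f \<le> 2 * E u u" if f: "f \<in> core" "\<And>x. x \<in> X ==> 0 \<le> f x \<and> f x \<le> 1" for f
 proof -
  have fb: "0 \<le> f x \<and> f x \<le> 1" if "x \<in> space M" for x using f(2) that by (simp add: space_M)
  show ?thesis using Gamma_mono(2)[OF u(1) ub core_F[OF f(1)] fb, of "\<lambda>t. t"] by simp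
 qed
qed

text \<open>The products \<open>u * s n\<close> are dominated by a multiple of u and so converge in
  L2, whether or not g is square integrable. For \<open>E (u^2) (s n)\<close> no such domination is
  built in, hence the extra majorant h in the last claim.\<close>

lemma Gamma_tendsto:
 assumes u: "u \<in> F" "\<And>x. x \<in> X ==> \<bar>u x\<bar> \<le> b"
  and s: "\<And>n. s n \<in> F" "\<And>n x. x \<in> X ==> \<bar>s n x\<bar> \<le> c" "\<And>n. E (s n) (s n) \<le> B"
  and lim: "AE x in M. (\<lambda>n. s n x) ----> g x" "g \<in> borel_measurable M"
 shows "(\<lambda>x. u x * g x) \<in> F" "(\<lambda>n. E u (\<lambda>x. u x * s n x)) ----> E u (\<lambda>x. u x * g x)"
  "\<And>h. h \<in> L2_space M ==> (\<And>n. AE x in M. \<bar>s n x\<bar> \<le> d * \<bar>h x\<bar>) ==> g \<in> F \<and> (\<lambda>n. Gamma u (s n)) ----> Gamma u g"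
proof -
 have ub: "\<bar>u x\<bar> \<le> b" if "x \<in> space M" for x using u(2) that by (simp add: space_M)
 have sb: "\<bar>s n x\<bar> \<le> c" if "x \<in> space M" for n x using s(2) that by (simp add: space_M)
 have us: "(\<lambda>x. u x * s n x) \<in> F"
  "quad E (\<lambda>x. u x * s n x) \<le> 8 * c\<^sup>2 * E u u + 8 * b\<^sup>2 * E (s n) (s n)" for n
  by (rule mult_in[OF u(1) s(1) ub sb]; assumption)+
 have usb: "quad E (\<lambda>x. u x * s n x) \<le> 8 * c\<^sup>2 * E u u + 8 * b\<^sup>2 * B" for n
  using us(2)[of n] mult_left_mono[OF s(3)[of n], of "8 * b\<^sup>2"] by simp
 have um: "u \<in> borel_measurable M" by (rule F_measurable[OF u(1)])
 have "L2_tendsto M (\<lambda>n x. u x * s n x) (\<lambda>x. u x * g x)" and ugL: "(\<lambda>x. u x * g x) \<in> L2_space M"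
 proof -
  have 1: "(\<lambda>x. u x * s n x) \<in> borel_measurable M" for n by (rule F_measurable[OF us(1)])
  have 2: "(\<lambda>x. u x * g x) \<in> borel_measurable M" using um lim(2) by (rule borel_measurable_times)
  have 3: "AE x in M. (\<lambda>n. u x * s n x) ----> u x * g x"
   using lim(1) by eventually_elim (intro tendsto_intros)
  have 4: "AE x in M. \<bar>u x * s n x\<bar> \<le> c * \<bar>u x\<bar>" for n
  proof (rule AE_I2)
   fix x assume "x \<in> space M"
   then have "\<bar>u x\<bar> * \<bar>s n x\<bar> \<le> \<bar>u x\<bar> * c" using sb by (intro mult_left_mono) auto
   then show "\<bar>u x * s n x\<bar> \<le> c * \<bar>u x\<bar>" by (simp add: abs_mult mult.commute)
  qed
  show "L2_tendsto M (\<lambda>n x. u x * s n x) (\<lambda>x. u x * g x)" "(\<lambda>x. u x * g x) \<in> L2_space M"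
   using L2_dominated_convergence(1,2)[OF 1 2 F_L2[OF u(1)] 3 4] by auto
 qed
 note w = weak_convergence[OF us(1) usb ugL this(1)]
 show ug: "(\<lambda>x. u x * g x) \<in> F" by (rule w(1)[OF u(1)])
 show l1: "(\<lambda>n. E u (\<lambda>x. u x * s n x)) ----> E u (\<lambda>x. u x * g x)"
  using w(2)[OF u(1)] form_sym[OF u(1) us(1)] form_sym[OF u(1) ug] by simp
 fix h assume h: "h \<in> L2_space M" "\<And>n. AE x in M. \<bar>s n x\<bar> \<le> d * \<bar>h x\<bar>"
 note dc = L2_dominated_convergence(1,2)[OF F_measurable[OF s(1)] lim(2) h(1) lim(1) h(2)]
 note w' = weak_convergence[OF s(1,3) dc(2,1)]
 note u2 = square_in[OF u(1) ub]
 have gF: "g \<in> F" by (rule w'(1)[OF u2])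
 have "(\<lambda>n. E (\<lambda>x. (u x)\<^sup>2) (s n)) ----> E (\<lambda>x. (u x)\<^sup>2) g"
  using w'(2)[OF u2] form_sym[OF u2 s(1)] form_sym[OF u2 gF] by simp
 then have "(\<lambda>n. Gamma u (s n)) ----> Gamma u g" unfolding Gamma_def by (intro tendsto_intros l1)
 with gF show "g \<in> F \<and> (\<lambda>n. Gamma u (s n)) ----> Gamma u g" by simp
qed

text \<open>Absolute continuity of the energy measure with respect to capacity. Otherwise there are
  core functions \<open>h n\<close> with E1-energy tending to 0 but \<open>Gamma u (h n)\<close> at
  least epsilon; yet \<open>u * h n\<close> and \<open>h n\<close> tend weakly to 0, which makes
  \<open>Gamma u (h n)\<close> tend to 0.\<close>

lemma riesz_Gamma_small:
 assumes u: "u \<in> F" "\<And>x. x \<in> X ==> \<bar>u x\<bar> \<le> b" and e: "\<epsilon> > 0"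
 shows "\<exists>d>0. \<forall>h\<in>core. (\<forall>x\<in>X. 0 \<le> h x \<and> h x \<le> 1) \<longrightarrow> E1 h h < d \<longrightarrow>
   emeasure (riesz (Gamma u)) {x \<in> X. h x = 1} \<le> ennreal \<epsilon>"
proof (rule ccontr)
 interpret P: positive_functional M E F X "Gamma u" "2 * E u u" by (rule Gamma_functional[OF u])
 interpret R: finite_measure "riesz (Gamma u)" by (rule P.finite_riesz)
 assume n: "\<not> ?thesis"
 define Q where "Q n h \<longleftrightarrow> h \<in> core \<and> (\<forall>x\<in>X. 0 \<le> h x \<and> h x \<le> 1) \<and> E1 h h < inverse (real (Suc n)) \<and>
   \<not> emeasure (riesz (Gamma u)) {x \<in> X. h x = 1} \<le> ennreal \<epsilon>" for n :: nat and h
 have "\<exists>h. Q n h" for n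
 proof -
  have "inverse (real (Suc n)) > 0" by simp
  then show ?thesis using n unfolding Q_def by blast
 qed
 then obtain h where "\<And>n. Q n (h n)" by metis
 then have h: "h n \<in> core" "\<forall>x\<in>X. 0 \<le> h n x \<and> h n x \<le> 1" "E1 (h n) (h n) < inverse (real (Suc n))"
  "\<not> emeasure (riesz (Gamma u)) {x \<in> X. h n x = 1} \<le> ennreal \<epsilon>" for n unfolding Q_def by blast+
 note hF = h(1)[THEN core_F]
 have low: "\<epsilon> \<le> Gamma u (h n)" for n
 proof -
  have m: "{x \<in> X. h n x = 1} \<in> sets M"
  proof -
   have "h n -` {1} \<inter> space M \<in> sets M" using core_measurable[OF h(1)] by (rule measurable_sets) simp
   moreover have "h n -` {1} \<inter> space M = {x \<in> X. h n x = 1}" by (auto simp: space_M)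
   ultimately show ?thesis by simp
  qed
  have "measure (riesz (Gamma u)) {x \<in> X. h n x = 1} = (\<integral>x. indicator {x \<in> X. h n x = 1} x \<partial>riesz (Gamma u))"
  proof -
   have "{x \<in> X. h n x = 1} \<inter> space (riesz (Gamma u)) = {x \<in> X. h n x = 1}" by (auto simp: riesz_space)
   then show ?thesis by simp
  qed
  also have "\<dots> \<le> (\<integral>x. h n x \<partial>riesz (Gamma u))"
  proof (rule integral_mono)
   show "integrable (riesz (Gamma u)) (indicator {x \<in> X. h n x = 1} :: 'a \<Rightarrow> real)"
   proof -
    have "{x \<in> X. h n x = 1} \<in> sets (riesz (Gamma u))" using m by (simp only: riesz_sets)
    then show ?thesis by (intro R.integrable_const_bound[where B = 1]) auto
   qed
   show "integrable (riesz (Gamma u)) (h n)"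
    using h(2)[of n] by (intro P.integrable_riesz[where c = 1] core_measurable h) auto
  qed (use h(2)[of n] in "auto simp: riesz_space indicator_def")
  also have "\<dots> = Gamma u (h n)" by (rule P.integral_riesz[OF h(1)])
  finally show ?thesis using h(4)[of n] by (simp add: R.emeasure_eq_measure not_le) (metis ennreal_leI less_imp_le linear not_less order_trans)
 qed
 have E1h: "(\<lambda>n. quad E1 (\<lambda>x. h n x - 0)) ----> 0"
  by (rule LIMSEQ_null_bounded[OF LIMSEQ_inverse_real_of_nat])
   (use h(3) form1.B_nonneg[OF hF] in "auto intro: less_imp_le")
 have L: "L2_tendsto M h (\<lambda>x. 0)" by (rule E1_tendsto_L2[OF hF domain_zero E1h])
 have hE: "E (h n) (h n) \<le> 1" for n
 proof -
  have "inverse (real (Suc n)) \<le> 1" by (simp add: field_simps)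
  then show ?thesis using E_le_E1[OF hF[of n]] h(3)[of n] by linarith
 qed
 have ub: "\<bar>u x\<bar> \<le> b" if "x \<in> space M" for x using u(2) that by (simp add: space_M)
 have hb: "\<bar>h n x\<bar> \<le> 1" if "x \<in> space M" for n x using h(2)[of n] that by (auto simp: space_M)
 note u2 = square_in[OF u(1) ub]
 note uh = mult_in[OF u(1) hF ub hb]
 have "(\<lambda>n. E (\<lambda>x. u x * h n x) u) ----> E (\<lambda>x. 0) u"
 proof (rule weak_convergence(2)[OF uh(1) _ L2_zero _ u(1)])
  show "quad E (\<lambda>x. u x * h n x) \<le> 8 * 1\<^sup>2 * E u u + 8 * b\<^sup>2 * 1" for n
   by (rule order_trans[OF uh(2)], assumption, assumption) (intro add_left_mono mult_left_mono hE, simp)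
  show "L2_tendsto M (\<lambda>n x. u x * h n x) (\<lambda>x. 0)"
  proof (rule L2_tendsto_le[where t = "\<lambda>n x. \<bar>b\<bar> * h n x" and g = "\<lambda>x. 0"])
   show "AE x in M. \<bar>u x * h n x - 0\<bar> \<le> \<bar>\<bar>b\<bar> * h n x - 0\<bar>" for n
   proof (rule AE_I2)
    fix x assume "x \<in> space M"
    then have "\<bar>u x\<bar> * \<bar>h n x\<bar> \<le> \<bar>b\<bar> * \<bar>h n x\<bar>" using ub[of x] by (intro mult_right_mono) auto
    then show "\<bar>u x * h n x - 0\<bar> \<le> \<bar>\<bar>b\<bar> * h n x - 0\<bar>" by (simp add: abs_mult)
   qed
   have "quad (L2_inner M) (\<lambda>x. \<bar>b\<bar> * h n x - 0) = \<bar>b\<bar>\<^sup>2 * quad (L2_inner M) (\<lambda>x. h n x - 0)" for n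
    using L2.B_square_scale[OF F_L2[OF hF[of n]], of "\<bar>b\<bar>"] by simp
   then show "L2_tendsto M (\<lambda>n x. \<bar>b\<bar> * h n x) (\<lambda>x. 0)"
    using tendsto_mult[OF tendsto_const L, of "\<bar>b\<bar>\<^sup>2"] by simp
  qed (auto intro!: F_L2 uh L2_zero domain_scale hF)
 qed
 then have l1: "(\<lambda>n. E u (\<lambda>x. u x * h n x)) ----> 0"
  using form_sym[OF u(1) uh(1)] form.B_zerol[OF u(1)] by simp
 have "(\<lambda>n. E (h n) (\<lambda>x. (u x)\<^sup>2)) ----> E (\<lambda>x. 0) (\<lambda>x. (u x)\<^sup>2)"
  by (rule weak_convergence(2)[OF hF hE L2_zero L u2])
 then have l2: "(\<lambda>n. E (\<lambda>x. (u x)\<^sup>2) (h n)) ----> 0"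
  using form_sym[OF u2 hF] form.B_zerol[OF u2] by simp
 have "(\<lambda>n. Gamma u (h n)) ----> 2 * 0 - 0" unfolding Gamma_def by (intro tendsto_intros l1 l2)
 then have "\<epsilon> \<le> 2 * 0 - 0" by (rule LIMSEQ_le_const) (use low in blast)
 then show False using e by simp
qed

text \<open>\<open>Gamma u (s n)\<close> has two limits along a bounded core sequence: the integral
  of g, by quasi-everywhere convergence and dominated convergence, and \<open>Gamma u g\<close>, by
  weak convergence.\<close>

lemma integral_riesz_quasi_continuous:
 assumes u: "u \<in> F" "\<And>x. x \<in> X ==> \<bar>u x\<bar> \<le> b"
  and g: "g \<in> F" "\<And>x. x \<in> X ==> \<bar>g x\<bar> \<le> c" "quasi_continuous M E F g" "c \<ge> 0"
 shows "(\<integral>x. g x \<partial>riesz (Gamma u)) = Gamma u g"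
proof -
 interpret P: positive_functional M E F X "Gamma u" "2 * E u u" by (rule Gamma_functional[OF u])
 interpret R: finite_measure "riesz (Gamma u)" by (rule P.finite_riesz)
 have gAE: "AE x in M. \<bar>g x\<bar> \<le> c" using g(2) by (intro AE_I2) (simp add: space_M)
 obtain s where s: "\<And>n. s n \<in> core" "\<And>n x. x \<in> X ==> \<bar>s n x\<bar> \<le> c"
  "form_tendsto E1 s g"
  by (rule core_sequence_bounded[OF g(1) gAE g(4)], rule that)
 note sF = s(1)[THEN core_F]
 have AEr: "AE x in M. g x = g x" by simp
 obtain r N where r: "strict_mono r" "cap N = 0" "\<And>x. x \<in> X - N ==> (\<lambda>n. s (r n) x) ----> g x"
  by (rule quasi_everywhere_convergence[OF sF core_continuous[OF s(1)] g(1) s(3) g(3) AEr], rule that)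
 obtain G where G: "G \<in> null_sets (riesz (Gamma u))" "N \<subseteq> G"
  using capacity_null[OF riesz_sets riesz_Gamma_small[OF u] r(2)] by blast
 have "(\<lambda>n. \<integral>x. s (r n) x \<partial>riesz (Gamma u)) ----> (\<integral>x. g x \<partial>riesz (Gamma u))"
 proof (rule integral_dominated_convergence[where w = "\<lambda>x. c"])
  show "g \<in> borel_measurable (riesz (Gamma u))" by (simp add: P.riesz_measurable F_measurable[OF g(1)])
  show "s (r n) \<in> borel_measurable (riesz (Gamma u))" for n by (simp add: P.riesz_measurable core_measurable s)
  show "AE x in riesz (Gamma u). (\<lambda>n. s (r n) x) ----> g x"
   by (rule AE_I'[OF G(1)]) (use r(3) G(2) in "auto simp: riesz_space")
  show "AE x in riesz (Gamma u). norm (s (r n) x) \<le> c" for n using s(2) by (intro AE_I2) (simp add: riesz_space)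
 qed simp
 moreover have "(\<integral>x. s (r n) x \<partial>riesz (Gamma u)) = Gamma u (s (r n))" for n by (rule P.integral_riesz[OF s(1)])
 ultimately have l1: "(\<lambda>n. Gamma u (s (r n))) ----> (\<integral>x. g x \<partial>riesz (Gamma u))" by simp
 have ub: "\<bar>u x\<bar> \<le> b" if "x \<in> space M" for x using u(2) that by (simp add: space_M)
 have sb: "\<bar>s n x\<bar> \<le> c" if "x \<in> space M" for n x using s(2) that by (simp add: space_M)
 have gb: "\<bar>g x\<bar> \<le> c" if "x \<in> space M" for x using g(2) that by (simp add: space_M)
 note u2 = square_in[OF u(1) ub] and us = mult_in[OF u(1) sF ub sb] and ug = mult_in(1)[OF u(1) g(1) ub gb]
 obtain B where B: "\<And>n. E (s n) (s n) \<le> B" using form_bounded_of_tendsto[OF sF g(1) E1_tendsto_E[OF sF g(1) s(3)]] by blast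
 have sL: "L2_tendsto M s g" by (rule E1_tendsto_L2[OF sF g(1) s(3)])
 have "(\<lambda>n. E (\<lambda>x. u x * s n x) u) ----> E (\<lambda>x. u x * g x) u"
 proof (rule weak_convergence(2)[OF us(1) _ F_L2[OF ug] _ u(1)])
  show "quad E (\<lambda>x. u x * s n x) \<le> 8 * c\<^sup>2 * E u u + 8 * b\<^sup>2 * B" for n
   by (rule order_trans[OF us(2)], assumption, assumption) (intro add_left_mono mult_left_mono B, simp)
  show "L2_tendsto M (\<lambda>n x. u x * s n x) (\<lambda>x. u x * g x)"
  proof (rule L2_tendsto_le[where t = "\<lambda>n x. \<bar>b\<bar> * s n x" and g = "\<lambda>x. \<bar>b\<bar> * g x"])
   show "AE x in M. \<bar>u x * s n x - u x * g x\<bar> \<le> \<bar>\<bar>b\<bar> * s n x - \<bar>b\<bar> * g x\<bar>" for n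
   proof (rule AE_I2)
    fix x assume "x \<in> space M"
    then have "\<bar>u x\<bar> * \<bar>s n x - g x\<bar> \<le> \<bar>b\<bar> * \<bar>s n x - g x\<bar>" using ub[of x] by (intro mult_right_mono) auto
    moreover have "\<bar>u x * s n x - u x * g x\<bar> = \<bar>u x\<bar> * \<bar>s n x - g x\<bar>"
     "\<bar>\<bar>b\<bar> * s n x - \<bar>b\<bar> * g x\<bar> = \<bar>b\<bar> * \<bar>s n x - g x\<bar>"
     by (simp_all only: right_diff_distrib[symmetric] abs_mult abs_abs)
    ultimately show "\<bar>u x * s n x - u x * g x\<bar> \<le> \<bar>\<bar>b\<bar> * s n x - \<bar>b\<bar> * g x\<bar>" by simp
   qed
   have eq: "(\<lambda>x. \<bar>b\<bar> * s n x - \<bar>b\<bar> * g x) = (\<lambda>x. \<bar>b\<bar> * (s n x - g x))" for n by (simp add: right_diff_distrib)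
   have "quad (L2_inner M) (\<lambda>x. \<bar>b\<bar> * s n x - \<bar>b\<bar> * g x) = \<bar>b\<bar>\<^sup>2 * quad (L2_inner M) (\<lambda>x. s n x - g x)" for n
    unfolding eq by (rule L2.B_square_scale[OF F_L2[OF form.V_diff[OF sF g(1)]]])
   then show "L2_tendsto M (\<lambda>n x. \<bar>b\<bar> * s n x) (\<lambda>x. \<bar>b\<bar> * g x)"
    using tendsto_mult[OF tendsto_const sL, of "\<bar>b\<bar>\<^sup>2"] by simp
  qed (auto intro!: F_L2 us ug domain_scale sF g)
 qed
 then have "(\<lambda>n. E u (\<lambda>x. u x * s n x)) ----> E u (\<lambda>x. u x * g x)"
  using form_sym[OF u(1) us(1)] form_sym[OF u(1) ug] by simp
 moreover have "(\<lambda>n. E (\<lambda>x. (u x)\<^sup>2) (s n)) ----> E (\<lambda>x. (u x)\<^sup>2) g"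
  using weak_convergence(2)[OF sF B F_L2[OF g(1)] sL u2] form_sym[OF u2 sF] form_sym[OF u2 g(1)] by simp
 ultimately have "(\<lambda>n. Gamma u (s n)) ----> Gamma u g" unfolding Gamma_def by (intro tendsto_intros)
 from LIMSEQ_subseq_LIMSEQ[OF this r(1)] have "(\<lambda>n. Gamma u (s (r n))) ----> Gamma u g" by (simp add: o_def)
 with l1 show ?thesis by (rule LIMSEQ_unique)
qed

text \<open>Quasi-everywhere convergence is available only in \<open>F\<close>, and g may lie
  outside. Products with cutoffs are in \<open>F\<close> and quasi-continuous, so integrals against
  them converge; the energy measure is finite, so a cutoff equal to 1 on a large compact set costs
  little, uniformly in n by the common bound c.\<close>

lemma integral_riesz_extended:
 assumes u: "u \<in> F" "\<And>x. x \<in> X ==> \<bar>u x\<bar> \<le> b"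
  and g: "g \<in> extended_space M E F" "\<And>x. x \<in> X ==> \<bar>g x\<bar> \<le> c" "quasi_continuous M E F g" "c \<ge> 0"
 shows "(\<integral>x. g x \<partial>riesz (Gamma u)) =
  2 * extended_form M E F u (\<lambda>x. u x * g x) - extended_form M E F (\<lambda>x. (u x)\<^sup>2) g"
proof -
 interpret P: positive_functional M E F X "Gamma u" "2 * E u u" by (rule Gamma_functional[OF u])
 interpret R: finite_measure "riesz (Gamma u)" by (rule P.finite_riesz)
 let ?\<mu> = "riesz (Gamma u)"
 have gm: "g \<in> borel_measurable M" using g(1) by (simp add: extended_space_def)
 obtain s where s: "\<And>n. s n \<in> core" "\<And>n x. x \<in> X ==> \<bar>s n x\<bar> \<le> c" "approximating_seq M E F g s"
  by (rule extended_space_bounded_sequence[OF g(1,2,4)], assumption, rule that)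
 note sF = s(1)[THEN core_F] and sD = approximating_seqD[OF s(3)]
 obtain B where B: "\<And>n. E (s n) (s n) \<le> B" using form.Cauchy_seq_bounded[OF sD(2,1)] by blast
 have ub: "\<bar>u x\<bar> \<le> b" if "x \<in> space M" for x using u(2) that by (simp add: space_M)
 note u2 = square_in[OF u(1) ub]
 have lim: "(\<lambda>x. u x * g x) \<in> F" "(\<lambda>n. E u (\<lambda>x. u x * s n x)) ----> E u (\<lambda>x. u x * g x)"
  by (rule Gamma_tendsto(1,2)[OF u sF s(2) B sD(3) gm]; assumption)+
 have L: "(\<lambda>n. Gamma u (s n)) ----> 2 * extended_form M E F u (\<lambda>x. u x * g x) - extended_form M E F (\<lambda>x. (u x)\<^sup>2) g"
  unfolding Gamma_def extended_form_eq[OF u(1) lim(1)]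
  by (intro tendsto_intros lim(2) extended_form_limit[OF approximating_seq_const[OF u2] s(3)])
 have is': "integrable ?\<mu> (s n)" for n by (rule P.integrable_riesz[OF core_measurable[OF s(1)] s(2)])
 have ig: "integrable ?\<mu> g" by (rule P.integrable_riesz[OF gm g(2)])
 have cutlim: "(\<lambda>n. \<integral>x. s n x * \<phi> x \<partial>?\<mu>) ----> (\<integral>x. g x * \<phi> x \<partial>?\<mu>)"
  if \<phi>: "\<phi> \<in> core" "\<And>x. x \<in> X ==> 0 \<le> \<phi> x \<and> \<phi> x \<le> 1" for \<phi>
 proof -
  have sp: "(\<lambda>x. s n x * \<phi> x) \<in> core" for n by (intro core_mult s \<phi>)
  have \<phi>b: "\<bar>\<phi> x\<bar> \<le> 1" if "x \<in> space M" for x using \<phi>(2)[of x] that by (simp add: space_M)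
  have sb: "\<bar>s n x\<bar> \<le> c" if "x \<in> space M" for n x using s(2) that by (simp add: space_M)
  have b1: "\<bar>s n x * \<phi> x\<bar> \<le> c * \<bar>\<phi> x\<bar>" if "x \<in> X" for n x
   using s(2)[OF that, of n] by (simp add: abs_mult mult_right_mono)
  have b2: "\<bar>y * \<phi> x\<bar> \<le> c" if "x \<in> X" "\<bar>y\<bar> \<le> c" for x y
  proof -
   have "\<bar>y\<bar> * \<bar>\<phi> x\<bar> \<le> c * 1" using that \<phi>(2)[OF that(1)] g(4) by (intro mult_mono) auto
   then show ?thesis by (simp add: abs_mult)
  qed
  have Eb: "quad E (\<lambda>x. s n x * \<phi> x) \<le> 8 * 1\<^sup>2 * B + 8 * c\<^sup>2 * E \<phi> \<phi>" for n
  proof -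
   have "quad E (\<lambda>x. s n x * \<phi> x) \<le> 8 * 1\<^sup>2 * E (s n) (s n) + 8 * c\<^sup>2 * E \<phi> \<phi>"
    by (rule mult_in(2)[OF sF core_F[OF \<phi>(1)] sb \<phi>b])
   then show ?thesis using B[of n] by simp
  qed
  have gpm: "(\<lambda>x. g x * \<phi> x) \<in> borel_measurable M" using gm core_measurable[OF \<phi>(1)] by (rule borel_measurable_times)
  have AEl: "AE x in M. (\<lambda>n. s n x * \<phi> x) ----> g x * \<phi> x"
   using sD(3) by eventually_elim (intro tendsto_intros)
  have "(\<lambda>x. g x * \<phi> x) \<in> F \<and> (\<lambda>n. Gamma u (\<lambda>x. s n x * \<phi> x)) ----> Gamma u (\<lambda>x. g x * \<phi> x)"
   by (rule Gamma_tendsto(3)[OF u core_F[OF sp] b2[OF _ s(2)] Eb AEl gpm F_L2[OF core_F[OF \<phi>(1)]], where d = c])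
    (use b1 in "auto intro!: AE_I2 simp: space_M")
  then have gp: "(\<lambda>x. g x * \<phi> x) \<in> F" "(\<lambda>n. Gamma u (\<lambda>x. s n x * \<phi> x)) ----> Gamma u (\<lambda>x. g x * \<phi> x)" by auto
  have "(\<integral>x. g x * \<phi> x \<partial>?\<mu>) = Gamma u (\<lambda>x. g x * \<phi> x)"
   by (rule integral_riesz_quasi_continuous[OF u gp(1) b2[OF _ g(2)] quasi_continuous_mult[OF g(3) core_continuous[OF \<phi>(1)]] g(4)])
  moreover have "(\<integral>x. s n x * \<phi> x \<partial>?\<mu>) = Gamma u (\<lambda>x. s n x * \<phi> x)" for n by (rule P.integral_riesz[OF sp])
  ultimately show ?thesis using gp(2) by simp
 qed
 have "(\<lambda>n. \<integral>x. s n x \<partial>?\<mu>) ----> (\<integral>x. g x \<partial>?\<mu>)"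
 proof (rule LIMSEQ_I)
  fix e :: real assume e: "e > 0"
  obtain K where K: "\<And>n. compact (K n)" "incseq K" "(\<Union>n. K n) = X"
   by (rule compact_exhaustion[OF open_X], rule that)
  have KX: "K n \<subseteq> X" for n using K(3) by auto
  have Ks: "K n \<in> sets ?\<mu>" for n using borel_compact[OF K(1)[of n]] KX[of n] by (auto simp: riesz_sets sets_M_iff)
  have "(\<lambda>n. measure ?\<mu> (K n)) ----> measure ?\<mu> (\<Union>n. K n)"
   using Ks K(2) by (intro R.finite_Lim_measure_incseq) auto
  then have "(\<lambda>n. measure ?\<mu> X - measure ?\<mu> (K n)) ----> measure ?\<mu> X - measure ?\<mu> X"
   unfolding K(3) by (intro tendsto_intros)
  \<comment> \<open>The mass off the compact set is multiplied by c below; dividing by c + 1 rather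
    than c keeps the quotient meaningful for c = 0 and makes the error at most e/8.\<close>
  then have "\<forall>\<^sub>F n in sequentially. measure ?\<mu> X - measure ?\<mu> (K n) < e / (8 * (c + 1))"
   using e g(4) by (intro order_tendstoD(2)) auto
  then obtain j where j: "measure ?\<mu> X - measure ?\<mu> (K j) < e / (8 * (c + 1))" by (auto simp: eventually_sequentially)
  obtain \<phi> V L where \<phi>: "\<phi> \<in> core" "\<And>x. x \<in> X ==> 0 \<le> \<phi> x \<and> \<phi> x \<le> 1" "K j \<subseteq> V" "\<And>x. x \<in> V ==> \<phi> x = 1"
   by (rule core_cutoff[OF K(1)[of j] KX open_X order_refl], rule that)
  have i\<phi>: "integrable ?\<mu> \<phi>"
   using \<phi>(2) by (intro P.integrable_riesz[OF core_measurable[OF \<phi>(1)], of 1]) auto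
  have iK: "integrable ?\<mu> (\<lambda>x. indicator (K j) x :: real)"
   using Ks by (intro R.integrable_const_bound[where B = 1]) auto
  have i1: "(\<integral>x. 1 - \<phi> x \<partial>?\<mu>) \<le> e / (8 * (c + 1))"
  proof -
   have "(\<integral>x. 1 - \<phi> x \<partial>?\<mu>) \<le> (\<integral>x. 1 - indicator (K j) x \<partial>?\<mu>)"
    using i\<phi> iK \<phi>(2,3,4) by (intro integral_mono) (auto simp: riesz_space indicator_def)
   also have "\<dots> = measure ?\<mu> X - measure ?\<mu> (K j)"
   proof -
    have "K j \<inter> space ?\<mu> = K j" using KX[of j] by (auto simp: riesz_space)
    then show ?thesis using iK by (simp add: riesz_space)
   qed
   finally show ?thesis using j by simp
  qed
  have rest: "\<bar>(\<integral>x. f x \<partial>?\<mu>) - (\<integral>x. f x * \<phi> x \<partial>?\<mu>)\<bar> \<le> e / 8"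
   if f: "f \<in> borel_measurable M" "\<And>x. x \<in> X ==> \<bar>f x\<bar> \<le> c" for f
  proof -
   have fi: "integrable ?\<mu> f" by (rule P.integrable_riesz[OF f])
   have fpi: "integrable ?\<mu> (\<lambda>x. f x * \<phi> x)"
   proof (rule P.integrable_riesz[where c = c])
    show "(\<lambda>x. f x * \<phi> x) \<in> borel_measurable M" using f(1) core_measurable[OF \<phi>(1)] by (rule borel_measurable_times)
    show "\<bar>f x * \<phi> x\<bar> \<le> c" if "x \<in> X" for x
     using mult_mono[of "\<bar>f x\<bar>" c "\<bar>\<phi> x\<bar>" 1] f(2)[OF that] \<phi>(2)[OF that] g(4) by (simp add: abs_mult)
   qed
   have "(\<integral>x. f x \<partial>?\<mu>) - (\<integral>x. f x * \<phi> x \<partial>?\<mu>) = (\<integral>x. f x * (1 - \<phi> x) \<partial>?\<mu>)"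
    using fi fpi by (simp add: right_diff_distrib)
   also have "\<bar>\<dots>\<bar> \<le> (\<integral>x. c * (1 - \<phi> x) \<partial>?\<mu>)"
   proof (rule order_trans[OF integral_abs_bound integral_mono])
    show "integrable ?\<mu> (\<lambda>x. \<bar>f x * (1 - \<phi> x)\<bar>)" using fi fpi by (simp add: right_diff_distrib)
    show "integrable ?\<mu> (\<lambda>x. c * (1 - \<phi> x))" using i\<phi> by simp
    show "\<bar>f x * (1 - \<phi> x)\<bar> \<le> c * (1 - \<phi> x)" if "x \<in> space ?\<mu>" for x
     using f(2)[of x] \<phi>(2)[of x] that by (auto simp: abs_mult riesz_space intro!: mult_right_mono)
   qed
   also have "\<dots> = c * (\<integral>x. 1 - \<phi> x \<partial>?\<mu>)" by simp
   also have "\<dots> \<le> c * (e / (8 * (c + 1)))" using i1 g(4) by (rule mult_left_mono)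
   also have "\<dots> \<le> (c + 1) * (e / (8 * (c + 1)))" using e g(4) by (intro mult_right_mono) auto
   also have "\<dots> = e / 8"
   proof -
    have "S * (e / (8 * S)) = e / 8" if "S > 0" for S :: real using that by simp
    from this[of "c + 1"] show ?thesis using g(4) by linarith
   qed
   finally show ?thesis .
  qed
  obtain N where N: "\<And>n. n \<ge> N ==> \<bar>(\<integral>x. s n x * \<phi> x \<partial>?\<mu>) - (\<integral>x. g x * \<phi> x \<partial>?\<mu>)\<bar> < e / 2"
   using LIMSEQ_D[OF cutlim[OF \<phi>(1,2)], of "e / 2"] e by auto
  have "norm ((\<integral>x. s n x \<partial>?\<mu>) - (\<integral>x. g x \<partial>?\<mu>)) < e" if "n \<ge> N" for n
   using rest[OF core_measurable[OF s(1)] s(2), of n] rest[OF gm g(2)] N[OF that] e unfolding real_norm_def by linarith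
  then show "\<exists>N. \<forall>n\<ge>N. norm ((\<integral>x. s n x \<partial>?\<mu>) - (\<integral>x. g x \<partial>?\<mu>)) < e" by blast
 qed
 moreover have "(\<integral>x. s n x \<partial>?\<mu>) = Gamma u (s n)" for n by (rule P.integral_riesz[OF s(1)])
 ultimately have "(\<lambda>n. Gamma u (s n)) ----> (\<integral>x. g x \<partial>?\<mu>)" by simp
 then show ?thesis using L by (rule LIMSEQ_unique)
qed

text \<open>Resolves the definite description: the Riesz measure satisfies the identity for all
  bounded quasi-continuous g in the extended space, and conversely core functions are among these g,
  which pins the measure down by \<open>riesz_unique\<close>.\<close>

theorem energy_measure_bounded_eq:
 assumes u: "u \<in> F" "\<And>x. x \<in> X ==> \<bar>u x\<bar> \<le> b"
 shows "energy_measure_bounded M E F u = riesz (Gamma u)"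
 unfolding energy_measure_bounded_def space_M
proof (rule the_equality)
 interpret P: positive_functional M E F X "Gamma u" "2 * E u u" by (rule Gamma_functional[OF u])
 interpret R: finite_measure "riesz (Gamma u)" by (rule P.finite_riesz)
 have ub: "\<bar>u x\<bar> \<le> b" if "x \<in> space M" for x using u(2) that by (simp add: space_M)
 show "radon_measure_on X (riesz (Gamma u)) \<and> (\<forall>g\<in>extended_space M E F. bounded (g ` X) \<and> quasi_continuous M E F g \<longrightarrow>
   (\<integral>x. g x \<partial>riesz (Gamma u)) = 2 * extended_form M E F u (\<lambda>x. u x * g x) - extended_form M E F (\<lambda>x. (u x)\<^sup>2) g)"
 proof (intro conjI ballI impI)
  show "radon_measure_on X (riesz (Gamma u))"
  proof -
   have "emeasure (riesz (Gamma u)) K < \<infinity>" for K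
    by (metis R.emeasure_finite top.not_eq_extremum infinity_ennreal_def)
   moreover have "sets (riesz (Gamma u)) = sets (restrict_space borel X)" by (simp only: riesz_sets sets_M)
   ultimately show ?thesis unfolding radon_measure_on_def by blast
  qed
  fix g assume g: "g \<in> extended_space M E F" "bounded (g ` X) \<and> quasi_continuous M E F g"
  then obtain c where c: "\<And>y. y \<in> g ` X ==> norm y \<le> c" unfolding bounded_iff by blast
  have c': "\<bar>g x\<bar> \<le> max c 0" if "x \<in> X" for x using c[of "g x"] that by (auto simp: le_max_iff_disj)
  have qc: "quasi_continuous M E F g" using g by blast
  show "(\<integral>x. g x \<partial>riesz (Gamma u)) = 2 * extended_form M E F u (\<lambda>x. u x * g x) - extended_form M E F (\<lambda>x. (u x)\<^sup>2) g"
   by (rule integral_riesz_extended[OF u g(1) c' qc]) simp_all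
 qed
 fix \<mu> :: "'a measure"
 assume \<mu>: "radon_measure_on X \<mu> \<and> (\<forall>g\<in>extended_space M E F. bounded (g ` X) \<and> quasi_continuous M E F g \<longrightarrow>
   (\<integral>x. g x \<partial>\<mu>) = 2 * extended_form M E F u (\<lambda>x. u x * g x) - extended_form M E F (\<lambda>x. (u x)\<^sup>2) g)"
 show "\<mu> = riesz (Gamma u)"
 proof (rule P.riesz_unique)
  show "radon_measure_on X \<mu>" using \<mu> by simp
  fix g assume g: "g \<in> core"
  obtain c where c: "\<And>x. x \<in> X ==> \<bar>g x\<bar> \<le> c" using core_bounded[OF g] by blast
  have gF: "g \<in> F" by (rule core_F[OF g])
  have "g \<in> extended_space M E F"
   unfolding extended_space_def using F_measurable[OF gF] approximating_seq_const[OF gF] by blast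
  moreover have "bounded (g ` X)" unfolding bounded_iff using c by auto
  moreover have "quasi_continuous M E F g" by (rule quasi_continuous_continuous[OF core_continuous[OF g]])
  ultimately have "(\<integral>x. g x \<partial>\<mu>) = 2 * extended_form M E F u (\<lambda>x. u x * g x) - extended_form M E F (\<lambda>x. (u x)\<^sup>2) g"
   using \<mu> by blast
  also have "\<dots> = Gamma u g"
  proof -
   have "\<bar>g x\<bar> \<le> c" if "x \<in> space M" for x using c that by (simp add: space_M)
   from mult_in(1)[OF u(1) gF ub this] have "(\<lambda>x. u x * g x) \<in> F" .
   then show ?thesis unfolding Gamma_def using u(1) gF square_in[OF u(1) ub] by (simp add: extended_form_eq)
  qed
  finally show "(\<integral>x. g x \<partial>\<mu>) = Gamma u g" .
 qed
qed

text \<open>A bounded d vanishing a.e. on \<open>W\<close> has energy 0 with any w carried by a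
  compact subset of \<open>W\<close>: by \<open>form_cutoff\<close> it may be multiplied by a cutoff
  inside \<open>W\<close>, which makes it a null function. This replaces u by v in the first slot;
  in the second slot the products with g agree almost everywhere.\<close>

lemma Gamma_local:
 assumes u: "u \<in> F" "\<And>x. x \<in> X ==> \<bar>u x\<bar> \<le> b" and v: "v \<in> F" "\<And>x. x \<in> X ==> \<bar>v x\<bar> \<le> b"
  and W: "open W" "W \<subseteq> X" and eq: "AE x in M. x \<in> W \<longrightarrow> u x = v x" and g: "g \<in> supported W"
 shows "Gamma u g = Gamma v g"
proof -
 obtain K where K: "compact K" "K \<subseteq> W" "\<And>x. x \<in> X - K ==> g x = 0" and gc: "g \<in> core" "\<And>x. x \<in> X ==> 0 \<le> g x \<and> g x \<le> 1"
  using g unfolding supported_def by blast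
 obtain \<phi> V L where \<phi>: "\<phi> \<in> core" "\<And>x. x \<in> X ==> 0 \<le> \<phi> x \<and> \<phi> x \<le> 1" "open V" "V \<subseteq> X" "K \<subseteq> V" "L \<subseteq> W"
  "\<And>x. x \<in> V ==> \<phi> x = 1" "\<And>x. x \<in> X - L ==> \<phi> x = 0"
  by (rule core_cutoff[OF K(1,2) W], rule that)
 note gF = core_F[OF gc(1)]
 have KX: "K \<subseteq> X" using K(2) W(2) by auto
 have ub: "\<bar>u x\<bar> \<le> \<bar>b\<bar>" if "x \<in> space M" for x using u(2)[of x] that by (simp add: space_M)
 have vb: "\<bar>v x\<bar> \<le> \<bar>b\<bar>" if "x \<in> space M" for x using v(2)[of x] that by (simp add: space_M)
 have gb: "\<bar>g x\<bar> \<le> 1" if "x \<in> space M" for x using gc(2)[of x] that by (simp add: space_M)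
 note ug = mult_in(1)[OF u(1) gF ub gb] and vg = mult_in(1)[OF v(1) gF vb gb]
 note u2 = square_in[OF u(1) ub] and v2 = square_in[OF v(1) vb]
 have zero: "E d w = 0" if d: "d \<in> F" "\<And>x. x \<in> X ==> \<bar>d x\<bar> \<le> c" "c \<ge> 0" "AE x in M. x \<in> W \<longrightarrow> d x = 0"
  and w: "w \<in> F" "\<And>x. x \<in> X - K ==> w x = 0" for d w c
 proof -
  note cut = form_cutoff[OF d(1,2,3) w(1) K(1) KX w(2) \<phi>(3,4,5,1,2,7)]
  have "AE x in M. d x * \<phi> x = 0"
   using d(4) AE_space
  proof eventually_elim
   case (elim x)
   then show ?case using \<phi>(6) \<phi>(8)[of x] by (cases "x \<in> L") (auto simp: space_M)
  qed
  then have "E (\<lambda>x. d x * \<phi> x) w = E (\<lambda>x. 0) w" by (intro form_version cut(1) domain_zero w)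
  then show ?thesis using cut(2) form.B_zerol[OF w(1)] by simp
 qed
 have "E (\<lambda>x. u x - v x) (\<lambda>x. u x * g x) = 0"
 proof (rule zero[where c = "2 * \<bar>b\<bar>"])
  show "\<bar>u x - v x\<bar> \<le> 2 * \<bar>b\<bar>" if "x \<in> X" for x using ub[of x] vb[of x] that by (simp add: space_M)
  show "AE x in M. x \<in> W \<longrightarrow> u x - v x = 0" using eq by eventually_elim simp
 qed (use u v ug K(3) in "auto intro: form.V_diff")
 moreover have "E v (\<lambda>x. u x * g x) = E v (\<lambda>x. v x * g x)"
 proof (rule E_cong_AE[OF v(1,1) ug vg])
  show "AE x in M. u x * g x = v x * g x"
   using eq AE_space
  proof eventually_elim
   case (elim x)
   then show ?case using K(2,3) by (cases "x \<in> K") (auto simp: space_M)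
  qed
  show "AE x in M. v x = v x" by (rule AE_I2) (rule refl)
 qed
 ultimately have 1: "E u (\<lambda>x. u x * g x) = E v (\<lambda>x. v x * g x)"
  using form.B_diffl[OF u(1) v(1) ug] by simp
 have "E (\<lambda>x. (u x)\<^sup>2 - (v x)\<^sup>2) g = 0"
 proof (rule zero[where c = "2 * \<bar>b\<bar>\<^sup>2"])
  show "\<bar>(u x)\<^sup>2 - (v x)\<^sup>2\<bar> \<le> 2 * \<bar>b\<bar>\<^sup>2" if "x \<in> X" for x
  proof -
   have "\<bar>u x\<bar> \<le> \<bar>b\<bar>" "\<bar>v x\<bar> \<le> \<bar>b\<bar>" using ub[of x] vb[of x] that by (auto simp: space_M)
   then have "(u x)\<^sup>2 \<le> b\<^sup>2" "(v x)\<^sup>2 \<le> b\<^sup>2" by (simp_all only: abs_le_square_iff)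
   moreover have "0 \<le> (u x)\<^sup>2" "0 \<le> (v x)\<^sup>2" by auto
   moreover have "\<bar>p - q\<bar> \<le> 2 * r" if "p \<le> r" "q \<le> r" "0 \<le> p" "0 \<le> q" for p q r :: real
    using that by linarith
   ultimately show ?thesis by simp
  qed
  show "AE x in M. x \<in> W \<longrightarrow> (u x)\<^sup>2 - (v x)\<^sup>2 = 0" using eq by eventually_elim simp
 qed (use u2 v2 gF K(3) in "auto intro: form.V_diff")
 then have 2: "E (\<lambda>x. (u x)\<^sup>2) g = E (\<lambda>x. (v x)\<^sup>2) g" using form.B_diffl[OF u2 v2 gF] by simp
 show ?thesis using 1 2 by (simp add: Gamma_def)
qed


section \<open>Energy measures of unbounded functions and of local functions\<close>

lemma truncate_truncate: "real n \<le> real m ==> truncate (real n) (truncate (real m) f) = truncate (real n) f"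
 by (auto simp: truncate_def fun_eq_iff)

definition truncated_energy :: "('a \<Rightarrow> real) \<Rightarrow> nat \<Rightarrow> 'a set \<Rightarrow> ennreal" where
 "truncated_energy u n A = riesz_outer (Gamma (truncate (real n) u)) A"

lemma truncate_F: "u \<in> F ==> truncate (real n) u \<in> F" by (rule truncate_in(1)) simp_all

lemma emeasure_truncated:
 assumes "u \<in> F" "A \<in> sets M"
 shows "emeasure (energy_measure_bounded M E F (truncate (real n) u)) A = truncated_energy u n A"
proof -
 have b: "\<bar>truncate (real n) u x\<bar> \<le> real n" for x by (rule truncate_bounded) simp
 interpret P: positive_functional M E F X "Gamma (truncate (real n) u)" "2 * E (truncate (real n) u) (truncate (real n) u)"
  by (rule Gamma_functional[OF truncate_F[OF assms(1)] b])
 show ?thesis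
  unfolding energy_measure_bounded_eq[OF truncate_F[OF assms(1)] b] truncated_energy_def
  by (rule P.emeasure_riesz[OF assms(2)])
qed

text \<open>Truncation at n is a normal contraction of truncation at n + 1, so monotonicity of
  \<open>Gamma\<close> under contractions applies.\<close>

lemma truncated_energy_incseq:
 assumes u: "u \<in> F" shows "incseq (\<lambda>n. truncated_energy u n A)"
proof (rule incseq_SucI)
 fix n
 define v where "v = truncate (real (Suc n)) u"
 have v: "v \<in> F" "\<And>x. \<bar>v x\<bar> \<le> real (Suc n)"
  unfolding v_def by (rule truncate_F[OF u], rule truncate_bounded, simp)
 have tv: "truncate (real n) u = (\<lambda>x. max (- real n) (min (real n) (v x)))"
  using truncate_truncate[of n "Suc n" u] unfolding v_def truncate_def by (simp add: fun_eq_iff)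
 show "truncated_energy u n A \<le> truncated_energy u (Suc n) A"
  unfolding truncated_energy_def v_def[symmetric]
 proof (rule riesz_outer_functional_mono)
  fix g assume g: "g \<in> supported X"
  have gb: "0 \<le> g x \<and> g x \<le> 1" if "x \<in> space M" for x using g that by (auto simp: supported_def space_M)
  have gF: "g \<in> F" using g by (auto simp: supported_def intro: core_F)
  show "Gamma (truncate (real n) u) g \<le> Gamma v g"
   unfolding tv by (rule Gamma_mono(1)[OF v gF gb]) (use truncate_contraction[of "real n"] in auto)
 qed
qed

lemma truncated_energy_additive:
 assumes "u \<in> F" shows "countably_additive (sets M) (truncated_energy u n)"
 unfolding countably_additive_def
proof (intro allI impI)
 fix A :: "nat \<Rightarrow> 'a set"
 assume A: "range A \<subseteq> sets M" "disjoint_family A" "(\<Union>i. A i) \<in> sets M"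
 let ?\<mu> = "energy_measure_bounded M E F (truncate (real n) u)"
 have b: "\<bar>truncate (real n) u x\<bar> \<le> real n" for x by (rule truncate_bounded) simp
 have s: "sets ?\<mu> = sets M"
  unfolding energy_measure_bounded_eq[OF truncate_F[OF assms(1)] b] by (rule riesz_sets)
 have "(\<Sum>i. emeasure ?\<mu> (A i)) = emeasure ?\<mu> (\<Union>i. A i)"
  using A by (intro suminf_emeasure) (auto simp: s)
 moreover have "emeasure ?\<mu> (A i) = truncated_energy u n (A i)" for i
  using A(1) by (intro emeasure_truncated assms) auto
 ultimately show "(\<Sum>i. truncated_energy u n (A i)) = truncated_energy u n (\<Union>i. A i)"
  using emeasure_truncated[OF assms A(3)] by simp
qed

text \<open>By monotonicity the limit in the definition is a supremum, and suprema of increasing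
  sequences commute with countable sums; hence the set function is a measure and
  \<open>measure_of\<close> returns it unchanged on measurable sets.\<close>

theorem emeasure_energy_measure:
 assumes u: "u \<in> F" and A: "A \<in> sets M"
 shows "emeasure (energy_measure M E F u) A = (SUP n. truncated_energy u n A)"
proof -
 have sup: "lim (\<lambda>n. emeasure (energy_measure_bounded M E F (truncate (real n) u)) B) = (SUP n. truncated_energy u n B)"
  if "B \<in> sets M" for B
  unfolding emeasure_truncated[OF u that]
  by (rule limI[OF LIMSEQ_SUP[OF truncated_energy_incseq[OF u]]])
 have em: "energy_measure M E F u = measure_of (space M) (sets M) (\<lambda>A. SUP n. truncated_energy u n A)"
  unfolding energy_measure_def
  by (rule measure_of_eq[OF sets.space_closed]) (simp add: sup sets.sigma_sets_eq)
 have sets: "sets (energy_measure M E F u) = sets M" unfolding em by simp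
 have "positive (sets M) (\<lambda>A. SUP n. truncated_energy u n A)"
  unfolding positive_def using emeasure_truncated[OF u, of "{}"] by simp
 moreover have "countably_additive (sets M) (\<lambda>A. SUP n. truncated_energy u n A)"
  unfolding countably_additive_def
 proof (intro allI impI)
  fix A :: "nat \<Rightarrow> 'a set"
  assume A: "range A \<subseteq> sets M" "disjoint_family A" "(\<Union>i. A i) \<in> sets M"
  have "(\<Sum>i. SUP n. truncated_energy u n (A i)) = (SUP n. \<Sum>i. truncated_energy u n (A i))"
   by (rule ennreal_suminf_SUP_eq[OF truncated_energy_incseq[OF u]])
  also have "\<dots> = (SUP n. truncated_energy u n (\<Union>i. A i))"
   using truncated_energy_additive[OF u] A unfolding countably_additive_def by simp
  finally show "(\<Sum>i. SUP n. truncated_energy u n (A i)) = (SUP n. truncated_energy u n (\<Union>i. A i))" .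
 qed
 ultimately show ?thesis
  by (intro emeasure_measure_of[OF em]) (use A sets sets.space_closed in auto)
qed

lemma sets_energy_measure: "sets (energy_measure M E F u) = sets M"
 unfolding energy_measure_def by simp

lemma energy_measure_local:
 assumes u: "u \<in> F" and v: "v \<in> F" and W: "open W" "W \<subseteq> X" and eq: "AE x in M. x \<in> W \<longrightarrow> u x = v x"
  and A: "A \<in> sets M" "A \<subseteq> W"
 shows "emeasure (energy_measure M E F u) A = emeasure (energy_measure M E F v) A"
proof -
 have "truncated_energy u n A = truncated_energy v n A" for n
  unfolding truncated_energy_def
 proof (rule riesz_outer_local[OF W _ A(2)])
  have b: "\<bar>truncate (real n) f x\<bar> \<le> real n" for f :: "'a \<Rightarrow> real" and x by (rule truncate_bounded) simp
  fix g assume g: "g \<in> supported W"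
  have "AE x in M. x \<in> W \<longrightarrow> truncate (real n) u x = truncate (real n) v x"
   using eq by eventually_elim (simp add: truncate_def)
  then show "Gamma (truncate (real n) u) g = Gamma (truncate (real n) v) g"
   by (intro Gamma_local[OF truncate_F[OF u] b truncate_F[OF v] b W _ g])
 qed
 then show ?thesis by (simp add: emeasure_energy_measure[OF u A(1)] emeasure_energy_measure[OF v A(1)])
qed

text \<open>The predicate under the definite description of \<open>energy_measure_loc\<close>,
  isolated so that existence and uniqueness can be stated separately.\<close>

definition local_energy :: "'a set \<Rightarrow> ('a \<Rightarrow> real) \<Rightarrow> 'a measure \<Rightarrow> bool" where
 "local_energy U f \<nu> \<longleftrightarrow> sets \<nu> = sets (restrict_space borel U) \<and>
    (\<forall>W. \<forall>u\<in>F. relcompact_open_in U W \<and> (AE x in M. x \<in> W \<longrightarrow> f x = u x) \<longrightarrow>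
      (\<forall>A \<in> sets borel. A \<subseteq> W \<longrightarrow> emeasure \<nu> A = emeasure (energy_measure M E F u) A))"

lemma local_exhaustion:
 assumes U: "open U" and f: "f \<in> F_loc M F U"
 obtains W u where "\<And>n. relcompact_open_in U (W n)" "(\<Union>n::nat. W n) = U" "\<And>n. u n \<in> F"
  "\<And>n. AE x in M. x \<in> W n \<longrightarrow> f x = u n x"
proof -
 obtain K where K: "\<And>n. compact (K n)" "incseq K" "(\<Union>n. K n) = U" "\<And>L. compact L ==> L \<subseteq> U ==> \<exists>n. L \<subseteq> interior (K n)"
  by (rule compact_exhaustion[OF U], rule that)
 have KU: "K n \<subseteq> U" for n using K(3) by auto
 define W where "W n = interior (K n)" for n
 have W: "relcompact_open_in U (W n)" for n
 proof -
  have cl: "closure (W n) \<subseteq> K n"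
   unfolding W_def by (rule closure_minimal[OF interior_subset compact_imp_closed[OF K(1)]])
  then have "compact (closure (W n))" using compact_Int_closed[OF K(1)[of n] closed_closure[of "W n"]] by (simp add: Int_absorb1)
  then show ?thesis unfolding relcompact_open_in_def using cl KU[of n] by (auto simp: W_def)
 qed
 have "(\<Union>n. W n) = U"
 proof
  show "(\<Union>n. W n) \<subseteq> U" using interior_subset KU unfolding W_def by (intro UN_least) (rule order_trans)
  show "U \<subseteq> (\<Union>n. W n)"
  proof
   fix x assume "x \<in> U"
   then obtain n where "{x} \<subseteq> interior (K n)" using K(4)[of "{x}"] by auto
   then show "x \<in> (\<Union>n. W n)" by (auto simp: W_def)
  qed
 qed
 moreover have "\<exists>u. u \<in> F \<and> (AE x in M. x \<in> W n \<longrightarrow> f x = u x)" for n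
  using f W[of n] unfolding F_loc_def by blast
 then obtain u where "\<And>n. u n \<in> F \<and> (AE x in M. x \<in> W n \<longrightarrow> f x = u n x)" by metis
 ultimately show ?thesis using that[of W u] W by blast
qed

lemma relcompact_open_inD:
 assumes "relcompact_open_in U W" shows "open W" "W \<subseteq> U"
 using assms closure_subset[of W] by (auto simp: relcompact_open_in_def)

text \<open>An open set is a countable union of relatively compact pieces; after making them
  disjoint, the measure of any Borel set is the sum of prescribed values.\<close>

lemma local_energy_unique:
 assumes U: "open U" and f: "f \<in> F_loc M F U" and "local_energy U f \<nu>" "local_energy U f \<nu>'"
 shows "\<nu> = \<nu>'"
proof -
 obtain W u where W: "\<And>n. relcompact_open_in U (W n)" "(\<Union>n::nat. W n) = U" "\<And>n. u n \<in> F"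
  "\<And>n. AE x in M. x \<in> W n \<longrightarrow> f x = u n x"
  by (rule local_exhaustion[OF U f], rule that)
 note Wo = relcompact_open_inD[OF W(1)]
 have Db: "disjointed W n \<in> sets borel" for n
  using Wo(1) by (intro sets.range_disjointed_sets[THEN subsetD, of W borel]) auto
 have key: "emeasure \<mu> A = (\<Sum>n. emeasure (energy_measure M E F (u n)) (A \<inter> disjointed W n))"
  if \<mu>: "local_energy U f \<mu>" and A: "A \<in> sets borel" "A \<subseteq> U" for \<mu> A
 proof -
  have s: "B \<in> sets \<mu>" if "B \<in> sets borel" "B \<subseteq> U" for B
   using that \<mu> U by (auto simp: local_energy_def sets_restrict_space_iff)
  have "emeasure \<mu> (A \<inter> disjointed W n) = emeasure (energy_measure M E F (u n)) (A \<inter> disjointed W n)" for n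
  proof -
   have "A \<inter> disjointed W n \<in> sets borel" using A Db by auto
   moreover have "A \<inter> disjointed W n \<subseteq> W n" using disjointed_subset[of W n] by auto
   ultimately show ?thesis using \<mu> W(1,3,4) unfolding local_energy_def by blast
  qed
  moreover have "(\<Sum>n. emeasure \<mu> (A \<inter> disjointed W n)) = emeasure \<mu> (\<Union>n. A \<inter> disjointed W n)"
  proof (rule suminf_emeasure)
   show "range (\<lambda>n. A \<inter> disjointed W n) \<subseteq> sets \<mu>"
    using A Db by (auto intro!: s)
   show "disjoint_family (\<lambda>n. A \<inter> disjointed W n)"
    using disjoint_family_disjointed[of W] by (auto simp: disjoint_family_on_def)
  qed
  moreover have "(\<Union>n. A \<inter> disjointed W n) = A"
   using UN_disjointed_eq[of W] W(2) A(2) by (simp add: Int_UN_distrib[symmetric] Int_absorb2)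
  ultimately show ?thesis by simp
 qed
 show ?thesis
 proof (rule measure_eqI)
  show "sets \<nu> = sets \<nu>'" using assms(3,4) by (simp add: local_energy_def)
  fix A assume "A \<in> sets \<nu>"
  then have "A \<in> sets borel" "A \<subseteq> U" using assms(3) U by (auto simp: local_energy_def sets_restrict_space_iff)
  then show "emeasure \<nu> A = emeasure \<nu>' A" using key[OF assms(3)] key[OF assms(4)] by simp
 qed
qed

lemma local_energy_exists:
 assumes f: "f \<in> F_loc M F X"
 shows "\<exists>\<nu>. local_energy X f \<nu>"
proof -
 obtain W u where W: "\<And>n. relcompact_open_in X (W n)" "(\<Union>n::nat. W n) = X" "\<And>n. u n \<in> F"
  "\<And>n. AE x in M. x \<in> W n \<longrightarrow> f x = u n x"
  by (rule local_exhaustion[OF open_X f], rule that)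
 note Wo = relcompact_open_inD[OF W(1)]
 have DM: "disjointed W n \<in> sets M" for n
  using Wo by (intro sets.range_disjointed_sets[THEN subsetD, of W M]) (auto simp: sets_M_iff)
 \<comment> \<open>The sum over the disjoint pieces is written as an integral over
   \<open>count_space\<close>, so that countable additivity is the exchange of an integral with a
   series.\<close>
 define N where "N A = (\<integral>\<^sup>+n. emeasure (energy_measure M E F (u n)) (A \<inter> disjointed W n) \<partial>count_space UNIV)" for A
 define \<nu> where "\<nu> = measure_of X (sets M) N"
 have XM: "sets M \<subseteq> Pow X" using sets.space_closed[of M] by (simp add: space_M)
 have \<nu>s: "sets \<nu> = sets M"
  unfolding \<nu>_def using XM sets.sigma_sets_eq[of M] by (simp add: space_M)
 have "countably_additive (sets M) N"
  unfolding countably_additive_def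
 proof (intro allI impI)
  fix A :: "nat \<Rightarrow> 'a set"
  assume A: "range A \<subseteq> sets M" "disjoint_family A" "(\<Union>i. A i) \<in> sets M"
  have "(\<Sum>i. N (A i)) = (\<integral>\<^sup>+n. (\<Sum>i. emeasure (energy_measure M E F (u n)) (A i \<inter> disjointed W n)) \<partial>count_space UNIV)"
   unfolding N_def by (rule nn_integral_suminf[symmetric]) simp
  also have "\<dots> = N (\<Union>i. A i)"
   unfolding N_def
  proof (rule nn_integral_cong)
   fix n :: nat
   have "(\<Sum>i. emeasure (energy_measure M E F (u n)) (A i \<inter> disjointed W n)) =
     emeasure (energy_measure M E F (u n)) (\<Union>i. A i \<inter> disjointed W n)"
   proof (rule suminf_emeasure)
    show "range (\<lambda>i. A i \<inter> disjointed W n) \<subseteq> sets (energy_measure M E F (u n))"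
     using A(1) DM[of n] by (auto simp: sets_energy_measure)
    show "disjoint_family (\<lambda>i. A i \<inter> disjointed W n)" using A(2) by (auto simp: disjoint_family_on_def)
   qed
   then show "(\<Sum>i. emeasure (energy_measure M E F (u n)) (A i \<inter> disjointed W n)) =
     emeasure (energy_measure M E F (u n)) ((\<Union>i. A i) \<inter> disjointed W n)" by simp
  qed
  finally show "(\<Sum>i. N (A i)) = N (\<Union>i. A i)" .
 qed
 moreover have "positive (sets M) N" by (simp add: positive_def N_def)
 ultimately have \<nu>e: "emeasure \<nu> A = N A" if "A \<in> sets M" for A
  by (intro emeasure_measure_of[OF \<nu>_def]) (use XM that \<nu>s in auto)
 have "local_energy X f \<nu>"
  unfolding local_energy_def
 proof (intro conjI allI ballI impI)
  show "sets \<nu> = sets (restrict_space borel X)" by (simp only: \<nu>s sets_M)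
  fix V v A assume v: "v \<in> F" and V: "relcompact_open_in X V \<and> (AE x in M. x \<in> V \<longrightarrow> f x = v x)"
   and A: "A \<in> sets borel" "A \<subseteq> V"
  have Vo: "open V" "V \<subseteq> X" using relcompact_open_inD V by blast+
  have AM: "A \<in> sets M" using A Vo by (auto simp: sets_M_iff)
  have "N A = (\<integral>\<^sup>+n. emeasure (energy_measure M E F v) (A \<inter> disjointed W n) \<partial>count_space UNIV)"
   unfolding N_def
  proof (rule nn_integral_cong)
   fix n :: nat
   have sub: "A \<inter> disjointed W n \<subseteq> W n \<inter> V" using disjointed_subset[of W n] A(2) by auto
   have "AE x in M. x \<in> W n \<inter> V \<longrightarrow> u n x = v x"
    using W(4)[of n] conjunct2[OF V] by eventually_elim auto
   then show "emeasure (energy_measure M E F (u n)) (A \<inter> disjointed W n) = emeasure (energy_measure M E F v) (A \<inter> disjointed W n)"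
    using Wo[of n] Vo AM DM[of n] by (intro energy_measure_local[OF W(3) v _ _ _ _ sub]) auto
  qed
  also have "\<dots> = (\<Sum>n. emeasure (energy_measure M E F v) (A \<inter> disjointed W n))"
   by (rule nn_integral_count_space_nat)
  also have "\<dots> = emeasure (energy_measure M E F v) (\<Union>n. A \<inter> disjointed W n)"
  proof (rule suminf_emeasure)
   show "range (\<lambda>n. A \<inter> disjointed W n) \<subseteq> sets (energy_measure M E F v)"
    using AM DM by (auto simp: sets_energy_measure)
   show "disjoint_family (\<lambda>n. A \<inter> disjointed W n)"
    using disjoint_family_disjointed[of W] by (auto simp: disjoint_family_on_def)
  qed
  also have "(\<Union>n. A \<inter> disjointed W n) = A"
  proof -
   have "A \<subseteq> X" using A(2) Vo(2) by (rule order_trans)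
   then show ?thesis using UN_disjointed_eq[of W] W(2) by (simp add: Int_UN_distrib[symmetric] Int_absorb2)
  qed
  finally show "emeasure \<nu> A = emeasure (energy_measure M E F v) A" using \<nu>e[OF AM] by simp
 qed
 then show ?thesis by blast
qed

lemma F_loc_subset:
 assumes f: "f \<in> F_loc M F X" and U: "U \<subseteq> X"
 shows "f \<in> F_loc M F U"
proof -
 have "f \<in> borel_measurable (restrict_space borel X)" using f by (simp add: F_loc_def)
 then have "f \<in> borel_measurable (restrict_space (restrict_space borel X) U)" by (rule measurable_restrict_space1)
 moreover have "sets (restrict_space (restrict_space (borel :: 'a measure) X) U) = sets (restrict_space borel U)"
  using U by (simp add: sets_restrict_restrict_space Int_absorb1)
 ultimately have "f \<in> borel_measurable (restrict_space borel U)"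
  using measurable_cong_sets[OF _ refl] by blast
 moreover have "relcompact_open_in X W" if "relcompact_open_in U W" for W
  using that U by (auto simp: relcompact_open_in_def)
 ultimately show ?thesis using f by (simp add: F_loc_def)
qed

text \<open>The Poincare inequality refers to the energy measure on a small ball, a description of
  its own. Restricting the measure on \<open>X\<close> to the open subset satisfies that
  description, so uniqueness identifies the two, and energies of overlapping balls become values of
  a single measure.\<close>

theorem energy_measure_loc_restrict:
 assumes f: "f \<in> F_loc M F X" and U: "open U" "U \<subseteq> X" and A: "A \<in> sets borel" "A \<subseteq> U"
 shows "emeasure (energy_measure_loc M E F U f) A = emeasure (energy_measure_loc M E F X f) A"
proof -
 obtain \<nu> where \<nu>: "local_energy X f \<nu>" using local_energy_exists[OF f] by blast
 have sets\<nu>: "sets \<nu> = sets M" using \<nu> sets_M by (simp add: local_energy_def)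
 have eq: "energy_measure_loc M E F V f = restrict_space \<nu> V" if V: "open V" "V \<subseteq> X" for V
 proof -
  have VM: "V \<inter> space \<nu> \<in> sets \<nu>"
   using V sets_eq_imp_space_eq[OF sets\<nu>] by (simp add: sets\<nu> space_M sets_M_iff Int_absorb2)
  have "local_energy V f (restrict_space \<nu> V)"
   unfolding local_energy_def
  proof (intro conjI allI ballI impI)
   show "sets (restrict_space \<nu> V) = sets (restrict_space borel V)"
   proof -
    have "sets (restrict_space \<nu> V) = sets (restrict_space (restrict_space borel X) V)"
     by (rule sets_restrict_space_cong) (simp only: sets\<nu> sets_M)
    also have "\<dots> = sets (restrict_space borel V)"
     using V(2) by (simp add: sets_restrict_restrict_space Int_absorb1)
    finally show ?thesis .
   qed
   fix W u B assume u: "u \<in> F" and W: "relcompact_open_in V W \<and> (AE x in M. x \<in> W \<longrightarrow> f x = u x)"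
    and B: "B \<in> sets borel" "B \<subseteq> W"
   have "relcompact_open_in X W" using W V(2) by (auto simp: relcompact_open_in_def)
   then have "emeasure \<nu> B = emeasure (energy_measure M E F u) B"
    using \<nu> u W B unfolding local_energy_def by blast
   moreover have "B \<subseteq> V" using B(2) W relcompact_open_inD(2) by blast
   ultimately show "emeasure (restrict_space \<nu> V) B = emeasure (energy_measure M E F u) B"
    using emeasure_restrict_space[OF VM] by simp
  qed
  then show ?thesis
   unfolding energy_measure_loc_def local_energy_def[symmetric]
   by (intro the_equality local_energy_unique[OF V(1) F_loc_subset[OF f V(2)]])
 qed
 have "emeasure (restrict_space \<nu> V) A = emeasure \<nu> A" if "open V" "V \<subseteq> X" "A \<subseteq> V" for V
  using that sets_eq_imp_space_eq[OF sets\<nu>]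
  by (intro emeasure_restrict_space) (auto simp: sets\<nu> space_M sets_M_iff Int_absorb2)
 then show ?thesis using U A open_X by (simp add: eq)
qed

lemma sets_energy_measure_loc:
 assumes f: "f \<in> F_loc M F X"
 shows "sets (energy_measure_loc M E F X f) = sets M"
proof -
 obtain \<nu> where \<nu>: "local_energy X f \<nu>" using local_energy_exists[OF f] by blast
 have "energy_measure_loc M E F X f = \<nu>"
  unfolding energy_measure_loc_def local_energy_def[symmetric]
  by (intro the_equality \<nu> local_energy_unique[OF open_X f])
 then show ?thesis using \<nu> sets_M by (simp add: local_energy_def)
qed

end

section \<open>Doubling measures\<close>

text \<open>A maximal separated subset, given by Zorn's lemma, is a net: a point farther than r from
  it could be added.\<close>

lemma separated_net:
 fixes B :: "'a::metric_space set"
 assumes "r > 0"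
 obtains S where "S \<subseteq> B" "\<And>x y. x \<in> S ==> y \<in> S ==> x \<noteq> y ==> r \<le> dist x y" "\<And>x. x \<in> B ==> \<exists>s\<in>S. dist s x < r"
proof -
 define \<A> where "\<A> = {S. S \<subseteq> B \<and> (\<forall>x\<in>S. \<forall>y\<in>S. x \<noteq> y \<longrightarrow> r \<le> dist x y)}"
 have "\<exists>M\<in>\<A>. \<forall>X\<in>\<A>. M \<subseteq> X \<longrightarrow> X = M"
 proof (rule subset_Zorn')
  fix \<C> assume c: "subset.chain \<A> \<C>"
  have "r \<le> dist x y" if xy: "x \<in> \<Union>\<C>" "y \<in> \<Union>\<C>" "x \<noteq> y" for x y
  proof -
   obtain S T where ST: "S \<in> \<C>" "T \<in> \<C>" "x \<in> S" "y \<in> T" using xy by blast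
   then have "S \<subseteq> T \<or> T \<subseteq> S" using c unfolding subset.chain_def by blast
   then obtain R where "R \<in> \<C>" "x \<in> R" "y \<in> R" using ST by blast
   moreover have "R \<in> \<A>" using c calculation(1) unfolding subset.chain_def by blast
   ultimately show ?thesis using xy(3) by (simp add: \<A>_def)
  qed
  moreover have "\<Union>\<C> \<subseteq> B" using c unfolding subset.chain_def \<A>_def by blast
  ultimately show "\<Union>\<C> \<in> \<A>" unfolding \<A>_def by blast
 qed
 then obtain S where S: "S \<in> \<A>" "\<And>X. X \<in> \<A> ==> S \<subseteq> X ==> X = S" by blast
 have "\<exists>s\<in>S. dist s x < r" if x: "x \<in> B" for x
 proof (rule ccontr)
  assume n: "\<not> (\<exists>s\<in>S. dist s x < r)"
  then have far: "r \<le> dist s x" if "s \<in> S" for s using that by force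
  have "insert x S \<in> \<A>"
   unfolding \<A>_def using S(1) x far by (auto simp: \<A>_def dist_commute)
  then have "x \<in> S" using S(2)[of "insert x S"] by blast
  then show False using far[of x] assms by simp
 qed
 then show ?thesis using S(1) that[of S] unfolding \<A>_def by blast
qed

lemma exists_power_2: "\<exists>k::nat. (c::real) \<le> 2 ^ k"
 using real_arch_pow[of 2 c] by (auto intro: less_imp_le)

locale doubling_measure =
 fixes \<mu> :: "'a::polish_space measure" and C :: real
 assumes sets_\<mu>: "sets \<mu> = sets borel"
  and ball_pos: "r > 0 ==> emeasure \<mu> (ball x r) > 0"
  and ball_finite: "emeasure \<mu> (ball x r) < \<infinity>"
  and doubling: "r > 0 ==> emeasure \<mu> (ball x (2 * r)) \<le> ennreal C * emeasure \<mu> (ball x r)"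
  and C_ge_1: "C \<ge> 1"
begin

abbreviation V :: "'a \<Rightarrow> real \<Rightarrow> real" where "V x r \<equiv> measure \<mu> (ball x r)"

lemma emeasure_ball: "emeasure \<mu> (ball x r) = ennreal (V x r)"
 using ball_finite[of x r] by (simp add: emeasure_eq_ennreal_measure less_top)

lemma V_pos: "r > 0 ==> V x r > 0"
 using ball_pos[of r x] by (simp add: emeasure_ball)

lemma ball_sets [simp]: "ball x r \<in> sets \<mu>" by (simp add: sets_\<mu>)

lemma V_mono: "ball x r \<subseteq> ball y s ==> V x r \<le> V y s"
 using emeasure_mono[of "ball x r" "ball y s" \<mu>] by (simp add: emeasure_ball)

lemma V_doubling: "r > 0 ==> V x (2 * r) \<le> C * V x r"
 using doubling[of r x] C_ge_1 by (simp add: emeasure_ball ennreal_mult[symmetric])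

lemma V_power: "r > 0 ==> V x (2 ^ k * r) \<le> C ^ k * V x r"
proof (induction k)
 case (Suc k)
 have "V x (2 * (2 ^ k * r)) \<le> C * V x (2 ^ k * r)" using Suc.prems by (intro V_doubling) simp
 also have "\<dots> \<le> C * (C ^ k * V x r)" using Suc C_ge_1 by (intro mult_left_mono) auto
 finally show ?case by (simp add: mult.assoc)
qed simp

lemma V_compare:
 assumes "r > 0" "dist x y + R \<le> 2 ^ k * r"
 shows "V x R \<le> C ^ k * V y r"
proof -
 have "ball x R \<subseteq> ball y (2 ^ k * r)"
 proof
  fix z assume "z \<in> ball x R"
  then show "z \<in> ball y (2 ^ k * r)" using dist_triangle[of y z x] assms(2) by (simp add: dist_commute)
 qed
 then show ?thesis using V_mono V_power[OF assms(1)] order_trans by blast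
qed

text \<open>Packing: the balls of radius r/2 about the points are disjoint, lie in one ball of
  radius R + r/2, and each carries at least the fraction C^(-k) of its measure. Finiteness is proved
  from a uniform bound on finite subsets.\<close>

lemma separated_finite_card:
 fixes S :: "'a set"
 assumes r: "r > 0" and S: "S \<subseteq> ball y R" "\<And>x z. x \<in> S ==> z \<in> S ==> x \<noteq> z ==> r \<le> dist x z"
  and k: "2 * R + r / 2 \<le> 2 ^ k * (r / 2)"
 shows "finite S" "real (card S) \<le> C ^ k"
proof -
 have bd: "real (card T) \<le> C ^ k" if T: "T \<subseteq> S" "finite T" for T
 proof (cases "T = {}")
  case True
  then show ?thesis using C_ge_1 by simp
 next
  case False
  then obtain t :: 'a where "t \<in> ball y R" using T S(1) by blast
  then have R: "R > 0" using zero_le_dist[of y t] by (simp del: zero_le_dist)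
  let ?W = "V y (R + r / 2)"
  have W: "?W > 0" using r R by (intro V_pos) simp
  have disj: "disjoint_family_on (\<lambda>x. ball x (r / 2)) T"
   unfolding disjoint_family_on_def
  proof (intro ballI impI)
   fix x z assume "x \<in> T" "z \<in> T" "x \<noteq> z"
   then have "r \<le> dist x z" using T(1) S(2) by blast
   then show "ball x (r / 2) \<inter> ball z (r / 2) = {}"
   proof -
    assume d: "r \<le> dist x z"
    have False if "w \<in> ball x (r / 2)" "w \<in> ball z (r / 2)" for w
     using that d dist_triangle[of x z w] by (simp add: dist_commute)
    then show ?thesis by blast
   qed
  qed
  have each: "?W \<le> C ^ k * V x (r / 2)" if "x \<in> T" for x
  proof (rule V_compare)
   have "dist y x < R" using that T(1) S(1) by auto
   then show "dist y x + (R + r / 2) \<le> 2 ^ k * (r / 2)" using k by simp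
  qed (use r in simp)
  have "(\<Sum>x\<in>T. V x (r / 2)) = measure \<mu> (\<Union>x\<in>T. ball x (r / 2))"
   using T(2) disj ball_finite by (intro measure_finite_Union[symmetric]) (auto simp: less_top)
  also have "\<dots> \<le> ?W"
  proof -
   have "(\<Union>x\<in>T. ball x (r / 2)) \<subseteq> ball y (R + r / 2)"
   proof (rule UN_least, rule subsetI)
    fix x w assume "x \<in> T" "w \<in> ball x (r / 2)"
    then have "dist y x < R" "dist x w < r / 2" using T(1) S(1) by auto
    then show "w \<in> ball y (R + r / 2)" using dist_triangle[of y w x] by simp
   qed
   then show ?thesis using ball_finite[of y "R + r / 2"]
    by (intro measure_mono_fmeasurable) (auto simp: fmeasurable_def sets_\<mu> intro!: borel_open)
  qed
  finally have s: "(\<Sum>x\<in>T. V x (r / 2)) \<le> ?W" .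
  have "real (card T) * ?W = (\<Sum>x\<in>T. ?W)" by simp
  also have "\<dots> \<le> (\<Sum>x\<in>T. C ^ k * V x (r / 2))" by (intro sum_mono each)
  also have "\<dots> = C ^ k * (\<Sum>x\<in>T. V x (r / 2))" by (simp add: sum_distrib_left)
  also have "\<dots> \<le> C ^ k * ?W" using s C_ge_1 by (intro mult_left_mono) auto
  finally show ?thesis using W by simp
 qed
 have "finite S \<and> card S \<le> nat \<lfloor>C ^ k\<rfloor>"
  by (rule finite_if_finite_subsets_card_bdd) (use bd in "auto simp: le_nat_floor")
 then show "finite S" by simp
 then show "real (card S) \<le> C ^ k" using bd by blast
qed

text \<open>Closed balls are complete, as closed subsets of a complete space, and totally bounded by
  the packing estimate.\<close>

lemma proper: "compact (cball (x :: 'a) r)"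
 unfolding compact_eq_totally_bounded
proof (intro conjI allI impI)
 show "complete (cball x r)" by (simp add: complete_eq_closed)
 fix e :: real assume e: "e > 0"
 obtain S where S: "S \<subseteq> cball x r" "\<And>y z. y \<in> S ==> z \<in> S ==> y \<noteq> z ==> e \<le> dist y z" "\<And>y. y \<in> cball x r ==> \<exists>s\<in>S. dist s y < e"
  using separated_net[OF e, of "cball x r"] by blast
 obtain k where k: "(2 * (r + 1) + e / 2) / (e / 2) \<le> 2 ^ k" using exists_power_2 by blast
 have "finite S"
 proof (rule separated_finite_card(1)[OF e _ S(2)])
  have "cball x r \<subseteq> ball x (r + 1)" by auto
  with S(1) show "S \<subseteq> ball x (r + 1)" by (rule order_trans)
  show "2 * (r + 1) + e / 2 \<le> 2 ^ k * (e / 2)" using k e by (simp add: field_simps)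
 qed
 moreover have "cball x r \<subseteq> (\<Union>s\<in>S. ball s e)" using S(3) by force
 ultimately show "\<exists>k. finite k \<and> cball x r \<subseteq> (\<Union>x\<in>k. ball x e)" by blast
qed

lemma separated_countable:
 fixes S :: "'a set"
 assumes r: "r > 0" and S: "\<And>x z. x \<in> S ==> z \<in> S ==> x \<noteq> z ==> r \<le> dist x z"
 shows "countable S"
proof -
 obtain x0 :: 'a where True by simp
 have "finite (S \<inter> ball x0 (real n))" for n
 proof -
  obtain k where k: "(2 * real n + r / 2) / (r / 2) \<le> 2 ^ k" using exists_power_2 by blast
  show ?thesis
   by (rule separated_finite_card(1)[OF r Int_lower2 _, of _ _ _ k]) (use S k r in "auto simp: field_simps")
 qed
 moreover have "S = (\<Union>n. S \<inter> ball x0 (real n))"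
 proof -
  have "\<exists>n. x \<in> ball x0 (real n)" for x using reals_Archimedean2[of "dist x0 x"] by auto
  then show ?thesis by blast
 qed
 ultimately show ?thesis by (metis countable_UN countableI_type countable_finite)
qed

text \<open>Summation over a net of scale \<open>r\<close> in \<open>B\<close>, whose dilated balls overlap boundedly often.\<close>

lemma net_integral_bound:
 assumes "\<Lambda> > 0"
 obtains N where "N > 0" "\<And>B r q G \<sigma> \<nu>. [|r > 0; q \<ge> 0; sets \<sigma> = sets borel; sets \<nu> = sets borel;
   \<And>s. s \<in> B ==> emeasure \<sigma> (ball s r) \<le> ennreal (q * V s r);
   \<And>x. x \<in> B ==> G x \<le> ennreal (1 / V x r) * emeasure \<nu> (ball x (\<Lambda> * r))|] ==>
   (\<integral>\<^sup>+x. G x * indicator B x \<partial>\<sigma>) \<le> ennreal (N * q) * emeasure \<nu> UNIV"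
proof -
 \<comment> \<open>The overlap exponent: centres whose dilated ball contains y lie within R =
   (Lambda + 1) r of y, and the packing estimate asks for
   \<open>2 * R + r / 2 = (4 * (\<Lambda> + 1) + 1) * (r / 2)\<close>.\<close>
 obtain k where k: "4 * (\<Lambda> + 1) + 1 \<le> (2::real) ^ k" using exists_power_2 by blast
 have Ck: "C * C ^ k > 0" using C_ge_1 by simp
 show ?thesis
 proof (rule that[OF Ck], goal_cases)
  case (1 B r q G \<sigma> \<nu>)
  note r = 1(1) and q = 1(2) and s\<sigma> = 1(3) and s\<nu> = 1(4) and \<sigma>B = 1(5) and G = 1(6)
  have b\<sigma>: "ball x t \<in> sets \<sigma>" and b\<nu>: "ball x t \<in> sets \<nu>" for x t by (auto simp: s\<sigma> s\<nu>)
  obtain S where S: "S \<subseteq> B" "\<And>x y. x \<in> S ==> y \<in> S ==> x \<noteq> y ==> r \<le> dist x y" "\<And>x. x \<in> B ==> \<exists>s\<in>S. dist s x < r"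
   using separated_net[OF r, of B] by blast
  have cS: "countable S" by (rule separated_countable[OF r S(2)])
  define R where "R = (\<Lambda> + 1) * r"
  define c where "c s = ennreal (C / V s r) * emeasure \<nu> (ball s R)" for s
  \<comment> \<open>Each x is charged to a net point s closer than r: the volumes at x and s differ
    by at most one doubling, and the ball of radius \<open>\<Lambda> * r\<close> about x lies in the
    ball of radius \<open>R\<close> about s.\<close>
  have "G x * indicator B x \<le> (\<integral>\<^sup>+s. c s * indicator (ball s r) x \<partial>count_space S)" for x
  proof (cases "x \<in> B")
   case True
   then obtain s where s: "s \<in> S" "dist s x < r" using S(3) by blast
   have "V s r \<le> C ^ 1 * V x r" using s(2) by (intro V_compare r) auto
   then have "1 / V x r \<le> C / V s r" using V_pos[OF r, of x] V_pos[OF r, of s] by (simp add: field_simps)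
   moreover have "ball x (\<Lambda> * r) \<subseteq> ball s R"
   proof
    fix z assume "z \<in> ball x (\<Lambda> * r)"
    then show "z \<in> ball s R" using dist_triangle[of s z x] s(2) by (simp add: R_def algebra_simps)
   qed
   then have "emeasure \<nu> (ball x (\<Lambda> * r)) \<le> emeasure \<nu> (ball s R)" by (rule emeasure_mono[OF _ b\<nu>])
   ultimately have "ennreal (1 / V x r) * emeasure \<nu> (ball x (\<Lambda> * r)) \<le> c s"
    unfolding c_def by (intro mult_mono ennreal_leI) auto
   then have "G x * indicator B x \<le> c s * indicator (ball s r) x"
    using G[OF True] True s(2) order_trans by auto
   also have "\<dots> \<le> (\<integral>\<^sup>+s. c s * indicator (ball s r) x \<partial>count_space S)"
    by (rule nn_integral_ge_point[OF s(1)])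
   finally show ?thesis .
  qed simp
  then have "(\<integral>\<^sup>+x. G x * indicator B x \<partial>\<sigma>) \<le> (\<integral>\<^sup>+x. \<integral>\<^sup>+s. c s * indicator (ball s r) x \<partial>count_space S \<partial>\<sigma>)"
   by (intro nn_integral_mono)
  also have "\<dots> = (\<integral>\<^sup>+s. \<integral>\<^sup>+x. c s * indicator (ball s r) x \<partial>\<sigma> \<partial>count_space S)"
   using b\<sigma> by (intro nn_integral_count_space_nn_integral cS) auto
  also have "\<dots> = (\<integral>\<^sup>+s. c s * emeasure \<sigma> (ball s r) \<partial>count_space S)"
   using b\<sigma> by (simp add: nn_integral_cmult_indicator)
  also have "\<dots> \<le> (\<integral>\<^sup>+s. ennreal (C * q) * emeasure \<nu> (ball s R) \<partial>count_space S)"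
  proof (rule nn_integral_mono)
   fix s assume "s \<in> space (count_space S)"
   then have "s \<in> B" using S(1) by auto
   then have "c s * emeasure \<sigma> (ball s r) \<le> c s * ennreal (q * V s r)" by (intro mult_left_mono \<sigma>B) auto
   also have "\<dots> = (ennreal (C / V s r) * ennreal (q * V s r)) * emeasure \<nu> (ball s R)"
    by (simp add: c_def ac_simps)
   also have "ennreal (C / V s r) * ennreal (q * V s r) = ennreal (C * q)"
    using V_pos[OF r, of s] C_ge_1 q by (simp add: ennreal_mult[symmetric])
   finally show "c s * emeasure \<sigma> (ball s r) \<le> ennreal (C * q) * emeasure \<nu> (ball s R)" .
  qed
  also have "\<dots> = ennreal (C * q) * (\<integral>\<^sup>+s. emeasure \<nu> (ball s R) \<partial>count_space S)"
   by (rule nn_integral_cmult) simp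
  also have "(\<integral>\<^sup>+s. emeasure \<nu> (ball s R) \<partial>count_space S) = (\<integral>\<^sup>+s. \<integral>\<^sup>+y. indicator (ball s R) y \<partial>\<nu> \<partial>count_space S)"
   using b\<nu> by simp
  also have "\<dots> = (\<integral>\<^sup>+y. \<integral>\<^sup>+s. indicator (ball s R) y \<partial>count_space S \<partial>\<nu>)"
   using b\<nu> by (intro nn_integral_count_space_nn_integral[symmetric] cS) auto
  also have "\<dots> \<le> (\<integral>\<^sup>+y. ennreal (C ^ k) \<partial>\<nu>)"
  proof (rule nn_integral_mono)
   fix y
   \<comment> \<open>The net points whose enlarged balls contain y; they are r-separated, so their
     number is bounded independently of r.\<close>
   define T where "T = {s \<in> S. dist s y < R}"
   have T: "finite T" "real (card T) \<le> C ^ k"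
   proof -
    have 1: "T \<subseteq> ball y R" by (auto simp: T_def dist_commute)
    have 2: "r \<le> dist x z" if "x \<in> T" "z \<in> T" "x \<noteq> z" for x z using S(2) that by (auto simp: T_def)
    have "2 * R + r / 2 = (4 * (\<Lambda> + 1) + 1) * (r / 2)" by (simp add: R_def algebra_simps)
    also have "\<dots> \<le> 2 ^ k * (r / 2)" using k r by (intro mult_right_mono) auto
    finally have 3: "2 * R + r / 2 \<le> 2 ^ k * (r / 2)" .
    show "finite T" "real (card T) \<le> C ^ k" using separated_finite_card[OF r 1 2 3] by auto
   qed
   have "(\<integral>\<^sup>+s. indicator (ball s R) y \<partial>count_space S) = (\<integral>\<^sup>+s. indicator T s \<partial>count_space S)"
    by (rule nn_integral_cong) (auto simp: T_def indicator_def)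
   also have "\<dots> = emeasure (count_space S) T" by (rule nn_integral_indicator) (auto simp: T_def)
   also have "\<dots> = ennreal (real (card T))"
    using T(1) by (subst emeasure_count_space_finite) (auto simp: T_def ennreal_of_nat_eq_real_of_nat)
   also have "\<dots> \<le> ennreal (C ^ k)" by (rule ennreal_leI[OF T(2)])
   finally show "(\<integral>\<^sup>+s. indicator (ball s R) y \<partial>count_space S) \<le> ennreal (C ^ k)" .
  qed
  also have "\<dots> = ennreal (C ^ k) * emeasure \<nu> UNIV"
   using sets_eq_imp_space_eq[OF s\<nu>] by simp
  finally have "(\<integral>\<^sup>+x. G x * indicator B x \<partial>\<sigma>) \<le> ennreal (C * q) * (ennreal (C ^ k) * emeasure \<nu> UNIV)"
   by (simp add: mult_left_mono)
  also have "\<dots> = ennreal (C * C ^ k * q) * emeasure \<nu> UNIV"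
   using C_ge_1 q by (simp add: ennreal_mult ac_simps)
  finally show ?case .
 qed
qed

end

section \<open>Chains of balls\<close>

text \<open>Successive last exit points from balls of radius \<open>\<rho>\<close> along a curve are \<open>\<rho>\<close>-separated, so their
 number is controlled.\<close>

lemma chain_bound:
 fixes \<gamma> :: "real \<Rightarrow> 'a::metric_space"
 assumes \<gamma>: "continuous_on {0..1} \<gamma>" and \<rho>: "\<rho> > 0"
  and a: "\<And>z w. z \<in> \<gamma> ` {0..1} ==> w \<in> \<gamma> ` {0..1} ==> dist z w \<le> \<rho> ==> \<bar>a z - a w\<bar> \<le> \<delta>"
  and s: "0 \<le> s" "s \<le> 1"
  and card: "\<And>T. T \<subseteq> \<gamma> ` {s..1} ==> finite T ==> (\<And>x y. x \<in> T ==> y \<in> T ==> x \<noteq> y ==> \<rho> \<le> dist x y) ==> card T \<le> n"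
 shows "\<bar>a (\<gamma> s) - a (\<gamma> 1)\<bar> \<le> real n * \<delta>"
 using s card
proof (induction n arbitrary: s)
 case 0
 have "{\<gamma> s} \<subseteq> \<gamma> ` {s..1}" using 0 by auto
 then have "card {\<gamma> s} \<le> 0" by (rule 0(3)) auto
 then show ?case by simp
next
 case (Suc n)
 have \<delta>: "\<delta> \<ge> 0" using a[of "\<gamma> 0" "\<gamma> 0"] \<rho> by simp
 define E where "E = {t \<in> {s..1}. dist (\<gamma> t) (\<gamma> s) \<le> \<rho>}"
 have cont: "continuous_on {s..1} (\<lambda>t. dist (\<gamma> t) (\<gamma> s))"
  by (intro continuous_intros continuous_on_subset[OF \<gamma>]) (use Suc.prems in auto)
 have "closedin (top_of_set {s..1}) ({s..1} \<inter> (\<lambda>t. dist (\<gamma> t) (\<gamma> s)) -` {..\<rho>})"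
  by (intro continuous_closedin_preimage cont) auto
 moreover have "{s..1} \<inter> (\<lambda>t. dist (\<gamma> t) (\<gamma> s)) -` {..\<rho>} = E" by (auto simp: E_def)
 ultimately have "compact E" using closedin_compact[of "{s..1}" E] by simp
 moreover have sE: "s \<in> E" using Suc.prems \<rho> by (simp add: E_def)
 ultimately obtain t0 where t0: "t0 \<in> E" "\<And>t. t \<in> E ==> t \<le> t0" using compact_attains_sup[of E] by blast
 have t01: "s \<le> t0" "t0 \<le> 1" "dist (\<gamma> t0) (\<gamma> s) \<le> \<rho>" using t0(1) by (auto simp: E_def)
 have im: "\<gamma> t \<in> \<gamma> ` {0..1}" if "s \<le> t" "t \<le> 1" for t using that Suc.prems(1) by auto
 have step: "\<bar>a (\<gamma> s) - a (\<gamma> t0)\<bar> \<le> \<delta>"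
  by (rule a) (use t01 Suc.prems im in "auto simp: dist_commute")
 show ?case
 proof (cases "t0 = 1")
  case True
  have "\<delta> \<le> real (Suc n) * \<delta>" using \<delta> by (simp add: distrib_right)
  then show ?thesis using step unfolding True by (rule order_trans[rotated])
 next
  case False
  then have lt: "t0 < 1" using t01(2) by simp
  \<comment> \<open>A time t >= t0 with distance below rho would belong to \<open>E\<close>, hence
    be t0; by continuity slightly later times would then belong to \<open>E\<close> as well, against
    maximality of t0.\<close>
  have far: "\<rho> \<le> dist (\<gamma> t) (\<gamma> s)" if "t0 \<le> t" "t \<le> 1" for t
  proof (rule ccontr)
   assume n: "\<not> \<rho> \<le> dist (\<gamma> t) (\<gamma> s)"
   then have "t \<in> E" using that t01 by (simp add: E_def)
   then have tt: "t = t0" using t0(2)[of t] that by simp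
   have "\<exists>d>0. \<forall>u\<in>{s..1}. dist u t0 < d \<longrightarrow> dist (dist (\<gamma> u) (\<gamma> s)) (dist (\<gamma> t0) (\<gamma> s)) < \<rho> - dist (\<gamma> t0) (\<gamma> s)"
    using cont[unfolded continuous_on_iff, rule_format, of t0 "\<rho> - dist (\<gamma> t0) (\<gamma> s)"] t01 n tt by auto
   then obtain d where d: "d > 0" "\<And>u. u \<in> {s..1} ==> dist u t0 < d ==>
     dist (dist (\<gamma> u) (\<gamma> s)) (dist (\<gamma> t0) (\<gamma> s)) < \<rho> - dist (\<gamma> t0) (\<gamma> s)" by blast
   define u where "u = min 1 (t0 + d / 2)"
   have u: "u \<in> {s..1}" "dist u t0 < d" "t0 < u" using d(1) lt t01 by (auto simp: u_def dist_real_def)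
   have "dist (\<gamma> u) (\<gamma> s) \<le> \<rho>" using d(2)[OF u(1,2)] by (simp add: dist_real_def)
   then have "u \<in> E" using u(1) by (simp add: E_def)
   then show False using t0(2)[of u] u(3) by simp
  qed
  have "\<bar>a (\<gamma> t0) - a (\<gamma> 1)\<bar> \<le> real n * \<delta>"
  proof (rule Suc.IH)
   show "0 \<le> t0" "t0 \<le> 1" using t01 Suc.prems by auto
   \<comment> \<open>Any separated set on the remaining arc can be enlarged by the starting point,
     so the arc after t0 admits one point fewer and the induction hypothesis applies.\<close>
   fix T assume T: "T \<subseteq> \<gamma> ` {t0..1}" "finite T" "\<And>x y. x \<in> T ==> y \<in> T ==> x \<noteq> y ==> \<rho> \<le> dist x y"
   have farT: "\<rho> \<le> dist x (\<gamma> s)" if "x \<in> T" for x using that T(1) far by auto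
   then have nin: "\<gamma> s \<notin> T" using \<rho> by fastforce
   have "card (insert (\<gamma> s) T) \<le> Suc n"
   proof (rule Suc.prems(3))
    show "insert (\<gamma> s) T \<subseteq> \<gamma> ` {s..1}" using T(1) t01 Suc.prems by fastforce
    show "finite (insert (\<gamma> s) T)" using T(2) by simp
    fix x y assume "x \<in> insert (\<gamma> s) T" "y \<in> insert (\<gamma> s) T" "x \<noteq> y"
    then show "\<rho> \<le> dist x y" using T(3) farT by (auto simp: dist_commute)
   qed
   then show "card T \<le> n" using nin T(2) by simp
  qed
  then have "\<bar>a (\<gamma> s) - a (\<gamma> 1)\<bar> \<le> \<delta> + real n * \<delta>" using step by linarith
  then show ?thesis by (simp add: algebra_simps)
 qed
qed

section \<open>Boundary traces in uniform domains\<close>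

locale poincare_domain = doubling_measure \<mu> C for \<mu> :: "'a::polish_space measure" and C :: real +
 fixes D :: "'a set" and A Ap Cp C\<Psi> :: real and \<Psi> :: "real \<Rightarrow> real"
 assumes open_D: "open D" and closure_D: "closure D = UNIV"
  and A: "A > 1" and uniform: "uniform_domain A D"
  and Ap: "Ap \<ge> 1" and Cp: "Cp > 0"
  and \<Psi>_pos: "r > 0 ==> \<Psi> r > 0"
  and \<Psi>_mono: "0 < s ==> s \<le> r ==> \<Psi> s \<le> C\<Psi> * \<Psi> r"
begin

definition avg :: "('a \<Rightarrow> real) \<Rightarrow> 'a \<Rightarrow> real \<Rightarrow> real" where
 "avg f x r = (LINT z:ball x r|\<mu>. f z) / V x r"

text \<open>The energy measure is replaced by an arbitrary measure \<open>\<nu>\<close>, which frees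
  the chain argument from Dirichlet forms.\<close>

definition PI :: "('a \<Rightarrow> real) \<Rightarrow> 'a measure \<Rightarrow> bool" where
 "PI f \<nu> \<longleftrightarrow> (\<forall>x\<in>D. \<forall>r. 0 < r \<and> r < infdist x (- D) / Ap \<longrightarrow>
   (\<integral>\<^sup>+z\<in>ball x r. ennreal ((f z - avg f x r)\<^sup>2) \<partial>\<mu>) \<le> ennreal (Cp * \<Psi> r) * emeasure \<nu> (ball x (Ap * r)))"

lemma C\<Psi>: "C\<Psi> > 0"
 using \<Psi>_mono[of 1 1] \<Psi>_pos[of 1] by (simp add: zero_less_mult_iff not_le)

text \<open>The point y only guarantees that the space extends beyond radius r. Join a point of
  \<open>D\<close> very near x to a point of \<open>D\<close> farther than r and stop at distance
  r/2 from x: both ends are then at least r/4 away, so uniformity gives distance r/(4A) to the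
  boundary.\<close>

lemma Whitney_point:
 assumes x: "x \<in> - D" and r: "r > 0" and y: "dist x y > r"
 obtains p where "p \<in> D" "dist x p \<le> r" "r / (4 * A) \<le> infdist p (- D)"
proof -
 have cl: "x \<in> closure D" "y \<in> closure D" by (simp_all add: closure_D)
 obtain y0 where y0: "y0 \<in> D" "dist y0 x < r / 4"
  using cl(1)[unfolded closure_approachable, rule_format, of "r / 4"] r by auto
 obtain y1 where y1: "y1 \<in> D" "dist y1 y < dist x y - r"
  using cl(2)[unfolded closure_approachable, rule_format, of "dist x y - r"] y by auto
 have y1x: "dist x y1 > r" using dist_triangle[of x y y1] y1(2) by simp
 obtain \<gamma> where g: "path \<gamma>" "pathstart \<gamma> = y0" "pathfinish \<gamma> = y1" "path_image \<gamma> \<subseteq> D"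
  "\<And>z. z \<in> path_image \<gamma> ==> infdist z (- D) \<ge> inverse A * min (dist y0 z) (dist y1 z)"
  using uniform y0(1) y1(1) unfolding uniform_domain_def by meson
 have cont: "continuous_on {0..1} (\<lambda>t. dist x (\<gamma> t))"
  by (intro continuous_intros) (use g(1) in "simp add: path_def")
 have "\<exists>t\<ge>0. t \<le> 1 \<and> dist x (\<gamma> t) = r / 2"
 proof (rule IVT'[OF _ _ _ cont])
  show "dist x (\<gamma> 0) \<le> r / 2" using g(2) y0(2) r by (simp add: pathstart_def dist_commute)
  show "r / 2 \<le> dist x (\<gamma> 1)" using g(3) y1x r by (simp add: pathfinish_def)
 qed simp
 then obtain t where t: "t \<ge> 0" "t \<le> 1" "dist x (\<gamma> t) = r / 2" by auto
 define z where "z = \<gamma> t"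
 have z: "z \<in> path_image \<gamma>" using t by (auto simp: z_def path_image_def)
 have xz: "dist x z = r / 2" using t(3) by (simp add: z_def)
 have "dist y0 z \<ge> r / 4" using dist_triangle[of x z y0] xz y0(2) by (simp add: dist_commute)
 moreover have "dist y1 z \<ge> r / 4" using dist_triangle[of x y1 z] xz y1x r by (simp add: dist_commute)
 ultimately have "inverse A * (r / 4) \<le> inverse A * min (dist y0 z) (dist y1 z)"
  using A by (intro mult_left_mono) auto
 then have "r / (4 * A) \<le> infdist z (- D)" using g(5)[OF z] by (simp add: field_simps)
 moreover have "z \<in> D" using z g(4) by blast
 ultimately show ?thesis using that[of z] xz r by simp
qed

text \<open>Near an end point the distance to the boundary is inherited by the triangle inequality;
  at distance more than \<open>\<kappa> / 2\<close> from both ends the uniformity condition itself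
  gives the bound.\<close>

lemma path_away_from_boundary:
 assumes pq: "p \<in> D" "q \<in> D" and \<kappa>: "\<kappa> > 0" "\<kappa> \<le> infdist p (- D)" "\<kappa> \<le> infdist q (- D)"
 obtains \<gamma> where "path \<gamma>" "pathstart \<gamma> = p" "pathfinish \<gamma> = q" "path_image \<gamma> \<subseteq> D"
  "\<And>z. z \<in> path_image \<gamma> ==> dist p z \<le> A * dist p q"
  "\<And>z. z \<in> path_image \<gamma> ==> \<kappa> / (2 * A) \<le> infdist z (- D)"
proof -
 obtain \<gamma> where g: "path \<gamma>" "pathstart \<gamma> = p" "pathfinish \<gamma> = q" "path_image \<gamma> \<subseteq> D"
  "diameter (path_image \<gamma>) \<le> A * dist p q"
  "\<And>z. z \<in> path_image \<gamma> ==> infdist z (- D) \<ge> inverse A * min (dist p z) (dist q z)"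
  using uniform pq unfolding uniform_domain_def by meson
 have p: "p \<in> path_image \<gamma>" using g(2) pathstart_in_path_image by metis
 have d: "dist p z \<le> A * dist p q" if z: "z \<in> path_image \<gamma>" for z
  using diameter_bounded_bound[OF compact_imp_bounded[OF compact_path_image[OF g(1)]] p z] g(5) by simp
 have i: "\<kappa> / (2 * A) \<le> infdist z (- D)" if z: "z \<in> path_image \<gamma>" for z
 proof -
  have half: "\<kappa> / (2 * A) \<le> \<kappa> / 2" using A \<kappa>(1) by (simp add: field_simps)
  show ?thesis
  proof (cases "dist p z \<le> \<kappa> / 2 \<or> dist q z \<le> \<kappa> / 2")
   case True
   then show ?thesis
    using infdist_triangle[of p "- D" z] infdist_triangle[of q "- D" z] \<kappa> half by auto
  next
   case False
   then have "inverse A * (\<kappa> / 2) \<le> inverse A * min (dist p z) (dist q z)"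
    using A by (intro mult_left_mono) auto
   then show ?thesis using g(6)[OF z] by (simp add: field_simps)
  qed
 qed
 show ?thesis by (intro that[of \<gamma>] g(1-4) d i)
qed

section \<open>Averages over neighbouring balls\<close>

lemma L2_indicator_ball: "(\<lambda>z. indicator (ball x r) z :: real) \<in> L2_space \<mu>"
proof -
 have "integrable \<mu> (\<lambda>z. indicator (ball x r) z :: real)"
  using ball_finite[of x r] by (intro integrable_real_indicator) (auto simp: sets_\<mu>)
 moreover have "(\<lambda>z. (indicator (ball x r) z :: real)\<^sup>2) = (\<lambda>z. indicator (ball x r) z)"
  by (auto simp: indicator_def)
 ultimately show ?thesis by (simp add: L2_space_iff borel_measurable_integrable)
qed

lemma avg_square_le:
 assumes f: "f \<in> L2_space \<mu>" and r: "r > 0"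
 shows "ennreal ((avg f x r - c)\<^sup>2) \<le> ennreal (1 / V x r) * (\<integral>\<^sup>+z\<in>ball x r. ennreal ((f z - c)\<^sup>2) \<partial>\<mu>)"
proof -
 define I where "I z = (indicator (ball x r) z :: real)" for z
 define g where "g z = I z * f z - c * I z" for z
 note [measurable] = L2_measurable[OF f]
 have I: "I \<in> L2_space \<mu>" unfolding I_def by (rule L2_indicator_ball)
 have If: "(\<lambda>z. I z * f z) \<in> L2_space \<mu>"
 proof (rule L2_bounded_by[OF f])
  show "(\<lambda>z. I z * f z) \<in> borel_measurable \<mu>" using L2_measurable[OF I] by measurable
  show "AE z in \<mu>. \<bar>I z * f z\<bar> \<le> \<bar>1 * f z\<bar>" by (auto simp: I_def indicator_def)
 qed
 have g: "g \<in> L2_space \<mu>" unfolding g_def by (rule L2.V_diff[OF If L2_scale[OF I]])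
 have V: "V x r > 0" by (rule V_pos[OF r])
 have "(\<lambda>z. (I z)\<^sup>2) = I" by (auto simp: I_def indicator_def)
 then have i1: "integrable \<mu> I" using L2_integrable_square[OF I] by simp
 have i2: "integrable \<mu> (\<lambda>z. I z * f z)" by (rule L2_integrable_mult[OF I f])
 have I1: "(\<integral>z. I z \<partial>\<mu>) = V x r" by (simp add: I_def)
 have eq: "I z * I z = I z" for z by (simp add: I_def indicator_def)
 have II: "(\<integral>z. I z * I z \<partial>\<mu>) = V x r" unfolding eq by (rule I1)
 have Ig: "I z * g z = g z" for z by (simp add: g_def I_def indicator_def)
 have "L2_inner \<mu> I g = (\<integral>z. g z \<partial>\<mu>)" by (simp add: L2_inner_def Ig)
 also have "\<dots> = (\<integral>z. I z * f z \<partial>\<mu>) - c * V x r" unfolding g_def using i1 i2 I1 by simp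
 also have "\<dots> = (avg f x r - c) * V x r"
  using V by (simp add: avg_def set_lebesgue_integral_def I_def field_simps)
 finally have e: "L2_inner \<mu> I g = (avg f x r - c) * V x r" .
 have "((avg f x r - c) * V x r)\<^sup>2 \<le> V x r * L2_inner \<mu> g g"
  using L2.Cauchy_Schwarz_square[OF I g] unfolding e by (simp add: L2_inner_def II)
 then have "(avg f x r - c)\<^sup>2 * V x r * V x r \<le> L2_inner \<mu> g g * V x r"
  by (simp add: power2_eq_square mult_ac)
 then have "(avg f x r - c)\<^sup>2 * V x r \<le> L2_inner \<mu> g g" using V mult_right_le_imp_le by blast
 then have le: "(avg f x r - c)\<^sup>2 \<le> 1 / V x r * L2_inner \<mu> g g" using V by (simp add: field_simps)
 have "ennreal (L2_inner \<mu> g g) = (\<integral>\<^sup>+z. ennreal ((g z)\<^sup>2) \<partial>\<mu>)"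
  unfolding L2_inner_square by (rule nn_integral_eq_integral[symmetric, OF L2_integrable_square[OF g]]) simp
 also have "\<dots> = (\<integral>\<^sup>+z\<in>ball x r. ennreal ((f z - c)\<^sup>2) \<partial>\<mu>)"
  by (rule nn_integral_cong) (simp add: g_def I_def indicator_def)
 finally have n: "ennreal (L2_inner \<mu> g g) = (\<integral>\<^sup>+z\<in>ball x r. ennreal ((f z - c)\<^sup>2) \<partial>\<mu>)" .
 have "ennreal ((avg f x r - c)\<^sup>2) \<le> ennreal (1 / V x r * L2_inner \<mu> g g)" by (rule ennreal_leI[OF le])
 also have "\<dots> = ennreal (1 / V x r) * ennreal (L2_inner \<mu> g g)"
  using V by (intro ennreal_mult) (auto simp: L2_inner_square)
 finally show ?thesis unfolding n .
qed

lemma avg_close: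
 assumes f: "f \<in> L2_space \<mu>" "PI f \<nu>" and z: "z \<in> D" "0 < R" "R < infdist z (- D) / Ap"
  and w: "r > 0" "ball w r \<subseteq> ball z R"
 shows "ennreal ((avg f w r - avg f z R)\<^sup>2) \<le> ennreal (1 / V w r) * (ennreal (Cp * \<Psi> R) * emeasure \<nu> (ball z (Ap * R)))"
proof -
 have "ennreal ((avg f w r - avg f z R)\<^sup>2) \<le> ennreal (1 / V w r) * (\<integral>\<^sup>+y\<in>ball w r. ennreal ((f y - avg f z R)\<^sup>2) \<partial>\<mu>)"
  by (rule avg_square_le[OF f(1) w(1)])
 also have "\<dots> \<le> ennreal (1 / V w r) * (\<integral>\<^sup>+y\<in>ball z R. ennreal ((f y - avg f z R)\<^sup>2) \<partial>\<mu>)"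
  using w(2) by (intro mult_left_mono nn_integral_mono) (auto simp: indicator_def)
 also have "\<dots> \<le> ennreal (1 / V w r) * (ennreal (Cp * \<Psi> R) * emeasure \<nu> (ball z (Ap * R)))"
  using f(2) z unfolding PI_def by (intro mult_left_mono) auto
 finally show ?thesis .
qed

text \<open>Balls of radius \<open>\<eta> * r\<close> around points at distance at least \<open>r / (16 * A\<^sup>2)\<close> from the boundary stay
 inside the domain when dilated by \<open>Ap\<close>; the chains joining two such points near \<open>x\<close> stay in the ball of radius
 \<open>\<Lambda> * r\<close>.\<close>

definition \<eta> :: real where "\<eta> = 1 / (64 * A\<^sup>2 * Ap)"

definition \<Lambda> :: real where "\<Lambda> = 2 * A + 3"

lemma \<eta>: "0 < \<eta>" "\<eta> \<le> 1" "\<eta> * Ap = 1 / (64 * A\<^sup>2)"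
proof -
 have "1 \<le> A\<^sup>2" using A by simp
 then have "1 * 1 \<le> A\<^sup>2 * Ap" using Ap by (intro mult_mono) auto
 then show "0 < \<eta>" "\<eta> \<le> 1" using A Ap by (auto simp: \<eta>_def field_simps)
 show "\<eta> * Ap = 1 / (64 * A\<^sup>2)" using Ap by (simp add: \<eta>_def)
qed

text \<open>The curve from p to q is followed with balls of radius \<open>\<rho>\<close>, half of
  \<open>\<eta> * r\<close>. Averages over two such balls with centres closer than
  \<open>\<rho>\<close> are both compared with the average over one ball of radius
  \<open>2 * \<rho>\<close>, where the Poincare inequality applies. Halving the radius at q prepares
  the next level.\<close>

lemma level_step:
 obtains K where "K > 0" "\<And>f \<nu> x p q r. [|f \<in> L2_space \<mu>; PI f \<nu>; sets \<nu> = sets borel; emeasure \<nu> UNIV < \<infinity>; r > 0;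
   p \<in> D; q \<in> D; dist x p \<le> r; dist x q \<le> r / 2; r / (8 * A) \<le> infdist p (- D); r / (8 * A) \<le> infdist q (- D)|] ==>
   (avg f p (\<eta> * r) - avg f q (\<eta> * r / 2))\<^sup>2 \<le> K * \<Psi> r / V x r * measure \<nu> (ball x (\<Lambda> * r))"
proof -
 \<comment> \<open>Every point of the curve is within \<open>(2 * A + 1) * r\<close> of x. The
   exponent k compares the volume of \<open>ball x r\<close> with that of a chain ball; j bounds the
   number of separated points on the curve.\<close>
 obtain k where "(2 * A + 3) / (\<eta> / 2) \<le> 2 ^ k" using exists_power_2 by blast
 then have k: "2 * A + 3 \<le> 2 ^ k * (\<eta> / 2)" using \<eta>(1) by (simp add: field_simps)
 obtain j where "(2 * (2 * A + 3) + \<eta> / 4) / (\<eta> / 4) \<le> 2 ^ j" using exists_power_2 by blast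
 then have j: "2 * (2 * A + 3) + \<eta> / 4 \<le> 2 ^ j * (\<eta> / 4)" using \<eta>(1) by (simp add: field_simps)
 define n where "n = nat \<lfloor>C ^ j\<rfloor>"
 \<comment> \<open>The factor \<open>1 + 2 * n\<close> counts one change of radius at p and two
   comparisons for each of at most n links; it is squared at the end.\<close>
 define K where "K = (1 + 2 * real n)\<^sup>2 * (Cp * C\<Psi> * C ^ k)"
 have K: "K > 0" unfolding K_def using Cp C\<Psi> C_ge_1 by (intro mult_pos_pos zero_less_power) auto
 show ?thesis
 proof (rule that[OF K], goal_cases)
  case (1 f \<nu> x p q r)
  note f = 1(1,2) and \<nu> = 1(3,4) and r = 1(5) and pq = 1(6,7) and d = 1(8,9) and i = 1(10,11)
  define \<rho> where "\<rho> = \<eta> * r / 2"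
  have \<rho>: "\<rho> > 0" "2 * \<rho> = \<eta> * r" using \<eta>(1) r by (auto simp: \<rho>_def)
  have Ar: "r \<le> A * r" using A r by simp
  have "Ap * (2 * \<rho>) = (\<eta> * Ap) * r" unfolding \<rho>(2) by simp
  then have ApR: "Ap * (2 * \<rho>) = r / (64 * A\<^sup>2)" unfolding \<eta>(3) by simp
  obtain \<gamma> where g: "path \<gamma>" "pathstart \<gamma> = p" "pathfinish \<gamma> = q" "path_image \<gamma> \<subseteq> D"
   "\<And>z. z \<in> path_image \<gamma> ==> dist p z \<le> A * dist p q"
   "\<And>z. z \<in> path_image \<gamma> ==> r / (8 * A) / (2 * A) \<le> infdist z (- D)"
   using path_away_from_boundary[OF pq _ i] A r by auto
  have dpq: "dist p q \<le> 2 * r" using dist_triangle2[of p q x] d r by (simp add: dist_commute)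
  have xz: "dist x z \<le> r + 2 * (A * r)" if "z \<in> path_image \<gamma>" for z
  proof -
   have "A * dist p q \<le> A * (2 * r)" using dpq A by (intro mult_left_mono) auto
   then show ?thesis using g(5)[OF that] dist_triangle[of x z p] d(1) by simp
  qed
  define d0 where "d0 = sqrt (Cp * C\<Psi> * C ^ k * \<Psi> r / V x r * measure \<nu> (ball x (\<Lambda> * r)))"
  have pos: "0 \<le> Cp * C\<Psi> * C ^ k * \<Psi> r / V x r" using Cp C\<Psi> C_ge_1 \<Psi>_pos[OF r] V_pos[OF r, of x] by simp
  have d0: "d0 \<ge> 0" "d0\<^sup>2 = Cp * C\<Psi> * C ^ k * \<Psi> r / V x r * measure \<nu> (ball x (\<Lambda> * r))"
   unfolding d0_def using mult_nonneg_nonneg[OF pos measure_nonneg]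
   by (rule real_sqrt_ge_zero, rule real_sqrt_pow2)
  \<comment> \<open>One estimate covers both moves: shrinking the radius at a fixed centre, and
    passing to a neighbouring centre.\<close>
  have near: "\<bar>avg f w \<rho> - avg f z (2 * \<rho>)\<bar> \<le> d0"
   if z: "z \<in> path_image \<gamma>" and w: "w \<in> path_image \<gamma>" "ball w \<rho> \<subseteq> ball z (2 * \<rho>)" for w z
  proof -
   have zD: "z \<in> D" using z g(4) by blast
   \<comment> \<open>The dilated ball has radius \<open>r / (64 * A^2)\<close> by the choice of
     \<open>\<eta>\<close>, while the curve keeps distance \<open>r / (16 * A^2)\<close> from the
     boundary.\<close>
   have "r / (64 * A\<^sup>2) < r / (8 * A) / (2 * A)"
    using r A by (simp add: field_simps power2_eq_square)
   then have "Ap * (2 * \<rho>) < infdist z (- D)" unfolding ApR using g(6)[OF z] by (rule less_le_trans)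
   then have lt: "2 * \<rho> < infdist z (- D) / Ap" using Ap by (simp add: field_simps)
   have V1: "1 / V w \<rho> \<le> C ^ k / V x r"
   proof -
    have "V x r \<le> C ^ k * V w \<rho>"
    proof (rule V_compare[OF \<rho>(1)])
     have "dist x w + r \<le> (2 * A + 3) * r" using xz[OF w(1)] Ar r by (simp add: algebra_simps)
     also have "\<dots> \<le> (2 ^ k * (\<eta> / 2)) * r" using k r by (intro mult_right_mono) auto
     finally show "dist x w + r \<le> 2 ^ k * \<rho>" by (simp add: \<rho>_def)
    qed
    then show ?thesis using V_pos[OF r, of x] V_pos[OF \<rho>(1), of w] by (simp add: field_simps)
   qed
   have sub: "ball z (Ap * (2 * \<rho>)) \<subseteq> ball x (\<Lambda> * r)"
   proof
    fix y assume y: "y \<in> ball z (Ap * (2 * \<rho>))"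
    note ApR
    also have "r / (64 * A\<^sup>2) \<le> r"
    proof -
     have "1 \<le> A\<^sup>2" using A by simp
     then have "r * 1 \<le> r * (64 * A\<^sup>2)" using r by (intro mult_left_mono) auto
     then show ?thesis using A by (simp add: field_simps)
    qed
    finally have "dist z y < r" using y by simp
    then show "y \<in> ball x (\<Lambda> * r)" using dist_triangle[of x y z] xz[OF z] A Ar r
     by (simp add: \<Lambda>_def algebra_simps)
   qed
   have \<Psi>: "\<Psi> (2 * \<rho>) \<le> C\<Psi> * \<Psi> r"
    by (rule \<Psi>_mono) (use \<rho> \<eta> r in "auto simp: mult_left_le_one_le")
   have fin: "emeasure \<nu> (ball y s) = ennreal (measure \<nu> (ball y s))" for y s
    using emeasure_mono[of "ball y s" UNIV \<nu>] \<nu> by (intro emeasure_eq_ennreal_measure) (auto simp: less_top top_unique)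
   have "measure \<nu> (ball z (Ap * (2 * \<rho>))) \<le> measure \<nu> (ball x (\<Lambda> * r))"
    using emeasure_mono[OF sub, of \<nu>] by (simp add: \<nu> fin)
   moreover have "(avg f w \<rho> - avg f z (2 * \<rho>))\<^sup>2 \<le> 1 / V w \<rho> * (Cp * \<Psi> (2 * \<rho>) * measure \<nu> (ball z (Ap * (2 * \<rho>))))"
   proof -
    have 1: "0 \<le> Cp * \<Psi> (2 * \<rho>)" using Cp \<Psi>_pos[of "2 * \<rho>"] \<rho>(1) by simp
    have 2: "0 \<le> 1 / V w \<rho>" by simp
    note 3 = mult_nonneg_nonneg[OF 1 measure_nonneg]
    have "0 < 2 * \<rho>" using \<rho>(1) by simp
    from avg_close[OF f zD this lt \<rho>(1) w(2)]
    show ?thesis unfolding fin ennreal_mult[OF 1 measure_nonneg, symmetric] ennreal_mult[OF 2 3, symmetric]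
     by (rule ennreal_le_iff[OF mult_nonneg_nonneg[OF 2 3], THEN iffD1])
   qed
   moreover have "1 / V w \<rho> * (Cp * \<Psi> (2 * \<rho>) * measure \<nu> (ball z (Ap * (2 * \<rho>))))
     \<le> C ^ k / V x r * (Cp * (C\<Psi> * \<Psi> r) * measure \<nu> (ball x (\<Lambda> * r)))"
    using V1 \<Psi> calculation(1) Cp \<Psi>_pos[of "2 * \<rho>"] \<rho>(1) C_ge_1 C\<Psi> \<Psi>_pos[OF r] by (intro mult_mono) auto
   ultimately have "(avg f w \<rho> - avg f z (2 * \<rho>))\<^sup>2 \<le> d0\<^sup>2" unfolding d0(2) by (simp add: mult_ac)
   then show ?thesis using d0(1) by (metis abs_le_square_iff abs_of_nonneg)
  qed
  have pim: "p \<in> path_image \<gamma>" using g(2) pathstart_in_path_image by metis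
  have a1: "\<bar>avg f p \<rho> - avg f p (2 * \<rho>)\<bar> \<le> d0"
   by (rule near[OF pim pim]) (use \<rho> in auto)
  have a2: "\<bar>avg f (\<gamma> 0) \<rho> - avg f (\<gamma> 1) \<rho>\<bar> \<le> real n * (2 * d0)"
  proof (rule chain_bound[where a="\<lambda>z. avg f z \<rho>" and \<gamma>=\<gamma> and \<rho>=\<rho>])
   show "continuous_on {0..1} \<gamma>" using g(1) by (simp add: path_def)
   show "\<rho> > 0" by (rule \<rho>(1))
   fix z w assume zw: "z \<in> \<gamma> ` {0..1}" "w \<in> \<gamma> ` {0..1}" "dist z w \<le> \<rho>"
   then have im: "z \<in> path_image \<gamma>" "w \<in> path_image \<gamma>" by (auto simp: path_image_def)
   have sb: "ball z \<rho> \<subseteq> ball z (2 * \<rho>)" by (rule subset_ball) (use \<rho>(1) in simp)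
   have "ball w \<rho> \<subseteq> ball z (2 * \<rho>)"
   proof
    fix y assume "y \<in> ball w \<rho>"
    then show "y \<in> ball z (2 * \<rho>)" using dist_triangle[of z y w] zw(3) by simp
   qed
   from near[OF im this] near[OF im(1) im(1) sb]
   have "\<bar>avg f w \<rho> - avg f z (2 * \<rho>)\<bar> \<le> d0" "\<bar>avg f z \<rho> - avg f z (2 * \<rho>)\<bar> \<le> d0" by auto
   then show "\<bar>avg f z \<rho> - avg f w \<rho>\<bar> \<le> 2 * d0" by linarith
  next
   fix T assume T: "T \<subseteq> \<gamma> ` {0..1}" "finite T" "\<And>x y. x \<in> T ==> y \<in> T ==> x \<noteq> y ==> \<rho> \<le> dist x y"
   have "T \<subseteq> ball x ((2 * A + 3) * r)"
   proof
    fix z assume "z \<in> T"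
    then have "z \<in> path_image \<gamma>" using T(1) by (auto simp: path_image_def)
    from xz[OF this] show "z \<in> ball x ((2 * A + 3) * r)" using A Ar r by (simp add: algebra_simps)
   qed
   moreover have "2 * ((2 * A + 3) * r) + \<rho> / 2 \<le> 2 ^ j * (\<rho> / 2)"
   proof -
    have "2 * ((2 * A + 3) * r) + \<rho> / 2 = (2 * (2 * A + 3) + \<eta> / 4) * r" by (simp add: \<rho>_def algebra_simps)
    also have "\<dots> \<le> (2 ^ j * (\<eta> / 4)) * r" using j r by (intro mult_right_mono) auto
    finally show ?thesis by (simp add: \<rho>_def)
   qed
   ultimately have "real (card T) \<le> C ^ j" using separated_finite_card(2)[OF \<rho>(1) _ T(3)] by blast
   then show "card T \<le> n" unfolding n_def by (simp add: le_nat_floor)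
  qed auto
  have "\<bar>avg f p (2 * \<rho>) - avg f q \<rho>\<bar> \<le> (1 + 2 * real n) * d0"
   using a1 a2 g(2,3) by (simp add: pathstart_def pathfinish_def algebra_simps)
  then have "\<bar>avg f p (2 * \<rho>) - avg f q \<rho>\<bar>\<^sup>2 \<le> ((1 + 2 * real n) * d0)\<^sup>2" by (intro power_mono) auto
  then have "(avg f p (2 * \<rho>) - avg f q \<rho>)\<^sup>2 \<le> (1 + 2 * real n)\<^sup>2 * d0\<^sup>2"
   by (simp add: power_mult_distrib)
  also have "\<dots> = K * \<Psi> r / V x r * measure \<nu> (ball x (\<Lambda> * r))" unfolding d0(2) K_def by (simp add: mult_ac)
  finally show ?case by (simp add: \<rho>_def)
 qed
qed

end

text \<open>Cauchy-Schwarz with weights \<open>\<theta> ^ k\<close> on the telescoping sum; the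
  price for summability of the weights is the division of each increment by
  \<open>\<theta> ^ k\<close>.\<close>

lemma telescope_square_le:
 fixes a :: "nat \<Rightarrow> real"
 assumes \<theta>: "0 < \<theta>" "\<theta> < 1"
 shows "(a n)\<^sup>2 \<le> 2 * (a 0)\<^sup>2 + 2 / (1 - \<theta>) * (\<Sum>k<n. (a k - a (Suc k))\<^sup>2 / \<theta> ^ k)"
proof -
 define b where "b k = a k - a (Suc k)" for k
 have "(\<Sum>k<n. b k) = a 0 - a n" by (simp add: b_def sum_lessThan_telescope')
 then have e: "a n = a 0 - (\<Sum>k<n. b k)" by simp
 have "(\<Sum>k<n. b k)\<^sup>2 = (\<Sum>k<n. sqrt (\<theta> ^ k) * (b k / sqrt (\<theta> ^ k)))\<^sup>2" using \<theta> by simp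
 also have "\<dots> \<le> (\<Sum>k<n. (sqrt (\<theta> ^ k))\<^sup>2) * (\<Sum>k<n. (b k / sqrt (\<theta> ^ k))\<^sup>2)"
  by (rule Cauchy_Schwarz_ineq_sum)
 also have "\<dots> = (\<Sum>k<n. \<theta> ^ k) * (\<Sum>k<n. (b k)\<^sup>2 / \<theta> ^ k)" using \<theta> by (simp add: power_divide)
 also have "\<dots> \<le> 1 / (1 - \<theta>) * (\<Sum>k<n. (b k)\<^sup>2 / \<theta> ^ k)"
 proof (rule mult_right_mono)
  have "(\<Sum>k<n. \<theta> ^ k) \<le> (\<Sum>k. \<theta> ^ k)" using \<theta> by (intro sum_le_suminf summable_geometric) auto
  then show "(\<Sum>k<n. \<theta> ^ k) \<le> 1 / (1 - \<theta>)" using \<theta> by (simp add: suminf_geometric)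
  show "0 \<le> (\<Sum>k<n. (b k)\<^sup>2 / \<theta> ^ k)" using \<theta> by (intro sum_nonneg) auto
 qed
 finally have s: "(\<Sum>k<n. b k)\<^sup>2 \<le> 1 / (1 - \<theta>) * (\<Sum>k<n. (b k)\<^sup>2 / \<theta> ^ k)" .
 have "(a n)\<^sup>2 \<le> 2 * (a 0)\<^sup>2 + 2 * (\<Sum>k<n. b k)\<^sup>2"
  unfolding e using sum_squares_bound[of "a 0" "- (\<Sum>k<n. b k)"] by (simp add: power2_diff)
 also have "\<dots> \<le> 2 * (a 0)\<^sup>2 + 2 / (1 - \<theta>) * (\<Sum>k<n. (b k)\<^sup>2 / \<theta> ^ k)" using s by simp
 finally show ?thesis by (simp add: b_def)
qed

text \<open>The measure of an open ball is lower semicontinuous in the centre: a slightly smaller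
  concentric ball still has mass above a, and it lies in all balls of radius r with nearby
  centre.\<close>

lemma borel_measurable_emeasure_ball:
 fixes \<nu> :: "'a::metric_space measure"
 assumes s: "sets \<nu> = sets borel"
 shows "(\<lambda>x. emeasure \<nu> (ball x r)) \<in> borel_measurable borel"
proof (rule borel_measurableI_greater)
 fix a
 have "open {x. a < emeasure \<nu> (ball x r)}"
  unfolding open_dist
 proof (intro ballI)
  fix x assume x: "x \<in> {x. a < emeasure \<nu> (ball x r)}"
  define U where "U n = ball x (r - 1 / real (Suc n))" for n
  have inc: "incseq U"
   unfolding incseq_def U_def by (intro allI impI subset_ball) (simp add: frac_le)
  have "ball x r \<subseteq> (\<Union>n. U n)"
  proof
   fix y assume "y \<in> ball x r"
   then obtain n where "inverse (real (Suc n)) < r - dist x y"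
    using reals_Archimedean[of "r - dist x y"] by auto
   then have "y \<in> U n" by (simp add: U_def inverse_eq_divide)
   then show "y \<in> (\<Union>n. U n)" by blast
  qed
  moreover have "(\<Union>n. U n) \<subseteq> ball x r" unfolding U_def by (intro UN_least subset_ball) simp
  ultimately have un: "(\<Union>n. U n) = ball x r" by blast
  have "(SUP n. emeasure \<nu> (U n)) = emeasure \<nu> (ball x r)"
   unfolding un[symmetric] by (rule SUP_emeasure_incseq[OF _ inc]) (auto simp: s U_def)
  then have "a < (SUP n. emeasure \<nu> (U n))" using x by simp
  then obtain n where n: "a < emeasure \<nu> (U n)" by (auto simp: less_SUP_iff)
  show "\<exists>e>0. \<forall>y. dist y x < e \<longrightarrow> y \<in> {x. a < emeasure \<nu> (ball x r)}"
  proof (intro exI[of _ "1 / real (Suc n)"] conjI allI impI)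
   fix y assume y: "dist y x < 1 / real (Suc n)"
   have "U n \<subseteq> ball y r"
   proof
    fix z assume "z \<in> U n"
    then show "z \<in> ball y r" using y dist_triangle[of y z x] by (simp add: U_def)
   qed
   then have "emeasure \<nu> (U n) \<le> emeasure \<nu> (ball y r)" by (rule emeasure_mono) (simp add: s)
   then show "y \<in> {x. a < emeasure \<nu> (ball x r)}" using n by simp
  qed simp
 qed
 then show "{x \<in> space borel. a < emeasure \<nu> (ball x r)} \<in> sets borel" by (simp add: borel_open)
qed

section \<open>From averages to boundary values, and the trace inequality for an abstract energy
  measure\<close>

context poincare_domain
begin

lemma avg_tendsto:
 assumes f: "f \<in> L2_space \<mu>" "continuous_on UNIV f" and s: "\<And>k. s k > 0" "s ----> 0"
  and p: "\<And>k. dist x (p k) + s k \<le> t k" "t ----> 0"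
 shows "(\<lambda>k. avg f (p k) (s k)) ----> f x"
proof (rule LIMSEQ_I)
 fix e :: real assume e: "e > 0"
 obtain d where d: "d > 0" "\<And>y. dist y x < d ==> dist (f y) (f x) < e / 2"
  using f(2)[unfolded continuous_on_iff, rule_format, of x "e / 2"] e by auto
 obtain N where N: "\<And>k. k \<ge> N ==> norm (t k - 0) < d" using LIMSEQ_D[OF p(2) d(1)] by blast
 have "norm (avg f (p k) (s k) - f x) < e" if k: "k \<ge> N" for k
 proof -
  have V: "V (p k) (s k) > 0" by (rule V_pos[OF s(1)])
  have "ennreal ((avg f (p k) (s k) - f x)\<^sup>2)
    \<le> ennreal (1 / V (p k) (s k)) * (\<integral>\<^sup>+z\<in>ball (p k) (s k). ennreal ((f z - f x)\<^sup>2) \<partial>\<mu>)"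
   by (rule avg_square_le[OF f(1) s(1)])
  also have "\<dots> \<le> ennreal (1 / V (p k) (s k)) * (\<integral>\<^sup>+z. ennreal ((e / 2)\<^sup>2) * indicator (ball (p k) (s k)) z \<partial>\<mu>)"
  proof (intro mult_left_mono nn_integral_mono)
   fix z
   show "ennreal ((f z - f x)\<^sup>2) * indicator (ball (p k) (s k)) z \<le> ennreal ((e / 2)\<^sup>2) * indicator (ball (p k) (s k)) z"
   proof (cases "z \<in> ball (p k) (s k)")
    case True
    then have "dist z x < t k" using p(1)[of k] dist_triangle[of z x "p k"] by (simp add: dist_commute)
    then have "dist z x < d" using N[OF k] by simp
    then have "\<bar>f z - f x\<bar> \<le> e / 2" using d(2)[of z] by (simp add: dist_real_def)
    then have "(f z - f x)\<^sup>2 \<le> (e / 2)\<^sup>2" using e by (simp add: abs_le_square_iff[symmetric])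
    then show ?thesis using True by (simp add: ennreal_leI)
   qed simp
  qed simp
  also have "\<dots> = ennreal (1 / V (p k) (s k)) * (ennreal ((e / 2)\<^sup>2) * ennreal (V (p k) (s k)))"
   by (simp add: nn_integral_cmult_indicator emeasure_ball)
  also have "\<dots> = ennreal ((e / 2)\<^sup>2)" using V by (simp add: ennreal_mult[symmetric])
  finally have "(avg f (p k) (s k) - f x)\<^sup>2 \<le> (e / 2)\<^sup>2" by simp
  then have "\<bar>avg f (p k) (s k) - f x\<bar> \<le> e / 2" using e by (simp add: abs_le_square_iff[symmetric])
  then show ?thesis using e by simp
 qed
 then show "\<exists>N. \<forall>k\<ge>N. norm (avg f (p k) (s k) - f x) < e" by blast
qed

text \<open>Telescoping over Whitney points at scales r/2^k. The zeroth average is expressed through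
  the measure with density f^2, so that afterwards it can be integrated by the same net argument as
  the energies.\<close>

lemma pointwise_bound:
 obtains K where "K > 0" "\<And>f \<nu> x y r \<theta>. [|f \<in> L2_space \<mu>; continuous_on UNIV f; PI f \<nu>; sets \<nu> = sets borel; emeasure \<nu> UNIV < \<infinity>;
   r > 0; x \<in> - D; dist x y > r; 0 < \<theta>; \<theta> < 1|] ==>
   ennreal ((f x)\<^sup>2) \<le> ennreal K * (ennreal (1 / V x r) * emeasure (density \<mu> (\<lambda>z. ennreal ((f z)\<^sup>2))) (ball x (\<Lambda> * r))) +
    (\<Sum>k. ennreal (K / ((1 - \<theta>) * \<theta> ^ k) * \<Psi> (r / 2 ^ k)) * (ennreal (1 / V x (r / 2 ^ k)) * emeasure \<nu> (ball x (\<Lambda> * (r / 2 ^ k)))))"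
proof -
 obtain K1 where K1: "K1 > 0" "\<And>f \<nu> x p q r. [|f \<in> L2_space \<mu>; PI f \<nu>; sets \<nu> = sets borel; emeasure \<nu> UNIV < \<infinity>; r > 0;
   p \<in> D; q \<in> D; dist x p \<le> r; dist x q \<le> r / 2; r / (8 * A) \<le> infdist p (- D); r / (8 * A) \<le> infdist q (- D)|] ==>
   (avg f p (\<eta> * r) - avg f q (\<eta> * r / 2))\<^sup>2 \<le> K1 * \<Psi> r / V x r * measure \<nu> (ball x (\<Lambda> * r))"
  by (rule level_step, rule that)
 \<comment> \<open>The Whitney point at scale r is within r of x, so \<open>ball x r\<close> lies in
   a ball of radius 2r about it; j doublings of radius \<open>\<eta> * r\<close> cover this.\<close>
 obtain j where "2 / \<eta> \<le> 2 ^ j" using exists_power_2 by blast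
 then have j: "2 \<le> 2 ^ j * \<eta>" using \<eta>(1) by (simp add: field_simps)
 define K where "K = 2 * K1 + 2 * C ^ j"
 have Cj: "C ^ j > 0" using C_ge_1 by simp
 have K: "K > 0" "2 * K1 \<le> K" "2 * C ^ j \<le> K" using K1(1) Cj by (auto simp: K_def)
 show ?thesis
 proof (rule that[OF K(1)], goal_cases)
  case (1 f \<nu> x y r \<theta>)
  note f = 1(1-3) and \<nu> = 1(4,5) and r = 1(6) and x = 1(7,8) and \<theta> = 1(9,10)
  define R where "R k = r / 2 ^ k" for k :: nat
  have R: "R k > 0" "R k \<le> r" "R (Suc k) = R k / 2" for k using r by (auto simp: R_def field_simps)
  define P where "P k p \<longleftrightarrow> p \<in> D \<and> dist x p \<le> R k \<and> R k / (4 * A) \<le> infdist p (- D)" for k p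
  have "\<exists>p. P k p" for k
  proof -
   have "R k < dist x y" using R(2)[of k] x(2) by simp
   from Whitney_point[OF x(1) R(1) this] show ?thesis unfolding P_def by metis
  qed
  then obtain p where p: "\<And>k. P k (p k)" by metis
  have p: "p k \<in> D" "dist x (p k) \<le> R k" "R k / (4 * A) \<le> infdist (p k) (- D)" for k
   using p[of k] by (auto simp: P_def)
  define a where "a k = avg f (p k) (\<eta> * R k)" for k
  define T where "T k = K1 * \<Psi> (R k) / V x (R k) * measure \<nu> (ball x (\<Lambda> * R k))" for k
  have a1: "a (Suc k) = avg f (p (Suc k)) (\<eta> * R k / 2)" for k by (simp add: a_def R(3))
  have step: "(a k - a (Suc k))\<^sup>2 \<le> T k" for k
   unfolding a1 T_def unfolding a_def
  proof (rule K1(2)[OF f(1,3) \<nu> R(1) p(1) p(1) p(2)])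
   show "dist x (p (Suc k)) \<le> R k / 2" using p(2)[of "Suc k"] by (simp add: R(3))
   \<comment> \<open>\<open>level_step\<close> asks for the bound \<open>R k / (8 * A)\<close> at
     both points precisely so that the next Whitney point, taken at half the scale, satisfies it
     with equality of constants.\<close>
   show "R k / (8 * A) \<le> infdist (p (Suc k)) (- D)" using p(3)[of "Suc k"] by (simp add: R(3))
   have "R k / (8 * A) \<le> R k / (4 * A)" using R(1)[of k] A by (simp add: field_simps)
   then show "R k / (8 * A) \<le> infdist (p k) (- D)" using p(3)[of k] by linarith
  qed
  have Rlim: "R ----> 0" unfolding R_def by (rule LIMSEQ_divide_realpow_zero) simp
  have lim: "a ----> f x"
   unfolding a_def
  proof (rule avg_tendsto[OF f(1,2)])
   show "\<eta> * R k > 0" for k using \<eta>(1) R(1) by simp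
   show "(\<lambda>k. \<eta> * R k) ----> 0" using tendsto_mult_left[OF Rlim, of \<eta>] by simp
   show "(\<lambda>k. 2 * R k) ----> 0" using tendsto_mult_left[OF Rlim, of 2] by simp
   fix k
   have "\<eta> * R k \<le> 1 * R k" using \<eta>(2) R(1)[of k] by (intro mult_right_mono) auto
   then show "dist x (p k) + \<eta> * R k \<le> 2 * R k" using p(2)[of k] by simp
  qed
  have T0: "T k \<ge> 0" for k
   unfolding T_def using K1(1) \<Psi>_pos[OF R(1)] V_pos[OF R(1)] by (intro mult_nonneg_nonneg divide_nonneg_pos) (auto intro: less_imp_le)
  let ?l = "emeasure (density \<mu> (\<lambda>z. ennreal ((f z)\<^sup>2))) (ball x (\<Lambda> * r))"
  have a0: "ennreal (2 * (a 0)\<^sup>2) \<le> ennreal K * (ennreal (1 / V x r) * ?l)"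
  proof -
   have er: "\<eta> * r > 0" using \<eta>(1) r by simp
   have "V x r \<le> C ^ j * V (p 0) (\<eta> * r)"
   proof (rule V_compare[OF er])
    have "dist x (p 0) + r \<le> 2 * r" using p(2)[of 0] by (simp add: R_def)
    also have "\<dots> \<le> (2 ^ j * \<eta>) * r" using j r by (intro mult_right_mono) auto
    finally show "dist x (p 0) + r \<le> 2 ^ j * (\<eta> * r)" by simp
   qed
   then have v: "1 / V (p 0) (\<eta> * r) \<le> C ^ j * (1 / V x r)"
    using V_pos[OF r, of x] V_pos[OF er, of "p 0"] by (simp add: field_simps)
   have sub: "ball (p 0) (\<eta> * r) \<subseteq> ball x (\<Lambda> * r)"
   proof
    fix z assume z: "z \<in> ball (p 0) (\<eta> * r)"
    have "\<eta> * r \<le> r" using \<eta>(2) r by simp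
    moreover have "2 * r \<le> \<Lambda> * r" using A r by (intro mult_right_mono) (auto simp: \<Lambda>_def)
    ultimately show "z \<in> ball x (\<Lambda> * r)"
     using z p(2)[of 0] dist_triangle[of x z "p 0"] by (simp add: R_def)
   qed
   have "ennreal ((a 0)\<^sup>2) \<le> ennreal (1 / V (p 0) (\<eta> * r)) * (\<integral>\<^sup>+z\<in>ball (p 0) (\<eta> * r). ennreal ((f z)\<^sup>2) \<partial>\<mu>)"
    using avg_square_le[OF f(1) er, of "p 0" 0] by (simp add: a_def R_def)
   also have "\<dots> \<le> ennreal (C ^ j * (1 / V x r)) * (\<integral>\<^sup>+z\<in>ball x (\<Lambda> * r). ennreal ((f z)\<^sup>2) \<partial>\<mu>)"
    using sub by (intro mult_mono ennreal_leI v nn_integral_mono) (auto simp: indicator_def)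
   also have "(\<integral>\<^sup>+z\<in>ball x (\<Lambda> * r). ennreal ((f z)\<^sup>2) \<partial>\<mu>) = ?l"
    using L2_measurable[OF f(1)] by (simp add: emeasure_density)
   finally have le: "ennreal ((a 0)\<^sup>2) \<le> ennreal (C ^ j * (1 / V x r)) * ?l" .
   have "ennreal (2 * (a 0)\<^sup>2) = ennreal 2 * ennreal ((a 0)\<^sup>2)" by (rule ennreal_mult) auto
   also have "\<dots> \<le> ennreal 2 * (ennreal (C ^ j * (1 / V x r)) * ?l)" by (intro mult_left_mono le) auto
   also have "\<dots> = ennreal (2 * C ^ j) * (ennreal (1 / V x r) * ?l)"
   proof -
    have "0 \<le> C ^ j" "0 \<le> 1 / V x r" using Cj by auto
    then show ?thesis by (simp only: ennreal_mult ennreal_mult[of 2] mult.assoc zero_le_numeral)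
   qed
   also have "\<dots> \<le> ennreal K * (ennreal (1 / V x r) * ?l)" using K(3) by (intro mult_right_mono ennreal_leI) auto
   finally show ?thesis .
  qed
  define S where "S k = ennreal (K / ((1 - \<theta>) * \<theta> ^ k) * \<Psi> (R k)) * (ennreal (1 / V x (R k)) * emeasure \<nu> (ball x (\<Lambda> * R k)))" for k
  have fin: "emeasure \<nu> (ball y s) = ennreal (measure \<nu> (ball y s))" for y s
   using emeasure_mono[of "ball y s" UNIV \<nu>] \<nu> by (intro emeasure_eq_ennreal_measure) (auto simp: less_top top_unique)
  have TS: "ennreal (2 / (1 - \<theta>) * (T k / \<theta> ^ k)) \<le> S k" for k
  proof -
   have pos: "0 \<le> \<Psi> (R k)" "0 \<le> 1 / V x (R k)" "0 \<le> (1 - \<theta>) * \<theta> ^ k" using \<Psi>_pos[OF R(1)] V_pos[OF R(1)] \<theta> by (auto intro: less_imp_le)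
   have "2 / (1 - \<theta>) * (T k / \<theta> ^ k) = 2 * K1 / ((1 - \<theta>) * \<theta> ^ k) * \<Psi> (R k) * (1 / V x (R k) * measure \<nu> (ball x (\<Lambda> * R k)))"
    using \<theta> by (simp add: T_def mult_ac)
   also have "\<dots> \<le> K / ((1 - \<theta>) * \<theta> ^ k) * \<Psi> (R k) * (1 / V x (R k) * measure \<nu> (ball x (\<Lambda> * R k)))"
    using K(2) pos \<theta> by (intro mult_right_mono divide_right_mono mult_nonneg_nonneg measure_nonneg) auto
   finally have "ennreal (2 / (1 - \<theta>) * (T k / \<theta> ^ k)) \<le>
     ennreal (K / ((1 - \<theta>) * \<theta> ^ k) * \<Psi> (R k) * (1 / V x (R k) * measure \<nu> (ball x (\<Lambda> * R k))))" by (rule ennreal_leI)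
   also have "\<dots> = S k"
   proof -
    have 1: "0 \<le> K / ((1 - \<theta>) * \<theta> ^ k) * \<Psi> (R k)" using K(1) pos \<theta> by (intro mult_nonneg_nonneg divide_nonneg_nonneg) auto
    have 2: "0 \<le> 1 / V x (R k) * measure \<nu> (ball x (\<Lambda> * R k))" using pos by (intro mult_nonneg_nonneg measure_nonneg)
    show ?thesis unfolding S_def fin ennreal_mult[OF 1 2] ennreal_mult[OF pos(2) measure_nonneg] ..
   qed
   finally show ?thesis .
  qed
  have bound: "ennreal ((a n)\<^sup>2) \<le> ennreal K * (ennreal (1 / V x r) * ?l) + (\<Sum>k. S k)" for n
  proof -
   have "(a n)\<^sup>2 \<le> 2 * (a 0)\<^sup>2 + 2 / (1 - \<theta>) * (\<Sum>k<n. (a k - a (Suc k))\<^sup>2 / \<theta> ^ k)"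
    by (rule telescope_square_le[OF \<theta>])
   also have "\<dots> \<le> 2 * (a 0)\<^sup>2 + 2 / (1 - \<theta>) * (\<Sum>k<n. T k / \<theta> ^ k)"
    using \<theta> by (intro add_left_mono mult_left_mono sum_mono divide_right_mono step) auto
   finally have "ennreal ((a n)\<^sup>2) \<le> ennreal (2 * (a 0)\<^sup>2 + (\<Sum>k<n. 2 / (1 - \<theta>) * (T k / \<theta> ^ k)))"
    unfolding sum_distrib_left by (rule ennreal_leI)
   also have "\<dots> = ennreal (2 * (a 0)\<^sup>2) + (\<Sum>k<n. ennreal (2 / (1 - \<theta>) * (T k / \<theta> ^ k)))"
    using \<theta> T0 by (subst ennreal_plus) (auto intro!: sum_nonneg sum_ennreal[symmetric] arg_cong2[where f="(+)"])
   also have "\<dots> \<le> ennreal K * (ennreal (1 / V x r) * ?l) + (\<Sum>k<n. S k)" by (intro add_mono a0 sum_mono TS)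
   also have "\<dots> \<le> ennreal K * (ennreal (1 / V x r) * ?l) + (\<Sum>k. S k)"
    by (intro add_left_mono sum_le_suminf) auto
   finally show ?thesis .
  qed
  have "(\<lambda>n. ennreal ((a n)\<^sup>2)) ----> ennreal ((f x)\<^sup>2)" by (intro tendsto_ennrealI tendsto_power lim)
  then have "ennreal ((f x)\<^sup>2) \<le> ennreal K * (ennreal (1 / V x r) * ?l) + (\<Sum>k. S k)"
   by (rule LIMSEQ_le_const2) (use bound in blast)
  then show ?case unfolding S_def R_def .
 qed
qed

text \<open>The hypothesis \<open>scale\<close> contains the square of \<open>\<theta> ^ k\<close>.
  One factor cancels the weight from the pointwise bound and the other remains for the geometric
  series; the values of \<open>\<Psi>\<close> and the volumes cancel against those of the Poincare
  inequality.\<close>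

lemma trace_bound:
 assumes r: "r > 0" and \<theta>: "0 < \<theta>" "\<theta> < 1" and M: "M > 0"
  and \<sigma>: "sets \<sigma> = sets borel" and B: "B \<in> sets borel" "B \<subseteq> - D"
  and far: "\<And>x. x \<in> B ==> \<exists>y. dist x y > r"
  and scale: "\<And>x k. x \<in> B ==> emeasure \<sigma> (ball x (r / 2 ^ k)) \<le> ennreal (M * (\<theta> ^ k)\<^sup>2 / \<Psi> (r / 2 ^ k) * V x (r / 2 ^ k))"
 obtains K where "K > 0" "\<And>f \<nu>. [|f \<in> L2_space \<mu>; continuous_on UNIV f; PI f \<nu>; sets \<nu> = sets borel; emeasure \<nu> UNIV < \<infinity>|] ==>
   (\<integral>\<^sup>+x. ennreal ((f x)\<^sup>2) * indicator B x \<partial>\<sigma>) \<le> ennreal K * (emeasure \<nu> UNIV + (\<integral>\<^sup>+z. ennreal ((f z)\<^sup>2) \<partial>\<mu>))"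
proof -
 obtain K where K: "K > 0" "\<And>f \<nu> x y r \<theta>. [|f \<in> L2_space \<mu>; continuous_on UNIV f; PI f \<nu>; sets \<nu> = sets borel; emeasure \<nu> UNIV < \<infinity>;
   r > 0; x \<in> - D; dist x y > r; 0 < \<theta>; \<theta> < 1|] ==>
   ennreal ((f x)\<^sup>2) \<le> ennreal K * (ennreal (1 / V x r) * emeasure (density \<mu> (\<lambda>z. ennreal ((f z)\<^sup>2))) (ball x (\<Lambda> * r))) +
    (\<Sum>k. ennreal (K / ((1 - \<theta>) * \<theta> ^ k) * \<Psi> (r / 2 ^ k)) * (ennreal (1 / V x (r / 2 ^ k)) * emeasure \<nu> (ball x (\<Lambda> * (r / 2 ^ k)))))"
  by (rule pointwise_bound, rule that)
 have \<Lambda>: "\<Lambda> > 0" using A by (simp add: \<Lambda>_def)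
 obtain N where N: "N > 0" "\<And>B r q G \<sigma> \<nu>. [|r > 0; q \<ge> 0; sets \<sigma> = sets borel; sets \<nu> = sets borel;
   \<And>s. s \<in> B ==> emeasure \<sigma> (ball s r) \<le> ennreal (q * V s r);
   \<And>x. x \<in> B ==> G x \<le> ennreal (1 / V x r) * emeasure \<nu> (ball x (\<Lambda> * r))|] ==>
   (\<integral>\<^sup>+x. G x * indicator B x \<partial>\<sigma>) \<le> ennreal (N * q) * emeasure \<nu> UNIV"
  using net_integral_bound[OF \<Lambda>] by blast
 \<comment> \<open>The first summand comes from the zeroth average, the second from the series:
   \<open>c k * (N * q k)\<close> equals \<open>K * N * M / (1 - \<theta>) * \<theta> ^ k\<close>,
   and the series contributes another factor \<open>1 / (1 - \<theta>)\<close>.\<close>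
 define L where "L = K * N * M / \<Psi> r + K * N * M / (1 - \<theta>) * (1 / (1 - \<theta>))"
 have L1: "0 < K * N * M / \<Psi> r" "0 < K * N * M / (1 - \<theta>) * (1 / (1 - \<theta>))"
  using K(1) N(1) M \<theta> \<Psi>_pos[OF r] by auto
 have L: "L > 0" using L1 unfolding L_def by simp
 show ?thesis
 proof (rule that[OF L], goal_cases)
  case (1 f \<nu>)
  note f = 1(1-3) and \<nu> = 1(4,5)
  define l where "l = density \<mu> (\<lambda>z. ennreal ((f z)\<^sup>2))"
  have l: "sets l = sets borel" by (simp add: l_def sets_\<mu>)
  have lU: "emeasure l UNIV = (\<integral>\<^sup>+z. ennreal ((f z)\<^sup>2) \<partial>\<mu>)"
   unfolding l_def using L2_measurable[OF f(1)] by (subst emeasure_density) (auto simp: sets_\<mu>)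
  define R where "R k = r / 2 ^ k" for k :: nat
  have R: "R k > 0" "R 0 = r" for k using r by (auto simp: R_def)
  define c where "c k = K / ((1 - \<theta>) * \<theta> ^ k) * \<Psi> (R k)" for k
  have c: "c k > 0" for k unfolding c_def using K(1) \<theta> \<Psi>_pos[OF R(1)] by (intro mult_pos_pos divide_pos_pos) auto
  define q where "q k = M * (\<theta> ^ k)\<^sup>2 / \<Psi> (R k)" for k
  have q: "q k > 0" for k unfolding q_def using M \<theta> \<Psi>_pos[OF R(1)] by (intro mult_pos_pos divide_pos_pos) auto
  define W where "W \<rho> k x = ennreal (1 / V x (R k)) * emeasure \<rho> (ball x (\<Lambda> * R k))" for \<rho> :: "'a measure" and k x
  have Wm: "W \<rho> k \<in> borel_measurable \<sigma>" if "sets \<rho> = sets borel" for \<rho> k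
  proof -
   have "(\<lambda>x. V x (R k)) \<in> borel_measurable borel"
    unfolding measure_def using borel_measurable_emeasure_ball[OF sets_\<mu>] by measurable
   then have "W \<rho> k \<in> borel_measurable borel"
    unfolding W_def using borel_measurable_emeasure_ball[OF that] by measurable
   then show ?thesis by (simp add: measurable_cong_sets[OF \<sigma> refl])
  qed
  have Bm: "B \<in> sets \<sigma>" by (simp add: \<sigma> B(1))
  have int: "(\<integral>\<^sup>+x. W \<rho> k x * indicator B x \<partial>\<sigma>) \<le> ennreal (N * q k) * emeasure \<rho> UNIV"
   if "sets \<rho> = sets borel" for \<rho> k
   by (rule N(2)[OF R(1) less_imp_le[OF q] \<sigma> that]) (use scale in "auto simp: W_def q_def R_def")
  have "ennreal ((f x)\<^sup>2) * indicator B x \<le> ennreal K * (W l 0 x * indicator B x) + (\<Sum>k. ennreal (c k) * (W \<nu> k x * indicator B x))" for x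
  proof (cases "x \<in> B")
   case True
   then obtain y where y: "dist x y > r" using far by blast
   have "x \<in> - D" using True B(2) by blast
   from K(2)[OF f \<nu> r this y \<theta>] show ?thesis using True unfolding W_def c_def l_def R_def by simp
  qed simp
  then have "(\<integral>\<^sup>+x. ennreal ((f x)\<^sup>2) * indicator B x \<partial>\<sigma>)
    \<le> (\<integral>\<^sup>+x. ennreal K * (W l 0 x * indicator B x) + (\<Sum>k. ennreal (c k) * (W \<nu> k x * indicator B x)) \<partial>\<sigma>)"
   by (intro nn_integral_mono)
  also have "\<dots> = ennreal K * (\<integral>\<^sup>+x. W l 0 x * indicator B x \<partial>\<sigma>) + (\<Sum>k. ennreal (c k) * (\<integral>\<^sup>+x. W \<nu> k x * indicator B x \<partial>\<sigma>))"
  proof -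
   have m: "(\<lambda>x. W \<rho> k x * indicator B x) \<in> borel_measurable \<sigma>" if "sets \<rho> = sets borel" for \<rho> k
    using Wm[OF that] Bm by measurable
   note m1 = borel_measurable_times_ennreal[OF borel_measurable_const m[OF l]]
   have m2: "(\<lambda>x. ennreal (c k) * (W \<nu> k x * indicator B x)) \<in> borel_measurable \<sigma>" for k
    by (rule borel_measurable_times_ennreal[OF borel_measurable_const m[OF \<nu>(1)]])
   then have m3: "(\<lambda>x. \<Sum>k. ennreal (c k) * (W \<nu> k x * indicator B x)) \<in> borel_measurable \<sigma>"
    by (rule borel_measurable_suminf_order)
   show ?thesis
    by (simp add: nn_integral_add[OF m1 m3] nn_integral_cmult[OF m[OF l]] nn_integral_suminf[OF m2] nn_integral_cmult[OF m[OF \<nu>(1)]])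
  qed
  also have "\<dots> \<le> ennreal K * (ennreal (N * q 0) * emeasure l UNIV) + (\<Sum>k. ennreal (c k) * (ennreal (N * q k) * emeasure \<nu> UNIV))"
   by (intro add_mono mult_left_mono suminf_le int l \<nu>(1)) auto
  also have "(\<Sum>k. ennreal (c k) * (ennreal (N * q k) * emeasure \<nu> UNIV)) = ennreal (K * N * M / (1 - \<theta>) * (1 / (1 - \<theta>))) * emeasure \<nu> UNIV"
  proof -
   have ck: "c k * (N * q k) = K * N * M / (1 - \<theta>) * \<theta> ^ k" for k
    unfolding c_def q_def using \<theta> \<Psi>_pos[OF R(1), of k] by (simp add: power2_eq_square)
   have "(\<Sum>k. ennreal (c k) * (ennreal (N * q k) * emeasure \<nu> UNIV)) = (\<Sum>k. ennreal (c k * (N * q k)) * emeasure \<nu> UNIV)"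
    using c q N(1) by (simp add: ennreal_mult less_imp_le mult.assoc)
   also have "\<dots> = (\<Sum>k. ennreal (c k * (N * q k))) * emeasure \<nu> UNIV" by simp
   also have "(\<Sum>k. ennreal (c k * (N * q k))) = ennreal (\<Sum>k. K * N * M / (1 - \<theta>) * \<theta> ^ k)"
    unfolding ck using \<theta> K(1) N(1) M by (intro suminf_ennreal2 summable_mult summable_geometric) auto
   also have "(\<Sum>k. K * N * M / (1 - \<theta>) * \<theta> ^ k) = K * N * M / (1 - \<theta>) * (1 / (1 - \<theta>))"
    using \<theta> by (subst suminf_mult) (auto simp: suminf_geometric)
   finally show ?thesis .
  qed
  also have "ennreal K * (ennreal (N * q 0) * emeasure l UNIV) = ennreal (K * N * M / \<Psi> r) * emeasure l UNIV"
  proof -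
   have "ennreal K * ennreal (N * q 0) = ennreal (K * N * M / \<Psi> r)"
   proof -
    have "0 \<le> K" "0 \<le> N * q 0" using K(1) N(1) q[of 0] by auto
    then have "ennreal K * ennreal (N * q 0) = ennreal (K * (N * q 0))" by (rule ennreal_mult[symmetric])
    then show ?thesis by (simp add: q_def R(2) mult.assoc)
   qed
   then show ?thesis by (simp add: mult.assoc[symmetric])
  qed
  also have "ennreal (K * N * M / \<Psi> r) * emeasure l UNIV + ennreal (K * N * M / (1 - \<theta>) * (1 / (1 - \<theta>))) * emeasure \<nu> UNIV
    \<le> ennreal L * emeasure l UNIV + ennreal L * emeasure \<nu> UNIV"
   using L1 by (intro add_mono mult_right_mono ennreal_leI) (auto simp: L_def)
  also have "\<dots> = ennreal L * (emeasure \<nu> UNIV + (\<integral>\<^sup>+z. ennreal ((f z)\<^sup>2) \<partial>\<mu>))"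
   unfolding lU by (simp add: distrib_left add.commute)
  finally show ?case .
 qed
qed

end

section \<open>The active reflected form\<close>

locale reflected_setting =
 fixes D :: "'a::polish_space set" and m \<sigma> :: "'a measure"
  and E0 Ebar :: "('a \<Rightarrow> real) \<Rightarrow> ('a \<Rightarrow> real) \<Rightarrow> real" and F0 Fbar :: "('a \<Rightarrow> real) set"
  and A :: real and \<Psi> :: "real \<Rightarrow> real"
 assumes lc: "locally compact D" and dense_D: "closure D = UNIV"
  and radon_m: "radon_measure_on D m" and full_m: "full_support_on D m"
  and radon_ext: "radon_measure_on UNIV (ext_measure m)"
  and vd: "volume_doubling_on UNIV (ext_measure m)"
  and A: "A > 1" and uniform: "uniform_domain A D"
  and rdf0: "regular_dirichlet_form m E0 F0" and sl0: "strongly_local m E0 F0"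
  and reflected: "is_reflected_form m E0 F0 Ebar Fbar"
  and rdf: "regular_dirichlet_form (ext_measure m) Ebar Fbar"
  and scale: "scale_function \<Psi>"
  and radon_\<sigma>: "radon_measure_on (- D) \<sigma>"
  and ls: "lower_scaling (- D) (Theta m D \<Psi> \<sigma>)"
  and poincare: "poincare_inequality m E0 F0 D \<Psi>"
begin

abbreviation \<mu> :: "'a measure" where "\<mu> \<equiv> ext_measure m"

text \<open>A dense locally compact subset is open: a relative neighbourhood
  \<open>D \<inter> U\<close> of a point lies in a compact subset of \<open>D\<close>, and density
  places all of \<open>U\<close> in the closure of \<open>D \<inter> U\<close>, hence in that
  compact set.\<close>

lemma open_D: "open D"
proof (subst open_subopen, rule ballI)
 fix x assume x: "x \<in> D"
 have "\<exists>u v. openin (top_of_set D) u \<and> compact v \<and> x \<in> u \<and> u \<subseteq> v \<and> v \<subseteq> D"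
  using lc x unfolding locally_def by auto
 then obtain u v where uv: "openin (top_of_set D) u" "compact v" "x \<in> u" "u \<subseteq> v" "v \<subseteq> D" by blast
 obtain U where U: "open U" "u = D \<inter> U" using uv(1) by (auto simp: openin_open)
 have "U \<inter> closure D \<subseteq> closure (U \<inter> D)" by (rule open_Int_closure_subset[OF U(1)])
 also have "\<dots> \<subseteq> v" using uv(2,4) U(2) by (intro closure_minimal compact_imp_closed) auto
 finally have "U \<subseteq> D" using uv(5) by (auto simp: dense_D)
 then show "\<exists>T. open T \<and> x \<in> T \<and> T \<subseteq> D" using U uv(3) by blast
qed

lemma sets_m: "sets m = sets (restrict_space borel D)" using radon_m by (simp add: radon_measure_on_def)

lemma space_m: "space m = D" using sets_eq_imp_space_eq[OF sets_m] by (simp add: space_restrict_space)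

lemma sets_\<mu>: "sets \<mu> = sets borel" by (simp add: ext_measure_def)

lemma emeasure_\<mu>: "B \<in> sets borel ==> emeasure \<mu> B = emeasure m (B \<inter> D)"
 unfolding ext_measure_def
 by (subst emeasure_distr) (auto simp: space_m measurable_cong_sets[OF sets_m refl] intro: measurable_restrict_space1)

text \<open>Finiteness of balls cannot be taken from compactness of closed balls, which is itself
  deduced from doubling. Instead local compactness gives one small ball of finite measure, doubling
  enlarges it about the same centre, and every ball lies in one of these.\<close>

lemma doubling: "\<exists>C. doubling_measure \<mu> C"
proof -
 obtain C0 where C0: "C0 > 0" "\<And>x r. r > 0 ==> emeasure \<mu> (ball x (2 * r)) \<le> ennreal C0 * emeasure \<mu> (ball x r)"
  using vd unfolding volume_doubling_on_def by auto
 define C where "C = max 1 C0"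
 have C: "emeasure \<mu> (ball x (2 * r)) \<le> ennreal C * emeasure \<mu> (ball x r)" if "r > 0" for x r
  using C0(2)[OF that, of x] by (rule order_trans) (auto intro!: mult_right_mono ennreal_leI simp: C_def)
 have "D \<noteq> {}" using dense_D by auto
 then obtain y where y: "y \<in> D" by blast
 have "\<exists>u v. openin (top_of_set D) u \<and> compact v \<and> y \<in> u \<and> u \<subseteq> v \<and> v \<subseteq> D"
  using lc y unfolding locally_def by auto
 then obtain u v where uv: "openin (top_of_set D) u" "compact v" "y \<in> u" "u \<subseteq> v" by blast
 have "open u" using uv(1) open_D by (simp add: openin_open_eq)
 then obtain s where s: "s > 0" "ball y s \<subseteq> u" using uv(3) by (meson openE)
 have fin0: "emeasure \<mu> (ball y s) < \<infinity>"
 proof -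
  have "emeasure \<mu> (ball y s) \<le> emeasure \<mu> v"
   using s(2) uv(2,4) by (intro emeasure_mono) (auto simp: sets_\<mu> compact_imp_closed)
  also have "\<dots> < \<infinity>" using radon_ext uv(2) by (simp add: radon_measure_on_def)
  finally show ?thesis .
 qed
 have fin: "emeasure \<mu> (ball y (2 ^ k * s)) < \<infinity>" for k
 proof (induction k)
  case (Suc k)
  have "emeasure \<mu> (ball y (2 * (2 ^ k * s))) \<le> ennreal C * emeasure \<mu> (ball y (2 ^ k * s))"
   using s(1) by (intro C) simp
  also have "\<dots> < \<infinity>" using Suc by (simp add: ennreal_mult_less_top)
  finally show ?case by (simp add: mult.assoc)
 qed (use fin0 in simp)
 have "doubling_measure \<mu> C"
 proof
  show "sets \<mu> = sets borel" by (rule sets_\<mu>)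
  show "C \<ge> 1" by (simp add: C_def)
  show "r > 0 ==> emeasure \<mu> (ball x (2 * r)) \<le> ennreal C * emeasure \<mu> (ball x r)" for x r by (rule C)
  show "emeasure \<mu> (ball x r) > 0" if r: "r > 0" for x r
  proof -
   have "x \<in> closure D" by (simp add: dense_D)
   then obtain z where "z \<in> D" "dist z x < r" using r by (auto simp: closure_approachable)
   then have "ball x r \<inter> D \<noteq> {}" by (auto simp: dist_commute)
   moreover have "openin (top_of_set D) (ball x r \<inter> D)"
    using openin_open_Int[OF open_ball, of D x r] by (simp add: Int_commute)
   ultimately have "emeasure m (ball x r \<inter> D) > 0"
    using full_m unfolding full_support_on_def by blast
   then show ?thesis by (simp add: emeasure_\<mu>)
  qed
  show "emeasure \<mu> (ball x r) < \<infinity>" for x r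
  proof -
   obtain k where "(dist y x + r) / s \<le> 2 ^ k" using exists_power_2 by blast
   then have k: "dist y x + r \<le> 2 ^ k * s" using s(1) by (simp add: field_simps)
   have "ball x r \<subseteq> ball y (2 ^ k * s)"
   proof
    fix z assume "z \<in> ball x r"
    then show "z \<in> ball y (2 ^ k * s)" using k dist_triangle[of y z x] by simp
   qed
   then have "emeasure \<mu> (ball x r) \<le> emeasure \<mu> (ball y (2 ^ k * s))" by (rule emeasure_mono) (simp add: sets_\<mu>)
   also have "\<dots> < \<infinity>" by (rule fin)
   finally show ?thesis .
  qed
 qed
 then show ?thesis ..
qed

lemma proper: "compact (cball (x :: 'a) r)"
proof -
 obtain C where "doubling_measure \<mu> C" using doubling by blast
 then interpret doubling_measure \<mu> C .
 show ?thesis by (rule proper)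
qed

lemma local0: "local_form_space m E0 F0 D"
 by (intro local_form_space.intro regular_form_space.intro regular_form_space_axioms.intro
   local_form_space_axioms.intro rdf0 open_D radon_m sl0 proper)

lemma bar: "regular_form_space \<mu> Ebar Fbar UNIV"
 by (intro regular_form_space.intro regular_form_space_axioms.intro rdf open_UNIV radon_ext proper)

text \<open>The energy measure is pushed forward to the completion so that it can be evaluated on
  balls centred at boundary points.\<close>

definition energy :: "('a \<Rightarrow> real) \<Rightarrow> 'a measure" where
 "energy f = distr (energy_measure_loc m E0 F0 D f) borel (\<lambda>x. x)"

lemma Fbar_D:
 assumes "f \<in> Fbar"
 shows "f \<in> L2_space \<mu>" "f \<in> F_loc m F0 D" "emeasure (energy_measure_loc m E0 F0 D f) D < \<infinity>"
  "Ebar f f = measure (energy_measure_loc m E0 F0 D f) D / 2"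
 using assms reflected unfolding is_reflected_form_def reflected_domain_def space_m by auto

lemma sets_energy_loc: "f \<in> Fbar ==> sets (energy_measure_loc m E0 F0 D f) = sets (restrict_space borel D)"
 using local_form_space.sets_energy_measure_loc[OF local0 Fbar_D(2)] sets_m by simp

lemma emeasure_energy:
 assumes f: "f \<in> Fbar" and B: "B \<in> sets borel"
 shows "emeasure (energy f) B = emeasure (energy_measure_loc m E0 F0 D f) (B \<inter> D)"
proof -
 note s = sets_energy_loc[OF f]
 have "space (energy_measure_loc m E0 F0 D f) = D"
  using sets_eq_imp_space_eq[OF s] by (simp add: space_restrict_space)
 then show ?thesis
  unfolding energy_def using B
  by (subst emeasure_distr) (auto simp: measurable_cong_sets[OF s refl] intro: measurable_restrict_space1)
qed

lemma emeasure_energy_UNIV: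
 assumes f: "f \<in> Fbar"
 shows "emeasure (energy f) UNIV = ennreal (2 * Ebar f f)"
proof -
 have e: "2 * Ebar f f = measure (energy_measure_loc m E0 F0 D f) D" using Fbar_D(4)[OF f] by simp
 show ?thesis unfolding e
  using Fbar_D(3)[OF f] emeasure_eq_ennreal_measure[of "energy_measure_loc m E0 F0 D f" D]
  by (simp add: emeasure_energy[OF f] less_top)
qed

text \<open>Balls dilated by \<open>Ap\<close> stay in \<open>D\<close>, so the local energy
  measures in the Poincare inequality are restrictions of the one on \<open>D\<close>. Monotonicity
  of \<open>\<Psi>\<close> up to a constant is the lower power bound with the power estimated by
  1.\<close>

lemma poincare_domain:
 obtains C Ap Cp C\<Psi> where "poincare_domain \<mu> C D A Ap Cp C\<Psi> \<Psi>"
  "\<And>f. f \<in> Fbar ==> poincare_domain.PI \<mu> D Ap Cp \<Psi> f (energy f)"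
proof -
 obtain C where "doubling_measure \<mu> C" using doubling by blast
 then interpret doubling_measure \<mu> C .
 have bij: "bij_betw \<Psi> {0<..} {0<..}" using scale by (simp add: scale_function_def)
 have \<Psi>_pos: "\<Psi> r > 0" if "r > 0" for r using bij_betwE[OF bij] that by simp
 obtain C\<Psi> \<beta>1 \<beta>2 where \<Psi>: "1 \<le> C\<Psi>" "0 < \<beta>1"
  "\<And>r R. 0 < r ==> r < R ==> inverse C\<Psi> * (R / r) powr \<beta>1 \<le> \<Psi> R / \<Psi> r \<and> \<Psi> R / \<Psi> r \<le> C\<Psi> * (R / r) powr \<beta>2"
  using scale unfolding scale_function_def by metis
 have \<Psi>_mono: "\<Psi> s \<le> C\<Psi> * \<Psi> r" if sr: "0 < s" "s \<le> r" for s r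
 proof (cases "s = r")
  case True
  have "1 * \<Psi> r \<le> C\<Psi> * \<Psi> r" using \<Psi>(1) \<Psi>_pos[of r] sr by (intro mult_right_mono) auto
  then show ?thesis using True by simp
 next
  case False
  have "1 \<le> (r / s) powr \<beta>1" using sr \<Psi>(2) by (intro ge_one_powr_ge_zero) auto
  then have "inverse C\<Psi> * 1 \<le> inverse C\<Psi> * (r / s) powr \<beta>1" using \<Psi>(1) by (intro mult_left_mono) auto
  also have "\<dots> \<le> \<Psi> r / \<Psi> s" using \<Psi>(3)[of s r] sr False by auto
  finally show ?thesis using \<Psi>(1) \<Psi>_pos[OF sr(1)] by (simp add: field_simps)
 qed
 obtain Cp Ap where P: "0 < Cp" "1 \<le> Ap" "\<And>x r f. x \<in> D ==> 0 < r ==> r < infdist x (- D) / Ap ==> f \<in> F_loc m F0 (ball x (Ap * r)) ==>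
   (\<integral>\<^sup>+z\<in>ball x r. ennreal ((f z - (LINT z:ball x r|\<mu>. f z) / measure \<mu> (ball x r))\<^sup>2) \<partial>\<mu>)
    \<le> ennreal (Cp * \<Psi> r) * emeasure (energy_measure_loc m E0 F0 (ball x (Ap * r)) f) (ball x (Ap * r))"
  using poincare unfolding poincare_inequality_def Let_def by blast
 interpret poincare_domain \<mu> C D A Ap Cp C\<Psi> \<Psi>
  by unfold_locales (fact open_D dense_D A uniform P(1) P(2) \<Psi>_pos \<Psi>_mono)+
 have "PI f (energy f)" if f: "f \<in> Fbar" for f
  unfolding PI_def avg_def
 proof (intro ballI allI impI, elim conjE)
  fix x r assume x: "x \<in> D" and r: "0 < r" "r < infdist x (- D) / Ap"
  have sub: "ball x (Ap * r) \<subseteq> D"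
  proof
   fix z assume z: "z \<in> ball x (Ap * r)"
   have "Ap * r < infdist x (- D)" using r(2) P(2) by (simp add: field_simps)
   then have "dist x z < infdist x (- D)" using z by simp
   then show "z \<in> D" using infdist_le[of z "- D" x] by fastforce
  qed
  have "emeasure (energy_measure_loc m E0 F0 (ball x (Ap * r)) f) (ball x (Ap * r))
    = emeasure (energy_measure_loc m E0 F0 D f) (ball x (Ap * r))"
   by (rule local_form_space.energy_measure_loc_restrict[OF local0 Fbar_D(2)[OF f] open_ball sub]) auto
  also have "\<dots> = emeasure (energy f) (ball x (Ap * r))"
   using emeasure_energy[OF f, of "ball x (Ap * r)"] sub by (simp add: Int_absorb2)
  finally show "(\<integral>\<^sup>+z\<in>ball x r. ennreal ((f z - (LINT z:ball x r|\<mu>. f z) / measure \<mu> (ball x r))\<^sup>2) \<partial>\<mu>)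
    \<le> ennreal (Cp * \<Psi> r) * emeasure (energy f) (ball x (Ap * r))"
   using P(3)[OF x r local_form_space.F_loc_subset[OF local0 Fbar_D(2)[OF f] sub]] by simp
 qed
 then show ?thesis by (rule that[OF poincare_domain_axioms])
qed

section \<open>The boundary measure, zero capacity and the trace inequality for the reflected
  form\<close>

lemma sets_\<sigma>: "sets \<sigma> = sets (restrict_space borel (- D))" using radon_\<sigma> by (simp add: radon_measure_on_def)

lemma space_\<sigma>: "space \<sigma> = - D" using sets_eq_imp_space_eq[OF sets_\<sigma>] by (simp add: space_restrict_space)

lemma id_\<sigma>: "(\<lambda>x. x) \<in> \<sigma> \<rightarrow>\<^sub>M borel"
 by (simp add: measurable_cong_sets[OF sets_\<sigma> refl] measurable_restrict_space1)

abbreviation \<sigma>' :: "'a measure" where "\<sigma>' \<equiv> ext_measure \<sigma>"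

lemma emeasure_\<sigma>': "B \<in> sets borel ==> emeasure \<sigma>' B = emeasure \<sigma> (B \<inter> - D)"
 unfolding ext_measure_def by (subst emeasure_distr[OF id_\<sigma>]) (auto simp: space_\<sigma>)

lemma emeasure_\<sigma>'_ball: "emeasure \<sigma>' (ball x r) = ennreal (measure \<sigma> (ball x r \<inter> - D))"
proof -
 have "compact (cball x r \<inter> - D)" using proper open_D by (intro compact_Int_closed) auto
 then have "emeasure \<sigma> (cball x r \<inter> - D) < \<infinity>" using radon_\<sigma> by (simp add: radon_measure_on_def)
 moreover have "emeasure \<sigma> (ball x r \<inter> - D) \<le> emeasure \<sigma> (cball x r \<inter> - D)"
  using open_D by (intro emeasure_mono) (auto simp: sets_\<sigma> sets_restrict_space_iff)
 ultimately have "emeasure \<sigma> (ball x r \<inter> - D) < \<infinity>" by (rule le_less_trans[rotated])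
 then show ?thesis using emeasure_eq_ennreal_measure[of \<sigma> "ball x r \<inter> - D"] by (simp add: emeasure_\<sigma>' less_top)
qed

lemma \<Psi>_pos: "r > 0 ==> \<Psi> r > 0"
 using scale bij_betwE[of \<Psi> "{0<..}" "{0<..}"] by (auto simp: scale_function_def)

lemma V_pos: "r > 0 ==> measure \<mu> (ball x r) > 0"
 using doubling doubling_measure.V_pos by blast

lemma Theta_nonneg: "r > 0 ==> Theta m D \<Psi> \<sigma> x r \<ge> 0"
 unfolding Theta_def using \<Psi>_pos[of r] by (intro divide_nonneg_nonneg mult_nonneg_nonneg measure_nonneg) auto

abbreviation "bar1 \<equiv> form_plus \<mu> Ebar 1"
abbreviation "cap \<equiv> capacity \<mu> Ebar Fbar"

text \<open>The condition on r does two things: it gives every x a point farther than r, as Whitney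
  points require, and it keeps r within the range of lower scaling. Stating the result for a Borel
  piece \<open>B\<close> of the boundary allows bounds on Theta that hold only locally.\<close>

lemma trace:
 assumes r: "r > 0" "ennreal (2 * r) < ediam (- D)" and B: "B \<in> sets borel" "B \<subseteq> - D"
  and M: "\<And>x. x \<in> B ==> Theta m D \<Psi> \<sigma> x r \<le> M"
 obtains K where "K > 0" "\<And>f. f \<in> Fbar ==> continuous_on UNIV f ==>
  (\<integral>\<^sup>+x. ennreal ((f x)\<^sup>2) * indicator B x \<partial>\<sigma>') \<le> ennreal (K * bar1 f f)"
proof -
 obtain C Ap Cp C\<Psi> where pd: "poincare_domain \<mu> C D A Ap Cp C\<Psi> \<Psi>"
  "\<And>f. f \<in> Fbar ==> poincare_domain.PI \<mu> D Ap Cp \<Psi> f (energy f)"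
  using poincare_domain by blast
 interpret poincare_domain \<mu> C D A Ap Cp C\<Psi> \<Psi> by (rule pd(1))
 obtain c \<beta> where c: "0 < c" "0 < \<beta>" "\<And>x s R. x \<in> - D ==> 0 < s ==> s < R ==> ennreal R < ediam (- D) ==>
   Theta m D \<Psi> \<sigma> x R / Theta m D \<Psi> \<sigma> x s \<ge> c * (R / s) powr \<beta>"
  using ls unfolding lower_scaling_def by blast
 \<comment> \<open>Lower scaling from r/2^k to r gives decay 2^(-k beta), which is the square of
   \<open>\<theta> ^ k\<close>; this is the form of the hypothesis in
   \<open>trace_bound\<close>.\<close>
 define \<theta> where "\<theta> = 2 powr (- \<beta> / 2)"
 have \<theta>: "0 < \<theta>" "\<theta> < 1" using c(2) by (auto simp: \<theta>_def powr_less_one)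
 have \<theta>k: "((2::real) ^ k) powr \<beta> = 1 / (\<theta> ^ k)\<^sup>2" for k
 proof -
  have "((2::real) ^ k) powr \<beta> = 2 powr (real k * \<beta>)" by (simp add: powr_realpow[symmetric] powr_powr)
  moreover have "(\<theta> ^ k)\<^sup>2 = 2 powr (- (real k * \<beta>))"
   unfolding \<theta>_def power_mult[symmetric] by (simp add: powr_realpow[symmetric] powr_powr mult.commute)
  ultimately show ?thesis by (simp add: powr_minus_divide)
 qed
 obtain a b where ab: "a \<in> - D" "b \<in> - D" "ennreal (2 * r) < ennreal (dist a b)"
  using r(2) unfolding ediam_def less_SUP_iff by blast
 then have ab': "2 * r < dist a b" using r(1) by (simp add: ennreal_less_iff)
 \<comment> \<open>Two boundary points a and b are more than 2r apart, so at least one of them is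
   farther than r from x.\<close>
 have far: "\<exists>y. dist x y > r" for x :: 'a
  using ab' dist_triangle3[of a b x] by (cases "dist x a > r") (auto intro: exI[of _ a] exI[of _ b])
 have rd: "ennreal r < ediam (- D)"
  using r by (intro le_less_trans[OF _ r(2)] ennreal_leI) simp
 \<comment> \<open>One positive constant for all levels: it exceeds \<open>M\<close> for k = 0 and
   \<open>max 1 M / c\<close> for k > 0, where lower scaling brings in \<open>c\<close>.\<close>
 define M' where "M' = max 1 M * (1 + 1 / c)"
 have M': "M' > 0" "M \<le> M'" "max 1 M / c \<le> M'"
 proof -
  have e: "M' = max 1 M + max 1 M / c" by (simp add: M'_def distrib_left)
  have "0 < max 1 M / c" using c(1) by simp
  then show "M' > 0" "M \<le> M'" "max 1 M / c \<le> M'" unfolding e by auto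
 qed
 have Th: "Theta m D \<Psi> \<sigma> x (r / 2 ^ k) \<le> M' * (\<theta> ^ k)\<^sup>2" if x: "x \<in> B" for x k
 proof (cases "k = 0")
  case True
  then show ?thesis using M[OF x] M'(2) by simp
 next
  case False
  have s: "0 < r / 2 ^ k" "r / 2 ^ k < r" using r(1) False by (auto simp: field_simps one_less_power)
  let ?T = "Theta m D \<Psi> \<sigma> x"
  show ?thesis
  \<comment> \<open>If Theta vanishes at the small scale the bound is trivial; otherwise the
    denominator is positive and the scaling quotient can be cleared.\<close>
  proof (cases "?T (r / 2 ^ k) = 0")
   case True
   then show ?thesis using M'(1) by simp
  next
   case T: False
   have Tp: "?T (r / 2 ^ k) > 0" using T Theta_nonneg[OF s(1), of x] by simp
   have "x \<in> - D" using x B(2) by blast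
   from c(3)[OF this s rd] have "c * (1 / (\<theta> ^ k)\<^sup>2) \<le> ?T r / ?T (r / 2 ^ k)"
    using r(1) by (simp add: \<theta>k)
   then have "c * (1 / (\<theta> ^ k)\<^sup>2) * ?T (r / 2 ^ k) \<le> ?T r" using Tp by (simp add: pos_le_divide_eq)
   then have "?T (r / 2 ^ k) \<le> ?T r / c * (\<theta> ^ k)\<^sup>2" using c(1) \<theta>(1) by (simp add: field_simps)
   also have "\<dots> \<le> M' * (\<theta> ^ k)\<^sup>2"
   proof (rule mult_right_mono)
    have "?T r / c \<le> max 1 M / c" using M[OF x] c(1) by (intro divide_right_mono) auto
    then show "?T r / c \<le> M'" using M'(3) by simp
   qed simp
   finally show ?thesis .
  qed
 qed
 have scl: "emeasure \<sigma>' (ball x (r / 2 ^ k)) \<le> ennreal (M' * (\<theta> ^ k)\<^sup>2 / \<Psi> (r / 2 ^ k) * V x (r / 2 ^ k))" if "x \<in> B" for x k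
  unfolding emeasure_\<sigma>'_ball
 proof (rule ennreal_leI)
  have "0 < r / 2 ^ k" using r(1) by simp
  then show "measure \<sigma> (ball x (r / 2 ^ k) \<inter> - D) \<le> M' * (\<theta> ^ k)\<^sup>2 / \<Psi> (r / 2 ^ k) * V x (r / 2 ^ k)"
   using Th[OF that, of k] \<Psi>_pos[of "r / 2 ^ k"] V_pos[of "r / 2 ^ k" x] unfolding Theta_def
   by (simp add: pos_divide_le_eq pos_le_divide_eq mult_ac)
 qed
 have s\<sigma>: "sets \<sigma>' = sets borel" by (simp add: ext_measure_def)
 obtain K where K: "K > 0" "\<And>f \<nu>. [|f \<in> L2_space \<mu>; continuous_on UNIV f; PI f \<nu>; sets \<nu> = sets borel; emeasure \<nu> UNIV < \<infinity>|] ==>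
   (\<integral>\<^sup>+x. ennreal ((f x)\<^sup>2) * indicator B x \<partial>\<sigma>') \<le> ennreal K * (emeasure \<nu> UNIV + (\<integral>\<^sup>+z. ennreal ((f z)\<^sup>2) \<partial>\<mu>))"
  by (rule trace_bound[OF r(1) \<theta> M'(1) s\<sigma> B far scl], assumption, rule that)
 have K2: "2 * K > 0" using K(1) by simp
 show ?thesis
 proof (rule that[OF K2], goal_cases)
  case f: (1 f)
  have L2: "f \<in> L2_space \<mu>" by (rule Fbar_D(1)[OF f(1)])
  have n: "(\<integral>\<^sup>+z. ennreal ((f z)\<^sup>2) \<partial>\<mu>) = ennreal (\<integral>z. (f z)\<^sup>2 \<partial>\<mu>)"
   by (rule nn_integral_eq_integral[OF L2_integrable_square[OF L2]]) simp
  have E0: "0 \<le> Ebar f f" unfolding Fbar_D(4)[OF f(1)] by simp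
  have I0: "0 \<le> (\<integral>z. (f z)\<^sup>2 \<partial>\<mu>)" by simp
  have "(\<integral>\<^sup>+x. ennreal ((f x)\<^sup>2) * indicator B x \<partial>\<sigma>') \<le> ennreal K * (emeasure (energy f) UNIV + (\<integral>\<^sup>+z. ennreal ((f z)\<^sup>2) \<partial>\<mu>))"
   by (rule K(2)[OF L2 f(2) pd(2)[OF f(1)]]) (simp add: energy_def, simp add: emeasure_energy_UNIV[OF f(1)])
  also have "\<dots> = ennreal (K * (2 * Ebar f f + (\<integral>z. (f z)\<^sup>2 \<partial>\<mu>)))"
   unfolding n emeasure_energy_UNIV[OF f(1)] using K(1) E0 I0 by (simp add: ennreal_mult ennreal_plus)
  also have "\<dots> \<le> ennreal (2 * K * bar1 f f)"
  proof (rule ennreal_leI)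
   have "K * (2 * Ebar f f + (\<integral>z. (f z)\<^sup>2 \<partial>\<mu>)) \<le> K * (2 * (Ebar f f + (\<integral>z. (f z)\<^sup>2 \<partial>\<mu>)))"
    using K(1) I0 by (intro mult_left_mono) auto
   then show "K * (2 * Ebar f f + (\<integral>z. (f z)\<^sup>2 \<partial>\<mu>)) \<le> 2 * K * bar1 f f"
    by (simp add: form_plus_def L2_inner_square mult_ac)
  qed
  finally show ?case .
 qed
qed


lemma sets_\<sigma>': "sets \<sigma>' = sets borel" by (simp add: ext_measure_def)

text \<open>No uniform bound on Theta is assumed here, but on a single boundary ball the doubling of
  volumes and the finite mass of the doubled ball provide one, so the trace inequality holds on that
  piece.\<close>

lemma charge_local:
 assumes r: "r > 0" "ennreal (2 * r) < ediam (- D)" and N: "cap N = 0"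
 shows "\<exists>G\<in>null_sets \<sigma>. N \<inter> (ball x r \<inter> - D) \<subseteq> G"
proof -
 interpret bar: regular_form_space \<mu> Ebar Fbar UNIV by (rule bar)
 obtain C where "doubling_measure \<mu> C" using doubling by blast
 then interpret doubling_measure \<mu> C .
 define B where "B = ball x r \<inter> - D"
 have B: "B \<in> sets borel" "B \<subseteq> - D" using open_D by (auto simp: B_def)
 define M where "M = \<Psi> r * measure \<sigma> (ball x (2 * r) \<inter> - D) * (C / V x r)"
 have Th: "Theta m D \<Psi> \<sigma> y r \<le> M" if y: "y \<in> B" for y
 proof -
  have d: "dist x y < r" using y by (simp add: B_def)
  have "ball y r \<subseteq> ball x (2 * r)"
  proof
   fix z assume "z \<in> ball y r"
   then show "z \<in> ball x (2 * r)" using d dist_triangle[of x z y] by simp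
  qed
  then have "emeasure \<sigma>' (ball y r) \<le> emeasure \<sigma>' (ball x (2 * r))" by (rule emeasure_mono) (simp add: sets_\<sigma>')
  then have 1: "measure \<sigma> (ball y r \<inter> - D) \<le> measure \<sigma> (ball x (2 * r) \<inter> - D)"
   unfolding emeasure_\<sigma>'_ball by simp
  have "V x r \<le> C ^ 1 * V y r" by (rule V_compare[OF r(1)]) (use d in simp)
  then have 2: "1 / V y r \<le> C / V x r"
   using doubling_measure.V_pos[OF doubling_measure_axioms r(1), of x] doubling_measure.V_pos[OF doubling_measure_axioms r(1), of y]
   by (simp add: field_simps)
  have "\<Psi> r * measure \<sigma> (ball y r \<inter> - D) * (1 / V y r) \<le> M"
   unfolding M_def using 1 2 \<Psi>_pos[OF r(1)] by (intro mult_mono mult_nonneg_nonneg) auto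
  then show ?thesis by (simp add: Theta_def)
 qed
 obtain K where K: "K > 0" "\<And>f. f \<in> Fbar ==> continuous_on UNIV f ==>
  (\<integral>\<^sup>+x. ennreal ((f x)\<^sup>2) * indicator B x \<partial>\<sigma>') \<le> ennreal (K * bar1 f f)"
  by (rule trace[OF r B Th], assumption, rule that)
 \<comment> \<open>The boundary measure restricted to \<open>B\<close> and viewed on the completion.
   For a core function h with values in [0,1], its mass on \<open>{h = 1}\<close> is at most the
   integral of h^2 over \<open>B\<close>, so the trace inequality gives the smallness required by
   \<open>capacity_null\<close>.\<close>
 define \<kappa> where "\<kappa> = density \<sigma>' (indicator B)"
 have s\<kappa>: "sets \<kappa> = sets \<mu>" by (simp add: \<kappa>_def sets_\<sigma>' sets_\<mu>)
 have em: "emeasure \<kappa> S = (\<integral>\<^sup>+x. indicator B x * indicator S x \<partial>\<sigma>')" if "S \<in> sets borel" for S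
  unfolding \<kappa>_def using that B(1) by (intro emeasure_density borel_measurable_indicator) (auto simp: sets_\<sigma>')
 have small: "\<exists>\<delta>>0. \<forall>h\<in>bar.core. (\<forall>x\<in>UNIV. 0 \<le> h x \<and> h x \<le> 1) \<longrightarrow> bar1 h h < \<delta> \<longrightarrow>
   emeasure \<kappa> {x \<in> UNIV. h x = 1} \<le> ennreal e" if e: "e > 0" for e
 proof (intro exI[of _ "e / K"] conjI ballI impI)
  show "e / K > 0" using e K(1) by simp
  fix h assume h: "h \<in> bar.core" "bar1 h h < e / K"
  have hc: "continuous_on UNIV h" by (rule bar.core_continuous[OF h(1)])
  have S: "{x \<in> UNIV. h x = 1} \<in> sets borel"
   using continuous_closed_vimage[of "{1}" h] hc by (auto simp: vimage_def continuous_on_eq_continuous_at)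
  have "emeasure \<kappa> {x \<in> UNIV. h x = 1} \<le> (\<integral>\<^sup>+x. ennreal ((h x)\<^sup>2) * indicator B x \<partial>\<sigma>')"
   unfolding em[OF S] by (intro nn_integral_mono) (auto simp: indicator_def)
  also have "\<dots> \<le> ennreal (K * bar1 h h)" by (rule K(2)[OF bar.core_F[OF h(1)] hc])
  also have "\<dots> \<le> ennreal e" using h(2) K(1) by (intro ennreal_leI) (simp add: field_simps)
  finally show "emeasure \<kappa> {x \<in> UNIV. h x = 1} \<le> ennreal e" .
 qed
 obtain G where G: "G \<in> null_sets \<kappa>" "N \<subseteq> G" by (rule bar.capacity_null[OF s\<kappa> small N], assumption, rule that)
 have Gm: "G \<in> sets borel" using G(1) s\<kappa> by (auto simp: sets_\<mu>)
 have "emeasure \<sigma>' (G \<inter> B) = (\<integral>\<^sup>+x. indicator (G \<inter> B) x \<partial>\<sigma>')"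
  using Gm B(1) by (intro nn_integral_indicator[symmetric]) (auto simp: sets_\<sigma>')
 also have "\<dots> = (\<integral>\<^sup>+x. indicator B x * indicator G x \<partial>\<sigma>')"
  by (rule nn_integral_cong) (auto simp: indicator_def)
 also have "\<dots> = 0" using G(1) by (simp add: em[OF Gm, symmetric] null_sets_def)
 finally have "emeasure \<sigma> (G \<inter> B \<inter> - D) = 0" using emeasure_\<sigma>'[of "G \<inter> B"] Gm B(1) by simp
 moreover have "G \<inter> B \<inter> - D \<in> sets \<sigma>" using Gm B(1) open_D by (auto simp: sets_\<sigma> sets_restrict_space_iff)
 ultimately show ?thesis using G(2) B(2) by (intro bexI[of _ "G \<inter> B \<inter> - D"]) (auto simp: B_def null_sets_def)
qed

text \<open>By the Lindelof property countably many balls of one fixed radius cover the boundary,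
  and the local null covers are united.\<close>

lemma charge:
 assumes pos: "cap (- D) > 0" and N: "cap N = 0"
 shows "\<exists>G\<in>null_sets \<sigma>. N \<inter> - D \<subseteq> G"
proof (cases "ediam (- D) = 0")
 \<comment> \<open>Lower scaling is void for a one-point boundary, but a set meeting it then contains it.\<close>
 case True
 interpret bar: regular_form_space \<mu> Ebar Fbar UNIV by (rule bar)
 have "N \<inter> - D = {}"
 proof (rule ccontr)
  assume "N \<inter> - D \<noteq> {}"
  then obtain b where b: "b \<in> N" "b \<in> - D" by blast
  have "- D \<subseteq> N"
  proof
   fix x assume x: "x \<in> - D"
   have "ennreal (dist x b) \<le> (SUP y\<in>- D. ennreal (dist x y))" by (rule SUP_upper[OF b(2)])
   also have "\<dots> \<le> ediam (- D)" unfolding ediam_def by (rule SUP_upper[OF x])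
   finally have "dist x b = 0" using True by (simp add: ennreal_eq_0_iff)
   then show "x \<in> N" using b(1) by simp
  qed
  then have "cap (- D) \<le> cap N" by (rule bar.cap_mono)
  then show False using pos N by simp
 qed
 then show ?thesis by (intro bexI[of _ "{}"]) auto
next
 case False
 obtain r where r: "r > 0" "ennreal (2 * r) < ediam (- D)"
 proof -
  obtain e where e: "0 < e" "e < ediam (- D)" using False dense[of 0 "ediam (- D)"] by (auto simp: zero_less_iff_neq_zero)
  have "e < top" using less_le_trans[OF e(2) top_greatest] .
  then obtain t where t: "e = ennreal t" "t \<ge> 0" by (cases e) auto
  then show thesis using e by (intro that[of "t / 2"]) (auto simp: ennreal_less_zero_iff)
 qed
 obtain \<F> where F: "\<F> \<subseteq> (\<lambda>x. ball x r) ` (- D)" "countable \<F>" "\<Union>\<F> = \<Union>((\<lambda>x. ball x r) ` (- D))"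
 proof (rule Lindelof[of "(\<lambda>x. ball x r) ` (- D)"])
  show "open S" if "S \<in> (\<lambda>x. ball x r) ` (- D)" for S using that by auto
 qed (rule that)
 have "\<exists>G. G \<in> null_sets \<sigma> \<and> N \<inter> (b \<inter> - D) \<subseteq> G" if "b \<in> \<F>" for b
 proof -
  obtain x where "b = ball x r" using F(1) \<open>b \<in> \<F>\<close> by blast
  then show ?thesis using charge_local[OF r N, of x] by auto
 qed
 then have "\<exists>G. \<forall>b\<in>\<F>. G b \<in> null_sets \<sigma> \<and> N \<inter> (b \<inter> - D) \<subseteq> G b" by (intro bchoice) blast
 then obtain G where G: "\<And>b. b \<in> \<F> ==> G b \<in> null_sets \<sigma>" "\<And>b. b \<in> \<F> ==> N \<inter> (b \<inter> - D) \<subseteq> G b" by blast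
 have "- D \<subseteq> \<Union>\<F>" unfolding F(3) using r(1) by auto
 then have "N \<inter> - D \<subseteq> (\<Union>b\<in>\<F>. G b)" using G(2) by blast
 moreover have "(\<Union>b\<in>\<F>. G b) \<in> null_sets \<sigma>" by (rule null_sets_UN'[OF F(2) G(1)])
 ultimately show ?thesis by (rule bexI)
qed

text \<open>For continuous functions this is the trace inequality on the whole boundary. A
  quasi-continuous version g is the limit of core functions off a set of zero capacity, hence
  sigma-almost everywhere, and Fatou's lemma transfers the bound with the same constant.\<close>

lemma L2_trace:
 assumes r: "r > 0" "ennreal r < ediam (- D) / 2" and bdd: "bdd_above ((\<lambda>x. Theta m D \<Psi> \<sigma> x r) ` (- D))"
  and pos: "cap (- D) > 0"
 shows "\<exists>C>0. (\<forall>f\<in>Fbar. continuous_on UNIV f \<longrightarrow>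
      f \<in> L2_space \<sigma> \<and> L2_norm \<sigma> f \<le> C * sqrt (bar1 f f)) \<and>
    (\<forall>f\<in>Fbar. \<forall>g. quasi_continuous \<mu> Ebar Fbar g \<and> (AE x in \<mu>. f x = g x) \<longrightarrow>
      g \<in> L2_space (completion \<sigma>) \<and> L2_norm (completion \<sigma>) g \<le> C * sqrt (bar1 f f))"
proof -
 interpret bar: regular_form_space \<mu> Ebar Fbar UNIV by (rule bar)
 \<comment> \<open>The diameter is an extended number and may be infinite, so the factor 2 is moved
   across the inequality by contradiction.\<close>
 have d: "ennreal (2 * r) < ediam (- D)"
 proof (rule ccontr)
  assume "\<not> ennreal (2 * r) < ediam (- D)"
  then have "ediam (- D) / 2 \<le> ennreal (2 * r) / 2" by (intro divide_right_mono_ennreal) simp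
  also have "ennreal (2 * r) / 2 = ennreal r"
   using divide_ennreal[of "2 * r" 2] r(1) by simp
  finally show False using r(2) by simp
 qed
 obtain M where M: "\<And>x. x \<in> - D ==> Theta m D \<Psi> \<sigma> x r \<le> M" using bdd by (auto simp: bdd_above_def)
 have Dm: "- D \<in> sets borel" using open_D by auto
 obtain K where K: "K > 0" "\<And>f. f \<in> Fbar ==> continuous_on UNIV f ==>
  (\<integral>\<^sup>+x. ennreal ((f x)\<^sup>2) * indicator (- D) x \<partial>\<sigma>') \<le> ennreal (K * bar1 f f)"
  by (rule trace[OF r(1) d Dm order_refl M], assumption, rule that)
 have bound: "(\<integral>\<^sup>+x. ennreal ((f x)\<^sup>2) \<partial>\<sigma>) \<le> ennreal (K * bar1 f f)"
  if f: "f \<in> Fbar" "continuous_on UNIV f" for f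
 proof -
  have [measurable]: "D \<in> sets borel" using open_D by simp
  have [measurable]: "f \<in> borel_measurable borel" using f(2) by (rule borel_measurable_continuous_onI)
  have "(\<integral>\<^sup>+x. ennreal ((f x)\<^sup>2) * indicator (- D) x \<partial>\<sigma>') = (\<integral>\<^sup>+x. ennreal ((f x)\<^sup>2) * indicator (- D) x \<partial>\<sigma>)"
   unfolding ext_measure_def using Dm by (intro nn_integral_distr[OF id_\<sigma>]) measurable
  also have "\<dots> = (\<integral>\<^sup>+x. ennreal ((f x)\<^sup>2) \<partial>\<sigma>)" by (rule nn_integral_cong) (simp add: space_\<sigma>)
  finally show ?thesis using K(2)[OF f] by simp
 qed
 have L2I: "f \<in> L2_space M \<and> L2_norm M f \<le> sqrt K * sqrt e"
  if f: "f \<in> borel_measurable M" "(\<integral>\<^sup>+x. ennreal ((f x)\<^sup>2) \<partial>M) \<le> ennreal (K * e)" and e: "e \<ge> 0"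
  for f e and M :: "'a measure"
 proof -
  have "integrable M (\<lambda>x. (f x)\<^sup>2)"
  proof (rule integrableI_bounded)
   show "(\<lambda>x. (f x)\<^sup>2) \<in> borel_measurable M" using f(1) by measurable
   show "(\<integral>\<^sup>+x. ennreal (norm ((f x)\<^sup>2)) \<partial>M) < \<infinity>" using le_less_trans[OF f(2)] by simp
  qed
  moreover from this have "ennreal (\<integral>x. (f x)\<^sup>2 \<partial>M) \<le> ennreal (K * e)"
   using f(2) by (subst nn_integral_eq_integral[symmetric]) auto
  then have "(\<integral>x. (f x)\<^sup>2 \<partial>M) \<le> K * e" using K(1) e by simp
  ultimately show ?thesis using f(1) by (simp add: L2_space_iff L2_norm_def real_sqrt_mult[symmetric])
 qed
 have cont_meas: "f \<in> borel_measurable \<sigma>" if "continuous_on UNIV f" for f :: "'a \<Rightarrow> real"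
  using measurable_comp[OF id_\<sigma> borel_measurable_continuous_onI[OF that]] by (simp add: comp_def)
 have E1: "0 \<le> bar1 f f" if "f \<in> Fbar" for f by (rule bar.form1.B_nonneg[OF that])
 have "g \<in> L2_space (completion \<sigma>) \<and> L2_norm (completion \<sigma>) g \<le> sqrt K * sqrt (bar1 f f)"
  if f: "f \<in> Fbar" and g: "quasi_continuous \<mu> Ebar Fbar g" "AE x in \<mu>. f x = g x" for f g
 proof -
  obtain s where s: "\<And>n. s n \<in> bar.core"
   "form_tendsto (bar1) s f"
   by (rule bar.core_sequence[OF f], rule that)
  note sF = bar.core_F[OF s(1)] and sc = bar.core_continuous[OF s(1)]
  obtain \<rho> N where \<rho>: "strict_mono \<rho>" "cap N = 0" "\<And>x. x \<in> UNIV - N ==> (\<lambda>n. s (\<rho> n) x) ----> g x"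
   by (rule bar.quasi_everywhere_convergence[OF sF sc f s(2) g], rule that)
  obtain G where G: "G \<in> null_sets \<sigma>" "N \<inter> - D \<subseteq> G" using charge[OF pos \<rho>(2)] by blast
  \<comment> \<open>Both sequence and limit are set to 0 on the null cover \<open>G\<close>, which
    makes convergence hold everywhere and the limit v measurable for \<open>\<sigma>\<close>
    itself.\<close>
  define u where "u n x = (if x \<in> G then 0 else s (\<rho> n) x)" for n x
  define v where "v x = (if x \<in> G then 0 else g x)" for x
  have um: "u n \<in> borel_measurable \<sigma>" for n
   unfolding u_def using G(1) cont_meas[OF sc] by (intro measurable_If_set) auto
  have lim: "(\<lambda>n. u n x) ----> v x" if "x \<in> space \<sigma>" for x
  proof (cases "x \<in> G")
   case False
   then have "x \<in> UNIV - N" using that G(2) by (auto simp: space_\<sigma>)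
   from \<rho>(3)[OF this] show ?thesis using False by (simp add: u_def v_def)
  qed (simp add: u_def v_def)
  have vm: "v \<in> borel_measurable \<sigma>" by (rule borel_measurable_LIMSEQ_real[OF lim um])
  have Gn: "AE x in \<sigma>. x \<notin> G" by (rule AE_not_in[OF G(1)])
  have "(\<integral>\<^sup>+x. ennreal ((v x)\<^sup>2) \<partial>\<sigma>) = (\<integral>\<^sup>+x. liminf (\<lambda>n. ennreal ((u n x)\<^sup>2)) \<partial>\<sigma>)"
  proof (rule nn_integral_cong)
   fix x assume "x \<in> space \<sigma>"
   then have "(\<lambda>n. ennreal ((u n x)\<^sup>2)) ----> ennreal ((v x)\<^sup>2)" by (intro tendsto_ennrealI tendsto_power lim)
   then show "ennreal ((v x)\<^sup>2) = liminf (\<lambda>n. ennreal ((u n x)\<^sup>2))"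
    by (rule lim_imp_Liminf[OF sequentially_bot, symmetric])
  qed
  also have "\<dots> \<le> liminf (\<lambda>n. \<integral>\<^sup>+x. ennreal ((u n x)\<^sup>2) \<partial>\<sigma>)"
   using um by (intro nn_integral_liminf) measurable
  also have "\<dots> \<le> liminf (\<lambda>n. ennreal (K * bar1 (s (\<rho> n)) (s (\<rho> n))))"
  proof (rule Liminf_mono, rule always_eventually, rule allI)
   fix n
   have "(\<integral>\<^sup>+x. ennreal ((u n x)\<^sup>2) \<partial>\<sigma>) \<le> (\<integral>\<^sup>+x. ennreal ((s (\<rho> n) x)\<^sup>2) \<partial>\<sigma>)"
    by (intro nn_integral_mono) (simp add: u_def)
   also have "\<dots> \<le> ennreal (K * bar1 (s (\<rho> n)) (s (\<rho> n)))" by (rule bound[OF sF sc])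
   finally show "(\<integral>\<^sup>+x. ennreal ((u n x)\<^sup>2) \<partial>\<sigma>) \<le> ennreal (K * bar1 (s (\<rho> n)) (s (\<rho> n)))" .
  qed
  also have "\<dots> = ennreal (K * bar1 f f)"
  proof (rule lim_imp_Liminf[OF sequentially_bot tendsto_ennrealI])
   have "(\<lambda>n. bar1 (s n) (s n)) ----> bar1 f f"
    by (rule bar.form1.tendsto_B[OF sF sF f f s(2) s(2)])
   from LIMSEQ_subseq_LIMSEQ[OF this \<rho>(1)]
   show "(\<lambda>n. K * bar1 (s (\<rho> n)) (s (\<rho> n))) ----> K * bar1 f f"
    by (intro tendsto_mult_left) (simp add: comp_def)
  qed
  finally have v: "(\<integral>\<^sup>+x. ennreal ((v x)\<^sup>2) \<partial>\<sigma>) \<le> ennreal (K * bar1 f f)" .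
  \<comment> \<open>g may behave arbitrarily on \<open>G\<close>, so it is only measurable for the
    completion: off \<open>G\<close> it agrees with v, and every subset of \<open>G\<close> is a
    null set there.\<close>
  have gm: "g \<in> borel_measurable (completion \<sigma>)"
  proof (rule measurableI)
   fix S :: "real set" assume S: "S \<in> sets borel"
   have Gc: "G \<in> null_sets (completion \<sigma>)" by (rule null_sets_completionI[OF G(1)])
   have 1: "v -` S \<inter> space \<sigma> \<in> sets (completion \<sigma>)" using measurable_sets[OF vm S] by auto
   have 2: "g -` S \<inter> G \<in> null_sets (completion \<sigma>)" by (rule null_sets_completion_subset[OF Int_lower2 Gc])
   have "G \<subseteq> space \<sigma>" using G(1) by (auto dest: null_setsD2 sets.sets_into_space)
   then have "g -` S \<inter> space (completion \<sigma>) = (v -` S \<inter> space \<sigma> - G) \<union> (g -` S \<inter> G)"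
    by (auto simp: v_def)
   then show "g -` S \<inter> space (completion \<sigma>) \<in> sets (completion \<sigma>)"
    using 1 null_setsD2[OF 2] null_setsD2[OF Gc] by auto
  qed simp
  have "(\<integral>\<^sup>+x. ennreal ((g x)\<^sup>2) \<partial>completion \<sigma>) = (\<integral>\<^sup>+x. ennreal ((v x)\<^sup>2) \<partial>completion \<sigma>)"
   by (rule nn_integral_cong_AE) (use AE_completion[OF Gn] in eventually_elim, simp add: v_def)
  also have "\<dots> \<le> ennreal (K * bar1 f f)" using v by (simp add: nn_integral_completion)
  finally show ?thesis by (rule L2I[OF gm _ E1[OF f]])
 qed
 moreover have "f \<in> L2_space \<sigma> \<and> L2_norm \<sigma> f \<le> sqrt K * sqrt (bar1 f f)"
  if "f \<in> Fbar" "continuous_on UNIV f" for f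
  by (rule L2I[OF cont_meas[OF that(2)] bound[OF that] E1[OF that(1)]])
 ultimately show ?thesis using K(1) by (intro exI[of _ "sqrt K"] conjI) auto
qed

end

theorem theorem3p7:
  fixes D :: "'a::polish_space set"
    and m \<sigma> :: "'a measure"
    and E0 Ebar :: "('a \<Rightarrow> real) \<Rightarrow> ('a \<Rightarrow> real) \<Rightarrow> real"
    and F0 Fbar :: "('a \<Rightarrow> real) set"
    and A :: real
    and \<Psi> :: "real \<Rightarrow> real"
  assumes "locally compact D" and "closure D = UNIV"
    and "radon_measure_on D m" and "full_support_on D m"
    and "radon_measure_on UNIV (ext_measure m)"
    and "volume_doubling_on UNIV (ext_measure m)"
    and "A > 1" and "uniform_domain A D"
    and "regular_dirichlet_form m E0 F0" and "strongly_local m E0 F0"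
    and "transient m E0 F0" and "irreducible_form m E0 F0"
    and "is_reflected_form m E0 F0 Ebar Fbar"
    and "regular_dirichlet_form (ext_measure m) Ebar Fbar"
    and "capacity (ext_measure m) Ebar Fbar (- D) > 0"
    and "scale_function \<Psi>"
    and "radon_measure_on (- D) \<sigma>" and "full_support_on (- D) \<sigma>"
    and "volume_doubling_on (- D) \<sigma>"
    and "lower_scaling (- D) (Theta m D \<Psi> \<sigma>)"
    and "poincare_inequality m E0 F0 D \<Psi>"
  shows "(\<forall>N. capacity (ext_measure m) Ebar Fbar N = 0 \<longrightarrow> N \<inter> - D \<in> null_sets (completion \<sigma>)) \<and>
    ((\<exists>r0. 0 < r0 \<and> ennreal r0 < ediam (- D) / 2 \<and> bdd_above ((\<lambda>x. Theta m D \<Psi> \<sigma> x r0) ` (- D))) \<longrightarrow>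
      (\<exists>C>0.
        (\<forall>f\<in>Fbar. continuous_on UNIV f \<longrightarrow>
           f \<in> L2_space \<sigma> \<and>
           L2_norm \<sigma> f \<le> C * sqrt (form_plus (ext_measure m) Ebar 1 f f)) \<and>
        (\<forall>f\<in>Fbar. \<forall>g. quasi_continuous (ext_measure m) Ebar Fbar g \<and>
                      (AE x in ext_measure m. f x = g x) \<longrightarrow>
           g \<in> L2_space (completion \<sigma>) \<and>
           L2_norm (completion \<sigma>) g \<le> C * sqrt (form_plus (ext_measure m) Ebar 1 f f))))"
proof -
  interpret reflected_setting D m \<sigma> E0 Ebar F0 Fbar A \<Psi> by (intro reflected_setting.intro assms)
  \<comment> \<open>\<open>N\<close> need not be measurable; lying inside a null set makes its
    boundary part measurable and null for the completion.\<close>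
  have "N \<inter> - D \<in> null_sets (completion \<sigma>)" if N: "capacity (ext_measure m) Ebar Fbar N = 0" for N
  proof -
    obtain G where "G \<in> null_sets \<sigma>" "N \<inter> - D \<subseteq> G" using charge[OF assms(15) N] by blast
    then show ?thesis using null_sets_completion_subset[OF _ null_sets_completionI] by blast
  qed
  then show ?thesis using L2_trace[OF _ _ _ assms(15)] by blast
qed

end
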